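(* Let $k\in\mathbb{N}$ be fixed (independent of $p$) and let $\Sigma=\Sigma_p\in\mathbb{R}^{p\times p}$ be a sequence of symmetric matrices such that, as $p\to\infty$: $\lambda_i(\Sigma)\to\gamma_i\in[0,\infty)$ for $i=1,\dots,k+1$, with $\Delta:=\gamma_k-\gamma_{k+1}>0$; and $\frac1p\sum_{i=k+1}^p\delta_{\lambda_i(\Sigma)}$ converges weakly to a probability measure $\mu$ with bounded support. Let $\beta_p\to\beta\in(H_\mu(\gamma_k),\infty)$. Let $\hat\nu(\cdot\mid\Sigma,\beta_p,k)$ be the law of the random matrix $$\boldsymbol V=U\begin{bmatrix}(I_k-\boldsymbol Z^\top\boldsymbol Z)_+^{1/2}\\ \boldsymbol Z\end{bmatrix}\boldsymbol Q ,$$ where $\Sigma=U\,\mathrm{Diag}(\lambda_1,\dots,\lambda_p)\,U^\top$ is an eigendecomposition with $\lambda_1\ge\dots\ge\lambda_p$, $\boldsymbol Q$ is uniformly (Haar) distributed on the orthogonal group $\mathbb O(k)$, and $\boldsymbol Z\in\mathbb{R}^{(p-k)\times k}$ has entries $\boldsymbol Z_{ij}\sim\mathsf N\big(0,\frac{1}{\beta_p\,p\,(\lambda_j-\lambda_{k+i})}\big)$, $i\in\{1,\dots,p-k\}$, $j\in\{1,\dots,k\}$, independent of each other and of $\boldsymbol Q$. Then $$\lim_{p\to\infty}\mathrm d_{\mathrm{TV}}\big(\nu(\cdot\mid\Sigma,\beta_p,k),\ \hat\nu(\cdot\mid\Sigma,\beta_p,k)\big)=0 .$$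
   Context: $\mathbb O(p,k)$ is the set of $p\times k$ real matrices with orthonormal columns, $\xi_{p,k}$ its uniform (Haar) probability measure. The Gibbs distribution $\nu(\cdot\mid\Sigma,\beta,k)$ on $\mathbb O(p,k)$ has $\frac{d\nu}{d\xi_{p,k}}(V)\propto\exp\big(\frac{p\beta}{2}\mathrm{Tr}[V^\top\Sigma V]\big)$. Both laws are viewed as probability measures on $\mathbb{R}^{p\times k}$ and $\mathrm d_{\mathrm{TV}}$ is total variation distance. $\lambda_i(\cdot)$ is the $i$-th largest eigenvalue. $H_\mu(\lambda)=\int\frac{d\mu(t)}{\lambda-t}$ for $\lambda\notin\mathrm{supp}(\mu)$. For a symmetric matrix $S$ with eigendecomposition $W\Lambda W^\top$, $(S)_+=W\max\{\Lambda,0\}W^\top$ (entrywise max on eigenvalues), and $(S)_+^{1/2}$ is its symmetric PSD square root. Under the hypotheses the variances are well defined for all large $p$. *)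

theory Defs
  imports "HOL-Probability.Probability" "Jordan_Normal_Form.Char_Poly"
begin

hide_const (open) Finite_Cartesian_Product.mat Finite_Cartesian_Product.vec

text \<open>
  Matrices are those of \<open>Jordan_Normal_Form\<close>, whose dimensions are values and whose entries
  are indexed from 0. Eigenvalues \<open>eigval A i\<close> are indexed from 1.
\<close>

section \<open>Linear algebra\<close>

definition mat_trace :: "real mat \<Rightarrow> real" where
  "mat_trace A = (\<Sum>i<dim_row A. A $$ (i, i))"

text \<open>
  The \<open>i\<close>-th largest eigenvalue, counted with multiplicity, for \<open>1 \<le> i \<le> dim_row A\<close>; meant for
  symmetric \<open>A\<close>, whose characteristic polynomial splits over the reals.
\<close>
definition eigval :: "real mat \<Rightarrow> nat \<Rightarrow> real" where
  "eigval A i = rev (sorted_list_of_multiset (proots (char_poly A))) ! (i - 1)"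

definition stiefel :: "nat \<Rightarrow> nat \<Rightarrow> real mat set" where
  "stiefel p k = {V \<in> carrier_mat p k. V\<^sup>T * V = 1\<^sub>m k}"

text \<open>
  \<open>W max{\<Lambda>,0} W\<^sup>T\<close> does not depend on the eigendecomposition \<open>W \<Lambda> W\<^sup>T\<close> chosen for the symmetric
  matrix \<open>S\<close>.
\<close>
definition pos_part_mat :: "real mat \<Rightarrow> real mat" where
  "pos_part_mat S = (let n = dim_row S in
     THE B. \<exists>W d. W \<in> stiefel n n \<and> S = W * mat_diag n d * W\<^sup>T \<and>
                  B = W * mat_diag n (\<lambda>i. max (d i) 0) * W\<^sup>T)"

definition sym_psd :: "nat \<Rightarrow> real mat \<Rightarrow> bool" where
  "sym_psd n A \<longleftrightarrow> A \<in> carrier_mat n n \<and> A\<^sup>T = A \<and>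
     (\<forall>v \<in> carrier_vec n. 0 \<le> scalar_prod v (A *\<^sub>v v))"

definition psd_sqrt :: "real mat \<Rightarrow> real mat" where
  "psd_sqrt A = (THE B. sym_psd (dim_row A) B \<and> B * B = A)"

section \<open>Probability measures on matrices\<close>

text \<open>The Borel space of \<open>n \<times> m\<close> real matrices, transported along the entry map.\<close>
definition mat_borel :: "nat \<Rightarrow> nat \<Rightarrow> real mat measure" where
  "mat_borel n m = vimage_algebra (carrier_mat n m)
     (\<lambda>A. \<lambda>ij\<in>{..<n} \<times> {..<m}. A $$ ij) (\<Pi>\<^sub>M ij\<in>{..<n} \<times> {..<m}. borel)"

text \<open>
  The uniform law: the unique probability measure carried by the matrices with orthonormal columns
  that is invariant under left multiplication by orthogonal matrices. It exists for \<open>k \<le> p\<close>;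
  for \<open>k = p\<close> it is the Haar probability measure of the orthogonal group.
\<close>
definition stiefel_uniform :: "nat \<Rightarrow> nat \<Rightarrow> real mat measure" where
  "stiefel_uniform p k = (THE M. prob_space M \<and> sets M = sets (mat_borel p k) \<and>
     emeasure M (stiefel p k) = 1 \<and>
     (\<forall>R \<in> stiefel p p. distr M M (\<lambda>V. R * V) = M))"

definition gibbs_weight :: "real mat \<Rightarrow> real \<Rightarrow> real mat \<Rightarrow> real" where
  "gibbs_weight S \<beta> V = exp (real (dim_row S) * \<beta> / 2 * mat_trace (V\<^sup>T * S * V))"

definition gibbs :: "real mat \<Rightarrow> real \<Rightarrow> nat \<Rightarrow> real mat measure" where
  "gibbs S \<beta> k = (let \<xi> = stiefel_uniform (dim_row S) k in
     density \<xi> (\<lambda>V. ennreal (gibbs_weight S \<beta> V / (LINT V'|\<xi>. gibbs_weight S \<beta> V'))))"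

text \<open>Law of an \<open>n \<times> m\<close> matrix with independent centred normal entries of variances \<open>v i j\<close>.\<close>
definition gaussian_mat :: "nat \<Rightarrow> nat \<Rightarrow> (nat \<Rightarrow> nat \<Rightarrow> real) \<Rightarrow> real mat measure" where
  "gaussian_mat n m v = distr
     (\<Pi>\<^sub>M (i, j)\<in>{..<n} \<times> {..<m}. density lborel (\<lambda>x. ennreal (normal_density 0 (sqrt (v i j)) x)))
     (mat_borel n m) (\<lambda>z. Matrix.mat n m z)"

text \<open>
  In the variances the row and column indices \<open>i\<close>, \<open>j\<close> count from 0, hence the shifts by 1 in
  \<open>eigval\<close>.
\<close>
definition gibbs_approx :: "real mat \<Rightarrow> real mat \<Rightarrow> real \<Rightarrow> nat \<Rightarrow> real mat measure" where
  "gibbs_approx S U \<beta> k = (let p = dim_row S in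
     distr
       (gaussian_mat (p - k) k
          (\<lambda>i j. 1 / (\<beta> * real p * (eigval S (j + 1) - eigval S (k + (i + 1)))))
        \<Otimes>\<^sub>M stiefel_uniform k k)
       (mat_borel p k)
       (\<lambda>(Z, Q). U * (psd_sqrt (pos_part_mat (1\<^sub>m k - Z\<^sup>T * Z)) @\<^sub>r Z) * Q))"

definition tv_dist :: "'a measure \<Rightarrow> 'a measure \<Rightarrow> real" where
  "tv_dist M N = (SUP A \<in> sets M. \<bar>measure M A - measure N A\<bar>)"

section \<open>Spectral measures\<close>

text \<open>
  \<open>(1/p) \<Sum>\<^bsub>i=k+1\<^esub>\<^bsup>p\<^esup> \<delta>\<^bsub>\<lambda>\<^sub>i\<^esub>\<close>. Its total mass is \<open>(p - k)/p\<close>, which tends to 1, so that convergence of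
  distribution functions in the sense of \<open>weak_conv_m\<close> to a probability measure is weak convergence.
\<close>
definition bulk_spectral_measure :: "real mat \<Rightarrow> nat \<Rightarrow> real measure" where
  "bulk_spectral_measure S k =
     distr (point_measure {k+1..dim_row S} (\<lambda>_. ennreal (1 / real (dim_row S)))) borel (eigval S)"

definition measure_support :: "real measure \<Rightarrow> real set" where
  "measure_support \<mu> = {x. \<forall>T. open T \<and> x \<in> T \<longrightarrow> emeasure \<mu> T > 0}"

text \<open>Only meaningful for \<open>x\<close> outside the support of \<open>\<mu>\<close>.\<close>
definition stieltjes :: "real measure \<Rightarrow> real \<Rightarrow> real" where
  "stieltjes \<mu> x = (LINT t|\<mu>. 1 / (x - t))"

end

theory Submission
  imports Defs "HOL-Computational_Algebra.Fundamental_Theorem_Algebra"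
begin

text \<open>
  In an eigenbasis of \<open>\<Sigma>\<close> a uniform frame is, by invariance, \<open>((1 - Z\<^sup>TZ)\<^sup>1\<^sup>/\<^sup>2 ; Z) Q\<close> with \<open>Q\<close> uniform on the
  orthogonal group and independent of its lower block \<open>Z\<close>. Splitting off one row at a time shows that
  \<open>Z\<close> has Lebesgue density proportional to \<open>h(Z) = det(1 - Z\<^sup>TZ)\<^sup>-\<^sup>1\<^sup>/\<^sup>2\<close> on \<open>{Z\<^sup>TZ < 1}\<close>; the uniform law itself is
  obtained from Lebesgue measure by normalising and iterating Householder reflections. The Gibbs weight
  is a constant times the Gaussian density of the approximating \<open>Z\<close>, so the two laws differ by the factor
  \<open>h / E h\<close>, and their distance is at most \<open>E |h / E h - 1|\<close> for Gaussian \<open>Z\<close>. By exponential moment bounds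
  \<open>Z\<^sup>TZ\<close> concentrates at a diagonal matrix whose entries \<open>H\<^sub>\<mu>(\<gamma>\<^sub>j) / \<beta>\<close> are less than 1, and \<open>h\<close> is
  continuous there. The singularity of \<open>h\<close> is harmless: its integral over a single row is bounded
  uniformly in the other rows, which costs only a factor polynomial in \<open>p\<close>.
\<close>

text \<open>The Gaussian does not come from an expansion of the exponent. The trace in the Gibbs
  weight is exactly a constant minus a weighted sum of the squared entries of the lower block, with
  weights \<lambda>_j - \<lambda>_(k+i); multiplied by p \<beta> / 2, these are the precisions of
  the prescribed normal entries. Normalising constants are never computed: total mass fixes each of
  them. The obstacle is that total variation asks for convergence of h in L1, while h is unbounded
  near the boundary of its domain. Convergence in probability of the Gram matrix therefore does not
  suffice; the share of E h carried by atypical Gram matrices must vanish too. This is why one row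
  is sacrificed: tail bounds of order exp(-c p) come from the remaining rows, the price of the
  sacrificed row is at most (B p)^k times a constant, and k is fixed. The Gram matrix has size k
  whatever p is, so continuity of h is needed at a single point of a fixed space. The assumption on
  \<beta> at column k covers all columns, since H_\<mu> decreases to the right of the mass of
  \<mu>.\<close>

lemma stiefel_carrier: "V \<in> stiefel p k \<Longrightarrow> V \<in> carrier_mat p k"
  by (simp add: stiefel_def)

lemma stiefel_iff:
  "V \<in> stiefel p k \<longleftrightarrow> V \<in> carrier_mat p k \<and>
    (\<forall>i<k. \<forall>j<k. (\<Sum>l<p. V $$ (l,i) * V $$ (l,j)) = (if i = j then 1 else 0))"
proof (cases "V \<in> carrier_mat p k")
  case True
  have "V\<^sup>T * V = 1\<^sub>m k \<longleftrightarrow> (\<forall>i<k. \<forall>j<k. (V\<^sup>T * V) $$ (i,j) = (1\<^sub>m k :: real mat) $$ (i,j))"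
  proof (intro iffI allI impI)
    assume "\<forall>i<k. \<forall>j<k. (V\<^sup>T * V) $$ (i,j) = (1\<^sub>m k :: real mat) $$ (i,j)"
    then show "V\<^sup>T * V = 1\<^sub>m k" using True by (intro eq_matI) auto
  qed simp
  also have "\<dots> \<longleftrightarrow> (\<forall>i<k. \<forall>j<k. (\<Sum>l<p. V $$ (l,i) * V $$ (l,j)) = (if i = j then 1 else 0))"
    using True by (simp add: scalar_prod_def atLeast0LessThan)
  finally show ?thesis using True by (simp add: stiefel_def)
qed (simp add: stiefel_def)

lemma stiefel_square:
  assumes "W \<in> stiefel n n"
  shows "W \<in> carrier_mat n n" "W\<^sup>T * W = 1\<^sub>m n" "W * W\<^sup>T = 1\<^sub>m n" "W\<^sup>T \<in> stiefel n n"
proof -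
  show c: "W \<in> carrier_mat n n" and o: "W\<^sup>T * W = 1\<^sub>m n" using assms by (auto simp: stiefel_def)
  show o': "W * W\<^sup>T = 1\<^sub>m n"
    using mat_mult_left_right_inverse[OF _ c o] c by simp
  show "W\<^sup>T \<in> stiefel n n" using c o' by (simp add: stiefel_def)
qed

lemma stiefel_mult:
  assumes "A \<in> stiefel p n" "B \<in> stiefel n k"
  shows "A * B \<in> stiefel p k"
proof -
  have c: "A \<in> carrier_mat p n" "B \<in> carrier_mat n k" using assms by (auto simp: stiefel_def)
  have "(A * B)\<^sup>T * (A * B) = B\<^sup>T * (A\<^sup>T * (A * B))"
    unfolding transpose_mult[OF c] using c by (intro assoc_mult_mat[of _ k n _ p]) auto
  also have "A\<^sup>T * (A * B) = (A\<^sup>T * A) * B"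
    using c by (intro assoc_mult_mat[symmetric, of _ n p _ n]) auto
  also have "\<dots> = B" using assms c by (simp add: stiefel_def)
  finally have "(A * B)\<^sup>T * (A * B) = B\<^sup>T * B" .
  then show ?thesis using assms c by (simp add: stiefel_def)
qed

lemma det_stiefel: "W \<in> stiefel n n \<Longrightarrow> det W * det W = 1"
  using det_mult[of "W\<^sup>T" n W] det_transpose[of W n] stiefel_square[of W n] by simp

section \<open>Householder reflections\<close>

text \<open>The reflection along \<open>u = v - e\<close>, with \<open>e\<close> the first basis
  vector; for a unit vector \<open>v\<close> it exchanges \<open>v\<close> and \<open>e\<close>. If
  \<open>v = e\<close> the division by zero yields 0 and the value is the identity, which is the
  right choice.\<close>

definition householder :: "nat \<Rightarrow> real mat \<Rightarrow> real mat" where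
  "householder n v = (let u = (\<lambda>i. v $$ (i, 0) - (if i = 0 then 1 else 0)) in
     Matrix.mat n n (\<lambda>(i, j). (if i = j then 1 else 0) - 2 / (\<Sum>l<n. (u l)\<^sup>2) * u i * u j))"

lemma householder_carrier[simp]: "householder n v \<in> carrier_mat n n"
  by (simp add: householder_def Let_def)

lemma householder_transpose: "(householder n v)\<^sup>T = householder n v"
  by (rule eq_matI) (auto simp: householder_def Let_def)

text \<open>The terms with factors 2/s, 2/s and (2/s)^2 s cancel for every \<open>v\<close>, unit or
  not; for \<open>s = 0\<close> all of them are 0.\<close>

lemma householder_stiefel: "householder n v \<in> stiefel n n"
proof -
  define u where "u = (\<lambda>i. v $$ (i, 0) - (if i = 0 then 1 else (0::real)))"
  define s where "s = (\<Sum>l<n. (u l)\<^sup>2)"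
  have e: "householder n v $$ (i,j) = (if i = j then 1 else 0) - 2 / s * u i * u j" if "i < n" "j < n" for i j
    using that by (simp add: householder_def Let_def u_def s_def)
  have "(\<Sum>l<n. householder n v $$ (l,i) * householder n v $$ (l,j)) = (if i = j then 1 else 0)"
    if ij: "i < n" "j < n" for i j
  proof -
    have "(\<Sum>l<n. householder n v $$ (l,i) * householder n v $$ (l,j))
      = (\<Sum>l<n. (if l = i then (if i = j then 1 else 0) else 0) - (if l = i then 2 / s * u i * u j else 0)
           - (if l = j then 2 / s * u i * u j else 0) + (2/s)\<^sup>2 * u i * u j * (u l)\<^sup>2)"
      using ij by (intro sum.cong) (auto simp: e algebra_simps power2_eq_square)
    also have "\<dots> = (if i = j then 1 else 0) - 2 / s * u i * u j - 2 / s * u i * u j + (2/s)\<^sup>2 * u i * u j * s"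
      using ij by (simp add: sum.distrib sum_subtractf s_def sum_distrib_left[symmetric])
    also have "\<dots> = (if i = j then 1 else 0)"
      by (cases "s = 0") (auto simp: field_simps power2_eq_square)
    finally show ?thesis .
  qed
  then show ?thesis by (simp add: stiefel_iff)
qed

text \<open>For a unit vector the squared length of \<open>u\<close> is 2 - 2
  \<open>v $$ (0,0)\<close>, that is -2 \<open>u 0\<close>, so the correction in column 0 is exactly
  \<open>u i\<close>.\<close>

lemma householder_col0:
  assumes "v \<in> carrier_mat n 1" "(\<Sum>l<n. (v $$ (l,0))\<^sup>2) = 1" "i < n"
  shows "householder n v $$ (i, 0) = v $$ (i, 0)"
proof -
  define u where "u = (\<lambda>i. v $$ (i, 0) - (if i = 0 then 1 else (0::real)))"
  define s where "s = (\<Sum>l<n. (u l)\<^sup>2)"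
  have n: "0 < n" using assms by auto
  have e: "householder n v $$ (i,j) = (if i = j then 1 else 0) - 2 / s * u i * u j" if "i < n" "j < n" for i j
    using that by (simp add: householder_def Let_def u_def s_def)
  have "s = (\<Sum>l<n. (v $$ (l,0))\<^sup>2 + (if l = 0 then 1 - 2 * v $$ (0,0) else 0))"
    unfolding s_def u_def by (intro sum.cong) (auto simp: power2_eq_square algebra_simps)
  then have s: "s = 2 - 2 * v $$ (0,0)" using assms n by (simp add: sum.distrib)
  show ?thesis
  proof (cases "s = 0")
    case True
    then have "u i = 0" using assms(3) unfolding s_def by (simp add: sum_nonneg_eq_0_iff)
    then show ?thesis using e[of i 0] assms n by (auto simp: u_def split: if_splits)
  next
    case False
    have "u 0 = - s / 2" using s by (simp add: u_def)
    then have "2 / s * u i * u 0 = - u i" using False by simp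
    then have "householder n v $$ (i,0) = (if i = 0 then 1 else 0) + u i"
      using e[OF assms(3) n] by simp
    then show ?thesis by (simp add: u_def)
  qed
qed

section \<open>Bordered matrices\<close>

text \<open>The block matrix diag(\<open>a\<close>, \<open>M\<close>). With \<open>a = 1\<close> it
  embeds frames as those frames, one dimension up, whose first column is the first basis vector;
  this carries the inductions on dimension.\<close>

definition border :: "real \<Rightarrow> real mat \<Rightarrow> real mat" where
  "border a M = Matrix.mat (Suc (dim_row M)) (Suc (dim_col M))
     (\<lambda>(i, j). if i = 0 \<and> j = 0 then a else if i = 0 \<or> j = 0 then 0 else M $$ (i - 1, j - 1))"

lemma border_carrier[simp]: "M \<in> carrier_mat r c \<Longrightarrow> border a M \<in> carrier_mat (Suc r) (Suc c)"
  by (auto simp: border_def)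

lemma border_index:
  assumes "M \<in> carrier_mat r c"
  shows "border a M $$ (0, 0) = a" "j < c \<Longrightarrow> border a M $$ (0, Suc j) = 0"
    "i < r \<Longrightarrow> border a M $$ (Suc i, 0) = 0"
    "i < r \<Longrightarrow> j < c \<Longrightarrow> border a M $$ (Suc i, Suc j) = M $$ (i, j)"
  using assms by (auto simp: border_def)

lemma border_mult:
  assumes M: "M \<in> carrier_mat r n" and N: "N \<in> carrier_mat n c"
  shows "border a M * border b N = border (a * b) (M * N)"
proof (rule eq_matI, goal_cases)
  case (1 i j)
  have B: "border a M \<in> carrier_mat (Suc r) (Suc n)" "border b N \<in> carrier_mat (Suc n) (Suc c)" using M N by auto
  have ij: "i < Suc r" "j < Suc c" using 1 M N by (auto simp: border_def)
  have "(border a M * border b N) $$ (i,j) = (\<Sum>l<Suc n. border a M $$ (i,l) * border b N $$ (l,j))"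
    using B ij by (simp add: scalar_prod_def atLeast0LessThan)
  also have "\<dots> = border a M $$ (i,0) * border b N $$ (0,j)
      + (\<Sum>l<n. border a M $$ (i,Suc l) * border b N $$ (Suc l,j))"
    by (rule sum.lessThan_Suc_shift)
  also have "\<dots> = border (a * b) (M * N) $$ (i,j)"
    using ij M N by (cases i; cases j)
      (auto simp: border_index[OF M] border_index[OF N] border_index[OF mult_carrier_mat[OF M N]]
        scalar_prod_def atLeast0LessThan)
  finally show ?case .
qed (use M N in \<open>auto simp: border_def\<close>)

lemma border_transpose: "(border a M)\<^sup>T = border a (M\<^sup>T)"
  by (rule eq_matI) (auto simp: border_def)

lemma border_one: "border 1 (1\<^sub>m n) = 1\<^sub>m (Suc n)"
  by (rule eq_matI) (auto simp: border_def)

lemma border_inject: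
  assumes "M \<in> carrier_mat r c" "N \<in> carrier_mat r c" "border a M = border b N"
  shows "M = N"
proof (rule eq_matI)
  fix i j assume "i < dim_row N" "j < dim_col N"
  then show "M $$ (i,j) = N $$ (i,j)"
    using border_index(4)[OF assms(1), of i j a] border_index(4)[OF assms(2), of i j b] assms by auto
qed (use assms in auto)

lemma border_stiefel_iff:
  assumes "M \<in> carrier_mat p k"
  shows "border 1 M \<in> stiefel (Suc p) (Suc k) \<longleftrightarrow> M \<in> stiefel p k"
proof -
  have "border 1 (M\<^sup>T * M) = 1\<^sub>m (Suc k) \<longleftrightarrow> M\<^sup>T * M = 1\<^sub>m k"
    using border_inject[of "M\<^sup>T * M" k k "1\<^sub>m k" 1 1] assms by (auto simp: border_one)
  then show ?thesis
    using assms by (simp add: stiefel_def border_transpose border_mult[of _ k p _ k])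
qed

lemma border_collapse:
  assumes "A \<in> carrier_mat (Suc r) (Suc c)" "\<And>i. i < r \<Longrightarrow> A $$ (Suc i, 0) = 0" "\<And>j. j < c \<Longrightarrow> A $$ (0, Suc j) = 0"
  shows "A = border (A $$ (0,0)) (Matrix.mat r c (\<lambda>(i,j). A $$ (Suc i, Suc j)))"
proof (rule eq_matI, goal_cases)
  case (1 i j)
  then show ?case using assms by (cases i; cases j) (auto simp: border_def)
qed (use assms in \<open>auto simp: border_def\<close>)

text \<open>The other columns are orthogonal to the first basis vector, so the first row vanishes
  outside the corner.\<close>

lemma stiefel_first_col_border:
  assumes "A \<in> stiefel (Suc p) (Suc k)" "A $$ (0,0) = 1" "\<And>i. i < p \<Longrightarrow> A $$ (Suc i, 0) = 0"
  obtains M where "M \<in> stiefel p k" "A = border 1 M"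
proof -
  have c: "A \<in> carrier_mat (Suc p) (Suc k)" using assms by (simp add: stiefel_def)
  have "A $$ (0, Suc j) = 0" if "j < k" for j
  proof -
    have "(\<Sum>l<Suc p. A $$ (l,0) * A $$ (l,Suc j)) = 0"
      using assms(1) that unfolding stiefel_iff by (auto)
    then show ?thesis unfolding sum.lessThan_Suc_shift using assms by simp
  qed
  from border_collapse[OF c assms(3) this] assms(2)
  have A: "A = border 1 (Matrix.mat p k (\<lambda>(i,j). A $$ (Suc i, Suc j)))" by simp
  show ?thesis
  proof (rule that[OF _ A])
    show "Matrix.mat p k (\<lambda>(i,j). A $$ (Suc i, Suc j)) \<in> stiefel p k"
      using assms(1) A border_stiefel_iff[of "Matrix.mat p k (\<lambda>(i,j). A $$ (Suc i, Suc j))" p k] by simp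
  qed
qed

definition eye :: "nat \<Rightarrow> nat \<Rightarrow> real mat" where
  "eye p k = Matrix.mat p k (\<lambda>(i, j). if i = j then 1 else 0)"

lemma eye_carrier[simp]: "eye p k \<in> carrier_mat p k"
  by (simp add: eye_def)

lemma border_eye: "border 1 (eye p k) = eye (Suc p) (Suc k)"
  by (rule eq_matI) (auto simp: border_def eye_def)

text \<open>The reflection is symmetric and has \<open>v\<close> as its column 0, so this is the
  orthogonality of its columns \<open>i\<close> and 0.\<close>

lemma householder_mult_col0:
  assumes "v \<in> carrier_mat n 1" "(\<Sum>l<n. (v $$ (l,0))\<^sup>2) = 1" "i < n"
  shows "(\<Sum>l<n. householder n v $$ (i,l) * v $$ (l,0)) = (if i = 0 then 1 else 0)"
proof -
  have n: "0 < n" using assms by auto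
  have "(\<Sum>l<n. householder n v $$ (l,i) * householder n v $$ (l,0)) = (if i = 0 then 1 else 0)"
    using householder_stiefel[of n v] n assms by (auto simp: stiefel_iff)
  moreover have "householder n v $$ (l,i) = householder n v $$ (i,l)" if "l < n" for l
    using that assms(3) householder_transpose[of n v]
    by (metis householder_carrier carrier_matD index_transpose_mat(1))
  ultimately show ?thesis using householder_col0[OF assms(1,2)] by simp
qed

text \<open>A reflection moves the first column to the first basis vector; what remains is a frame
  with one column less in one dimension less, which is completed by induction.\<close>

lemma stiefel_completion:
  "V \<in> stiefel p k \<Longrightarrow> \<exists>R\<in>stiefel p p. V = R * eye p k"
proof (induction k arbitrary: p V)
  case 0
  then show ?case
    by (intro bexI[of _ "1\<^sub>m p"]) (auto simp: stiefel_def eye_def intro!: eq_matI)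
next
  case (Suc k)
  show ?case
  proof (cases p)
    case 0
    then have "(0::real) = 1" using Suc.prems unfolding stiefel_iff by (auto dest!: spec[of _ 0])
    then show ?thesis by simp
  next
    case (Suc q)
    define v where "v = Matrix.mat p 1 (\<lambda>(i,j). V $$ (i,0))"
    have V: "V \<in> carrier_mat p (Suc k)" using Suc.prems by (simp add: stiefel_def)
    have v: "v \<in> carrier_mat p 1" "(\<Sum>l<p. (v $$ (l,0))\<^sup>2) = 1"
      using Suc.prems by (auto simp: v_def stiefel_iff power2_eq_square)
    let ?H = "householder p v"
    have HV: "?H * V \<in> stiefel (Suc q) (Suc k)"
      using stiefel_mult[OF householder_stiefel Suc.prems, of v] Suc by simp
    have e: "(?H * V) $$ (i,0) = (if i = 0 then 1 else 0)" if "i < p" for i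
      using householder_mult_col0[OF v that] that V
      by (simp add: v_def scalar_prod_def atLeast0LessThan carrier_matD[OF householder_carrier])
    obtain M where M: "M \<in> stiefel q k" "?H * V = border 1 M"
      using stiefel_first_col_border[OF HV] e Suc by auto
    obtain R where R: "R \<in> stiefel q q" "M = R * eye q k" using Suc.IH[OF M(1)] by auto
    have Rc: "R \<in> carrier_mat q q" using R by (simp add: stiefel_def)
    have "V = ?H * (?H * V)"
      using assoc_mult_mat[of ?H p p ?H p V "Suc k"] V stiefel_square(2)[OF householder_stiefel, of p v]
      by (simp add: householder_transpose)
    also have "?H * V = border 1 R * eye p (Suc k)"
      unfolding M(2) R(2) using border_mult[OF Rc eye_carrier[of q k], of 1 1] Suc by (simp add: border_eye)
    also have "?H * \<dots> = (?H * border 1 R) * eye p (Suc k)"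
      using Suc Rc by (intro assoc_mult_mat[symmetric, of _ p p _ p _ "Suc k"]) auto
    finally show ?thesis using stiefel_mult[OF householder_stiefel] R Rc Suc border_stiefel_iff[OF Rc]
      by (intro bexI[of _ "?H * border 1 R"]) auto
  qed
qed

section \<open>Spectral theorem and functional calculus\<close>

lemma mult_carrier_square: "A \<in> carrier_mat n n \<Longrightarrow> B \<in> carrier_mat n n \<Longrightarrow> A * B \<in> carrier_mat n n"
  by (rule mult_carrier_mat)

lemma assoc_square:
  "A \<in> carrier_mat n n \<Longrightarrow> B \<in> carrier_mat n n \<Longrightarrow> C \<in> carrier_mat n n \<Longrightarrow> A * B * C = A * (B * C)"
  by (rule assoc_mult_mat)

lemma sqrt_prod_nonneg: "(\<And>i. i \<in> I \<Longrightarrow> 0 \<le> f i) \<Longrightarrow> sqrt (\<Prod>i\<in>I. f i) = (\<Prod>i\<in>I. sqrt (f i))"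
  by (induction I rule: infinite_finite_induct) (auto simp: real_sqrt_mult)

text \<open>A complex eigenpair (\<open>z\<close>, \<open>X\<close>) exists by the fundamental
  theorem of algebra. The Hermitian form \<open>T\<close> of \<open>X\<close> equals
  \<open>z\<close> times a positive number and is its own conjugate, so \<open>z\<close> is real.
  The real and the imaginary part of \<open>X\<close> then both solve the real eigenvalue equation,
  and one of them is nonzero and can be normalised.\<close>

lemma symmetric_unit_eigenvector:
  fixes A :: "real mat"
  assumes A: "A \<in> carrier_mat n n" "A\<^sup>T = A" and n: "0 < n"
  obtains ev v where "v \<in> carrier_mat n 1" "(\<Sum>l<n. (v $$ (l,0))\<^sup>2) = 1" "A * v = ev \<cdot>\<^sub>m v"
proof -
  note goal = that
  have sym: "A $$ (i,j) = A $$ (j,i)" if "i < n" "j < n" for i j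
    using A that by (metis carrier_matD index_transpose_mat(1))
  define C where "C = map_mat complex_of_real A"
  have C: "C \<in> carrier_mat n n" using A by (simp add: C_def)
  have Cij: "C $$ (i,j) = complex_of_real (A $$ (i,j))" if "i < n" "j < n" for i j
    using A that by (simp add: C_def)
  have "degree (char_poly C) = n" using degree_monic_char_poly[OF C] by simp
  then have "\<not> constant (poly (char_poly C))" using n by (simp add: constant_degree)
  then obtain z where "poly (char_poly C) z = 0" using fundamental_theorem_of_algebra by blast
  then have "eigenvalue C z" using eigenvalue_root_char_poly[OF C] by simp
  then obtain x where x: "x \<in> carrier_vec n" "x \<noteq> 0\<^sub>v n" "C *\<^sub>v x = z \<cdot>\<^sub>v x"
    using C by (auto simp: eigenvalue_def eigenvector_def)
  define X where "X = (\<lambda>i. vec_index x i)"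
  have evx: "(\<Sum>j<n. complex_of_real (A $$ (i,j)) * X j) = z * X i" if "i < n" for i
  proof -
    have "vec_index (C *\<^sub>v x) i = (\<Sum>j<n. complex_of_real (A $$ (i,j)) * X j)"
      using C x(1) that by (simp add: scalar_prod_def atLeast0LessThan Cij X_def)
    then show ?thesis using x that by (simp add: X_def)
  qed
  have "\<exists>i<n. X i \<noteq> 0"
  proof (rule ccontr)
    assume "\<not> ?thesis"
    then have "x = 0\<^sub>v n" using x by (intro eq_vecI) (auto simp: X_def)
    then show False using x by simp
  qed
  then have pos: "0 < (\<Sum>i<n. (cmod (X i))\<^sup>2)"
    by (auto intro!: sum_pos2)
  define T where "T = (\<Sum>i<n. \<Sum>j<n. cnj (X i) * complex_of_real (A $$ (i,j)) * X j)"
  have T1: "T = z * complex_of_real (\<Sum>i<n. (cmod (X i))\<^sup>2)"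
  proof -
    have "T = (\<Sum>i<n. cnj (X i) * (\<Sum>j<n. complex_of_real (A $$ (i,j)) * X j))"
      by (simp add: T_def sum_distrib_left mult.assoc)
    also have "\<dots> = (\<Sum>i<n. cnj (X i) * (z * X i))" using evx by simp
    also have "\<dots> = (\<Sum>i<n. z * (X i * cnj (X i)))" by (simp add: ac_simps)
    also have "\<dots> = z * complex_of_real (\<Sum>i<n. (cmod (X i))\<^sup>2)"
      by (simp add: sum_distrib_left complex_norm_square[symmetric])
    finally show ?thesis .
  qed
  have "cnj T = (\<Sum>i<n. \<Sum>j<n. X i * complex_of_real (A $$ (i,j)) * cnj (X j))" by (simp add: T_def)
  also have "\<dots> = (\<Sum>j<n. \<Sum>i<n. X i * complex_of_real (A $$ (i,j)) * cnj (X j))" by (rule sum.swap)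
  also have "\<dots> = T" unfolding T_def by (intro sum.cong refl) (auto simp: sym)
  finally have "cnj z * complex_of_real (\<Sum>i<n. (cmod (X i))\<^sup>2) = z * complex_of_real (\<Sum>i<n. (cmod (X i))\<^sup>2)"
    unfolding T1 by simp
  then have "cnj z = z" using pos by (metis mult_right_cancel of_real_eq_0_iff less_irrefl)
  then have z: "Im z = 0" by (simp add: complex_eq_iff)
  have gen: thesis if y: "\<And>i. i < n \<Longrightarrow> (\<Sum>j<n. A $$ (i,j) * y j) = Re z * y i" and nz: "\<exists>i<n. y i \<noteq> 0" for y
  proof -
    define s where "s = sqrt (\<Sum>l<n. (y l)\<^sup>2)"
    have "0 < (\<Sum>l<n. (y l)\<^sup>2)" using nz by (auto intro!: sum_pos2)
    then have s: "s > 0" "s\<^sup>2 = (\<Sum>l<n. (y l)\<^sup>2)" by (auto simp: s_def)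
    define v where "v = Matrix.mat n 1 (\<lambda>(i,j). y i / s)"
    have "(\<Sum>l<n. (v $$ (l,0))\<^sup>2) = 1"
      using s(1) by (simp add: v_def power_divide sum_divide_distrib[symmetric] s(2)[symmetric])
    moreover have "A * v = Re z \<cdot>\<^sub>m v"
    proof (rule eq_matI)
      fix i j assume "i < dim_row (Re z \<cdot>\<^sub>m v)" "j < dim_col (Re z \<cdot>\<^sub>m v)"
      then have "i < n" "j = 0" by (auto simp: v_def)
      then show "(A * v) $$ (i,j) = (Re z \<cdot>\<^sub>m v) $$ (i,j)"
        using A y[of i] by (simp add: v_def scalar_prod_def atLeast0LessThan sum_divide_distrib[symmetric])
    qed (use A in \<open>auto simp: v_def\<close>)
    moreover have "v \<in> carrier_mat n 1" by (simp add: v_def)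
    ultimately show thesis by (intro goal)
  qed
  have re: "(\<Sum>j<n. A $$ (i,j) * Re (X j)) = Re z * Re (X i)" if "i < n" for i
    using arg_cong[OF evx[OF that], of Re] z by simp
  have im: "(\<Sum>j<n. A $$ (i,j) * Im (X j)) = Re z * Im (X i)" if "i < n" for i
    using arg_cong[OF evx[OF that], of Im] z by simp
  obtain i where i: "i < n" "X i \<noteq> 0" using \<open>\<exists>i<n. X i \<noteq> 0\<close> by auto
  then consider "Re (X i) \<noteq> 0" | "Im (X i) \<noteq> 0" by (auto simp: complex_eq_iff)
  then show thesis
  proof cases
    case 1 then show thesis using gen[of "\<lambda>i. Re (X i)"] re i by blast
  next
    case 2 then show thesis using gen[of "\<lambda>i. Im (X i)"] im i by blast
  qed
qed

definition spectral_decomp :: "nat \<Rightarrow> real mat \<Rightarrow> real mat \<Rightarrow> (nat \<Rightarrow> real) \<Rightarrow> bool" where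
  "spectral_decomp n A W d \<longleftrightarrow> W \<in> stiefel n n \<and> A = W * mat_diag n d * W\<^sup>T"

lemma border_mat_diag: "border a (mat_diag n d) = mat_diag (Suc n) (\<lambda>i. case i of 0 \<Rightarrow> a | Suc j \<Rightarrow> d j)"
  by (rule eq_matI) (auto simp: border_def mat_diag_def split: nat.splits)

text \<open>Deflation: conjugating with the reflection that exchanges a unit eigenvector and the
  first basis vector clears the first column below the corner, by symmetry also the first row, and
  leaves a smaller symmetric block.\<close>

theorem spectral_theorem:
  "A \<in> carrier_mat n n \<Longrightarrow> A\<^sup>T = A \<Longrightarrow> \<exists>W d. spectral_decomp n A W d"
proof (induction n arbitrary: A)
  case 0
  then show ?case
    by (intro exI[of _ "1\<^sub>m 0"] exI[of _ "\<lambda>_. 0"])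
       (auto simp: spectral_decomp_def stiefel_def intro!: eq_matI)
next
  case (Suc n)
  note A = Suc.prems
  obtain ev v where v: "v \<in> carrier_mat (Suc n) 1" "(\<Sum>l<Suc n. (v $$ (l,0))\<^sup>2) = 1" "A * v = ev \<cdot>\<^sub>m v"
    using symmetric_unit_eigenvector[OF A] by blast
  define H where "H = householder (Suc n) v"
  have H: "H \<in> carrier_mat (Suc n) (Suc n)" "H * H = 1\<^sub>m (Suc n)" "H\<^sup>T = H"
    using stiefel_square(2)[OF householder_stiefel, of "Suc n" v] by (auto simp: H_def householder_transpose)
  define B where "B = H * (A * H)"
  have B: "B \<in> carrier_mat (Suc n) (Suc n)" using A H by (simp add: B_def)
  have Bs: "B\<^sup>T = B"
  proof -
    have "B\<^sup>T = (A * H)\<^sup>T * H\<^sup>T" unfolding B_def using A H by (intro transpose_mult) auto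
    also have "(A * H)\<^sup>T = H * A" using A H by (subst transpose_mult) auto
    also have "H * A * H\<^sup>T = B" unfolding B_def H(3) using A H by (intro assoc_mult_mat) auto
    finally show ?thesis .
  qed
  have e: "B $$ (i,0) = (if i = 0 then ev else 0)" if i: "i < Suc n" for i
  proof -
    have AH: "(A * H) $$ (l,0) = ev * v $$ (l,0)" if "l < Suc n" for l
    proof -
      have "(A * H) $$ (l,0) = (\<Sum>j<Suc n. A $$ (l,j) * H $$ (j,0))"
        using A H that by (simp add: scalar_prod_def atLeast0LessThan)
      also have "\<dots> = (\<Sum>j<Suc n. A $$ (l,j) * v $$ (j,0))"
        using householder_col0[OF v(1,2)] by (intro sum.cong) (auto simp: H_def)
      also have "\<dots> = (A * v) $$ (l,0)"
        using A v(1) that by (simp add: scalar_prod_def atLeast0LessThan)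
      finally show ?thesis using v that by simp
    qed
    have "B $$ (i,0) = (\<Sum>l<Suc n. H $$ (i,l) * (A * H) $$ (l,0))"
      using A H i by (simp add: B_def scalar_prod_def atLeast0LessThan del: sum.lessThan_Suc)
    also have "\<dots> = (\<Sum>l<Suc n. H $$ (i,l) * (ev * v $$ (l,0)))"
      using AH by (intro sum.cong) auto
    also have "\<dots> = ev * (\<Sum>l<Suc n. H $$ (i,l) * v $$ (l,0))"
      unfolding sum_distrib_left by (intro sum.cong) auto
    finally show ?thesis using householder_mult_col0[OF v(1,2) i] by (simp add: H_def)
  qed
  have e': "B $$ (0, Suc j) = 0" if "j < n" for j
  proof -
    have "B $$ (0, Suc j) = B\<^sup>T $$ (0, Suc j)" using Bs by simp
    also have "\<dots> = B $$ (Suc j, 0)" using B that by simp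
    finally show ?thesis using e[of "Suc j"] that by simp
  qed
  define M where "M = Matrix.mat n n (\<lambda>(i,j). B $$ (Suc i, Suc j))"
  have BM: "B = border ev M" using border_collapse[OF B _ e'] e by (simp add: M_def)
  have M: "M \<in> carrier_mat n n" by (simp add: M_def)
  have "M\<^sup>T = M" using Bs border_inject[of "M\<^sup>T" n n M ev ev] M by (simp add: BM border_transpose)
  then obtain W d where W: "W \<in> stiefel n n" "M = W * mat_diag n d * W\<^sup>T"
    using Suc.IH[OF M] by (auto simp: spectral_decomp_def)
  have Wc: "W \<in> carrier_mat n n" using W by (simp add: stiefel_def)
  define d' where "d' = (\<lambda>i. case i of 0 \<Rightarrow> ev | Suc j \<Rightarrow> d j)"
  define V where "V = H * border 1 W"
  have Vs: "V \<in> stiefel (Suc n) (Suc n)" unfolding V_def H_def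
    using border_stiefel_iff[OF Wc] W by (intro stiefel_mult[OF householder_stiefel]) auto
  have bW: "border 1 W \<in> carrier_mat (Suc n) (Suc n)" "(border 1 W)\<^sup>T \<in> carrier_mat (Suc n) (Suc n)" using Wc by auto
  have D: "mat_diag (Suc n) d' \<in> carrier_mat (Suc n) (Suc n)" by simp
  have Bd: "B = border 1 W * mat_diag (Suc n) d' * (border 1 W)\<^sup>T"
    unfolding BM W(2) d'_def border_mat_diag[symmetric] border_transpose
    using Wc by (simp add: border_mult[of _ n n _ n])
  have "A = H * (B * H)"
  proof -
    have "B * H = H * A"
      unfolding B_def using A H by (simp add: assoc_square[where n="Suc n"] mult_carrier_square)
    moreover have "(H * H) * A = H * (H * A)" using A H by (intro assoc_square)
    ultimately show ?thesis using A H(2) by simp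
  qed
  also have "\<dots> = V * mat_diag (Suc n) d' * V\<^sup>T"
    unfolding Bd V_def using H bW D
    by (simp add: transpose_mult[OF H(1) bW(1)] assoc_square[where n="Suc n"] mult_carrier_square)
  finally show ?case using Vs by (auto simp: spectral_decomp_def)
qed

lemma conj_diag_index:
  fixes W :: "real mat"
  assumes "W \<in> carrier_mat m n" "a < m" "b < m"
  shows "(W * mat_diag n f * W\<^sup>T) $$ (a,b) = (\<Sum>l<n. W $$ (a,l) * f l * W $$ (b,l))"
  using assms by (simp add: mat_diag_mult_right[OF assms(1)] scalar_prod_def atLeast0LessThan)

lemma conj_diag_carrier: "(W :: real mat) \<in> carrier_mat m n \<Longrightarrow> W * mat_diag n f * W\<^sup>T \<in> carrier_mat m m"
  by (metis carrier_matI mult_carrier_mat mat_diag_dim transpose_carrier_mat)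

lemma conj_diag_mult:
  assumes "W \<in> stiefel n n"
  shows "(W * mat_diag n f * W\<^sup>T) * (W * mat_diag n g * W\<^sup>T) = W * mat_diag n (\<lambda>i. f i * g i) * W\<^sup>T"
proof -
  note W = stiefel_square[OF assms]
  have WT: "W\<^sup>T \<in> carrier_mat n n" using W by simp
  have "(W * mat_diag n f * W\<^sup>T) * (W * mat_diag n g * W\<^sup>T)
    = W * (mat_diag n f * ((W\<^sup>T * W) * (mat_diag n g * W\<^sup>T)))"
    using W(1) WT by (simp add: assoc_square[where n=n] mult_carrier_square del: mat_diag_diag)
  also have "\<dots> = W * ((mat_diag n f * mat_diag n g) * W\<^sup>T)"
    unfolding W(2) left_mult_one_mat[OF mult_carrier_square[OF mat_diag_dim WT]]
    using W(1) WT by (simp add: assoc_square[where n=n] mult_carrier_square del: mat_diag_diag)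
  finally show ?thesis using W(1) WT by (simp add: assoc_square[where n=n] mult_carrier_square)
qed

lemma conj_diag_one: "W \<in> stiefel n n \<Longrightarrow> W * mat_diag n (\<lambda>_. 1) * W\<^sup>T = 1\<^sub>m n"
  using stiefel_square[of W n] by simp

lemma conj_diag_transpose:
  fixes W :: "real mat"
  assumes "W \<in> carrier_mat m n"
  shows "(W * mat_diag n f * W\<^sup>T)\<^sup>T = W * mat_diag n f * W\<^sup>T"
proof (rule eq_matI)
  note c = carrier_matD[OF conj_diag_carrier[OF assms, of f]]
  fix i j assume "i < dim_row (W * mat_diag n f * W\<^sup>T)" "j < dim_col (W * mat_diag n f * W\<^sup>T)"
  then have ij: "i < m" "j < m" using c by auto
  then have "(W * mat_diag n f * W\<^sup>T)\<^sup>T $$ (i,j) = (W * mat_diag n f * W\<^sup>T) $$ (j,i)"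
    using c by (intro index_transpose_mat(1)) auto
  also have "\<dots> = (W * mat_diag n f * W\<^sup>T) $$ (i,j)"
    unfolding conj_diag_index[OF assms ij] conj_diag_index[OF assms ij(2,1)]
    by (intro sum.cong refl) (simp add: mult.commute mult.left_commute)
  finally show "(W * mat_diag n f * W\<^sup>T)\<^sup>T $$ (i,j) = (W * mat_diag n f * W\<^sup>T) $$ (i,j)" .
qed (use conj_diag_carrier[OF assms, of f] in auto)

lemma conj_diag_pow:
  assumes "W \<in> stiefel n n"
  shows "(W * mat_diag n f * W\<^sup>T) ^\<^sub>m r = W * mat_diag n (\<lambda>i. f i ^ r) * W\<^sup>T"
proof (induction r)
  case 0
  have "dim_row (W * mat_diag n f * W\<^sup>T) = n" using stiefel_square(1)[OF assms] by simp
  then show ?case using conj_diag_one[OF assms] by simp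
next
  case (Suc r)
  then show ?case by (simp add: conj_diag_mult[OF assms] power_Suc2 del: power_Suc)
qed

text \<open>The Weierstrass theorem on [-m, m] with error 1/(m+1). Every \<open>x\<close> lies in
  all but finitely many of these intervals, so a single sequence of polynomials serves all points,
  and later all matrices of all sizes.\<close>

lemma polynomial_pointwise_approx:
  fixes f :: "real \<Rightarrow> real"
  assumes "continuous_on UNIV f"
  obtains a :: "nat \<Rightarrow> nat \<Rightarrow> real" and N :: "nat \<Rightarrow> nat"
  where "\<And>x. (\<lambda>m. \<Sum>r\<le>N m. a m r * x ^ r) \<longlonglongrightarrow> f x"
proof -
  have "\<exists>a N. \<forall>x\<in>{-real m..real m}. \<bar>f x - (\<Sum>r\<le>N. a r * x ^ r)\<bar> < inverse (real (Suc m))" for m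
  proof -
    obtain g where "real_polynomial_function g" "\<And>x. x \<in> {-real m..real m} \<Longrightarrow> \<bar>f x - g x\<bar> < inverse (real (Suc m))"
      using Stone_Weierstrass_real_polynomial_function[of "{-real m..real m}" f "inverse (real (Suc m))"]
        continuous_on_subset[OF assms, of "{-real m..real m}"] by auto
    moreover obtain a n where "g = (\<lambda>x. \<Sum>i\<le>n. a i * x ^ i)"
      using \<open>real_polynomial_function g\<close> by (auto simp: real_polynomial_function_iff_sum)
    ultimately show ?thesis by (intro exI[of _ a] exI[of _ n]) auto
  qed
  then obtain a N where aN: "\<And>m x. x \<in> {-real m..real m} \<Longrightarrow> \<bar>f x - (\<Sum>r\<le>N m. a m r * x ^ r)\<bar> < inverse (real (Suc m))"
    by metis
  show ?thesis
  proof (rule that)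
    fix x :: real
    obtain m0 where m0: "\<bar>x\<bar> \<le> real m0" using real_arch_simple by blast
    have "(\<lambda>m. f x - (\<Sum>r\<le>N m. a m r * x ^ r)) \<longlonglongrightarrow> 0"
    proof (rule Lim_null_comparison)
      show "\<forall>\<^sub>F m in sequentially. norm (f x - (\<Sum>r\<le>N m. a m r * x ^ r)) \<le> inverse (real (Suc m))"
        using eventually_ge_at_top[of m0]
      proof eventually_elim
        case (elim m)
        then show ?case using aN[of x m] m0 by (auto simp: abs_le_iff)
      qed
      show "(\<lambda>m. inverse (real (Suc m))) \<longlonglongrightarrow> 0" by (rule LIMSEQ_inverse_real_of_nat)
    qed
    from tendsto_diff[OF tendsto_const[of "f x"] this]
    show "(\<lambda>m. \<Sum>r\<le>N m. a m r * x ^ r) \<longlonglongrightarrow> f x" by simp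
  qed
qed

text \<open>Since the approximating expression involves only powers of \<open>A\<close>, the limit depends on \<open>A\<close> alone
  and is a measurable function of \<open>A\<close>.\<close>
lemma functional_calculus_limit:
  fixes f :: "real \<Rightarrow> real"
  assumes "continuous_on UNIV f"
  obtains a :: "nat \<Rightarrow> nat \<Rightarrow> real" and N :: "nat \<Rightarrow> nat"
  where "\<And>n A W d i j. spectral_decomp n A W d \<Longrightarrow> i < n \<Longrightarrow> j < n \<Longrightarrow>
    (\<lambda>m. \<Sum>r\<le>N m. a m r * (A ^\<^sub>m r) $$ (i,j)) \<longlonglongrightarrow> (W * mat_diag n (\<lambda>i. f (d i)) * W\<^sup>T) $$ (i,j)"
proof -
  obtain a N where lim: "\<And>x. (\<lambda>m. \<Sum>r\<le>N m. a m r * x ^ r) \<longlonglongrightarrow> f x"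
    using polynomial_pointwise_approx[OF assms] by blast
  show ?thesis
  proof (rule that[of a N])
    fix n A W d i j assume sd: "spectral_decomp n A W d" and ij: "i < n" "j < (n::nat)"
    have W: "W \<in> stiefel n n" "W \<in> carrier_mat n n" and A: "A = W * mat_diag n d * W\<^sup>T"
      using sd by (auto simp: spectral_decomp_def stiefel_def)
    have "(\<Sum>r\<le>N m. a m r * (A ^\<^sub>m r) $$ (i,j)) = (\<Sum>l<n. W $$ (i,l) * (\<Sum>r\<le>N m. a m r * d l ^ r) * W $$ (j,l))" for m
      unfolding A conj_diag_pow[OF W(1)] conj_diag_index[OF W(2) ij] sum_distrib_left sum_distrib_right
      by (subst sum.swap) (simp add: ac_simps)
    moreover have "(\<lambda>m. \<Sum>l<n. W $$ (i,l) * (\<Sum>r\<le>N m. a m r * d l ^ r) * W $$ (j,l))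
       \<longlonglongrightarrow> (\<Sum>l<n. W $$ (i,l) * f (d l) * W $$ (j,l))"
      by (intro tendsto_intros lim)
    ultimately show "(\<lambda>m. \<Sum>r\<le>N m. a m r * (A ^\<^sub>m r) $$ (i,j)) \<longlonglongrightarrow> (W * mat_diag n (\<lambda>i. f (d i)) * W\<^sup>T) $$ (i,j)"
      by (simp add: conj_diag_index[OF W(2) ij])
  qed
qed

lemma functional_calculus_unique:
  fixes f :: "real \<Rightarrow> real"
  assumes "continuous_on UNIV f" "spectral_decomp n A W d" "spectral_decomp n A W' d'"
  shows "W * mat_diag n (\<lambda>i. f (d i)) * W\<^sup>T = W' * mat_diag n (\<lambda>i. f (d' i)) * W'\<^sup>T"
proof -
  have c: "W \<in> carrier_mat n n" "W' \<in> carrier_mat n n"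
    using assms by (auto simp: spectral_decomp_def stiefel_def)
  obtain a N where lim: "\<And>n A W d i j. spectral_decomp n A W d \<Longrightarrow> i < n \<Longrightarrow> j < n \<Longrightarrow>
    (\<lambda>m. \<Sum>r\<le>N m. a m r * (A ^\<^sub>m r) $$ (i,j)) \<longlonglongrightarrow> (W * mat_diag n (\<lambda>i. f (d i)) * W\<^sup>T) $$ (i,j)"
    using functional_calculus_limit[OF assms(1)] by blast
  show ?thesis
    using c LIMSEQ_unique[OF lim[OF assms(2)] lim[OF assms(3)]] by (intro eq_matI) (auto simp del: index_mult_mat(1))
qed

text \<open>The functional calculus of the continuous function sqrt (max x 0). The composite is
  defined on all symmetric matrices, so no domain restriction interferes with measurability.\<close>

definition psd_sqrt_pos :: "real mat \<Rightarrow> real mat" where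
  "psd_sqrt_pos A = psd_sqrt (pos_part_mat A)"

lemma quadratic_form_conj_diag:
  fixes W :: "real mat"
  assumes W: "W \<in> carrier_mat m n" and v: "v \<in> carrier_vec m"
  shows "scalar_prod v ((W * mat_diag n d * W\<^sup>T) *\<^sub>v v)
    = (\<Sum>l<n. d l * (\<Sum>i<m. W $$ (i,l) * vec_index v i)\<^sup>2)"
proof -
  have "scalar_prod v ((W * mat_diag n d * W\<^sup>T) *\<^sub>v v)
    = (\<Sum>i<m. vec_index v i * (\<Sum>j<m. (W * mat_diag n d * W\<^sup>T) $$ (i,j) * vec_index v j))"
    using W v conj_diag_carrier[OF W, of d] by (simp add: scalar_prod_def atLeast0LessThan del: index_mult_mat(1))
  also have "\<dots> = (\<Sum>i<m. \<Sum>j<m. \<Sum>l<n. vec_index v i * (W $$ (i,l) * d l * W $$ (j,l)) * vec_index v j)"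
    using conj_diag_index[OF W] by (simp add: sum_distrib_left sum_distrib_right mult.assoc)
  also have "\<dots> = (\<Sum>i<m. \<Sum>l<n. \<Sum>j<m. vec_index v i * (W $$ (i,l) * d l * W $$ (j,l)) * vec_index v j)"
    by (rule sum.cong[OF refl], rule sum.swap)
  also have "\<dots> = (\<Sum>l<n. \<Sum>i<m. \<Sum>j<m. vec_index v i * (W $$ (i,l) * d l * W $$ (j,l)) * vec_index v j)"
    by (rule sum.swap)
  also have "\<dots> = (\<Sum>l<n. d l * (\<Sum>i<m. W $$ (i,l) * vec_index v i)\<^sup>2)"
  proof (intro sum.cong refl)
    fix l
    have "d l * (\<Sum>i<m. W $$ (i,l) * vec_index v i)\<^sup>2
      = (\<Sum>i<m. \<Sum>j<m. d l * ((W $$ (i,l) * vec_index v i) * (W $$ (j,l) * vec_index v j)))"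
      by (simp only: power2_eq_square sum_product) (simp only: sum_distrib_left)
    also have "\<dots> = (\<Sum>i<m. \<Sum>j<m. vec_index v i * (W $$ (i,l) * d l * W $$ (j,l)) * vec_index v j)"
      by (intro sum.cong refl) (simp add: mult.commute mult.left_commute)
    finally show "(\<Sum>i<m. \<Sum>j<m. vec_index v i * (W $$ (i,l) * d l * W $$ (j,l)) * vec_index v j)
      = d l * (\<Sum>i<m. W $$ (i,l) * vec_index v i)\<^sup>2" by simp
  qed
  finally show ?thesis .
qed

text \<open>The quadratic form is a combination of squares with coefficients \<open>d l\<close>;
  evaluated at column \<open>i\<close> of \<open>W\<close> it equals \<open>d i\<close>.\<close>

lemma sym_psd_conj_diag_iff:
  assumes W: "W \<in> stiefel n n"
  shows "sym_psd n (W * mat_diag n d * W\<^sup>T) \<longleftrightarrow> (\<forall>i<n. 0 \<le> d i)"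
proof
  have Wc: "W \<in> carrier_mat n n" using W by (simp add: stiefel_def)
  note quad = quadratic_form_conj_diag[OF Wc, of _ d]
  {
    assume "\<forall>i<n. 0 \<le> d i"
    then show "sym_psd n (W * mat_diag n d * W\<^sup>T)"
      using conj_diag_carrier[OF Wc, of d] by (auto simp: sym_psd_def conj_diag_transpose[OF Wc] quad intro!: sum_nonneg)
  next
    assume psd: "sym_psd n (W * mat_diag n d * W\<^sup>T)"
    show "\<forall>i<n. 0 \<le> d i"
    proof (intro allI impI)
      fix i assume i: "i < n"
      have "(\<Sum>j<n. W $$ (j,l) * vec_index (col W i) j) = (if l = i then 1 else 0)" if "l < n" for l
        using W i that Wc by (auto simp: stiefel_iff)
      then have "scalar_prod (col W i) ((W * mat_diag n d * W\<^sup>T) *\<^sub>v col W i) = (\<Sum>l<n. d l * (if l = i then 1 else 0)\<^sup>2)"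
        using quad[of "col W i"] Wc i by (auto intro!: sum.cong)
      also have "\<dots> = (\<Sum>l<n. if l = i then d i else 0)" by (intro sum.cong) auto
      also have "\<dots> = d i" using i by simp
      finally show "0 \<le> d i" using psd Wc i unfolding sym_psd_def
        by (auto dest!: bspec[of _ _ "col W i"])
    qed
  }
qed

text \<open>The definite description has a unique value because max x 0 is continuous, so that
  \<open>functional_calculus_unique\<close> identifies the results of any two
  decompositions.\<close>

lemma pos_part_mat_eq:
  assumes "spectral_decomp n A W d"
  shows "pos_part_mat A = W * mat_diag n (\<lambda>i. max (d i) 0) * W\<^sup>T"
proof -
  have W: "W \<in> stiefel n n" "W \<in> carrier_mat n n" using assms by (auto simp: spectral_decomp_def stiefel_def)
  have dr: "dim_row A = n" using assms W conj_diag_carrier[OF W(2), of d] by (auto simp: spectral_decomp_def)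
  have cont: "continuous_on UNIV (\<lambda>x::real. max x 0)" by (intro continuous_intros)
  show ?thesis unfolding pos_part_mat_def Let_def dr
  proof (rule the_equality)
    show "\<exists>W' d'. W' \<in> stiefel n n \<and> A = W' * mat_diag n d' * W'\<^sup>T \<and>
      W * mat_diag n (\<lambda>i. max (d i) 0) * W\<^sup>T = W' * mat_diag n (\<lambda>i. max (d' i) 0) * W'\<^sup>T"
      using assms by (auto simp: spectral_decomp_def)
  next
    fix B assume "\<exists>W d. W \<in> stiefel n n \<and> A = W * mat_diag n d * W\<^sup>T \<and> B = W * mat_diag n (\<lambda>i. max (d i) 0) * W\<^sup>T"
    then obtain W' d' where "spectral_decomp n A W' d'" "B = W' * mat_diag n (\<lambda>i. max (d' i) 0) * W'\<^sup>T"
      by (auto simp: spectral_decomp_def)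
    then show "B = W * mat_diag n (\<lambda>i. max (d i) 0) * W\<^sup>T"
      using functional_calculus_unique[OF cont _ assms] by blast
  qed
qed

text \<open>For uniqueness, a second root \<open>B\<close> is diagonalised with nonnegative
  eigenvalues \<open>e i\<close>. Its square is then a decomposition of the same matrix with
  eigenvalues \<open>e i * e i\<close>, and the functional calculus of the square root returns
  \<open>B\<close>.\<close>

lemma psd_sqrt_eq:
  assumes W: "W \<in> stiefel n n" and d: "\<forall>i<n. 0 \<le> d i"
  shows "psd_sqrt (W * mat_diag n d * W\<^sup>T) = W * mat_diag n (\<lambda>i. sqrt (d i)) * W\<^sup>T"
proof -
  let ?A = "W * mat_diag n d * W\<^sup>T"
  have Wc: "W \<in> carrier_mat n n" using W by (simp add: stiefel_def)
  have dr: "dim_row ?A = n" using conj_diag_carrier[OF Wc, of d] by blast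
  have dcong: "W * mat_diag n f * W\<^sup>T = W * mat_diag n g * W\<^sup>T" if "\<forall>i<n. f i = g i" for f g W
  proof -
    have "mat_diag n f = mat_diag n g" using that by (auto simp: mat_diag_def intro!: eq_matI)
    then show ?thesis by simp
  qed
  show ?thesis unfolding psd_sqrt_def dr
  proof (rule the_equality)
    show "sym_psd n (W * mat_diag n (\<lambda>i. sqrt (d i)) * W\<^sup>T) \<and>
      W * mat_diag n (\<lambda>i. sqrt (d i)) * W\<^sup>T * (W * mat_diag n (\<lambda>i. sqrt (d i)) * W\<^sup>T) = ?A"
      using d by (auto simp: sym_psd_conj_diag_iff[OF W] conj_diag_mult[OF W] intro!: dcong)
  next
    fix B assume B: "sym_psd n B \<and> B * B = ?A"
    then obtain V e where V: "V \<in> stiefel n n" "B = V * mat_diag n e * V\<^sup>T"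
      using spectral_theorem[of B n] by (auto simp: sym_psd_def spectral_decomp_def)
    have e: "\<forall>i<n. 0 \<le> e i" using B V sym_psd_conj_diag_iff[OF V(1)] by simp
    have A: "spectral_decomp n ?A V (\<lambda>i. e i * e i)"
      using B V conj_diag_mult[OF V(1), of e e] by (simp add: spectral_decomp_def)
    have "V * mat_diag n (\<lambda>i. sqrt (e i * e i)) * V\<^sup>T = W * mat_diag n (\<lambda>i. sqrt (d i)) * W\<^sup>T"
      by (rule functional_calculus_unique[OF _ A, of sqrt W d])
        (auto simp: spectral_decomp_def W intro!: continuous_intros)
    then show "B = W * mat_diag n (\<lambda>i. sqrt (d i)) * W\<^sup>T"
      using V(2) dcong[of "\<lambda>i. sqrt (e i * e i)" e V] e by simp
  qed
qed

lemma psd_sqrt_pos_eq: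
  assumes "spectral_decomp n A W d"
  shows "psd_sqrt_pos A = W * mat_diag n (\<lambda>i. sqrt (max (d i) 0)) * W\<^sup>T"
  unfolding psd_sqrt_pos_def pos_part_mat_eq[OF assms]
  by (rule psd_sqrt_eq) (use assms in \<open>auto simp: spectral_decomp_def\<close>)

lemma det_conj_diag:
  assumes "W \<in> stiefel n n"
  shows "det (W * mat_diag n d * W\<^sup>T) = (\<Prod>i<n. d i)"
proof -
  have Wc: "W \<in> carrier_mat n n" using assms by (simp add: stiefel_def)
  have "det (W * mat_diag n d * W\<^sup>T) = det W * det (mat_diag n d) * det W"
    using Wc by (simp add: det_mult[of _ n] det_transpose[OF Wc])
  also have "\<dots> = det (mat_diag n d) * (det W * det W)" by simp
  also have "det W * det W = 1" by (rule det_stiefel[OF assms])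
  also have "det (mat_diag n d) = prod_list (diag_mat (mat_diag n d))"
    by (rule det_upper_triangular[of _ n]) (auto simp: mat_diag_def)
  also have "diag_mat (mat_diag n d) = map d [0..<n]"
    by (auto simp: diag_mat_def mat_diag_def)
  also have "prod_list (map d [0..<n]) = (\<Prod>i<n. d i)"
    by (simp add: prod.list_conv_set_nth atLeast0LessThan)
  finally show ?thesis by simp
qed

section \<open>Positive definite matrices\<close>

text \<open>Nonsingularity replaces strict positivity of the form: the condition then splits into an
  equation between measurable functions and a determinant, see \<open>pred_sym_pd\<close>. The usual
  form is \<open>sym_pd_iff\<close>.\<close>

definition sym_pd :: "nat \<Rightarrow> real mat \<Rightarrow> bool" where
  "sym_pd n A \<longleftrightarrow> sym_psd n A \<and> det A \<noteq> 0"

lemma sym_pd_conj_diag_iff: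
  assumes W: "W \<in> stiefel n n"
  shows "sym_pd n (W * mat_diag n d * W\<^sup>T) \<longleftrightarrow> (\<forall>i<n. 0 < d i)"
  by (auto simp: sym_pd_def sym_psd_conj_diag_iff[OF W] det_conj_diag[OF W] order.strict_iff_order)

lemma sym_pd_decomp:
  assumes "sym_pd n A"
  obtains W d where "spectral_decomp n A W d" "\<forall>i<n. 0 < d i"
proof -
  obtain W d where W: "spectral_decomp n A W d"
    using spectral_theorem[of A n] assms by (auto simp: sym_pd_def sym_psd_def)
  then show ?thesis using that[OF W] assms sym_pd_conj_diag_iff[of W n d] by (auto simp: spectral_decomp_def)
qed

lemma sym_pd_carrier: "sym_pd n A \<Longrightarrow> A \<in> carrier_mat n n" "sym_pd n A \<Longrightarrow> A\<^sup>T = A"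
  by (auto simp: sym_pd_def sym_psd_def)

lemma det_sym_pd_pos: "sym_pd n A \<Longrightarrow> 0 < det A"
  by (erule sym_pd_decomp) (auto simp: spectral_decomp_def det_conj_diag intro!: prod_pos)

lemma psd_sqrt_pos_carrier: 
  assumes "A \<in> carrier_mat n n" "A\<^sup>T = A"
  shows "psd_sqrt_pos A \<in> carrier_mat n n" "(psd_sqrt_pos A)\<^sup>T = psd_sqrt_pos A"
proof -
  obtain W d where W: "spectral_decomp n A W d" using spectral_theorem[OF assms] by auto
  have Wc: "W \<in> carrier_mat n n" using W by (simp add: spectral_decomp_def stiefel_def)
  show "psd_sqrt_pos A \<in> carrier_mat n n" unfolding psd_sqrt_pos_eq[OF W] by (rule conj_diag_carrier[OF Wc])
  show "(psd_sqrt_pos A)\<^sup>T = psd_sqrt_pos A" unfolding psd_sqrt_pos_eq[OF W] by (rule conj_diag_transpose[OF Wc])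
qed

text \<open>The square of the root is the positive part, which equals \<open>A\<close> only for
  nonnegative eigenvalues. This turns positive semidefiniteness into an equation that can be tested
  entry by entry.\<close>

lemma psd_sqrt_pos_square_iff:
  assumes "A \<in> carrier_mat n n" "A\<^sup>T = A"
  shows "psd_sqrt_pos A * psd_sqrt_pos A = A \<longleftrightarrow> sym_psd n A"
proof -
  obtain W d where W: "spectral_decomp n A W d" using spectral_theorem[OF assms] by auto
  have Ws: "W \<in> stiefel n n" and A: "A = W * mat_diag n d * W\<^sup>T" using W by (auto simp: spectral_decomp_def)
  have sq: "psd_sqrt_pos A * psd_sqrt_pos A = W * mat_diag n (\<lambda>i. max (d i) 0) * W\<^sup>T"
    unfolding psd_sqrt_pos_eq[OF W] conj_diag_mult[OF Ws] by simp
  show ?thesis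
  proof
    assume "psd_sqrt_pos A * psd_sqrt_pos A = A"
    then show "sym_psd n A" using sq sym_psd_conj_diag_iff[OF Ws, of "\<lambda>i. max (d i) 0"] by simp
  next
    assume "sym_psd n A"
    then have "\<forall>i<n. 0 \<le> d i" using A sym_psd_conj_diag_iff[OF Ws] by simp
    then have "mat_diag n (\<lambda>i. max (d i) 0) = mat_diag n d" by (auto simp: mat_diag_def intro!: eq_matI)
    then show "psd_sqrt_pos A * psd_sqrt_pos A = A" using sq A by simp
  qed
qed

lemma psd_sqrt_pos_pd:
  assumes "sym_pd n A"
  shows "sym_pd n (psd_sqrt_pos A)" "psd_sqrt_pos A * psd_sqrt_pos A = A" "det (psd_sqrt_pos A) = sqrt (det A)"
proof -
  obtain W d where W: "spectral_decomp n A W d" "\<forall>i<n. 0 < d i" using sym_pd_decomp[OF assms] by blast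
  have Ws: "W \<in> stiefel n n" and A: "A = W * mat_diag n d * W\<^sup>T" using W by (auto simp: spectral_decomp_def)
  show "sym_pd n (psd_sqrt_pos A)" unfolding psd_sqrt_pos_eq[OF W(1)] sym_pd_conj_diag_iff[OF Ws] using W by simp
  show "psd_sqrt_pos A * psd_sqrt_pos A = A" using assms psd_sqrt_pos_square_iff[of A n] by (auto simp: sym_pd_def sym_psd_def)
  show "det (psd_sqrt_pos A) = sqrt (det A)"
    unfolding psd_sqrt_pos_eq[OF W(1)] unfolding A det_conj_diag[OF Ws] using W(2)
    by (subst sqrt_prod_nonneg) (auto intro!: prod.cong simp: less_imp_le)
qed

section \<open>Measurability of matrix operations\<close>

lemma space_mat_borel[simp]: "space (mat_borel n m) = carrier_mat n m"
  by (simp add: mat_borel_def)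

lemma measurable_to_mat_borel:
  assumes "\<And>x. x \<in> space M \<Longrightarrow> f x \<in> carrier_mat n m"
    "\<And>i j. i < n \<Longrightarrow> j < m \<Longrightarrow> (\<lambda>x. f x $$ (i,j)) \<in> borel_measurable M"
  shows "f \<in> M \<rightarrow>\<^sub>M mat_borel n m"
  unfolding mat_borel_def
proof (rule measurable_vimage_algebra2)
  show "f \<in> space M \<rightarrow> carrier_mat n m" using assms by auto
  show "(\<lambda>x. \<lambda>ij\<in>{..<n} \<times> {..<m}. f x $$ ij) \<in> M \<rightarrow>\<^sub>M (\<Pi>\<^sub>M ij\<in>{..<n} \<times> {..<m}. borel)"
    by (rule measurable_restrict) (use assms(2) in auto)
qed

lemma measurable_entries:
  "(\<lambda>A. \<lambda>ij\<in>{..<n} \<times> {..<m}. A $$ ij) \<in> mat_borel n m \<rightarrow>\<^sub>M (\<Pi>\<^sub>M ij\<in>{..<n} \<times> {..<m}. borel)"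
  unfolding mat_borel_def
  by (rule measurable_vimage_algebra1) (auto simp: space_PiM)

lemma measurable_entry0:
  assumes "i < n" "j < m"
  shows "(\<lambda>A. A $$ (i,j)) \<in> borel_measurable (mat_borel n m)"
  using measurable_compose[OF measurable_entries measurable_component_singleton[of "(i,j)"], of n m] assms by simp

lemma measurable_entry:
  assumes "f \<in> M \<rightarrow>\<^sub>M mat_borel n m" "i < n" "j < m"
  shows "(\<lambda>x. f x $$ (i,j)) \<in> borel_measurable M"
  using measurable_compose[OF assms(1) measurable_entry0[OF assms(2,3)]] .

lemma measurable_mat_carrier:
  assumes "f \<in> M \<rightarrow>\<^sub>M mat_borel n m" "x \<in> space M"
  shows "f x \<in> carrier_mat n m" "dim_row (f x) = n" "dim_col (f x) = m"
  using measurable_space[OF assms] by auto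

lemma measurable_mat_by_entries:
  assumes "\<And>x. x \<in> space M \<Longrightarrow> f x \<in> carrier_mat n m"
    "\<And>i j x. i < n \<Longrightarrow> j < m \<Longrightarrow> x \<in> space M \<Longrightarrow> f x $$ (i,j) = g i j x"
    "\<And>i j. i < n \<Longrightarrow> j < m \<Longrightarrow> g i j \<in> borel_measurable M"
  shows "f \<in> M \<rightarrow>\<^sub>M mat_borel n m"
proof (rule measurable_to_mat_borel)
  fix i j assume "i < n" "j < m"
  then show "(\<lambda>x. f x $$ (i,j)) \<in> borel_measurable M"
    using assms by (subst measurable_cong[of _ _ "g i j"]) auto
qed (use assms in auto)

lemma measurable_mat_mult[measurable (raw)]:
  assumes "f \<in> M \<rightarrow>\<^sub>M mat_borel n l" "g \<in> M \<rightarrow>\<^sub>M mat_borel l m"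
  shows "(\<lambda>x. f x * g x) \<in> M \<rightarrow>\<^sub>M mat_borel n m"
proof (rule measurable_mat_by_entries)
  fix i j assume ij: "i < n" "j < m"
  show "(f x * g x) $$ (i,j) = (\<Sum>r<l. f x $$ (i,r) * g x $$ (r,j))" if "x \<in> space M" for x
    using ij measurable_mat_carrier[OF assms(1) that] measurable_mat_carrier[OF assms(2) that]
    by (simp add: scalar_prod_def atLeast0LessThan)
  show "(\<lambda>x. \<Sum>r<l. f x $$ (i,r) * g x $$ (r,j)) \<in> borel_measurable M"
    using ij by (intro borel_measurable_sum borel_measurable_times measurable_entry[OF assms(1)] measurable_entry[OF assms(2)]) auto
next
  fix x assume "x \<in> space M"
  then show "f x * g x \<in> carrier_mat n m"
    using measurable_mat_carrier(1)[OF assms(1)] measurable_mat_carrier(1)[OF assms(2)] by (meson mult_carrier_mat)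
qed

lemma measurable_mat_transpose[measurable (raw)]:
  assumes "f \<in> M \<rightarrow>\<^sub>M mat_borel n m"
  shows "(\<lambda>x. (f x)\<^sup>T) \<in> M \<rightarrow>\<^sub>M mat_borel m n"
  by (rule measurable_mat_by_entries[where g="\<lambda>i j x. f x $$ (j,i)"])
     (use measurable_mat_carrier[OF assms] measurable_entry[OF assms] in auto)

lemma measurable_mat_add[measurable (raw)]:
  assumes "f \<in> M \<rightarrow>\<^sub>M mat_borel n m" "g \<in> M \<rightarrow>\<^sub>M mat_borel n m"
  shows "(\<lambda>x. f x + g x) \<in> M \<rightarrow>\<^sub>M mat_borel n m"
  by (rule measurable_mat_by_entries[where g="\<lambda>i j x. f x $$ (i,j) + g x $$ (i,j)"])
     (use measurable_mat_carrier[OF assms(1)] measurable_mat_carrier[OF assms(2)]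
        measurable_entry[OF assms(1)] measurable_entry[OF assms(2)] in auto)

lemma measurable_mat_minus[measurable (raw)]:
  assumes "f \<in> M \<rightarrow>\<^sub>M mat_borel n m" "g \<in> M \<rightarrow>\<^sub>M mat_borel n m"
  shows "(\<lambda>x. f x - g x) \<in> M \<rightarrow>\<^sub>M mat_borel n m"
  by (rule measurable_mat_by_entries[where g="\<lambda>i j x. f x $$ (i,j) - g x $$ (i,j)"])
     (use measurable_mat_carrier[OF assms(1)] measurable_mat_carrier[OF assms(2)]
        measurable_entry[OF assms(1)] measurable_entry[OF assms(2)] in auto)

lemma measurable_mat_smult[measurable (raw)]:
  assumes "c \<in> borel_measurable M" "f \<in> M \<rightarrow>\<^sub>M mat_borel n m"
  shows "(\<lambda>x. (c x :: real) \<cdot>\<^sub>m f x) \<in> M \<rightarrow>\<^sub>M mat_borel n m"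
  by (rule measurable_mat_by_entries[where g="\<lambda>i j x. c x * f x $$ (i,j)"])
     (use measurable_mat_carrier[OF assms(2)] measurable_entry[OF assms(2)] assms(1) in auto)

lemma append_rows_index:
  assumes "A \<in> carrier_mat n m" "B \<in> carrier_mat n' m" "i < n + n'" "j < m"
  shows "(A @\<^sub>r B) $$ (i,j) = (if i < n then A $$ (i,j) else B $$ (i - n, j))"
  using assms by (auto simp: append_rows_def)

lemma measurable_append_rows[measurable (raw)]:
  assumes "f \<in> M \<rightarrow>\<^sub>M mat_borel n m" "g \<in> M \<rightarrow>\<^sub>M mat_borel n' m"
  shows "(\<lambda>x. f x @\<^sub>r g x) \<in> M \<rightarrow>\<^sub>M mat_borel (n + n') m"
proof (rule measurable_mat_by_entries)
  fix i j assume ij: "i < n + n'" "j < m"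
  show "(f x @\<^sub>r g x) $$ (i,j) = (if i < n then f x $$ (i,j) else g x $$ (i - n, j))" if "x \<in> space M" for x
    using append_rows_index[OF measurable_mat_carrier(1)[OF assms(1) that] measurable_mat_carrier(1)[OF assms(2) that] ij] .
  show "(\<lambda>x. if i < n then f x $$ (i,j) else g x $$ (i - n, j)) \<in> borel_measurable M"
    using ij measurable_entry[OF assms(1), of i j] measurable_entry[OF assms(2), of "i - n" j] by (cases "i < n") auto
qed (use measurable_mat_carrier(1)[OF assms(1)] measurable_mat_carrier(1)[OF assms(2)] in auto)

lemma measurable_det[measurable (raw)]:
  assumes f: "f \<in> M \<rightarrow>\<^sub>M mat_borel n n"
  shows "(\<lambda>x. det (f x :: real mat)) \<in> borel_measurable M"
proof -
  have "det (f x) = (\<Sum>p | p permutes {0..<n}. signof p * (\<Prod>i = 0..<n. f x $$ (i, p i)))" if "x \<in> space M" for x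
    using det_def'[OF measurable_mat_carrier(1)[OF f that]] .
  then show ?thesis
  proof (subst measurable_cong)
    show "(\<lambda>x. \<Sum>p | p permutes {0..<n}. signof p * (\<Prod>i = 0..<n. f x $$ (i, p i))) \<in> borel_measurable M"
      by (intro borel_measurable_sum borel_measurable_times borel_measurable_const borel_measurable_prod measurable_entry[OF f])
         (auto simp: permutes_in_image)
  qed
qed

lemma measurable_adj_mat:
  assumes f: "f \<in> M \<rightarrow>\<^sub>M mat_borel n n"
  shows "(\<lambda>x. adj_mat (f x :: real mat)) \<in> M \<rightarrow>\<^sub>M mat_borel n n"
proof (rule measurable_mat_by_entries)
  fix i j assume ij: "i < n" "j < n"
  show "adj_mat (f x) $$ (i,j) = (-1) ^ (j + i) * det (mat_delete (f x) j i)" if "x \<in> space M" for x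
    using ij measurable_mat_carrier[OF f that] by (simp add: adj_mat_def cofactor_def)
  have "(\<lambda>x. mat_delete (f x) j i) \<in> M \<rightarrow>\<^sub>M mat_borel (n - 1) (n - 1)"
  proof (rule measurable_mat_by_entries)
    fix a b assume ab: "a < n - 1" "b < n - 1"
    show "mat_delete (f x) j i $$ (a,b) = f x $$ (if a < j then a else Suc a, if b < i then b else Suc b)"
      if "x \<in> space M" for x
      using ab measurable_mat_carrier[OF f that] by (simp add: mat_delete_def)
    show "(\<lambda>x. f x $$ (if a < j then a else Suc a, if b < i then b else Suc b)) \<in> borel_measurable M"
      using ab by (intro measurable_entry[OF f]) auto
  qed (use measurable_mat_carrier[OF f] in \<open>auto simp: mat_delete_def\<close>)
  then show "(\<lambda>x. (-1) ^ (j + i) * det (mat_delete (f x) j i)) \<in> borel_measurable M"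
    by (intro borel_measurable_times measurable_det) auto
qed (use measurable_mat_carrier(1)[OF f] adj_mat(1) in blast)

lemma measurable_mat_pow:
  assumes f: "f \<in> M \<rightarrow>\<^sub>M mat_borel n n"
  shows "(\<lambda>x. (f x :: real mat) ^\<^sub>m r) \<in> M \<rightarrow>\<^sub>M mat_borel n n"
proof (induction r)
  case 0
  show ?case
    by (rule measurable_mat_by_entries[where g="\<lambda>i j x. if i = j then 1 else 0"])
       (use measurable_mat_carrier[OF f] in auto)
next
  case (Suc r)
  then show ?case using f by (auto intro: measurable_mat_mult)
qed

text \<open>One array of coefficients serves every \<open>x\<close>, so the root is a pointwise
  limit of polynomials in the entries of \<open>f x\<close>.\<close>

lemma measurable_psd_sqrt_pos:
  assumes f: "f \<in> M \<rightarrow>\<^sub>M mat_borel n n" and sym: "\<And>x. x \<in> space M \<Longrightarrow> (f x)\<^sup>T = f x"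
  shows "(\<lambda>x. psd_sqrt_pos (f x)) \<in> M \<rightarrow>\<^sub>M mat_borel n n"
proof (rule measurable_to_mat_borel)
  note c = measurable_mat_carrier[OF f]
  show "psd_sqrt_pos (f x) \<in> carrier_mat n n" if "x \<in> space M" for x
    using psd_sqrt_pos_carrier[OF c(1)[OF that] sym[OF that]] by simp
  fix i j assume ij: "i < n" "j < n"
  have "continuous_on UNIV (\<lambda>x::real. sqrt (max x 0))" by (intro continuous_intros)
  then obtain a N where lim: "\<And>n A W d i j. spectral_decomp n A W d \<Longrightarrow> i < n \<Longrightarrow> j < n \<Longrightarrow>
    (\<lambda>m. \<Sum>r\<le>N m. a m r * (A ^\<^sub>m r) $$ (i,j)) \<longlonglongrightarrow> (W * mat_diag n (\<lambda>i. sqrt (max (d i) 0)) * W\<^sup>T) $$ (i,j)"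
    using functional_calculus_limit by blast
  show "(\<lambda>x. psd_sqrt_pos (f x) $$ (i,j)) \<in> borel_measurable M"
  proof (rule borel_measurable_LIMSEQ_real)
    fix x assume x: "x \<in> space M"
    obtain W d where "spectral_decomp n (f x) W d" using spectral_theorem[OF c(1)[OF x] sym[OF x]] by auto
    then show "(\<lambda>m. \<Sum>r\<le>N m. a m r * (f x ^\<^sub>m r) $$ (i,j)) \<longlonglongrightarrow> psd_sqrt_pos (f x) $$ (i,j)"
      using lim[of n "f x" W d i j] ij by (simp only: psd_sqrt_pos_eq)
  next
    fix m
    show "(\<lambda>x. \<Sum>r\<le>N m. a m r * (f x ^\<^sub>m r) $$ (i,j)) \<in> borel_measurable M"
      using ij by (intro borel_measurable_sum borel_measurable_times borel_measurable_const
         measurable_entry[OF measurable_mat_pow[OF f]]) auto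
  qed
qed

lemma pred_mat_eq:
  assumes f: "f \<in> M \<rightarrow>\<^sub>M mat_borel n m" and g: "g \<in> M \<rightarrow>\<^sub>M mat_borel n m"
  shows "Measurable.pred M (\<lambda>x. f x = g x)"
proof -
  have "f x = g x \<longleftrightarrow> (\<forall>i\<in>{..<n}. \<forall>j\<in>{..<m}. f x $$ (i,j) - g x $$ (i,j) = 0)" if "x \<in> space M" for x
    using measurable_mat_carrier[OF f that] measurable_mat_carrier[OF g that] by (auto intro!: eq_matI)
  then show ?thesis
  proof (subst measurable_cong)
    show "Measurable.pred M (\<lambda>x. \<forall>i\<in>{..<n}. \<forall>j\<in>{..<m}. f x $$ (i,j) - g x $$ (i,j) = 0)"
    proof (intro pred_intros_finite finite_lessThan)
      fix i j assume "i \<in> {..<n}" "j \<in> {..<m}"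
      then have [measurable]: "(\<lambda>x. f x $$ (i,j)) \<in> borel_measurable M" "(\<lambda>x. g x $$ (i,j)) \<in> borel_measurable M"
        using measurable_entry[OF f] measurable_entry[OF g] by auto
      show "Measurable.pred M (\<lambda>x. f x $$ (i,j) - g x $$ (i,j) = 0)" by measurable
    qed
  qed
qed

lemma measurable_const_mat[measurable (raw)]: "A \<in> carrier_mat n m \<Longrightarrow> (\<lambda>x. A) \<in> M \<rightarrow>\<^sub>M mat_borel n m"
  by (rule measurable_const) simp

lemma pred_sym_pd:
  assumes f: "f \<in> M \<rightarrow>\<^sub>M mat_borel n n" and sym: "\<And>x. x \<in> space M \<Longrightarrow> (f x)\<^sup>T = f x"
  shows "Measurable.pred M (\<lambda>x. sym_pd n (f x))"
proof -
  note [measurable] = pred_mat_eq[OF measurable_mat_mult[OF measurable_psd_sqrt_pos[OF f sym] measurable_psd_sqrt_pos[OF f sym]] f]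
    measurable_det[OF f]
  have eq: "sym_pd n (f x) \<longleftrightarrow> psd_sqrt_pos (f x) * psd_sqrt_pos (f x) = f x \<and> det (f x) \<noteq> 0" if "x \<in> space M" for x
    using psd_sqrt_pos_square_iff[OF measurable_mat_carrier(1)[OF f that] sym[OF that]] by (simp add: sym_pd_def)
  show ?thesis by (subst measurable_cong[OF eq]) measurable
qed

lemma stiefel_sets: "stiefel p k \<in> sets (mat_borel p k)"
proof -
  have "Measurable.pred (mat_borel p k) (\<lambda>V. V\<^sup>T * V = 1\<^sub>m k)"
    by (rule pred_mat_eq[OF measurable_mat_mult[where l=p, OF measurable_mat_transpose]])
       (auto intro!: measurable_const_mat)
  then have "{V \<in> space (mat_borel p k). V\<^sup>T * V = 1\<^sub>m k} \<in> sets (mat_borel p k)"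
    by measurable
  then show ?thesis by (simp add: stiefel_def)
qed

section \<open>Lebesgue measure on matrices\<close>

definition mat_box :: "nat \<Rightarrow> nat \<Rightarrow> (nat \<times> nat \<Rightarrow> real set) \<Rightarrow> real mat set" where
  "mat_box n m B = {A \<in> carrier_mat n m. \<forall>i<n. \<forall>j<m. A $$ (i,j) \<in> B (i,j)}"

definition prod_mat :: "nat \<Rightarrow> nat \<Rightarrow> (nat \<times> nat \<Rightarrow> real measure) \<Rightarrow> real mat measure" where
  "prod_mat n m N = distr (\<Pi>\<^sub>M ij\<in>{..<n} \<times> {..<m}. N ij) (mat_borel n m) (Matrix.mat n m)"

abbreviation leb_mat :: "nat \<Rightarrow> nat \<Rightarrow> real mat measure" where
  "leb_mat n m \<equiv> prod_mat n m (\<lambda>_. lborel)"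

lemma sets_prod_mat[simp, measurable_cong]: "sets (prod_mat n m N) = sets (mat_borel n m)"
  by (simp add: prod_mat_def)

lemma space_prod_mat[simp]: "space (prod_mat n m N) = carrier_mat n m"
  by (simp add: prod_mat_def)

lemma measurable_mat_of_PiM:
  assumes "\<And>ij. sets (N ij) = sets borel"
  shows "Matrix.mat n m \<in> (\<Pi>\<^sub>M ij\<in>{..<n} \<times> {..<m}. N ij) \<rightarrow>\<^sub>M mat_borel n m"
proof (rule measurable_mat_by_entries)
  fix i j assume "i < n" "j < m"
  then show "(\<lambda>z. z (i,j)) \<in> borel_measurable (\<Pi>\<^sub>M ij\<in>{..<n} \<times> {..<m}. N ij)"
    using measurable_component_singleton[of "(i,j)" "{..<n} \<times> {..<m}" N] assms by (simp cong: measurable_cong_sets)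
qed auto

lemma measurable_entries_PiM:
  assumes "\<And>ij. sets (N ij) = sets borel"
  shows "(\<lambda>A. \<lambda>ij\<in>{..<n} \<times> {..<m}. A $$ ij) \<in> mat_borel n m \<rightarrow>\<^sub>M (\<Pi>\<^sub>M ij\<in>{..<n} \<times> {..<m}. N ij)"
proof -
  have "sets (\<Pi>\<^sub>M ij\<in>{..<n} \<times> {..<m}. N ij) = sets (\<Pi>\<^sub>M ij\<in>{..<n} \<times> {..<m}. borel)"
    by (rule sets_PiM_cong) (auto simp: assms)
  then show ?thesis using measurable_entries by (simp cong: measurable_cong_sets)
qed

lemma mat_box_sets[measurable]:
  assumes "\<And>ij. B ij \<in> sets borel"
  shows "mat_box n m B \<in> sets (mat_borel n m)"
proof -
  have "mat_box n m B = (\<lambda>A. \<lambda>ij\<in>{..<n} \<times> {..<m}. A $$ ij) -` (PiE ({..<n} \<times> {..<m}) B) \<inter> space (mat_borel n m)"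
    unfolding mat_box_def restrict_PiE_iff vimage_def Int_def by auto
  also have "\<dots> \<in> sets (mat_borel n m)"
    by (rule measurable_sets[OF measurable_entries]) (auto intro!: sets_PiM_I_finite assms)
  finally show ?thesis .
qed

text \<open>Building a matrix and reading its entries are inverse to each other, so this is the
  uniqueness of product measures on boxes.\<close>

lemma prod_mat_eqI:
  assumes N: "\<And>ij. sigma_finite_measure (N ij)" "\<And>ij. sets (N ij) = sets borel"
    and M: "sets M = sets (mat_borel n m)"
    and eq: "\<And>B. (\<And>ij. B ij \<in> sets borel) \<Longrightarrow> emeasure M (mat_box n m B) = (\<Prod>ij\<in>{..<n} \<times> {..<m}. emeasure (N ij) (B ij))"
  shows "M = prod_mat n m N"
proof -
  let ?I = "{..<n} \<times> {..<m}" and ?e = "\<lambda>A. \<lambda>ij\<in>{..<n} \<times> {..<m}. A $$ ij"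
  interpret product_sigma_finite N using N(1) by (simp add: product_sigma_finite_def)
  have sp: "space M = carrier_mat n m" using sets_eq_imp_space_eq[OF M] by simp
  have spN: "space (N ij) = UNIV" for ij using sets_eq_imp_space_eq[OF N(2)] by simp
  have e: "?e \<in> M \<rightarrow>\<^sub>M PiM ?I N" using measurable_entries_PiM[OF N(2)] M by (simp cong: measurable_cong_sets)
  have mm: "Matrix.mat n m \<in> PiM ?I N \<rightarrow>\<^sub>M M" using measurable_mat_of_PiM[OF N(2)] M by (simp cong: measurable_cong_sets)
  have eqP: "distr M (PiM ?I N) ?e = PiM ?I N"
  proof (rule PiM_eqI)
    fix A assume A: "\<And>i. i \<in> ?I \<Longrightarrow> A i \<in> sets (N i)"
    \<comment> \<open>\<open>mat_box\<close> takes a set for every pair of indices; pairs outside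
      the matrix receive the whole line.\<close>
    define B where "B = (\<lambda>ij. if ij \<in> ?I then A ij else UNIV)"
    have B: "B ij \<in> sets borel" for ij using A N(2) by (auto simp: B_def)
    have "emeasure (distr M (PiM ?I N) ?e) (PiE ?I A) = emeasure M (?e -` (PiE ?I A) \<inter> space M)"
      using A by (intro emeasure_distr[OF e] sets_PiM_I_finite) auto
    also have "?e -` (PiE ?I A) \<inter> space M = mat_box n m B"
      unfolding mat_box_def B_def sp restrict_PiE_iff vimage_def Int_def by auto
    also have "emeasure M \<dots> = (\<Prod>ij\<in>?I. emeasure (N ij) (A ij))" using eq[OF B] by (simp add: B_def)
    finally show "emeasure (distr M (PiM ?I N) ?e) (PiE ?I A) = (\<Prod>i\<in>?I. emeasure (N i) (A i))" .
  qed auto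
  have "prod_mat n m N = distr (distr M (PiM ?I N) ?e) M (Matrix.mat n m)"
    unfolding prod_mat_def eqP by (intro distr_cong refl M[symmetric])
  also have "\<dots> = distr M M (Matrix.mat n m \<circ> ?e)" by (rule distr_distr[OF mm e])
  also have "\<dots> = distr M M (\<lambda>x. x)"
    by (rule distr_cong) (auto simp: sp intro!: eq_matI)
  finally show ?thesis by simp
qed

lemma emeasure_prod_mat_box:
  assumes N: "\<And>ij. sigma_finite_measure (N ij)" "\<And>ij. sets (N ij) = sets borel"
    and B: "\<And>ij. B ij \<in> sets borel"
  shows "emeasure (prod_mat n m N) (mat_box n m B) = (\<Prod>ij\<in>{..<n} \<times> {..<m}. emeasure (N ij) (B ij))"
proof -
  let ?I = "{..<n} \<times> {..<m}"
  interpret product_sigma_finite N using N(1) by (simp add: product_sigma_finite_def)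
  have spN: "space (N ij) = UNIV" for ij using sets_eq_imp_space_eq[OF N(2)] by simp
  have "emeasure (prod_mat n m N) (mat_box n m B) = emeasure (PiM ?I N) (Matrix.mat n m -` mat_box n m B \<inter> space (PiM ?I N))"
    unfolding prod_mat_def by (rule emeasure_distr[OF measurable_mat_of_PiM[OF N(2)] mat_box_sets[OF B]])
  also have "Matrix.mat n m -` mat_box n m B \<inter> space (PiM ?I N) = PiE ?I B"
  proof (rule Set.set_eqI)
    fix z :: "nat \<times> nat \<Rightarrow> real"
    have "(\<forall>i<n. \<forall>j<m. Matrix.mat n m z $$ (i,j) \<in> B (i,j)) \<longleftrightarrow> (\<forall>ij\<in>?I. z ij \<in> B ij)" by auto
    then show "z \<in> Matrix.mat n m -` mat_box n m B \<inter> space (PiM ?I N) \<longleftrightarrow> z \<in> PiE ?I B"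
      by (simp add: mat_box_def space_PiM spN PiE_iff)
  qed
  also have "emeasure (PiM ?I N) \<dots> = (\<Prod>ij\<in>?I. emeasure (N ij) (B ij))"
    using B N(2) by (intro emeasure_PiM) auto
  finally show ?thesis .
qed

lemma emeasure_leb_mat_box:
  "(\<And>ij. B ij \<in> sets borel) \<Longrightarrow> emeasure (leb_mat n m) (mat_box n m B) = (\<Prod>ij\<in>{..<n} \<times> {..<m}. emeasure lborel (B ij))"
  by (rule emeasure_prod_mat_box) (auto simp: sigma_finite_lborel)

lemma leb_mat_eqI:
  assumes "sets M = sets (mat_borel n m)"
    "\<And>B. (\<And>ij. B ij \<in> sets borel) \<Longrightarrow> emeasure M (mat_box n m B) = (\<Prod>ij\<in>{..<n} \<times> {..<m}. emeasure lborel (B ij))"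
  shows "M = leb_mat n m"
  by (rule prod_mat_eqI) (use assms in \<open>auto simp: sigma_finite_lborel\<close>)

lemma sigma_finite_leb_mat: "sigma_finite_measure (leb_mat n m)"
proof -
  let ?I = "{..<n} \<times> {..<m}" and ?e = "\<lambda>A. \<lambda>ij\<in>{..<n} \<times> {..<m}. A $$ ij" and ?P = "\<Pi>\<^sub>M ij\<in>{..<n} \<times> {..<m}. (lborel :: real measure)"
  have m: "Matrix.mat n m \<in> ?P \<rightarrow>\<^sub>M mat_borel n m" by (rule measurable_mat_of_PiM) simp
  have e: "?e \<in> mat_borel n m \<rightarrow>\<^sub>M ?P" by (rule measurable_entries_PiM) simp
  interpret product_sigma_finite "\<lambda>_::nat\<times>nat. lborel :: real measure"
    by (simp add: product_sigma_finite_def sigma_finite_lborel)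
  have "distr (leb_mat n m) ?P ?e = distr ?P ?P (?e \<circ> Matrix.mat n m)"
    unfolding prod_mat_def by (rule distr_distr[OF e m])
  also have "\<dots> = distr ?P ?P (\<lambda>x. x)"
    by (rule distr_cong) (auto simp: space_PiM PiE_def extensional_def fun_eq_iff)
  finally have "distr (leb_mat n m) ?P ?e = ?P" by simp
  then have "sigma_finite_measure (distr (leb_mat n m) ?P ?e)" using sigma_finite[of ?I] by simp
  then show ?thesis
    by (rule sigma_finite_measure_distr) (use e in \<open>simp cong: measurable_cong_sets\<close>)
qed

lemma leb_mat_translate:
  assumes "C \<in> carrier_mat n m"
  shows "distr (leb_mat n m) (mat_borel n m) (\<lambda>A. A + C) = leb_mat n m"
proof (rule leb_mat_eqI)
  fix B :: "nat \<times> nat \<Rightarrow> real set" assume B: "\<And>ij. B ij \<in> sets borel"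
  have [measurable]: "(\<lambda>A. A + C) \<in> leb_mat n m \<rightarrow>\<^sub>M mat_borel n m" using assms by measurable
  define B' where "B' = (\<lambda>ij. (\<lambda>x. C $$ ij + x) -` B ij)"
  have B': "B' ij \<in> sets borel" for ij
    unfolding B'_def using measurable_sets[of "\<lambda>x. C $$ ij + x" borel borel, OF _ B] by simp
  have "emeasure (distr (leb_mat n m) (mat_borel n m) (\<lambda>A. A + C)) (mat_box n m B)
    = emeasure (leb_mat n m) ((\<lambda>A. A + C) -` mat_box n m B \<inter> space (leb_mat n m))"
    by (rule emeasure_distr) (use B in measurable)
  also have "(\<lambda>A. A + C) -` mat_box n m B \<inter> space (leb_mat n m) = mat_box n m B'"
  proof (rule Set.set_eqI)
    fix A
    show "A \<in> (\<lambda>A. A + C) -` mat_box n m B \<inter> space (leb_mat n m) \<longleftrightarrow> A \<in> mat_box n m B'"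
      using assms by (cases "A \<in> carrier_mat n m") (simp_all add: mat_box_def B'_def add.commute)
  qed
  also have "emeasure (leb_mat n m) \<dots> = (\<Prod>ij\<in>{..<n} \<times> {..<m}. emeasure lborel (B' ij))"
    by (rule emeasure_leb_mat_box[OF B'])
  also have "\<dots> = (\<Prod>ij\<in>{..<n} \<times> {..<m}. emeasure lborel (B ij))"
  proof (rule prod.cong[OF refl])
    fix ij
    have "emeasure lborel (B ij) = emeasure (distr lborel borel ((+) (C $$ ij))) (B ij)"
      by (simp add: lborel_distr_plus)
    also have "\<dots> = emeasure lborel ((+) (C $$ ij) -` B ij \<inter> space lborel)"
      by (rule emeasure_distr) (use B in auto)
    finally show "emeasure lborel (B' ij) = emeasure lborel (B ij)" by (simp add: B'_def)
  qed
  finally show "emeasure (distr (leb_mat n m) (mat_borel n m) (\<lambda>A. A + C)) (mat_box n m B) = (\<Prod>ij\<in>{..<n} \<times> {..<m}. emeasure lborel (B ij))" .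
qed simp

lemma nn_integral_leb_mat_translate:
  assumes "F \<in> borel_measurable (mat_borel n m)" "C \<in> carrier_mat n m"
  shows "(\<integral>\<^sup>+A. F (A + C) \<partial>leb_mat n m) = (\<integral>\<^sup>+A. F A \<partial>leb_mat n m)"
proof -
  have [measurable]: "(\<lambda>A. A + C) \<in> leb_mat n m \<rightarrow>\<^sub>M mat_borel n m" using assms by measurable
  have "(\<integral>\<^sup>+A. F A \<partial>distr (leb_mat n m) (mat_borel n m) (\<lambda>A. A + C)) = (\<integral>\<^sup>+A. F (A + C) \<partial>leb_mat n m)"
    by (rule nn_integral_distr) (use assms(1) in measurable)
  then show ?thesis by (simp add: leb_mat_translate[OF assms(2)])
qed

text \<open>A symmetric set \<open>S\<close> makes the argument work without reflection invariance of \<open>M\<close>.\<close>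
lemma translation_invariant_unique:
  assumes M: "sigma_finite_measure M" "sets M = sets (mat_borel n m)"
    and inv: "\<And>C. C \<in> carrier_mat n m \<Longrightarrow> distr M (mat_borel n m) (\<lambda>A. A + C) = M"
    and F: "F \<in> borel_measurable (mat_borel n m)"
    and S: "S \<in> sets (mat_borel n m)" "\<And>A. A \<in> carrier_mat n m \<Longrightarrow> - A \<in> S \<longleftrightarrow> A \<in> S"
  shows "(\<integral>\<^sup>+A. F A \<partial>M) * emeasure (leb_mat n m) S = emeasure M S * (\<integral>\<^sup>+A. F A \<partial>leb_mat n m)"
proof -
  let ?N = "leb_mat n m"
  interpret pair_sigma_finite M ?N
    using M(1) sigma_finite_leb_mat by (simp add: pair_sigma_finite_def)
  note [measurable_cong] = M(2)
  note F[measurable] S(1)[measurable]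
  have spM: "space M = carrier_mat n m" using sets_eq_imp_space_eq[OF M(2)] by simp
  have tM: "(\<integral>\<^sup>+A. G (A + C) \<partial>M) = (\<integral>\<^sup>+A. G A \<partial>M)"
    if G[measurable]: "G \<in> borel_measurable (mat_borel n m)" and C: "C \<in> carrier_mat n m" for G C
  proof -
    have [measurable]: "(\<lambda>A. A + C) \<in> M \<rightarrow>\<^sub>M mat_borel n m" using C by measurable
    have "(\<integral>\<^sup>+A. G A \<partial>distr M (mat_borel n m) (\<lambda>A. A + C)) = (\<integral>\<^sup>+A. G (A + C) \<partial>M)"
      by (rule nn_integral_distr) measurable
    then show ?thesis by (simp add: inv[OF C])
  qed
  have mneg: "(\<lambda>A. (-1 :: real) \<cdot>\<^sub>m A) \<in> mat_borel n m \<rightarrow>\<^sub>M mat_borel n m" by measurable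
  \<comment> \<open>Both sides are the double integral of \<open>F (x + y) * indicator S y\<close>:
    integrated over \<open>x\<close> first it gives the left side, and after the shift of
    \<open>y\<close> by \<open>x\<close> the right side.\<close>
  have "(\<integral>\<^sup>+x. F x \<partial>M) * emeasure ?N S = (\<integral>\<^sup>+y. (\<integral>\<^sup>+x. F x \<partial>M) * indicator S y \<partial>?N)"
    by (subst nn_integral_cmult) auto
  also have "\<dots> = (\<integral>\<^sup>+y. (\<integral>\<^sup>+x. F (x + y) * indicator S y \<partial>M) \<partial>?N)"
  proof (rule nn_integral_cong)
    fix y assume y: "y \<in> space ?N"
    then have [measurable]: "(\<lambda>x. x + y) \<in> M \<rightarrow>\<^sub>M mat_borel n m" by simp
    have "(\<integral>\<^sup>+x. F (x + y) * indicator S y \<partial>M) = (\<integral>\<^sup>+x. F (x + y) \<partial>M) * indicator S y"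
      by (rule nn_integral_multc) measurable
    then show "(\<integral>\<^sup>+x. F x \<partial>M) * indicator S y = (\<integral>\<^sup>+x. F (x + y) * indicator S y \<partial>M)"
      using tM[OF F, of y] y by simp
  qed
  also have "\<dots> = (\<integral>\<^sup>+x. (\<integral>\<^sup>+y. F (x + y) * indicator S y \<partial>?N) \<partial>M)"
    by (rule Fubini') measurable
  also have "\<dots> = (\<integral>\<^sup>+x. (\<integral>\<^sup>+y. F y * indicator S (y - x) \<partial>?N) \<partial>M)"
  proof (rule nn_integral_cong)
    fix x assume x: "x \<in> space M"
    then have xc: "x \<in> carrier_mat n m" "(-1 :: real) \<cdot>\<^sub>m x \<in> carrier_mat n m" by (auto simp: spM)
    have [measurable]: "(\<lambda>y. x + y) \<in> mat_borel n m \<rightarrow>\<^sub>M mat_borel n m"  "(\<lambda>y. y - x) \<in> mat_borel n m \<rightarrow>\<^sub>M mat_borel n m"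
      using xc by measurable
    have "(\<integral>\<^sup>+y. F (x + y) * indicator S y \<partial>?N)
      = (\<integral>\<^sup>+y. F (x + (y + (-1) \<cdot>\<^sub>m x)) * indicator S (y + (-1) \<cdot>\<^sub>m x) \<partial>?N)"
      by (rule nn_integral_leb_mat_translate[OF _ xc(2), symmetric]) measurable
    also have "\<dots> = (\<integral>\<^sup>+y. F y * indicator S (y - x) \<partial>?N)"
    proof (rule nn_integral_cong)
      fix y assume "y \<in> space ?N"
      then have "y \<in> carrier_mat n m" by simp
      then have "x + (y + (-1) \<cdot>\<^sub>m x) = y" "y + (-1) \<cdot>\<^sub>m x = y - x"
        using xc by (auto intro!: eq_matI)
      then show "F (x + (y + (-1) \<cdot>\<^sub>m x)) * indicator S (y + (-1) \<cdot>\<^sub>m x) = F y * indicator S (y - x)" by simp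
    qed
    finally show "(\<integral>\<^sup>+y. F (x + y) * indicator S y \<partial>?N) = (\<integral>\<^sup>+y. F y * indicator S (y - x) \<partial>?N)" .
  qed
  also have "\<dots> = (\<integral>\<^sup>+y. (\<integral>\<^sup>+x. F y * indicator S (y - x) \<partial>M) \<partial>?N)"
    by (rule Fubini'[symmetric]) measurable
  also have "\<dots> = (\<integral>\<^sup>+y. emeasure M S * F y \<partial>?N)"
  proof (rule nn_integral_cong)
    fix y assume y: "y \<in> space ?N"
    then have yc: "y \<in> carrier_mat n m" "(-1 :: real) \<cdot>\<^sub>m y \<in> carrier_mat n m" by auto
    have [measurable]: "(\<lambda>x. y - x) \<in> mat_borel n m \<rightarrow>\<^sub>M mat_borel n m"
      using yc by measurable
    have "(\<integral>\<^sup>+x. F y * indicator S (y - x) \<partial>M) = F y * (\<integral>\<^sup>+x. indicator S (y - x) \<partial>M)"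
      by (rule nn_integral_cmult) measurable
    also have "(\<integral>\<^sup>+x. indicator S (y - x) \<partial>M) = (\<integral>\<^sup>+x. indicator S (x + (-1) \<cdot>\<^sub>m y) \<partial>M)"
    proof (rule nn_integral_cong)
      fix x assume "x \<in> space M"
      then have x: "x \<in> carrier_mat n m" by (simp add: spM)
      have "- (y - x) = x + (-1) \<cdot>\<^sub>m y" using x yc by (auto intro!: eq_matI)
      moreover have "y - x \<in> carrier_mat n m" using x by (rule minus_carrier_mat)
      ultimately show "(indicator S (y - x) :: ennreal) = indicator S (x + (-1) \<cdot>\<^sub>m y)"
        using S(2)[of "y - x"] by (auto split: split_indicator)
    qed
    also have "\<dots> = (\<integral>\<^sup>+x. indicator S x \<partial>M)" by (rule tM[OF _ yc(2)]) measurable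
    also have "\<dots> = emeasure M S" by (rule nn_integral_indicator) (simp add: M(2) S)
    finally show "(\<integral>\<^sup>+x. F y * indicator S (y - x) \<partial>M) = emeasure M S * F y" by (simp add: mult.commute)
  qed
  also have "\<dots> = emeasure M S * (\<integral>\<^sup>+y. F y \<partial>?N)"
    by (rule nn_integral_cmult) measurable
  finally show ?thesis .
qed

section \<open>Invariance of Lebesgue measure under isometries of the squared Frobenius norm\<close>

definition fnorm2 :: "real mat \<Rightarrow> real" where
  "fnorm2 A = (\<Sum>i<dim_row A. \<Sum>j<dim_col A. (A $$ (i,j))\<^sup>2)"

lemma fnorm2_eq: "A \<in> carrier_mat n m \<Longrightarrow> fnorm2 A = (\<Sum>i<n. \<Sum>j<m. (A $$ (i,j))\<^sup>2)"
  by (auto simp: fnorm2_def)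

lemma fnorm2_nonneg: "0 \<le> fnorm2 A"
  by (auto simp: fnorm2_def intro!: sum_nonneg)

lemma fnorm2_transpose: "fnorm2 (A\<^sup>T) = fnorm2 A"
  unfolding fnorm2_def by (subst sum.swap) simp

lemma fnorm2_trace: "fnorm2 A = mat_trace (A\<^sup>T * A)"
  unfolding fnorm2_def mat_trace_def
  by (subst sum.swap) (simp add: scalar_prod_def atLeast0LessThan power2_eq_square)

lemma fnorm2_stiefel_left:
  assumes "R \<in> stiefel p n" "A \<in> carrier_mat n m"
  shows "fnorm2 (R * A) = fnorm2 A"
proof -
  have R: "R \<in> carrier_mat p n" "R\<^sup>T * R = 1\<^sub>m n" using assms by (auto simp: stiefel_def)
  have RT: "R\<^sup>T \<in> carrier_mat n p" "A\<^sup>T \<in> carrier_mat m n" using R assms by auto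
  have "(R * A)\<^sup>T * (R * A) = A\<^sup>T * (R\<^sup>T * (R * A))"
    unfolding transpose_mult[OF R(1) assms(2)] by (rule assoc_mult_mat[OF RT(2,1) mult_carrier_mat[OF R(1) assms(2)]])
  also have "R\<^sup>T * (R * A) = A"
    using assoc_mult_mat[OF RT(1) R(1) assms(2)] R assms by simp
  finally show ?thesis by (simp add: fnorm2_trace)
qed

lemma fnorm2_stiefel_right:
  assumes "W \<in> stiefel m m" "A \<in> carrier_mat n m"
  shows "fnorm2 (A * W) = fnorm2 A"
proof -
  have "fnorm2 (A * W) = fnorm2 (W\<^sup>T * A\<^sup>T)"
    using transpose_mult[OF assms(2) stiefel_square(1)[OF assms(1)]] fnorm2_transpose[of "A * W"] by simp
  also have "\<dots> = fnorm2 (A\<^sup>T)"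
    by (rule fnorm2_stiefel_left[OF stiefel_square(4)[OF assms(1)]]) (use assms in auto)
  finally show ?thesis by (simp add: fnorm2_transpose)
qed

lemma measurable_fnorm2[measurable (raw)]:
  assumes f: "f \<in> M \<rightarrow>\<^sub>M mat_borel n m"
  shows "(\<lambda>x. fnorm2 (f x)) \<in> borel_measurable M"
proof -
  have eq: "fnorm2 (f x) = (\<Sum>i<n. \<Sum>j<m. (f x $$ (i,j))\<^sup>2)" if "x \<in> space M" for x
    by (rule fnorm2_eq[OF measurable_mat_carrier(1)[OF f that]])
  show ?thesis
    by (subst measurable_cong[OF eq], assumption)
       (intro borel_measurable_sum borel_measurable_power measurable_entry[OF f], auto)
qed

definition fball :: "nat \<Rightarrow> nat \<Rightarrow> real mat set" where
  "fball n m = {A \<in> carrier_mat n m. fnorm2 A \<le> 1}"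

lemma fball_sets[measurable]: "fball n m \<in> sets (mat_borel n m)"
proof -
  have "{A \<in> space (mat_borel n m). fnorm2 A \<le> 1} \<in> sets (mat_borel n m)" by measurable
  then show ?thesis by (simp add: fball_def)
qed

text \<open>The ball lies between two cubes. Positive finite measure is what allows it to fix the
  factor of proportionality between invariant measures.\<close>

lemma emeasure_fball: "0 < emeasure (leb_mat n m) (fball n m)" "emeasure (leb_mat n m) (fball n m) < \<infinity>"
proof -
  \<comment> \<open>Chosen so that (1 + n m) e = 1: then n m entries of size at most e have sum of
    squares at most e, which is at most 1. The summand 1 keeps e meaningful for empty
    matrices.\<close>
  define e :: real where "e = 1 / (1 + real n * real m)"
  have e: "0 < e" by (auto simp: e_def intro!: divide_pos_pos add_pos_nonneg)
  have "0 < (\<Prod>ij\<in>{..<n} \<times> {..<m}. ennreal (2 * e))" using e by (simp add: prod_ennreal ennreal_power ennreal_zero_less_mult_iff)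
  also have "\<dots> = emeasure (leb_mat n m) (mat_box n m (\<lambda>_. {-e..e}))"
    using e by (subst emeasure_leb_mat_box) auto
  also have "\<dots> \<le> emeasure (leb_mat n m) (fball n m)"
  proof (rule emeasure_mono)
    show "mat_box n m (\<lambda>_. {-e..e}) \<subseteq> fball n m"
    proof
      fix A assume A: "A \<in> mat_box n m (\<lambda>_. {-e..e})"
      then have c: "A \<in> carrier_mat n m" by (simp add: mat_box_def)
      have "fnorm2 A \<le> (\<Sum>i<n. \<Sum>j<m. e\<^sup>2)"
        unfolding fnorm2_eq[OF c]
      proof (intro sum_mono)
        fix i j assume "i \<in> {..<n}" "j \<in> {..<m}"
        then have "-e \<le> A $$ (i,j)" "A $$ (i,j) \<le> e" using A by (auto simp: mat_box_def)
        then show "(A $$ (i,j))\<^sup>2 \<le> e\<^sup>2" by (intro abs_le_square_iff[THEN iffD1]) auto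
      qed
      also have "\<dots> = (real n * real m) * e\<^sup>2" by simp
      also have "\<dots> \<le> (1 + real n * real m) * e\<^sup>2" by (intro mult_right_mono) auto
      also have "\<dots> = e" by (simp add: e_def power2_eq_square)
      also have "\<dots> \<le> 1" unfolding e_def by (subst divide_le_eq_1_pos) (auto intro: add_pos_nonneg)
      finally show "A \<in> fball n m" using c by (simp add: fball_def)
    qed
  qed (simp add: fball_sets)
  finally show "0 < emeasure (leb_mat n m) (fball n m)" .
  have "emeasure (leb_mat n m) (fball n m) \<le> emeasure (leb_mat n m) (mat_box n m (\<lambda>_. {-1..1}))"
  proof (rule emeasure_mono)
    show "fball n m \<subseteq> mat_box n m (\<lambda>_. {-1..1})"
    proof
      fix A assume A: "A \<in> fball n m"
      then have c: "A \<in> carrier_mat n m" and le: "fnorm2 A \<le> 1" by (auto simp: fball_def)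
      have "A $$ (i,j) \<in> {-1..1}" if "i < n" "j < m" for i j
      proof -
        have "(A $$ (i,j))\<^sup>2 \<le> (\<Sum>j<m. (A $$ (i,j))\<^sup>2)" using that by (intro member_le_sum) auto
        also have "\<dots> \<le> (\<Sum>i<n. \<Sum>j<m. (A $$ (i,j))\<^sup>2)"
          using that by (intro member_le_sum[where f="\<lambda>i. \<Sum>j<m. (A $$ (i,j))\<^sup>2"] sum_nonneg) auto
        finally have "(A $$ (i,j))\<^sup>2 \<le> 1" using le fnorm2_eq[OF c] by simp
        then show ?thesis by (auto simp: abs_square_le_1 abs_le_iff)
      qed
      then show "A \<in> mat_box n m (\<lambda>_. {-1..1})" using c by (simp add: mat_box_def)
    qed
  qed simp
  also have "\<dots> < \<infinity>"
    by (subst emeasure_leb_mat_box) (auto simp: power_less_top_ennreal)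
  finally show "emeasure (leb_mat n m) (fball n m) < \<infinity>" .
qed

text \<open>\<open>T\<close> is additive and bijective, so the image measure is translation
  invariant and hence proportional to Lebesgue measure; the unit ball, mapped to itself, shows that
  the factor is 1. No Jacobian has to be computed.\<close>

lemma leb_mat_isometry:
  assumes T[measurable]: "T \<in> mat_borel n m \<rightarrow>\<^sub>M mat_borel n m" and T'[measurable]: "T' \<in> mat_borel n m \<rightarrow>\<^sub>M mat_borel n m"
    and inverse: "\<And>A. A \<in> carrier_mat n m \<Longrightarrow> T (T' A) = A" "\<And>A. A \<in> carrier_mat n m \<Longrightarrow> T' (T A) = A"
    and add: "\<And>A B. A \<in> carrier_mat n m \<Longrightarrow> B \<in> carrier_mat n m \<Longrightarrow> T (A + B) = T A + T B"
    and norm: "\<And>A. A \<in> carrier_mat n m \<Longrightarrow> fnorm2 (T A) = fnorm2 A"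
  shows "distr (leb_mat n m) (mat_borel n m) T = leb_mat n m"
proof -
  let ?N = "leb_mat n m" and ?B = "mat_borel n m" and ?M = "distr (leb_mat n m) (mat_borel n m) T"
  have Tc: "T A \<in> carrier_mat n m" "T' A \<in> carrier_mat n m" if "A \<in> carrier_mat n m" for A
    using measurable_space[OF T] measurable_space[OF T'] that by auto
  have "distr ?M ?B T' = distr ?N ?B (T' \<circ> T)" by (rule distr_distr) measurable
  also have "\<dots> = distr ?N ?N (\<lambda>x. x)" by (rule distr_cong) (auto simp: inverse)
  finally have "sigma_finite_measure (distr ?M ?B T')" using sigma_finite_leb_mat by simp
  then have sf: "sigma_finite_measure ?M" by (rule sigma_finite_measure_distr) simp
  have inv: "distr ?M ?B (\<lambda>A. A + C) = ?M" if C: "C \<in> carrier_mat n m" for C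
  proof -
    have [measurable]: "(\<lambda>A. A + C) \<in> ?B \<rightarrow>\<^sub>M ?B" "(\<lambda>A. A + T' C) \<in> ?B \<rightarrow>\<^sub>M ?B" using C Tc by measurable
    have "distr ?M ?B (\<lambda>A. A + C) = distr ?N ?B ((\<lambda>A. A + C) \<circ> T)" by (rule distr_distr) measurable
    also have "\<dots> = distr ?N ?B (T \<circ> (\<lambda>A. A + T' C))"
      using C by (intro distr_cong) (auto simp: add Tc inverse)
    also have "\<dots> = distr (distr ?N ?B (\<lambda>A. A + T' C)) ?B T" by (rule distr_distr[symmetric]) measurable
    also have "\<dots> = ?M" using leb_mat_translate[OF Tc(2)[OF C]] by simp
    finally show ?thesis .
  qed
  have neg: "- A \<in> fball n m \<longleftrightarrow> A \<in> fball n m" if "A \<in> carrier_mat n m" for A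
    using that by (auto simp: fball_def fnorm2_def)
  have "emeasure ?M (fball n m) = emeasure ?N (T -` fball n m \<inter> space ?N)"
    by (rule emeasure_distr) measurable
  also have "T -` fball n m \<inter> space ?N = fball n m" by (auto simp: fball_def norm Tc)
  finally have eqS: "emeasure ?M (fball n m) = emeasure ?N (fball n m)" .
  show ?thesis
  proof (rule measure_eqI)
    fix A assume A: "A \<in> sets ?M"
    then have [measurable]: "A \<in> sets ?B" by simp
    have "(\<integral>\<^sup>+x. indicator A x \<partial>?M) * emeasure ?N (fball n m) = emeasure ?M (fball n m) * (\<integral>\<^sup>+x. indicator A x \<partial>?N)"
      by (rule translation_invariant_unique[OF sf _ inv _ fball_sets neg]) auto
    then have "emeasure ?N (fball n m) * emeasure ?M A = emeasure ?N (fball n m) * emeasure ?N A"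
      using A by (simp add: eqS mult.commute)
    then show "emeasure ?M A = emeasure ?N A"
      using emeasure_fball[of n m] by (auto simp: ennreal_mult_cancel_left)
  qed simp
qed

lemma nn_integral_leb_mat_left_orth:
  assumes R: "R \<in> stiefel n n" and F: "F \<in> borel_measurable (mat_borel n m)"
  shows "(\<integral>\<^sup>+A. F (R * A) \<partial>leb_mat n m) = (\<integral>\<^sup>+A. F A \<partial>leb_mat n m)"
proof -
  note Rs = stiefel_square[OF R]
  have [measurable]: "(\<lambda>A. R * A) \<in> mat_borel n m \<rightarrow>\<^sub>M mat_borel n m" "(\<lambda>A. R\<^sup>T * A) \<in> mat_borel n m \<rightarrow>\<^sub>M mat_borel n m"
    using Rs by (auto intro!: measurable_mat_mult[where l=n] measurable_const_mat)
  have "R * (R\<^sup>T * A) = A" "R\<^sup>T * (R * A) = A" if "A \<in> carrier_mat n m" for A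
    using assoc_mult_mat[of R n n "R\<^sup>T" n A m] assoc_mult_mat[of "R\<^sup>T" n n R n A m] Rs that by auto
  then have "distr (leb_mat n m) (mat_borel n m) (\<lambda>A. R * A) = leb_mat n m"
    using Rs by (intro leb_mat_isometry[where T'="\<lambda>A. R\<^sup>T * A"])
      (auto simp: mult_add_distrib_mat[OF Rs(1)] fnorm2_stiefel_left[OF R])
  moreover have "(\<integral>\<^sup>+A. F A \<partial>distr (leb_mat n m) (mat_borel n m) (\<lambda>A. R * A)) = (\<integral>\<^sup>+A. F (R * A) \<partial>leb_mat n m)"
    by (rule nn_integral_distr) (use F in measurable)
  ultimately show ?thesis by simp
qed

lemma nn_integral_leb_mat_right_orth:
  assumes W: "W \<in> stiefel m m" and F: "F \<in> borel_measurable (mat_borel n m)"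
  shows "(\<integral>\<^sup>+A. F (A * W) \<partial>leb_mat n m) = (\<integral>\<^sup>+A. F A \<partial>leb_mat n m)"
proof -
  note Ws = stiefel_square[OF W]
  have [measurable]: "(\<lambda>A. A * W) \<in> mat_borel n m \<rightarrow>\<^sub>M mat_borel n m" "(\<lambda>A. A * W\<^sup>T) \<in> mat_borel n m \<rightarrow>\<^sub>M mat_borel n m"
    using Ws by (auto intro!: measurable_mat_mult[where l=m] measurable_const_mat)
  have "A * W * W\<^sup>T = A" "A * W\<^sup>T * W = A" if "A \<in> carrier_mat n m" for A
    using assoc_mult_mat[of A n m W m "W\<^sup>T" m] assoc_mult_mat[of A n m "W\<^sup>T" m W m] Ws that by auto
  then have "distr (leb_mat n m) (mat_borel n m) (\<lambda>A. A * W) = leb_mat n m"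
    using Ws by (intro leb_mat_isometry[where T'="\<lambda>A. A * W\<^sup>T"])
      (auto simp: add_mult_distrib_mat[where nc=m] fnorm2_stiefel_right[OF W])
  moreover have "(\<integral>\<^sup>+A. F A \<partial>distr (leb_mat n m) (mat_borel n m) (\<lambda>A. A * W)) = (\<integral>\<^sup>+A. F (A * W) \<partial>leb_mat n m)"
    by (rule nn_integral_distr) (use F in measurable)
  ultimately show ?thesis by simp
qed

section \<open>Transposition, scaling, positive definite factors and stacked blocks\<close>

lemma leb_mat_transpose: "distr (leb_mat n m) (mat_borel m n) (\<lambda>A. A\<^sup>T) = leb_mat m n"
proof (rule leb_mat_eqI)
  fix B :: "nat \<times> nat \<Rightarrow> real set" assume B: "\<And>ij. B ij \<in> sets borel"
  have "emeasure (distr (leb_mat n m) (mat_borel m n) (\<lambda>A. A\<^sup>T)) (mat_box m n B)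
    = emeasure (leb_mat n m) ((\<lambda>A. A\<^sup>T) -` mat_box m n B \<inter> space (leb_mat n m))"
    by (rule emeasure_distr) (use B in measurable)
  also have "(\<lambda>A. A\<^sup>T) -` mat_box m n B \<inter> space (leb_mat n m) = mat_box n m (\<lambda>(i,j). B (j,i))"
  proof (rule Set.set_eqI)
    fix A
    show "A \<in> (\<lambda>A. A\<^sup>T) -` mat_box m n B \<inter> space (leb_mat n m) \<longleftrightarrow> A \<in> mat_box n m (\<lambda>(i,j). B (j,i))"
      by (cases "A \<in> carrier_mat n m") (auto simp: mat_box_def)
  qed
  also have "emeasure (leb_mat n m) \<dots> = (\<Prod>ij\<in>{..<n} \<times> {..<m}. emeasure lborel ((\<lambda>(i,j). B (j,i)) ij))"
    by (rule emeasure_leb_mat_box) (use B in auto)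
  also have "\<dots> = (\<Prod>ij\<in>{..<m} \<times> {..<n}. emeasure lborel (B ij))"
    by (rule prod.reindex_bij_witness[where i=prod.swap and j=prod.swap]) auto
  finally show "emeasure (distr (leb_mat n m) (mat_borel m n) (\<lambda>A. A\<^sup>T)) (mat_box m n B) = \<dots>" .
qed simp

lemma nn_integral_leb_mat_transpose:
  assumes "F \<in> borel_measurable (mat_borel m n)"
  shows "(\<integral>\<^sup>+A. F (A\<^sup>T) \<partial>leb_mat n m) = (\<integral>\<^sup>+A. F A \<partial>leb_mat m n)"
  unfolding leb_mat_transpose[symmetric, of m n] by (rule nn_integral_distr[symmetric]) (use assms in measurable)

lemma measurable_mat_entrywise_scale:
  "(\<lambda>A. Matrix.mat n m (\<lambda>ij. c ij * A $$ ij)) \<in> mat_borel n m \<rightarrow>\<^sub>M mat_borel n m"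
  by (rule measurable_mat_by_entries[where g="\<lambda>i j A. c (i,j) * A $$ (i,j)"])
     (auto intro!: borel_measurable_times measurable_entry0)

lemma nn_integral_leb_mat_scale:
  fixes c :: "nat \<times> nat \<Rightarrow> real"
  assumes c: "\<And>ij. c ij \<noteq> 0" and F: "F \<in> borel_measurable (mat_borel n m)"
  shows "ennreal (\<Prod>ij\<in>{..<n} \<times> {..<m}. \<bar>c ij\<bar>) * (\<integral>\<^sup>+A. F (Matrix.mat n m (\<lambda>ij. c ij * A $$ ij)) \<partial>leb_mat n m)
    = (\<integral>\<^sup>+A. F A \<partial>leb_mat n m)"
proof -
  let ?I = "{..<n} \<times> {..<m}" and ?T = "\<lambda>A. Matrix.mat n m (\<lambda>ij. c ij * A $$ ij)"
  define K where "K = ennreal (\<Prod>ij\<in>?I. \<bar>c ij\<bar>)"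
  note [measurable] = measurable_mat_entrywise_scale[of n m c]
  have "density (distr (leb_mat n m) (mat_borel n m) ?T) (\<lambda>_. K) = leb_mat n m"
  proof (rule leb_mat_eqI)
    fix B :: "nat \<times> nat \<Rightarrow> real set" assume B: "\<And>ij. B ij \<in> sets borel"
    define B' where "B' = (\<lambda>ij. (\<lambda>x. c ij * x) -` B ij)"
    have B': "B' ij \<in> sets borel" for ij
      unfolding B'_def using measurable_sets[of "\<lambda>x. c ij * x" borel borel, OF _ B] by simp
    have "emeasure (density (distr (leb_mat n m) (mat_borel n m) ?T) (\<lambda>_. K)) (mat_box n m B)
      = K * emeasure (distr (leb_mat n m) (mat_borel n m) ?T) (mat_box n m B)"
      using B by (subst emeasure_density) (auto simp: nn_integral_cmult)
    also have "emeasure (distr (leb_mat n m) (mat_borel n m) ?T) (mat_box n m B)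
      = emeasure (leb_mat n m) (?T -` mat_box n m B \<inter> space (leb_mat n m))"
      by (rule emeasure_distr) (use B in measurable)
    also have "?T -` mat_box n m B \<inter> space (leb_mat n m) = mat_box n m B'"
    proof (rule Set.set_eqI)
      fix A
      show "A \<in> ?T -` mat_box n m B \<inter> space (leb_mat n m) \<longleftrightarrow> A \<in> mat_box n m B'"
        by (cases "A \<in> carrier_mat n m") (auto simp: mat_box_def B'_def)
    qed
    also have "emeasure (leb_mat n m) \<dots> = (\<Prod>ij\<in>?I. emeasure lborel (B' ij))"
      by (rule emeasure_leb_mat_box[OF B'])
    also have "K * \<dots> = (\<Prod>ij\<in>?I. ennreal \<bar>c ij\<bar> * emeasure lborel (B' ij))"
      by (simp add: K_def prod_ennreal[symmetric] prod.distrib)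
    also have "\<dots> = (\<Prod>ij\<in>?I. emeasure lborel (B ij))"
    proof (rule prod.cong[OF refl])
      fix ij
      have "emeasure lborel (B ij) = emeasure (density (distr lborel borel ((*) (c ij))) (\<lambda>_. \<bar>c ij\<bar>)) (B ij)"
        using lborel_distr_mult'[OF c, of ij] by simp
      also have "\<dots> = \<bar>c ij\<bar> * emeasure (distr lborel borel ((*) (c ij))) (B ij)"
        using B by (subst emeasure_density) (auto simp: nn_integral_cmult)
      also have "emeasure (distr lborel borel ((*) (c ij))) (B ij) = emeasure lborel ((*) (c ij) -` B ij \<inter> space lborel)"
        by (rule emeasure_distr) (use B in auto)
      finally show "ennreal \<bar>c ij\<bar> * emeasure lborel (B' ij) = emeasure lborel (B ij)" by (simp add: B'_def)
    qed
    finally show "emeasure (density (distr (leb_mat n m) (mat_borel n m) ?T) (\<lambda>_. K)) (mat_box n m B) = \<dots>" .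
  qed simp
  then have "(\<integral>\<^sup>+A. F A \<partial>leb_mat n m) = (\<integral>\<^sup>+A. F A \<partial>density (distr (leb_mat n m) (mat_borel n m) ?T) (\<lambda>_. K))" by simp
  also have "\<dots> = (\<integral>\<^sup>+A. K * F A \<partial>distr (leb_mat n m) (mat_borel n m) ?T)"
    by (rule nn_integral_density) (use F in measurable)
  also have "\<dots> = K * (\<integral>\<^sup>+A. F A \<partial>distr (leb_mat n m) (mat_borel n m) ?T)"
    by (rule nn_integral_cmult) (use F in measurable)
  also have "(\<integral>\<^sup>+A. F A \<partial>distr (leb_mat n m) (mat_borel n m) ?T) = (\<integral>\<^sup>+A. F (?T A) \<partial>leb_mat n m)"
    by (rule nn_integral_distr) (use F in measurable)
  finally show ?thesis by (simp add: K_def)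
qed

text \<open>With \<open>M = W * mat_diag m d * W\<^sup>T\<close> the orthogonal factors preserve
  Lebesgue measure, and the diagonal one scales column \<open>j\<close> by \<open>d j\<close>. Each
  of the \<open>n\<close> rows thus contributes one factor \<open>det M\<close>.\<close>

lemma nn_integral_leb_mat_right_pd:
  assumes M: "sym_pd m M" and F[measurable]: "F \<in> borel_measurable (mat_borel n m)"
  shows "ennreal (det M ^ n) * (\<integral>\<^sup>+A. F (A * M) \<partial>leb_mat n m) = (\<integral>\<^sup>+A. F A \<partial>leb_mat n m)"
proof -
  obtain W d where Wd: "spectral_decomp m M W d" and d: "\<forall>i<m. 0 < d i"
    using sym_pd_decomp[OF M] by blast
  then have W: "W \<in> stiefel m m" "M = W * mat_diag m d * W\<^sup>T" by (auto simp: spectral_decomp_def)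
  note Ws = stiefel_square[OF W(1)]
  have WT: "W\<^sup>T \<in> carrier_mat m m" using Ws by simp
  \<comment> \<open>The scaling rule wants nonzero factors at all index pairs, so columns outside
    the matrix get 1.\<close>
  define c where "c = (\<lambda>ij::nat\<times>nat. if snd ij < m then d (snd ij) else 1)"
  have c: "c ij \<noteq> 0" for ij using d by (auto simp: c_def less_imp_neq)
  have mW: "(\<lambda>A. A * W) \<in> mat_borel n m \<rightarrow>\<^sub>M mat_borel n m" "(\<lambda>A. A * W\<^sup>T) \<in> mat_borel n m \<rightarrow>\<^sub>M mat_borel n m"
    "(\<lambda>A. A * mat_diag m d) \<in> mat_borel n m \<rightarrow>\<^sub>M mat_borel n m"
    using Ws by (auto intro!: measurable_mat_mult[where l=m] measurable_const_mat)
  note [measurable] = mW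
  have G1: "(\<lambda>B. F (B * mat_diag m d * W\<^sup>T)) \<in> borel_measurable (mat_borel n m)"
    using measurable_compose[OF measurable_compose[OF mW(3) mW(2)] F] .
  have G2: "(\<lambda>B. F (B * W\<^sup>T)) \<in> borel_measurable (mat_borel n m)"
    using measurable_compose[OF mW(2) F] .
  have "(\<integral>\<^sup>+A. F (A * M) \<partial>leb_mat n m) = (\<integral>\<^sup>+A. F (A * W * mat_diag m d * W\<^sup>T) \<partial>leb_mat n m)"
  proof (rule nn_integral_cong)
    fix A assume "A \<in> space (leb_mat n m)"
    then have A: "A \<in> carrier_mat n m" by simp
    have WD: "W * mat_diag m d \<in> carrier_mat m m" using Ws by (intro mult_carrier_mat[of _ m m]) auto
    have "A * M = A * (W * mat_diag m d) * W\<^sup>T" unfolding W(2) by (rule assoc_mult_mat[OF A WD WT, symmetric])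
    also have "A * (W * mat_diag m d) = A * W * mat_diag m d"
      using assoc_mult_mat[OF A Ws(1) mat_diag_dim] by simp
    finally show "F (A * M) = F (A * W * mat_diag m d * W\<^sup>T)" by simp
  qed
  also have "\<dots> = (\<integral>\<^sup>+A. F (A * mat_diag m d * W\<^sup>T) \<partial>leb_mat n m)"
    by (rule nn_integral_leb_mat_right_orth[OF W(1) G1])
  also have "\<dots> = (\<integral>\<^sup>+A. F (Matrix.mat n m (\<lambda>ij. c ij * A $$ ij) * W\<^sup>T) \<partial>leb_mat n m)"
  proof (rule nn_integral_cong)
    fix A assume "A \<in> space (leb_mat n m)"
    then have A: "A \<in> carrier_mat n m" by simp
    have "A * mat_diag m d = Matrix.mat n m (\<lambda>ij. c ij * A $$ ij)"
      unfolding mat_diag_mult_right[OF A] by (rule eq_matI) (auto simp: c_def)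
    then show "F (A * mat_diag m d * W\<^sup>T) = F (Matrix.mat n m (\<lambda>ij. c ij * A $$ ij) * W\<^sup>T)" by simp
  qed
  finally have 1: "(\<integral>\<^sup>+A. F (A * M) \<partial>leb_mat n m) = (\<integral>\<^sup>+A. F (Matrix.mat n m (\<lambda>ij. c ij * A $$ ij) * W\<^sup>T) \<partial>leb_mat n m)" .
  have "(\<Prod>ij\<in>{..<n} \<times> {..<m}. \<bar>c ij\<bar>) = (\<Prod>i<n. \<Prod>j<m. \<bar>c (i,j)\<bar>)"
    by (simp add: prod.cartesian_product case_prod_unfold)
  also have "\<dots> = (\<Prod>i<n. \<Prod>j<m. d j)"
    using d by (intro prod.cong refl) (auto simp: c_def less_imp_le)
  also have "\<dots> = det M ^ n" by (simp add: W(2) det_conj_diag[OF W(1)])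
  finally have 2: "(\<Prod>ij\<in>{..<n} \<times> {..<m}. \<bar>c ij\<bar>) = det M ^ n" .
  have "ennreal (det M ^ n) * (\<integral>\<^sup>+A. F (Matrix.mat n m (\<lambda>ij. c ij * A $$ ij) * W\<^sup>T) \<partial>leb_mat n m)
    = (\<integral>\<^sup>+A. F (A * W\<^sup>T) \<partial>leb_mat n m)"
    unfolding 2[symmetric] by (rule nn_integral_leb_mat_scale[OF c G2])
  also have "\<dots> = (\<integral>\<^sup>+A. F A \<partial>leb_mat n m)"
    by (rule nn_integral_leb_mat_right_orth[OF Ws(4) F])
  finally show ?thesis by (simp add: 1)
qed

lemma leb_mat_append_rows:
  "distr (leb_mat n k \<Otimes>\<^sub>M leb_mat m k) (mat_borel (n + m) k) (\<lambda>(A, B). A @\<^sub>r B) = leb_mat (n + m) k"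
proof (rule leb_mat_eqI)
  fix B :: "nat \<times> nat \<Rightarrow> real set" assume B: "\<And>ij. B ij \<in> sets borel"
  let ?T = "\<lambda>(A, B). A @\<^sub>r B" and ?P = "leb_mat n k \<Otimes>\<^sub>M leb_mat m k"
  interpret pair_sigma_finite "leb_mat n k" "leb_mat m k"
    using sigma_finite_leb_mat by (simp add: pair_sigma_finite_def)
  have [measurable]: "?T \<in> ?P \<rightarrow>\<^sub>M mat_borel (n + m) k" by measurable
  have "emeasure (distr ?P (mat_borel (n + m) k) ?T) (mat_box (n + m) k B)
    = emeasure ?P (?T -` mat_box (n + m) k B \<inter> space ?P)"
    by (rule emeasure_distr) (use B in measurable)
  also have "?T -` mat_box (n + m) k B \<inter> space ?P = mat_box n k B \<times> mat_box m k (\<lambda>(i,j). B (i + n, j))"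
  proof (rule Set.set_eqI)
    fix AC :: "real mat \<times> real mat" obtain A C where AC: "AC = (A, C)" by (cases AC)
    show "AC \<in> ?T -` mat_box (n + m) k B \<inter> space ?P \<longleftrightarrow> AC \<in> mat_box n k B \<times> mat_box m k (\<lambda>(i,j). B (i + n, j))"
    proof (cases "A \<in> carrier_mat n k \<and> C \<in> carrier_mat m k")
      case True
      then have A: "A \<in> carrier_mat n k" and C: "C \<in> carrier_mat m k" by auto
      have "(\<forall>i<n + m. \<forall>j<k. (A @\<^sub>r C) $$ (i,j) \<in> B (i,j))
        \<longleftrightarrow> (\<forall>i<n. \<forall>j<k. A $$ (i,j) \<in> B (i,j)) \<and> (\<forall>i<m. \<forall>j<k. C $$ (i,j) \<in> B (i + n,j))"
        (is "?L \<longleftrightarrow> ?R")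
      proof
        assume L: ?L
        have "A $$ (i,j) \<in> B (i,j)" if "i < n" "j < k" for i j
          using L[rule_format, of i j] that append_rows_index[OF A C, of i j] by simp
        moreover have "C $$ (i,j) \<in> B (i + n,j)" if "i < m" "j < k" for i j
          using L[rule_format, of "i + n" j] that append_rows_index[OF A C, of "i + n" j] by simp
        ultimately show ?R by blast
      next
        assume R: ?R
        show ?L
        proof (intro allI impI)
          fix i j assume ij: "i < n + m" "j < k"
          show "(A @\<^sub>r C) $$ (i,j) \<in> B (i,j)"
          proof (cases "i < n")
            case True then show ?thesis using R ij append_rows_index[OF A C ij] by simp
          next
            case False
            then have "C $$ (i - n, j) \<in> B (i - n + n, j)" using R ij by (metis less_diff_conv2 add.commute not_less)
            then show ?thesis using False append_rows_index[OF A C ij] by simp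
          qed
        qed
      qed
      then show ?thesis using A C AC by (simp add: mat_box_def space_pair_measure)
    qed (auto simp: AC mat_box_def space_pair_measure)
  qed
  also have "emeasure ?P \<dots> = emeasure (leb_mat n k) (mat_box n k B) * emeasure (leb_mat m k) (mat_box m k (\<lambda>(i,j). B (i + n, j)))"
    using B by (intro M2.emeasure_pair_measure_Times) (auto intro!: mat_box_sets)
  also have "\<dots> = (\<Prod>ij\<in>{..<n} \<times> {..<k}. emeasure lborel (B ij)) * (\<Prod>ij\<in>{..<m} \<times> {..<k}. emeasure lborel ((\<lambda>(i,j). B (i + n, j)) ij))"
    using B by (intro arg_cong2[where f="(*)"] emeasure_leb_mat_box) auto
  also have "\<dots> = (\<Prod>i<n. \<Prod>j<k. emeasure lborel (B (i,j))) * (\<Prod>i<m. \<Prod>j<k. emeasure lborel (B (i + n,j)))"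
    by (simp add: prod.cartesian_product case_prod_unfold)
  also have "\<dots> = (\<Prod>i<n + m. \<Prod>j<k. emeasure lborel (B (i,j)))"
    by (subst lessThan_atLeast0, subst (2) lessThan_atLeast0, subst prod.atLeastLessThan_concat[of 0 n "n + m", symmetric])
      (auto simp: prod.shift_bounds_nat_ivl[of _ 0 n m, simplified add_0] add.commute lessThan_atLeast0)
  also have "\<dots> = (\<Prod>ij\<in>{..<n + m} \<times> {..<k}. emeasure lborel (B ij))"
    by (simp add: prod.cartesian_product case_prod_unfold)
  finally show "emeasure (distr ?P (mat_borel (n + m) k) ?T) (mat_box (n + m) k B) = \<dots>" .
qed simp

lemma nn_integral_leb_mat_append_rows:
  assumes F[measurable]: "F \<in> borel_measurable (mat_borel (n + m) k)"
  shows "(\<integral>\<^sup>+A. F A \<partial>leb_mat (n + m) k) = (\<integral>\<^sup>+A. (\<integral>\<^sup>+B. F (A @\<^sub>r B) \<partial>leb_mat m k) \<partial>leb_mat n k)"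
proof -
  interpret pair_sigma_finite "leb_mat n k" "leb_mat m k"
    using sigma_finite_leb_mat by (simp add: pair_sigma_finite_def)
  have "(\<integral>\<^sup>+A. F A \<partial>leb_mat (n + m) k) = (\<integral>\<^sup>+AB. F ((\<lambda>(A,B). A @\<^sub>r B) AB) \<partial>(leb_mat n k \<Otimes>\<^sub>M leb_mat m k))"
    unfolding leb_mat_append_rows[symmetric] by (rule nn_integral_distr) measurable
  also have "\<dots> = (\<integral>\<^sup>+A. (\<integral>\<^sup>+B. F (A @\<^sub>r B) \<partial>leb_mat m k) \<partial>leb_mat n k)"
    by (subst M2.nn_integral_fst[symmetric]) (auto simp: case_prod_unfold)
  finally show ?thesis .
qed

section \<open>The uniform law on the Stiefel manifold\<close>

text \<open>The property that \<open>stiefel_uniform\<close> describes. Arguing with an arbitrary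
  measure that has it postpones the definite description until existence and uniqueness are
  known.\<close>

definition is_haar :: "nat \<Rightarrow> nat \<Rightarrow> real mat measure \<Rightarrow> bool" where
  "is_haar p k M \<longleftrightarrow> prob_space M \<and> sets M = sets (mat_borel p k) \<and> emeasure M (stiefel p k) = 1 \<and>
     (\<forall>R \<in> stiefel p p. distr M M (\<lambda>V. R * V) = M)"

lemma measurable_left_mult:
  "R \<in> carrier_mat p n \<Longrightarrow> (\<lambda>V. R * V) \<in> mat_borel n k \<rightarrow>\<^sub>M mat_borel p k"
  by (intro measurable_mat_mult[where l=n] measurable_const_mat measurable_ident) auto

lemma measurable_right_mult:
  "R \<in> carrier_mat n k \<Longrightarrow> (\<lambda>V. V * R) \<in> mat_borel p n \<rightarrow>\<^sub>M mat_borel p k"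
  by (intro measurable_mat_mult[where l=n] measurable_const_mat measurable_ident) auto

lemma is_haarD:
  assumes "is_haar p k M"
  shows "prob_space M" "sets M = sets (mat_borel p k)" "space M = carrier_mat p k" "AE V in M. V \<in> stiefel p k"
    "sigma_finite_measure M"
proof -
  show p: "prob_space M" and s: "sets M = sets (mat_borel p k)" using assms by (auto simp: is_haar_def)
  show "space M = carrier_mat p k" using sets_eq_imp_space_eq[OF s] by simp
  interpret prob_space M by fact
  have "prob (stiefel p k) = 1" using assms by (simp add: is_haar_def measure_def)
  then show "AE V in M. V \<in> stiefel p k"
    using stiefel_sets s by (subst (asm) prob_eq_1) auto
  show "sigma_finite_measure M" by unfold_locales
qed

lemma nn_integral_haar_left:
  assumes M: "is_haar p k M" and R: "R \<in> stiefel p p" and F: "F \<in> borel_measurable (mat_borel p k)"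
  shows "(\<integral>\<^sup>+V. F (R * V) \<partial>M) = (\<integral>\<^sup>+V. F V \<partial>M)"
proof -
  note [measurable_cong] = is_haarD(2)[OF M]
  have [measurable]: "(\<lambda>V. R * V) \<in> M \<rightarrow>\<^sub>M M"
    using measurable_left_mult[OF stiefel_carrier[OF R]] by measurable
  have "(\<integral>\<^sup>+V. F V \<partial>distr M M (\<lambda>V. R * V)) = (\<integral>\<^sup>+V. F (R * V) \<partial>M)"
    by (rule nn_integral_distr) (use F in measurable)
  then show ?thesis using M R by (simp add: is_haar_def)
qed

lemma is_haarI:
  assumes "prob_space M" "sets M = sets (mat_borel p k)" "AE V in M. V \<in> stiefel p k"
    and inv: "\<And>R F. R \<in> stiefel p p \<Longrightarrow> F \<in> borel_measurable (mat_borel p k) \<Longrightarrow> (\<integral>\<^sup>+V. F (R * V) \<partial>M) = (\<integral>\<^sup>+V. F V \<partial>M)"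
  shows "is_haar p k M"
  unfolding is_haar_def
proof (intro conjI ballI)
  interpret prob_space M by fact
  show "emeasure M (stiefel p k) = 1"
    by (rule emeasure_eq_1_AE) (use assms stiefel_sets in auto)
  note [measurable_cong] = assms(2)
  fix R assume R: "R \<in> stiefel p p"
  have m[measurable]: "(\<lambda>V. R * V) \<in> M \<rightarrow>\<^sub>M M"
    using measurable_left_mult[OF stiefel_carrier[OF R]] by measurable
  show "distr M M (\<lambda>V. R * V) = M"
  proof (rule measure_eqI)
    fix A assume "A \<in> sets (distr M M (\<lambda>V. R * V))"
    then have A[measurable]: "A \<in> sets M" by simp
    then have A': "A \<in> sets (mat_borel p k)" by (simp add: assms(2))
    have "emeasure (distr M M (\<lambda>V. R * V)) A = (\<integral>\<^sup>+V. indicator A V \<partial>distr M M (\<lambda>V. R * V))" by simp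
    also have "\<dots> = (\<integral>\<^sup>+V. indicator A (R * V) \<partial>M)" by (rule nn_integral_distr) measurable
    also have "\<dots> = (\<integral>\<^sup>+V. indicator A V \<partial>M)" by (rule inv[OF R]) (use A' in measurable)
    finally show "emeasure (distr M M (\<lambda>V. R * V)) A = emeasure M A" by simp
  qed simp
qed (use assms in auto)

text \<open>A uniform point of the unit ball divided by its norm; rotation invariance is inherited
  from Lebesgue measure. For \<open>p > 0\<close> the zero vector, where the quotient is 0, is a
  null set.\<close>

definition sphere_law :: "nat \<Rightarrow> real mat measure" where
  "sphere_law p = distr (uniform_measure (leb_mat p 1) (fball p 1)) (mat_borel p 1) (\<lambda>g. (1 / sqrt (fnorm2 g)) \<cdot>\<^sub>m g)"

lemma sphere_law_simps[simp]: "space (sphere_law p) = carrier_mat p 1"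
  by (simp add: sphere_law_def)

lemma sets_sphere_law[simp, measurable_cong]: "sets (sphere_law p) = sets (mat_borel p 1)"
  by (simp add: sphere_law_def)

lemma prob_space_uniform_fball: "prob_space (uniform_measure (leb_mat n m) (fball n m))"
  by (rule prob_space_uniform_measure) (use emeasure_fball[of n m] in auto)

lemma prob_space_sphere_law: "prob_space (sphere_law p)"
proof -
  interpret prob_space "uniform_measure (leb_mat p 1) (fball p 1)" by (rule prob_space_uniform_fball)
  have "(\<lambda>g. (1 / sqrt (fnorm2 g)) \<cdot>\<^sub>m g) \<in> uniform_measure (leb_mat p 1) (fball p 1) \<rightarrow>\<^sub>M mat_borel p 1" by measurable
  then show ?thesis unfolding sphere_law_def by (rule prob_space_distr)
qed

lemma nn_integral_uniform_fball:
  assumes F[measurable]: "F \<in> borel_measurable (mat_borel n m)"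
  shows "(\<integral>\<^sup>+g. F g \<partial>uniform_measure (leb_mat n m) (fball n m))
    = (\<integral>\<^sup>+g. F g * indicator (fball n m) g \<partial>leb_mat n m) / emeasure (leb_mat n m) (fball n m)"
  by (rule nn_integral_uniform_measure) measurable

lemma nn_integral_sphere_law:
  assumes F[measurable]: "F \<in> borel_measurable (mat_borel p 1)"
  shows "(\<integral>\<^sup>+v. F v \<partial>sphere_law p) = (\<integral>\<^sup>+g. F ((1 / sqrt (fnorm2 g)) \<cdot>\<^sub>m g) \<partial>uniform_measure (leb_mat p 1) (fball p 1))"
  unfolding sphere_law_def by (rule nn_integral_distr) measurable

lemma normalize_left_orth:
  assumes "R \<in> stiefel n n" "g \<in> carrier_mat n m"
  shows "R * ((1 / sqrt (fnorm2 g)) \<cdot>\<^sub>m g) = (1 / sqrt (fnorm2 (R * g))) \<cdot>\<^sub>m (R * g)"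
  using mult_smult_distrib[OF stiefel_carrier[OF assms(1)] assms(2)] fnorm2_stiefel_left[OF assms] by simp

lemma nn_integral_sphere_law_left:
  assumes R: "R \<in> stiefel p p" and F[measurable]: "F \<in> borel_measurable (mat_borel p 1)"
  shows "(\<integral>\<^sup>+v. F (R * v) \<partial>sphere_law p) = (\<integral>\<^sup>+v. F v \<partial>sphere_law p)"
proof -
  note m[measurable] = measurable_left_mult[OF stiefel_carrier[OF R], of 1]
  let ?n = "\<lambda>g. (1 / sqrt (fnorm2 g)) \<cdot>\<^sub>m g" and ?U = "uniform_measure (leb_mat p 1) (fball p 1)"
  have "(\<integral>\<^sup>+g. F (R * ?n g) \<partial>?U) = (\<integral>\<^sup>+g. F (R * ?n g) * indicator (fball p 1) g \<partial>leb_mat p 1) / emeasure (leb_mat p 1) (fball p 1)"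
    by (rule nn_integral_uniform_fball) measurable
  also have "(\<integral>\<^sup>+g. F (R * ?n g) * indicator (fball p 1) g \<partial>leb_mat p 1)
    = (\<integral>\<^sup>+g. F (?n (R * g)) * indicator (fball p 1) (R * g) \<partial>leb_mat p 1)"
  proof (rule nn_integral_cong)
    fix g assume "g \<in> space (leb_mat p 1)"
    then have g: "g \<in> carrier_mat p 1" by simp
    have "R * g \<in> carrier_mat p 1" using mult_carrier_mat[OF stiefel_carrier[OF R] g] .
    then have "R * g \<in> fball p 1 \<longleftrightarrow> g \<in> fball p 1" using g fnorm2_stiefel_left[OF R g] by (simp add: fball_def)
    then show "F (R * ?n g) * indicator (fball p 1) g = F (?n (R * g)) * indicator (fball p 1) (R * g)"
      using normalize_left_orth[OF R g] by (simp split: split_indicator)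
  qed
  also have "\<dots> = (\<integral>\<^sup>+g. F (?n g) * indicator (fball p 1) g \<partial>leb_mat p 1)"
    by (rule nn_integral_leb_mat_left_orth[OF R]) measurable
  also have "\<dots> / emeasure (leb_mat p 1) (fball p 1) = (\<integral>\<^sup>+g. F (?n g) \<partial>?U)"
    by (rule nn_integral_uniform_fball[symmetric]) measurable
  finally have eq: "(\<integral>\<^sup>+g. F (R * ?n g) \<partial>?U) = (\<integral>\<^sup>+g. F (?n g) \<partial>?U)" .
  have mR: "(\<lambda>v. F (R * v)) \<in> borel_measurable (mat_borel p 1)" by measurable
  show ?thesis unfolding nn_integral_sphere_law[OF F] nn_integral_sphere_law[OF mR] by (rule eq)
qed

lemma fnorm2_zero_iff: "A \<in> carrier_mat n m \<Longrightarrow> fnorm2 A = 0 \<longleftrightarrow> A = 0\<^sub>m n m"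
proof
  assume A: "A \<in> carrier_mat n m" and 0: "fnorm2 A = 0"
  have "(A $$ (i,j)) = 0" if "i < n" "j < m" for i j
  proof -
    have "\<forall>i\<in>{..<n}. (\<Sum>j<m. (A $$ (i,j))\<^sup>2) = 0"
      using 0 unfolding fnorm2_eq[OF A] by (subst (asm) sum_nonneg_eq_0_iff) (auto intro!: sum_nonneg)
    then have "(\<Sum>j<m. (A $$ (i,j))\<^sup>2) = 0" using that by auto
    then show ?thesis using that by (subst (asm) sum_nonneg_eq_0_iff) auto
  qed
  then show "A = 0\<^sub>m n m" using A by (intro eq_matI) auto
qed (auto simp: fnorm2_def)

lemma AE_leb_mat_nonzero:
  assumes "0 < n" "0 < m"
  shows "AE A in leb_mat n m. fnorm2 A \<noteq> 0"
proof (rule AE_I)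
  have "(\<Prod>ij\<in>{..<n} \<times> {..<m}. emeasure lborel {0::real}) = 0"
    using assms by (simp add: power_0_left)
  then show "emeasure (leb_mat n m) (mat_box n m (\<lambda>_. {0})) = 0"
    by (subst emeasure_leb_mat_box) auto
  show "{A \<in> space (leb_mat n m). \<not> fnorm2 A \<noteq> 0} \<subseteq> mat_box n m (\<lambda>_. {0})"
    by (auto simp: mat_box_def fnorm2_zero_iff)
qed (auto intro!: mat_box_sets)

lemma fnorm2_smult: "fnorm2 (c \<cdot>\<^sub>m A) = c\<^sup>2 * fnorm2 A"
  by (simp add: fnorm2_def power_mult_distrib sum_distrib_left)

lemma fnorm2_normalize: "fnorm2 g \<noteq> 0 \<Longrightarrow> fnorm2 ((1 / sqrt (fnorm2 g)) \<cdot>\<^sub>m g) = 1"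
  using fnorm2_nonneg[of g] by (simp add: fnorm2_smult power_divide)

lemma AE_uniform_fball:
  assumes "AE A in leb_mat n m. P A"
  shows "AE A in uniform_measure (leb_mat n m) (fball n m). P A"
  by (rule AE_uniform_measureI) (use assms in auto)

lemma AE_sphere_law:
  assumes p: "0 < p"
  shows "AE v in sphere_law p. v \<in> carrier_mat p 1 \<and> fnorm2 v = 1"
proof -
  have "AE g in uniform_measure (leb_mat p 1) (fball p 1). fnorm2 g \<noteq> 0"
    by (rule AE_uniform_fball[OF AE_leb_mat_nonzero]) (use p in auto)
  then have "AE g in uniform_measure (leb_mat p 1) (fball p 1).
     (1 / sqrt (fnorm2 g)) \<cdot>\<^sub>m g \<in> carrier_mat p 1 \<and> fnorm2 ((1 / sqrt (fnorm2 g)) \<cdot>\<^sub>m g) = 1"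
    using AE_space
  proof eventually_elim
    case (elim g)
    then show ?case using fnorm2_normalize[of g] by auto
  qed
  then show ?thesis unfolding sphere_law_def
  proof (subst AE_distr_iff)
    have "{v \<in> space (mat_borel p 1). fnorm2 v = 1} \<in> sets (mat_borel p 1)" by measurable
    then show "{v \<in> space (mat_borel p 1). v \<in> carrier_mat p 1 \<and> fnorm2 v = 1} \<in> sets (mat_borel p 1)" by simp
  qed simp_all
qed

lemma measurable_householder: "householder p \<in> mat_borel p 1 \<rightarrow>\<^sub>M mat_borel p p"
proof (cases "0 < p")
  case True
  define u where "u = (\<lambda>v i. v $$ (i, 0) - (if i = (0::nat) then 1 else (0::real)))"
  have u: "(\<lambda>v. u v i) \<in> borel_measurable (mat_borel p 1)" if "i < p" for i
    unfolding u_def using that by (intro borel_measurable_diff measurable_entry0) auto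
  show ?thesis
  proof (rule measurable_mat_by_entries)
    fix i j assume ij: "i < p" "j < p"
    show "householder p v $$ (i,j) = (if i = j then 1 else 0) - 2 / (\<Sum>l<p. (u v l)\<^sup>2) * u v i * u v j" for v
      using ij by (simp add: householder_def Let_def u_def)
    show "(\<lambda>v. (if i = j then 1 else 0) - 2 / (\<Sum>l<p. (u v l)\<^sup>2) * u v i * u v j) \<in> borel_measurable (mat_borel p 1)"
      using ij by (intro borel_measurable_diff borel_measurable_times borel_measurable_divide
        borel_measurable_sum borel_measurable_power u) auto
  qed simp
next
  case False
  then show ?thesis by (intro measurable_to_mat_borel) auto
qed

lemma measurable_border[measurable (raw)]:
  assumes f: "f \<in> M \<rightarrow>\<^sub>M mat_borel n m"
  shows "(\<lambda>x. border 1 (f x)) \<in> M \<rightarrow>\<^sub>M mat_borel (Suc n) (Suc m)"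
proof (rule measurable_mat_by_entries)
  fix i j assume ij: "i < Suc n" "j < Suc m"
  show "border 1 (f x) $$ (i,j) = (if i = 0 \<and> j = 0 then 1 else if i = 0 \<or> j = 0 then 0 else f x $$ (i - 1, j - 1))"
    if "x \<in> space M" for x
    using ij measurable_mat_carrier[OF f that] by (simp add: border_def)
  show "(\<lambda>x. if i = 0 \<and> j = 0 then 1 else if i = 0 \<or> j = 0 then 0 else f x $$ (i - 1, j - 1)) \<in> borel_measurable M"
    using ij measurable_entry[OF f, of "i - 1" "j - 1"] by (cases i; cases j) auto
qed (use measurable_mat_carrier(1)[OF f] in auto)

lemma mult_index:
  fixes A B :: "real mat"
  assumes "A \<in> carrier_mat n l" "B \<in> carrier_mat l m" "i < n" "j < m"
  shows "(A * B) $$ (i,j) = (\<Sum>r<l. A $$ (i,r) * B $$ (r,j))"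
  using assms by (simp add: scalar_prod_def atLeast0LessThan)

lemma fnorm2_col: "v \<in> carrier_mat n 1 \<Longrightarrow> fnorm2 v = (\<Sum>l<n. (v $$ (l,0))\<^sup>2)"
  by (simp add: fnorm2_eq)

text \<open>For a unit vector \<open>v\<close>, \<open>H(Rv)\<^sup>T R H(v)\<close> fixes the first basis vector.\<close>
lemma householder_equivariant:
  assumes R: "R \<in> stiefel (Suc q) (Suc q)" and v: "v \<in> carrier_mat (Suc q) 1" "fnorm2 v = 1"
  obtains K where "K \<in> stiefel q q" "R * householder (Suc q) v = householder (Suc q) (R * v) * border 1 K"
proof -
  let ?p = "Suc q"
  let ?H = "householder ?p v" and ?G = "householder ?p (R * v)"
  have Rc: "R \<in> carrier_mat ?p ?p" using R by (rule stiefel_carrier)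
  have Rv: "R * v \<in> carrier_mat ?p 1" "fnorm2 (R * v) = 1"
    using mult_carrier_mat[OF Rc v(1)] fnorm2_stiefel_left[OF R v(1)] v by auto
  note v2 = v(2)[unfolded fnorm2_col[OF v(1)]] and Rv2 = Rv(2)[unfolded fnorm2_col[OF Rv(1)]]
  have RH: "R * ?H \<in> carrier_mat ?p ?p" using Rc by (intro mult_carrier_square) auto
  have K: "?G * (R * ?H) \<in> stiefel ?p ?p"
    by (rule stiefel_mult[OF householder_stiefel stiefel_mult[OF R householder_stiefel]])
  have RH0: "(R * ?H) $$ (i,0) = (R * v) $$ (i,0)" if "i < ?p" for i
  proof -
    have "(R * ?H) $$ (i,0) = (\<Sum>l<?p. R $$ (i,l) * ?H $$ (l,0))"
      using Rc that carrier_matD[OF householder_carrier[of ?p v]] by (simp add: scalar_prod_def atLeast0LessThan del: sum.lessThan_Suc)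
    also have "\<dots> = (\<Sum>l<?p. R $$ (i,l) * v $$ (l,0))"
      using householder_col0[OF v(1) v2] by (intro sum.cong) auto
    also have "\<dots> = (R * v) $$ (i,0)"
      using Rc that v(1) by (simp add: scalar_prod_def atLeast0LessThan del: sum.lessThan_Suc)
    finally show ?thesis .
  qed
  have K0: "(?G * (R * ?H)) $$ (i,0) = (if i = 0 then 1 else 0)" if "i < ?p" for i
  proof -
    have "(?G * (R * ?H)) $$ (i,0) = (\<Sum>l<?p. ?G $$ (i,l) * (R * ?H) $$ (l,0))"
      by (rule mult_index[OF householder_carrier RH]) (use that in auto)
    also have "\<dots> = (\<Sum>l<?p. ?G $$ (i,l) * (R * v) $$ (l,0))"
      using RH0 by (intro sum.cong) auto
    also have "\<dots> = (if i = 0 then 1 else 0)"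
      by (rule householder_mult_col0[OF Rv(1) Rv2 that])
    finally show ?thesis .
  qed
  obtain M where M: "M \<in> stiefel q q" "?G * (R * ?H) = border 1 M"
    using stiefel_first_col_border[OF K] K0 by auto
  have "?G * (?G * (R * ?H)) = (?G * ?G) * (R * ?H)"
    using RH by (intro assoc_square[symmetric]) auto
  also have "\<dots> = R * ?H"
    using stiefel_square(2)[OF householder_stiefel, of ?p "R * v"] left_mult_one_mat[OF RH] by (simp add: householder_transpose)
  finally show ?thesis using that[OF M(1)] M(2) by simp
qed

text \<open>A uniform first column \<open>v\<close>, followed by a uniform frame in the orthogonal
  complement of \<open>v\<close>, which the reflection identifies with the complement of the first
  basis vector.\<close>

definition haar_step :: "nat \<Rightarrow> nat \<Rightarrow> real mat measure \<Rightarrow> real mat measure" where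
  "haar_step q k M = distr (sphere_law (Suc q) \<Otimes>\<^sub>M M) (mat_borel (Suc q) (Suc k))
     (\<lambda>(v, V). householder (Suc q) v * border 1 V)"

text \<open>By \<open>householder_equivariant\<close>, a rotation \<open>R\<close> replaces
  \<open>v\<close> by \<open>R * v\<close> and \<open>V\<close> by \<open>K * V\<close>, where
  \<open>K\<close> depends on \<open>v\<close> but not on \<open>V\<close>. For fixed
  \<open>v\<close> the invariance of \<open>M\<close> absorbs \<open>K\<close>; afterwards the
  invariance of the sphere law absorbs \<open>R\<close>.\<close>

lemma is_haar_step:
  assumes M: "is_haar q k M"
  shows "is_haar (Suc q) (Suc k) (haar_step q k M)"
proof -
  let ?p = "Suc q" and ?S = "sphere_law (Suc q)" and ?m = "Suc k"
  note [measurable_cong] = is_haarD(2)[OF M]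
  note mh[measurable] = measurable_compose[OF _ measurable_householder[of ?p]]
  interpret M: prob_space M by (rule is_haarD(1)[OF M])
  interpret S: prob_space ?S by (rule prob_space_sphere_law)
  interpret pair_prob_space ?S M by unfold_locales
  have T[measurable]: "(\<lambda>(v, V). householder ?p v * border 1 V) \<in> ?S \<Otimes>\<^sub>M M \<rightarrow>\<^sub>M mat_borel ?p ?m"
    unfolding case_prod_unfold by (rule measurable_mat_mult[where l="?p"]) measurable
  have int: "(\<integral>\<^sup>+V. F V \<partial>haar_step q k M) = (\<integral>\<^sup>+v. (\<integral>\<^sup>+V. F (householder ?p v * border 1 V) \<partial>M) \<partial>?S)"
    if F[measurable]: "F \<in> borel_measurable (mat_borel ?p ?m)" for F
  proof -
    have "(\<integral>\<^sup>+V. F V \<partial>haar_step q k M) = (\<integral>\<^sup>+x. F ((\<lambda>(v, V). householder ?p v * border 1 V) x) \<partial>(?S \<Otimes>\<^sub>M M))"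
      unfolding haar_step_def by (rule nn_integral_distr) measurable
    also have "\<dots> = (\<integral>\<^sup>+v. (\<integral>\<^sup>+V. F ((\<lambda>(v, V). householder ?p v * border 1 V) (v, V)) \<partial>M) \<partial>?S)"
      by (rule M.nn_integral_fst[symmetric]) measurable
    finally show ?thesis by simp
  qed
  show ?thesis
  proof (rule is_haarI)
    show "prob_space (haar_step q k M)" unfolding haar_step_def by (rule prob_space_distr) measurable
    show "sets (haar_step q k M) = sets (mat_borel ?p ?m)" by (simp add: haar_step_def)
    show "AE V in haar_step q k M. V \<in> stiefel ?p ?m"
      unfolding haar_step_def
    proof (subst AE_distr_iff[OF T])
      show "{V \<in> space (mat_borel ?p ?m). V \<in> stiefel ?p ?m} \<in> sets (mat_borel ?p ?m)"
        using stiefel_sets[of ?p ?m] by (simp add: stiefel_def)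
      have ok: "householder ?p v * border 1 V \<in> stiefel ?p ?m" if "V \<in> stiefel q k" for v V
        using that border_stiefel_iff[OF stiefel_carrier[OF that]] by (intro stiefel_mult[OF householder_stiefel]) auto
      have "AE x in ?S \<Otimes>\<^sub>M M. snd x \<in> stiefel q k"
      proof (rule AE_pair_measure)
        have "{x \<in> space (?S \<Otimes>\<^sub>M M). snd x \<in> stiefel q k} = snd -` stiefel q k \<inter> space (?S \<Otimes>\<^sub>M M)" by auto
        also have "\<dots> \<in> sets (?S \<Otimes>\<^sub>M M)"
          by (rule measurable_sets[OF measurable_snd]) (simp add: is_haarD(2)[OF M] stiefel_sets)
        finally show "{x \<in> space (?S \<Otimes>\<^sub>M M). snd x \<in> stiefel q k} \<in> sets (?S \<Otimes>\<^sub>M M)" .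
        show "AE v in ?S. AE V in M. snd (v, V) \<in> stiefel q k" using is_haarD(4)[OF M] by simp
      qed
      then show "AE x in ?S \<Otimes>\<^sub>M M. (\<lambda>(v, V). householder ?p v * border 1 V) x \<in> stiefel ?p ?m"
        by eventually_elim (auto simp: ok)
    qed
    fix R and F :: "real mat \<Rightarrow> ennreal" assume R: "R \<in> stiefel ?p ?p" and F[measurable]: "F \<in> borel_measurable (mat_borel ?p ?m)"
    have Rc: "R \<in> carrier_mat ?p ?p" using R by (rule stiefel_carrier)
    note mR = measurable_left_mult[OF Rc]
    have G: "(\<lambda>v. \<integral>\<^sup>+V. F (householder ?p v * border 1 V) \<partial>M) \<in> borel_measurable ?S"
      using T by (intro M.borel_measurable_nn_integral) (auto simp: case_prod_unfold intro!: measurable_compose[OF _ F])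
    have "(\<integral>\<^sup>+V. F (R * V) \<partial>haar_step q k M) = (\<integral>\<^sup>+v. (\<integral>\<^sup>+V. F (R * (householder ?p v * border 1 V)) \<partial>M) \<partial>?S)"
      by (rule int) (rule measurable_compose[OF mR F])
    also have "\<dots> = (\<integral>\<^sup>+v. (\<integral>\<^sup>+V. F (householder ?p (R * v) * border 1 V) \<partial>M) \<partial>?S)"
    proof (rule nn_integral_cong_AE)
      show "AE v in ?S. (\<integral>\<^sup>+V. F (R * (householder ?p v * border 1 V)) \<partial>M) = (\<integral>\<^sup>+V. F (householder ?p (R * v) * border 1 V) \<partial>M)"
        using AE_sphere_law[OF zero_less_Suc]
      proof eventually_elim
        case (elim v)
        then have v: "v \<in> carrier_mat ?p 1" "fnorm2 v = 1" by auto
        let ?H = "householder ?p v" and ?G = "householder ?p (R * v)"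
        obtain K where K: "K \<in> stiefel q q" "R * ?H = ?G * border 1 K" using householder_equivariant[OF R v] by blast
        have Kc: "K \<in> carrier_mat q q" using K(1) by (rule stiefel_carrier)
        have "R * (?H * border 1 V) = ?G * border 1 (K * V)" if "V \<in> carrier_mat q k" for V
        proof -
          have b: "border 1 V \<in> carrier_mat ?p ?m" "border 1 K \<in> carrier_mat ?p ?p" using that Kc by auto
          have "R * (?H * border 1 V) = (R * ?H) * border 1 V"
            by (rule assoc_mult_mat[OF Rc householder_carrier b(1), symmetric])
          also have "\<dots> = ?G * (border 1 K * border 1 V)"
            unfolding K(2) by (rule assoc_mult_mat[OF householder_carrier b(2) b(1)])
          also have "border 1 K * border 1 V = border 1 (K * V)" using border_mult[OF Kc that, of 1 1] by simp
          finally show ?thesis .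
        qed
        then have "(\<integral>\<^sup>+V. F (R * (?H * border 1 V)) \<partial>M) = (\<integral>\<^sup>+V. F (?G * border 1 (K * V)) \<partial>M)"
          by (intro nn_integral_cong) (simp add: is_haarD(3)[OF M])
        also have "\<dots> = (\<integral>\<^sup>+V. F (?G * border 1 V) \<partial>M)"
        proof (rule nn_integral_haar_left[OF M K(1)])
          have "(\<lambda>V. ?G * border 1 V) \<in> mat_borel q k \<rightarrow>\<^sub>M mat_borel ?p ?m"
            by (rule measurable_compose[OF _ measurable_left_mult[OF householder_carrier]]) measurable
          then show "(\<lambda>V. F (?G * border 1 V)) \<in> borel_measurable (mat_borel q k)" by (rule measurable_compose[OF _ F])
        qed
        finally show ?case .
      qed
    qed
    also have "\<dots> = (\<integral>\<^sup>+v. (\<integral>\<^sup>+V. F (householder ?p v * border 1 V) \<partial>M) \<partial>?S)"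
      by (rule nn_integral_sphere_law_left[OF R]) (use G in \<open>simp cong: measurable_cong_sets\<close>)
    also have "\<dots> = (\<integral>\<^sup>+V. F V \<partial>haar_step q k M)" by (rule int[symmetric]) measurable
    finally show "(\<integral>\<^sup>+V. F (R * V) \<partial>haar_step q k M) = (\<integral>\<^sup>+V. F V \<partial>haar_step q k M)" .
  qed
qed

lemma is_haar_0: "is_haar p 0 (return (mat_borel p 0) (0\<^sub>m p 0))"
proof (rule is_haarI)
  show "prob_space (return (mat_borel p 0) (0\<^sub>m p 0))" by (rule prob_space_return) simp
  have eq: "V \<in> stiefel p 0 \<longleftrightarrow> V \<in> carrier_mat p 0" for V by (auto simp: stiefel_def intro!: eq_matI)
  show "AE V in return (mat_borel p 0) (0\<^sub>m p 0). V \<in> stiefel p 0"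
    using AE_space[of "return (mat_borel p 0) (0\<^sub>m p 0)"] by (simp add: eq)
  fix R and F :: "real mat \<Rightarrow> ennreal" assume R: "R \<in> stiefel p p" and F: "F \<in> borel_measurable (mat_borel p 0)"
  have "R * V = V" if "V \<in> carrier_mat p 0" for V
    using that stiefel_carrier[OF R] by (intro eq_matI) auto
  then show "(\<integral>\<^sup>+V. F (R * V) \<partial>return (mat_borel p 0) (0\<^sub>m p 0)) = (\<integral>\<^sup>+V. F V \<partial>return (mat_borel p 0) (0\<^sub>m p 0))"
    by (intro nn_integral_cong) simp
qed simp

lemma haar_exists: "k \<le> p \<Longrightarrow> \<exists>M. is_haar p k M"
proof (induction k arbitrary: p)
  case 0
  then show ?case using is_haar_0 by blast
next
  case (Suc k)
  then obtain q where "p = Suc q" "k \<le> q" by (cases p) auto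
  then show ?case using Suc.IH[of q] is_haar_step by blast
qed

text \<open>The right side does not mention \<open>M\<close>, so this yields uniqueness. Averaging
  over \<open>R\<close>, invariance of \<open>M\<close> replaces \<open>V\<close> by
  \<open>R\<^sup>T * V\<close>; writing \<open>V = P * eye p k\<close>, invariance of
  \<open>N\<close> absorbs \<open>P\<close>. The transpose is there because \<open>N\<close> is
  known to be invariant from the left only, and \<open>R\<^sup>T * P\<close> is the transpose of
  \<open>P\<^sup>T * R\<close>.\<close>

lemma nn_integral_haar_eq:
  assumes M: "is_haar p k M" and N: "is_haar p p N" and F[measurable]: "F \<in> borel_measurable (mat_borel p k)"
  shows "(\<integral>\<^sup>+V. F V \<partial>M) = (\<integral>\<^sup>+R. F (R\<^sup>T * eye p k) \<partial>N)"
proof -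
  note [measurable_cong] = is_haarD(2)[OF M] is_haarD(2)[OF N]
  interpret M: prob_space M by (rule is_haarD(1)[OF M])
  interpret N: prob_space N by (rule is_haarD(1)[OF N])
  interpret pair_sigma_finite M N by unfold_locales
  have mm[measurable]: "(\<lambda>x. (snd x)\<^sup>T * fst x) \<in> M \<Otimes>\<^sub>M N \<rightarrow>\<^sub>M mat_borel p k"
    by (rule measurable_mat_mult[where l=p]) measurable
  have "(\<integral>\<^sup>+V. F V \<partial>M) = (\<integral>\<^sup>+R. (\<integral>\<^sup>+V. F V \<partial>M) \<partial>N)" by (simp add: N.emeasure_space_1)
  also have "\<dots> = (\<integral>\<^sup>+R. (\<integral>\<^sup>+V. F (R\<^sup>T * V) \<partial>M) \<partial>N)"
  proof (rule nn_integral_cong_AE)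
    show "AE R in N. (\<integral>\<^sup>+V. F V \<partial>M) = (\<integral>\<^sup>+V. F (R\<^sup>T * V) \<partial>M)"
      using is_haarD(4)[OF N]
    proof eventually_elim
      case (elim R)
      show ?case by (rule nn_integral_haar_left[OF M stiefel_square(4)[OF elim] F, symmetric])
    qed
  qed
  also have "\<dots> = (\<integral>\<^sup>+V. (\<integral>\<^sup>+R. F (R\<^sup>T * V) \<partial>N) \<partial>M)"
    by (rule Fubini') (use measurable_compose[OF mm F] in \<open>simp add: case_prod_unfold\<close>)
  also have "\<dots> = (\<integral>\<^sup>+V. (\<integral>\<^sup>+R. F (R\<^sup>T * eye p k) \<partial>N) \<partial>M)"
  proof (rule nn_integral_cong_AE)
    show "AE V in M. (\<integral>\<^sup>+R. F (R\<^sup>T * V) \<partial>N) = (\<integral>\<^sup>+R. F (R\<^sup>T * eye p k) \<partial>N)"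
      using is_haarD(4)[OF M]
    proof eventually_elim
      case (elim V)
      obtain P where P: "P \<in> stiefel p p" "V = P * eye p k" using stiefel_completion[OF elim] by blast
      note Ps = stiefel_square[OF P(1)]
      have "R\<^sup>T * V = (P\<^sup>T * R)\<^sup>T * eye p k" if "R \<in> carrier_mat p p" for R
      proof -
        have R: "R\<^sup>T \<in> carrier_mat p p" "P\<^sup>T \<in> carrier_mat p p" using that Ps by auto
        have "(P\<^sup>T * R)\<^sup>T = R\<^sup>T * P" using transpose_mult[OF R(2) that] by simp
        then show ?thesis unfolding P(2) using assoc_mult_mat[OF R(1) Ps(1) eye_carrier] by simp
      qed
      then have "(\<integral>\<^sup>+R. F (R\<^sup>T * V) \<partial>N) = (\<integral>\<^sup>+R. F ((P\<^sup>T * R)\<^sup>T * eye p k) \<partial>N)"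
        by (intro nn_integral_cong) (simp add: is_haarD(3)[OF N])
      also have "\<dots> = (\<integral>\<^sup>+R. F (R\<^sup>T * eye p k) \<partial>N)"
      proof (rule nn_integral_haar_left[OF N Ps(4)])
        show "(\<lambda>R. F (R\<^sup>T * eye p k)) \<in> borel_measurable (mat_borel p p)"
        proof (rule measurable_compose[OF _ F])
          show "(\<lambda>R. R\<^sup>T * eye p k) \<in> mat_borel p p \<rightarrow>\<^sub>M mat_borel p k"
            by (rule measurable_compose[OF _ measurable_right_mult[OF eye_carrier]]) measurable
        qed
      qed
      finally show ?case .
    qed
  qed
  also have "\<dots> = (\<integral>\<^sup>+R. F (R\<^sup>T * eye p k) \<partial>N)" by (simp add: M.emeasure_space_1)
  finally show ?thesis .
qed

lemma haar_unique:
  assumes "is_haar p k M" "is_haar p k M'"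
  shows "M = M'"
proof (rule measure_eqI)
  show s: "sets M = sets M'" using assms by (simp add: is_haar_def)
  fix A assume A: "A \<in> sets M"
  then have A': "A \<in> sets (mat_borel p k)" "A \<in> sets M'" using s assms by (auto simp: is_haar_def)
  obtain N where N: "is_haar p p N" using haar_exists[of p p] by auto
  have "(\<integral>\<^sup>+V. indicator A V \<partial>M) = (\<integral>\<^sup>+V. indicator A V \<partial>M')"
    using nn_integral_haar_eq[OF assms(1) N, of "indicator A"] nn_integral_haar_eq[OF assms(2) N, of "indicator A"] A' by simp
  then show "emeasure M A = emeasure M' A" using A A' by simp
qed

lemma is_haar_stiefel_uniform:
  assumes "k \<le> p"
  shows "is_haar p k (stiefel_uniform p k)"
proof -
  obtain M where M: "is_haar p k M" using haar_exists[OF assms] by auto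
  have "stiefel_uniform p k = M"
    unfolding stiefel_uniform_def is_haar_def[symmetric] using M haar_unique by (intro the_equality) auto
  then show ?thesis using M by simp
qed

section \<open>Quadratic forms, inverses and congruence of positive definite matrices\<close>

lemma scalar_prod_self:
  "v \<in> carrier_vec n \<Longrightarrow> scalar_prod v v = (\<Sum>i<n. (vec_index v i)\<^sup>2 :: real)"
  by (simp add: scalar_prod_def atLeast0LessThan power2_eq_square)

lemma scalar_prod_self_pos:
  fixes v :: "real vec"
  assumes v: "v \<in> carrier_vec n" "v \<noteq> 0\<^sub>v n"
  shows "0 < scalar_prod v v"
proof -
  obtain i where "i < n" "vec_index v i \<noteq> 0" using v by (metis eq_vecI carrier_vecD index_zero_vec)
  then show ?thesis unfolding scalar_prod_self[OF v(1)] by (intro sum_pos2[of _ i]) auto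
qed

lemma sym_psdI:
  assumes "A \<in> carrier_mat n n" "A\<^sup>T = A" "\<And>v. v \<in> carrier_vec n \<Longrightarrow> 0 \<le> scalar_prod v (A *\<^sub>v v)"
  shows "sym_psd n A"
  using assms by (auto simp: sym_psd_def)

lemma scalar_prod_gram:
  fixes B :: "real mat"
  assumes B: "B \<in> carrier_mat m n" and v: "v \<in> carrier_vec n"
  shows "scalar_prod v ((B\<^sup>T * B) *\<^sub>v v) = scalar_prod (B *\<^sub>v v) (B *\<^sub>v v)"
proof -
  have "(B\<^sup>T * B) *\<^sub>v v = B\<^sup>T *\<^sub>v (B *\<^sub>v v)" using B v by (intro assoc_mult_mat_vec) auto
  moreover have "scalar_prod v (B\<^sup>T *\<^sub>v (B *\<^sub>v v)) = scalar_prod (B *\<^sub>v v) (B *\<^sub>v v)"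
    using transpose_vec_mult_scalar[of B m n v "B *\<^sub>v v"] B v
      comm_scalar_prod[of v n "B\<^sup>T *\<^sub>v (B *\<^sub>v v)"] by (metis mult_mat_vec_carrier transpose_carrier_mat)
  ultimately show ?thesis by simp
qed

lemma sym_psd_gram:
  fixes B :: "real mat"
  assumes B: "B \<in> carrier_mat m n"
  shows "sym_psd n (B\<^sup>T * B)"
proof (rule sym_psdI)
  show "B\<^sup>T * B \<in> carrier_mat n n" using B by (intro mult_carrier_mat[of _ _ m]) auto
  show "(B\<^sup>T * B)\<^sup>T = B\<^sup>T * B" using B by (subst transpose_mult[of _ n m]) auto
  fix v :: "real vec" assume "v \<in> carrier_vec n"
  then show "0 \<le> scalar_prod v ((B\<^sup>T * B) *\<^sub>v v)"
    using scalar_prod_self[of "B *\<^sub>v v" m] B by (simp only: scalar_prod_gram[OF B]) (auto intro!: sum_nonneg)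
qed

text \<open>The form at \<open>v\<close> is the squared length of \<open>P *\<^sub>v v\<close> for
  the nonsingular root \<open>P\<close>; conversely a kernel vector would make the form
  vanish.\<close>

lemma sym_pd_iff:
  "sym_pd n A \<longleftrightarrow> A \<in> carrier_mat n n \<and> A\<^sup>T = A \<and> (\<forall>v\<in>carrier_vec n. v \<noteq> 0\<^sub>v n \<longrightarrow> 0 < scalar_prod v (A *\<^sub>v v))"
  (is "_ \<longleftrightarrow> ?R")
proof
  assume pd: "sym_pd n A"
  note A = sym_pd_carrier[OF pd]
  define P where "P = psd_sqrt_pos A"
  have P: "sym_pd n P" "P * P = A" using psd_sqrt_pos_pd[OF pd] by (auto simp: P_def)
  note Pc = sym_pd_carrier[OF P(1)]
  have "0 < scalar_prod v (A *\<^sub>v v)" if v: "v \<in> carrier_vec n" "v \<noteq> 0\<^sub>v n" for v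
  proof -
    have "det P \<noteq> 0" using P by (simp add: sym_pd_def)
    then have "P *\<^sub>v v \<noteq> 0\<^sub>v n" using det_0_iff_vec_prod_zero_field[OF Pc(1)] v by auto
    moreover have "P *\<^sub>v v \<in> carrier_vec n" using Pc v by simp
    ultimately have "0 < scalar_prod (P *\<^sub>v v) (P *\<^sub>v v)"
      by (intro scalar_prod_self_pos)
    then show ?thesis using scalar_prod_gram[OF Pc(1) v(1)] by (simp add: Pc(2) P(2))
  qed
  then show ?R using A by auto
next
  assume R: ?R
  have "sym_psd n A"
  proof (rule sym_psdI)
    fix v :: "real vec" assume v: "v \<in> carrier_vec n"
    show "0 \<le> scalar_prod v (A *\<^sub>v v)"
    proof (cases "v = 0\<^sub>v n")
      case True
      have "A *\<^sub>v v \<in> carrier_vec n" using R v by (intro mult_mat_vec_carrier) auto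
      then show ?thesis using True by simp
    next
      case False then show ?thesis using R v by (auto intro: less_imp_le)
    qed
  qed (use R in auto)
  moreover have "det A \<noteq> 0"
  proof
    assume "det A = 0"
    then obtain v where v: "v \<in> carrier_vec n" "v \<noteq> 0\<^sub>v n" "A *\<^sub>v v = 0\<^sub>v n"
      using det_0_iff_vec_prod_zero_field[of A n] R by auto
    then have "0 < scalar_prod v (A *\<^sub>v v)" using R by auto
    then show False using v by simp
  qed
  ultimately show "sym_pd n A" by (simp add: sym_pd_def)
qed

lemma sym_psd_add: 
  assumes "sym_psd n A" "sym_psd n B" shows "sym_psd n (A + B)"
proof (rule sym_psdI)
  have c: "A \<in> carrier_mat n n" "B \<in> carrier_mat n n" using assms by (auto simp: sym_psd_def)
  then show "A + B \<in> carrier_mat n n" by simp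
  show "(A + B)\<^sup>T = A + B" using assms c by (simp add: transpose_add[OF c] sym_psd_def)
  fix v :: "real vec" assume v: "v \<in> carrier_vec n"
  then have "scalar_prod v ((A + B) *\<^sub>v v) = scalar_prod v (A *\<^sub>v v) + scalar_prod v (B *\<^sub>v v)"
    using c by (simp add: add_mult_distrib_mat_vec[OF c v] scalar_prod_add_distrib[of _ n])
  then show "0 \<le> scalar_prod v ((A + B) *\<^sub>v v)" using assms v by (simp add: sym_psd_def)
qed

lemma sym_pd_add:
  assumes "sym_pd n A" "sym_psd n B" shows "sym_pd n (A + B)"
  unfolding sym_pd_iff
proof (intro conjI ballI impI)
  have c: "A \<in> carrier_mat n n" "B \<in> carrier_mat n n" using assms by (auto simp: sym_pd_def sym_psd_def)
  have p: "sym_psd n (A + B)" using assms by (intro sym_psd_add) (auto simp: sym_pd_def)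
  then show "A + B \<in> carrier_mat n n" "(A + B)\<^sup>T = A + B" by (auto simp: sym_psd_def)
  fix v :: "real vec" assume v: "v \<in> carrier_vec n" "v \<noteq> 0\<^sub>v n"
  then have "scalar_prod v ((A + B) *\<^sub>v v) = scalar_prod v (A *\<^sub>v v) + scalar_prod v (B *\<^sub>v v)"
    using c by (simp add: add_mult_distrib_mat_vec[OF c v(1)] scalar_prod_add_distrib[of _ n])
  moreover have "0 < scalar_prod v (A *\<^sub>v v)" using assms(1) v by (auto simp: sym_pd_iff)
  moreover have "0 \<le> scalar_prod v (B *\<^sub>v v)" using assms(2) v by (auto simp: sym_psd_def)
  ultimately show "0 < scalar_prod v ((A + B) *\<^sub>v v)" by linarith
qed

text \<open>The adjugate formula makes the inverse a total function whose entries are quotients of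
  polynomials, hence measurable.\<close>

definition mat_inv :: "real mat \<Rightarrow> real mat" where
  "mat_inv A = (1 / det A) \<cdot>\<^sub>m adj_mat A"

lemma mat_inv:
  assumes "A \<in> carrier_mat n n" "det A \<noteq> 0"
  shows "mat_inv A \<in> carrier_mat n n" "A * mat_inv A = 1\<^sub>m n" "mat_inv A * A = 1\<^sub>m n"
proof -
  note ad = adj_mat[OF assms(1)]
  show "mat_inv A \<in> carrier_mat n n" using ad by (simp add: mat_inv_def)
  have "A * mat_inv A = (1 / det A) \<cdot>\<^sub>m (det A \<cdot>\<^sub>m 1\<^sub>m n)"
    unfolding mat_inv_def using mult_smult_distrib[OF assms(1) ad(1)] ad(2) by simp
  then show "A * mat_inv A = 1\<^sub>m n" using assms by (auto intro!: eq_matI)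
  have "mat_inv A * A = (1 / det A) \<cdot>\<^sub>m (det A \<cdot>\<^sub>m 1\<^sub>m n)"
    unfolding mat_inv_def using mult_smult_assoc_mat[OF ad(1) assms(1)] ad(3) by simp
  then show "mat_inv A * A = 1\<^sub>m n" using assms by (auto intro!: eq_matI)
qed

lemma mat_inv_transpose:
  assumes "A \<in> carrier_mat n n" "det A \<noteq> 0" "A\<^sup>T = A"
  shows "(mat_inv A)\<^sup>T = mat_inv A"
proof -
  note i = mat_inv[OF assms(1,2)]
  have t: "(mat_inv A)\<^sup>T \<in> carrier_mat n n" using i by simp
  have "(mat_inv A)\<^sup>T * A = (A * mat_inv A)\<^sup>T" using transpose_mult[OF assms(1) i(1)] assms by simp
  also have "\<dots> = 1\<^sub>m n" by (simp add: i)
  finally have l: "(mat_inv A)\<^sup>T * A = 1\<^sub>m n" .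
  have "(mat_inv A)\<^sup>T = (mat_inv A)\<^sup>T * (A * mat_inv A)" using i t by simp
  also have "\<dots> = ((mat_inv A)\<^sup>T * A) * mat_inv A" by (rule assoc_square[OF t assms(1) i(1), symmetric])
  finally show ?thesis using l i by simp
qed

lemma measurable_mat_inv:
  assumes f: "f \<in> M \<rightarrow>\<^sub>M mat_borel n n"
  shows "(\<lambda>x. mat_inv (f x)) \<in> M \<rightarrow>\<^sub>M mat_borel n n"
  unfolding mat_inv_def
  by (intro measurable_mat_smult borel_measurable_divide measurable_det[OF f] measurable_adj_mat[OF f]) auto

lemma sym_pd_congruence:
  assumes B: "B \<in> carrier_mat n n" "det B \<noteq> 0" and A: "sym_pd n A"
  shows "sym_pd n (B\<^sup>T * A * B)"
  unfolding sym_pd_iff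
proof (intro conjI ballI impI)
  note Ac = sym_pd_carrier[OF A]
  have BT: "B\<^sup>T \<in> carrier_mat n n" and BTA: "B\<^sup>T * A \<in> carrier_mat n n" and AB: "A * B \<in> carrier_mat n n"
    using B Ac by (auto intro: mult_carrier_square)
  have eq: "B\<^sup>T * A * B = B\<^sup>T * (A * B)" by (rule assoc_square[OF BT Ac(1) B(1)])
  show "B\<^sup>T * A * B \<in> carrier_mat n n" by (rule mult_carrier_square[OF BTA B(1)])
  show "(B\<^sup>T * A * B)\<^sup>T = B\<^sup>T * A * B"
    using transpose_mult[OF BTA B(1)] transpose_mult[OF BT Ac(1)] Ac(2) eq by simp
  fix v :: "real vec" assume v: "v \<in> carrier_vec n" "v \<noteq> 0\<^sub>v n"
  have Bv: "B *\<^sub>v v \<in> carrier_vec n" "B *\<^sub>v v \<noteq> 0\<^sub>v n"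
    using B v det_0_iff_vec_prod_zero_field[OF B(1)] by auto
  have "(B\<^sup>T * A * B) *\<^sub>v v = B\<^sup>T *\<^sub>v (A *\<^sub>v (B *\<^sub>v v))"
    using assoc_mult_mat_vec[OF BTA B(1) v(1)] assoc_mult_mat_vec[OF BT Ac(1) Bv(1)] by simp
  moreover have ABv: "A *\<^sub>v (B *\<^sub>v v) \<in> carrier_vec n" using Ac Bv by simp
  ultimately have "scalar_prod v ((B\<^sup>T * A * B) *\<^sub>v v) = scalar_prod (A *\<^sub>v (B *\<^sub>v v)) (B *\<^sub>v v)"
    using transpose_vec_mult_scalar[OF B(1) v(1) ABv] comm_scalar_prod[OF v(1), of "B\<^sup>T *\<^sub>v (A *\<^sub>v (B *\<^sub>v v))"] BT
    by (metis mult_mat_vec_carrier)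
  also have "\<dots> = scalar_prod (B *\<^sub>v v) (A *\<^sub>v (B *\<^sub>v v))" by (rule comm_scalar_prod[OF ABv Bv(1)])
  finally show "0 < scalar_prod v ((B\<^sup>T * A * B) *\<^sub>v v)" using A Bv by (auto simp: sym_pd_iff)
qed

lemma sym_pd_congruence_iff:
  assumes B: "sym_pd n B" and A: "A \<in> carrier_mat n n"
  shows "sym_pd n (B * A * B) \<longleftrightarrow> sym_pd n A"
proof
  note Bc = sym_pd_carrier[OF B]
  have dB: "det B \<noteq> 0" using B by (simp add: sym_pd_def)
  note i = mat_inv[OF Bc(1) dB] and it = mat_inv_transpose[OF Bc(1) dB Bc(2)]
  {
    assume "sym_pd n A"
    then show "sym_pd n (B * A * B)" using sym_pd_congruence[OF Bc(1) dB, of A] Bc by simp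
  next
    let ?I = "mat_inv B"
    assume pd: "sym_pd n (B * A * B)"
    have "det B * det ?I = 1" using det_mult[OF Bc(1) i(1)] i(2) by simp
    then have dI: "det ?I \<noteq> 0" by auto
    have BA: "B * A \<in> carrier_mat n n" "A * B \<in> carrier_mat n n" using Bc A by (auto intro: mult_carrier_square)
    have "?I * (B * A * B) * ?I = ?I * (B * (A * (B * ?I)))"
      using Bc A i(1) by (simp only: assoc_square[where n=n] mult_carrier_square)
    also have "\<dots> = ?I * (B * A)" using A i by simp
    also have "\<dots> = (?I * B) * A" by (rule assoc_square[OF i(1) Bc(1) A, symmetric])
    also have "\<dots> = A" using i A by simp
    finally show "sym_pd n A" using sym_pd_congruence[OF i(1) dI pd] it by simp
  }
qed

lemma ennreal_divide_mult_cancel: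
  fixes v x :: ennreal
  assumes "v \<noteq> 0" "v \<noteq> \<infinity>"
  shows "x / v * v = x"
proof -
  have "v / v = 1" using assms by (intro ennreal_divide_self) (auto simp: less_top)
  then show ?thesis by (simp add: ennreal_divide_times)
qed

section \<open>Splitting off rows\<close>

definition bot_rows :: "nat \<Rightarrow> nat \<Rightarrow> nat \<Rightarrow> real mat \<Rightarrow> real mat" where
  "bot_rows m n k V = Matrix.mat n k (\<lambda>(i, j). V $$ (m + i, j))"

definition top_rows :: "nat \<Rightarrow> nat \<Rightarrow> real mat \<Rightarrow> real mat" where
  "top_rows m k V = Matrix.mat m k (\<lambda>(i, j). V $$ (i, j))"

lemma bot_rows_carrier[simp]: "bot_rows m n k V \<in> carrier_mat n k"
  by (simp add: bot_rows_def)

lemma top_rows_carrier[simp]: "top_rows m k V \<in> carrier_mat m k"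
  by (simp add: top_rows_def)

lemma measurable_bot_rows: "bot_rows m n k \<in> mat_borel (m + n) k \<rightarrow>\<^sub>M mat_borel n k"
  by (rule measurable_mat_by_entries[where g="\<lambda>i j V. V $$ (m + i, j)"])
     (auto simp: bot_rows_def intro!: measurable_entry0)

lemma measurable_top_rows: "top_rows m k \<in> mat_borel (m + n) k \<rightarrow>\<^sub>M mat_borel m k"
  by (rule measurable_mat_by_entries[where g="\<lambda>i j V. V $$ (i, j)"])
     (auto simp: top_rows_def intro!: measurable_entry0)

lemma append_top_bot:
  assumes "V \<in> carrier_mat (m + n) k"
  shows "top_rows m k V @\<^sub>r bot_rows m n k V = V"
proof (rule eq_matI)
  fix i j assume "i < dim_row V" "j < dim_col V"
  then have ij: "i < m + n" "j < k" using assms by auto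
  show "(top_rows m k V @\<^sub>r bot_rows m n k V) $$ (i,j) = V $$ (i,j)"
    using append_rows_index[OF top_rows_carrier[of m k V] bot_rows_carrier[of m n k V] ij] ij
    by (auto simp: top_rows_def bot_rows_def)
qed (use assms carrier_matD[OF carrier_append_rows[OF top_rows_carrier[of m k V] bot_rows_carrier[of m n k V]]] in auto)

lemma bot_rows_append:
  assumes "A \<in> carrier_mat m k" "B \<in> carrier_mat n k"
  shows "bot_rows m n k (A @\<^sub>r B) = B" "top_rows m k (A @\<^sub>r B) = A"
  using assms append_rows_index[OF assms] by (auto simp: bot_rows_def top_rows_def intro!: eq_matI)

lemma append_rows_mult:
  fixes A B :: "real mat"
  assumes A: "A \<in> carrier_mat m l" and B: "B \<in> carrier_mat n l" and C: "C \<in> carrier_mat l k"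
  shows "(A @\<^sub>r B) * C = (A * C) @\<^sub>r (B * C)"
proof (rule eq_matI)
  have AB: "A @\<^sub>r B \<in> carrier_mat (m + n) l" using A B by auto
  have AC: "A * C \<in> carrier_mat m k" "B * C \<in> carrier_mat n k" using A B C by auto
  then have c: "(A * C) @\<^sub>r (B * C) \<in> carrier_mat (m + n) k" by auto
  show "dim_row ((A @\<^sub>r B) * C) = dim_row ((A * C) @\<^sub>r (B * C))" "dim_col ((A @\<^sub>r B) * C) = dim_col ((A * C) @\<^sub>r (B * C))"
    using carrier_matD[OF c] carrier_matD[OF AB] C by auto
  fix i j assume "i < dim_row ((A * C) @\<^sub>r (B * C))" "j < dim_col ((A * C) @\<^sub>r (B * C))"
  then have ij: "i < m + n" "j < k" using carrier_matD[OF c] by auto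
  have "((A @\<^sub>r B) * C) $$ (i,j) = (\<Sum>r<l. (A @\<^sub>r B) $$ (i,r) * C $$ (r,j))" by (rule mult_index[OF AB C ij])
  also have "\<dots> = (\<Sum>r<l. (if i < m then A $$ (i,r) else B $$ (i - m,r)) * C $$ (r,j))"
    using append_rows_index[OF A B ij(1)] by (intro sum.cong) auto
  also have "\<dots> = ((A * C) @\<^sub>r (B * C)) $$ (i,j)"
    unfolding append_rows_index[OF AC ij] using ij mult_index[OF A C, of i j] mult_index[OF B C, of "i - m" j] by auto
  finally show "((A @\<^sub>r B) * C) $$ (i,j) = ((A * C) @\<^sub>r (B * C)) $$ (i,j)" .
qed

lemma append_rows_gram:
  fixes A B :: "real mat"
  assumes A: "A \<in> carrier_mat m k" and B: "B \<in> carrier_mat n k"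
  shows "(A @\<^sub>r B)\<^sup>T * (A @\<^sub>r B) = A\<^sup>T * A + B\<^sup>T * B"
proof (rule eq_matI)
  have AB: "A @\<^sub>r B \<in> carrier_mat (m + n) k" using A B by auto
  show "dim_row ((A @\<^sub>r B)\<^sup>T * (A @\<^sub>r B)) = dim_row (A\<^sup>T * A + B\<^sup>T * B)" "dim_col ((A @\<^sub>r B)\<^sup>T * (A @\<^sub>r B)) = dim_col (A\<^sup>T * A + B\<^sup>T * B)"
    using carrier_matD[OF AB] B by auto
  fix i j assume "i < dim_row (A\<^sup>T * A + B\<^sup>T * B)" "j < dim_col (A\<^sup>T * A + B\<^sup>T * B)"
  then have ij: "i < k" "j < k" using B by auto
  have gram: "(C\<^sup>T * C) $$ (i,j) = (\<Sum>r<l. C $$ (r,i) * C $$ (r,j))" if "C \<in> carrier_mat l k" for C :: "real mat" and l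
    using mult_index[of "C\<^sup>T" k l C k i j] that ij by auto
  have "((A @\<^sub>r B)\<^sup>T * (A @\<^sub>r B)) $$ (i,j) = (\<Sum>r<m + n. (A @\<^sub>r B) $$ (r,i) * (A @\<^sub>r B) $$ (r,j))"
    by (rule gram[OF AB])
  also have "\<dots> = (\<Sum>r<m + n. if r < m then A $$ (r,i) * A $$ (r,j) else B $$ (r - m,i) * B $$ (r - m,j))"
    using append_rows_index[OF A B _ ij(1)] append_rows_index[OF A B _ ij(2)] by (intro sum.cong) auto
  also have "\<dots> = (\<Sum>r<m. A $$ (r,i) * A $$ (r,j)) + (\<Sum>r<n. B $$ (r,i) * B $$ (r,j))"
    by (induction n) auto
  also have "\<dots> = (A\<^sup>T * A + B\<^sup>T * B) $$ (i,j)"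
    using gram[OF A] gram[OF B] ij A B by simp
  finally show "((A @\<^sub>r B)\<^sup>T * (A @\<^sub>r B)) $$ (i,j) = (A\<^sup>T * A + B\<^sup>T * B) $$ (i,j)" .
qed

lemma block_orth:
  assumes R: "R \<in> stiefel m m"
  obtains Q where "Q \<in> stiefel (m + n) (m + n)"
    "\<And>A B k. A \<in> carrier_mat m k \<Longrightarrow> B \<in> carrier_mat n k \<Longrightarrow> Q * (A @\<^sub>r B) = (R * A) @\<^sub>r B"
proof -
  note Rs = stiefel_square[OF R]
  define Q where "Q = four_block_mat R (0\<^sub>m m n) (0\<^sub>m n m) (1\<^sub>m n)"
  have Qc: "Q \<in> carrier_mat (m + n) (m + n)" using Rs by (simp add: Q_def)
  have "Q\<^sup>T = four_block_mat (R\<^sup>T) (0\<^sub>m m n) (0\<^sub>m n m) (1\<^sub>m n)"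
    unfolding Q_def using Rs by (subst transpose_four_block_mat[of _ m m _ n _ n]) (auto intro!: cong_four_block_mat)
  then have "Q\<^sup>T * Q = four_block_mat (R\<^sup>T * R) (0\<^sub>m m n) (0\<^sub>m n m) (1\<^sub>m n)"
    unfolding Q_def using Rs
    by (simp add: mult_four_block_mat[of "R\<^sup>T" m m "0\<^sub>m m n" n "0\<^sub>m n m" n "1\<^sub>m n" R m "0\<^sub>m m n" n "0\<^sub>m n m" "1\<^sub>m n"])
  then have "Q\<^sup>T * Q = 1\<^sub>m (m + n)" using Rs by simp
  then have Q: "Q \<in> stiefel (m + n) (m + n)" using Qc by (simp add: stiefel_def)
  have "Q * (A @\<^sub>r B) = (R * A) @\<^sub>r B" if A: "A \<in> carrier_mat m k" and B: "B \<in> carrier_mat n k" for A B k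
    unfolding Q_def append_rows_def using Rs A B
    by (simp add: mult_four_block_mat[of R m m "0\<^sub>m m n" n "0\<^sub>m n m" n "1\<^sub>m n" A k "0\<^sub>m m 0" 0 B "0\<^sub>m n 0"])
  then show ?thesis using that Q by blast
qed

text \<open>The Gram matrix that the upper block of a frame must have when its lower block is
  \<open>Z\<close>, see \<open>stiefel_cogram\<close>.\<close>

definition cogram :: "nat \<Rightarrow> real mat \<Rightarrow> real mat" where
  "cogram k Z = 1\<^sub>m k - Z\<^sup>T * Z"

lemma cogram_carrier: "Z \<in> carrier_mat n k \<Longrightarrow> cogram k Z \<in> carrier_mat k k"
  unfolding cogram_def by (intro minus_carrier_mat mult_carrier_mat[of _ k n]) auto

lemma cogram_transpose:
  assumes "Z \<in> carrier_mat n k"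
  shows "(cogram k Z)\<^sup>T = cogram k Z"
proof -
  have g: "Z\<^sup>T * Z \<in> carrier_mat k k" "(Z\<^sup>T * Z)\<^sup>T = Z\<^sup>T * Z"
    using sym_psd_gram[OF assms] by (auto simp: sym_psd_def)
  then show ?thesis unfolding cogram_def by (subst transpose_minus[of _ k k]) auto
qed

lemma measurable_cogram: "cogram k \<in> mat_borel n k \<rightarrow>\<^sub>M mat_borel k k"
  unfolding cogram_def
  by (rule measurable_mat_minus[OF measurable_const_mat measurable_mat_mult[where l=n]]) measurable

definition root_cogram :: "nat \<Rightarrow> real mat \<Rightarrow> real mat" where
  "root_cogram k Z = psd_sqrt_pos (cogram k Z)"

lemma measurable_root_cogram: "root_cogram k \<in> mat_borel n k \<rightarrow>\<^sub>M mat_borel k k"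
  unfolding root_cogram_def
  by (rule measurable_psd_sqrt_pos[OF measurable_cogram]) (auto simp: cogram_transpose)

lemma root_cogram_carrier: "Z \<in> carrier_mat n k \<Longrightarrow> root_cogram k Z \<in> carrier_mat k k"
  unfolding root_cogram_def using psd_sqrt_pos_carrier[OF cogram_carrier cogram_transpose] by blast

lemma pred_cogram_pd: "Measurable.pred (mat_borel n k) (\<lambda>Z. sym_pd k (cogram k Z))"
  by (rule pred_sym_pd[OF measurable_cogram]) (auto simp: cogram_transpose)

lemma cogram_append:
  assumes A: "A \<in> carrier_mat m k" and B: "B \<in> carrier_mat n k"
  shows "cogram k (A @\<^sub>r B) = cogram k B - A\<^sup>T * A" "cogram k (A @\<^sub>r B) = cogram k A - B\<^sup>T * B"
  unfolding cogram_def append_rows_gram[OF A B] using A B by (auto intro!: eq_matI)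

text \<open>Stacking subtracts a Gram matrix, which is positive semidefinite; adding it back
  preserves positive definiteness.\<close>

lemma cogram_append_pd:
  assumes A: "A \<in> carrier_mat m k" and B: "B \<in> carrier_mat n k" and pd: "sym_pd k (cogram k (A @\<^sub>r B))"
  shows "sym_pd k (cogram k A)" "sym_pd k (cogram k B)"
proof -
  note c = cogram_carrier[OF A] cogram_carrier[OF B]
  have g: "A\<^sup>T * A \<in> carrier_mat k k" "B\<^sup>T * B \<in> carrier_mat k k" using A B by auto
  have cancel: "X - Y + Y = X" if "X \<in> carrier_mat k k" "Y \<in> carrier_mat k k" for X Y :: "real mat"
    using that by (auto intro!: eq_matI)
  have "cogram k (A @\<^sub>r B) + A\<^sup>T * A = cogram k B" "cogram k (A @\<^sub>r B) + B\<^sup>T * B = cogram k A"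
    unfolding cogram_append(1)[OF A B] cancel[OF c(2) g(1)]
    by (simp_all only: cogram_append[OF A B, symmetric]) (simp only: cogram_append(2)[OF A B] cancel[OF c(1) g(2)])
  then show "sym_pd k (cogram k A)" "sym_pd k (cogram k B)"
    using sym_pd_add[OF pd sym_psd_gram[OF A]] sym_pd_add[OF pd sym_psd_gram[OF B]] by auto
qed

lemma stiefel_cogram:
  assumes "A \<in> carrier_mat m k" "B \<in> carrier_mat n k" "A @\<^sub>r B \<in> stiefel (m + n) k"
  shows "A\<^sup>T * A = cogram k B"
proof -
  have g: "A\<^sup>T * A \<in> carrier_mat k k" "B\<^sup>T * B \<in> carrier_mat k k" using assms by auto
  have "A\<^sup>T * A + B\<^sup>T * B = 1\<^sub>m k" using assms append_rows_gram[OF assms(1,2)] by (simp add: stiefel_def)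
  then have "\<And>i j. i < k \<Longrightarrow> j < k \<Longrightarrow> (A\<^sup>T * A) $$ (i,j) + (B\<^sup>T * B) $$ (i,j) = (1\<^sub>m k) $$ (i,j)"
    using g by (metis index_add_mat(1) carrier_matD)
  note e = this
  show ?thesis unfolding cogram_def
  proof (rule eq_matI)
    fix i j assume "i < dim_row (1\<^sub>m k - B\<^sup>T * B)" "j < dim_col (1\<^sub>m k - B\<^sup>T * B)"
    then have ij: "i < k" "j < k" using assms by auto
    then have "(1\<^sub>m k - B\<^sup>T * B) $$ (i,j) = (1\<^sub>m k) $$ (i,j) - (B\<^sup>T * B) $$ (i,j)"
      using assms by (intro index_minus_mat(1)) auto
    then show "(A\<^sup>T * A) $$ (i,j) = (1\<^sub>m k - B\<^sup>T * B) $$ (i,j)" using e[OF ij] by linarith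
  qed (use assms in auto)
qed

text \<open>Given its last rows \<open>Y\<close>, the upper part of a uniform frame is \<open>R (1 - Y\<^sup>TY)\<^sup>1\<^sup>/\<^sup>2\<close> with \<open>R\<close> uniform:
  conditioning on an event in \<open>Y\<close> preserves invariance under rotations of the upper part, and
  uniqueness of the invariant law does the rest.\<close>
lemma haar_split:
  assumes M: "is_haar (m + n) k M" and N: "is_haar m k N"
    and pd: "AE V in M. sym_pd k (cogram k (bot_rows m n k V))"
    and F: "F \<in> borel_measurable (mat_borel (m + n) k)"
  shows "(\<integral>\<^sup>+V. F V \<partial>M) = (\<integral>\<^sup>+V. (\<integral>\<^sup>+R. F ((R * root_cogram k (bot_rows m n k V)) @\<^sub>r bot_rows m n k V) \<partial>N) \<partial>M)"
proof -
  note sM[measurable_cong] = is_haarD(2)[OF M] and sN[measurable_cong] = is_haarD(2)[OF N]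
  interpret M: prob_space M by (rule is_haarD(1)[OF M])
  interpret N: prob_space N by (rule is_haarD(1)[OF N])
  let ?b = "bot_rows m n k" and ?t = "top_rows m k"
  note mb[measurable] = measurable_compose[OF _ measurable_bot_rows[of m n k]]
  note mt[measurable] = measurable_compose[OF _ measurable_top_rows[of m k n]]
  note mr[measurable] = measurable_compose[OF _ measurable_root_cogram[of k n]]
  \<comment> \<open>The upper block normalised to a frame. On the almost sure event
    \<open>pd\<close> the root is invertible and \<open>X V\<close> times the root gives the upper
    block back.\<close>
  define X where "X = (\<lambda>V. ?t V * mat_inv (root_cogram k (?b V)))"
  have mX[measurable]: "X \<in> mat_borel (m + n) k \<rightarrow>\<^sub>M mat_borel m k"
    unfolding X_def by (rule measurable_mat_mult[where l=k, OF _ measurable_mat_inv]) measurable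
  have mb0[measurable]: "?b \<in> mat_borel (m + n) k \<rightarrow>\<^sub>M mat_borel n k" by measurable
  let ?L = "distr M (mat_borel n k) ?b" and ?J = "distr M (mat_borel m k \<Otimes>\<^sub>M mat_borel n k) (\<lambda>V. (X V, ?b V))"
  interpret L: prob_space ?L by (rule M.prob_space_distr) measurable
  have good: "AE V in M. V \<in> carrier_mat (m + n) k \<and> X V \<in> stiefel m k \<and> X V * root_cogram k (?b V) = ?t V"
    using is_haarD(4)[OF M] pd
  proof eventually_elim
    case (elim V)
    have Vc: "V \<in> carrier_mat (m + n) k" using elim(1) by (rule stiefel_carrier)
    define P where "P = root_cogram k (?b V)"
    have P: "sym_pd k P" "P * P = cogram k (?b V)" using psd_sqrt_pos_pd[OF elim(2)] by (auto simp: P_def root_cogram_def)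
    note Pc = sym_pd_carrier[OF P(1)]
    have dP: "det P \<noteq> 0" using P by (simp add: sym_pd_def)
    note i = mat_inv[OF Pc(1) dP] and it = mat_inv_transpose[OF Pc(1) dP Pc(2)]
    have XV: "X V = ?t V * mat_inv P" by (simp add: X_def P_def)
    have tt: "(?t V)\<^sup>T * ?t V = P * P"
      using stiefel_cogram[of "?t V" m k "?b V" n] append_top_bot[OF Vc] elim(1) P by simp
    have tT: "(?t V)\<^sup>T \<in> carrier_mat k m" by simp
    have "(X V)\<^sup>T * X V = mat_inv P * (((?t V)\<^sup>T * ?t V) * mat_inv P)"
    proof -
      have "(X V)\<^sup>T = mat_inv P * (?t V)\<^sup>T" unfolding XV using transpose_mult[OF top_rows_carrier i(1)] it by simp
      then have "(X V)\<^sup>T * X V = mat_inv P * (?t V)\<^sup>T * (?t V * mat_inv P)" by (simp add: XV)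
      also have "\<dots> = mat_inv P * ((?t V)\<^sup>T * (?t V * mat_inv P))"
        by (rule assoc_mult_mat[OF i(1) tT mult_carrier_mat[OF top_rows_carrier i(1)]])
      also have "(?t V)\<^sup>T * (?t V * mat_inv P) = ((?t V)\<^sup>T * ?t V) * mat_inv P"
        by (rule assoc_mult_mat[OF tT top_rows_carrier i(1), symmetric])
      finally show ?thesis .
    qed
    also have "\<dots> = (mat_inv P * P) * (P * mat_inv P)"
      unfolding tt using Pc i(1) by (simp only: assoc_square[where n=k] mult_carrier_square)
    also have "\<dots> = 1\<^sub>m k" using i by simp
    finally have "X V \<in> stiefel m k" using mult_carrier_mat[OF top_rows_carrier[of m k V] i(1)] XV by (simp add: stiefel_def)
    moreover have "X V * P = ?t V"
      unfolding XV using assoc_mult_mat[OF top_rows_carrier[of m k V] i(1) Pc(1)] right_mult_one_mat[OF top_rows_carrier[of m k V]] i(3) by simp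
    ultimately show ?case using Vc by (simp add: P_def)
  qed
  \<comment> \<open>The claim is that \<open>X V\<close> and the lower rows are independent and that
    \<open>X V\<close> has law \<open>N\<close>; it is tested on rectangles, conditioning on the
    event \<open>E\<close> that the lower rows lie in \<open>B\<close>.\<close>
  have J: "N \<Otimes>\<^sub>M ?L = ?J"
  proof (rule pair_measure_eqI)
    show "sigma_finite_measure N" "sigma_finite_measure ?L" by unfold_locales
    show "sets (N \<Otimes>\<^sub>M ?L) = sets ?J" using sN by (simp cong: sets_pair_measure_cong)
    fix A B assume A: "A \<in> sets N" and B: "B \<in> sets ?L"
    have A'[measurable]: "A \<in> sets (mat_borel m k)" and B'[measurable]: "B \<in> sets (mat_borel n k)" using A B sN by auto
    define E where "E = ?b -` B \<inter> space M"
    have E[measurable]: "E \<in> sets M" unfolding E_def by measurable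
    have LB: "emeasure ?L B = emeasure M E" unfolding E_def by (rule emeasure_distr) measurable
    have JAB: "emeasure ?J (A \<times> B) = emeasure M (X -` A \<inter> E)"
    proof -
      have "emeasure ?J (A \<times> B) = emeasure M ((\<lambda>V. (X V, ?b V)) -` (A \<times> B) \<inter> space M)"
        by (rule emeasure_distr) measurable
      also have "(\<lambda>V. (X V, ?b V)) -` (A \<times> B) \<inter> space M = X -` A \<inter> E" by (auto simp: E_def)
      finally show ?thesis .
    qed
    show "emeasure N A * emeasure ?L B = emeasure ?J (A \<times> B)"
    proof (cases "emeasure M E = 0")
      case True
      have "emeasure M (X -` A \<inter> E) \<le> emeasure M E" by (intro emeasure_mono) auto
      then show ?thesis using True by (simp add: LB JAB)
    next
      case False
      let ?U = "uniform_measure M E"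
      interpret U: prob_space ?U by (rule prob_space_uniform_measure[OF False]) simp
      have "is_haar m k (distr ?U (mat_borel m k) X)"
      proof (rule is_haarI)
        show "prob_space (distr ?U (mat_borel m k) X)" by (rule U.prob_space_distr) measurable
        have "AE V in ?U. X V \<in> stiefel m k"
          by (rule AE_uniform_measureI) (use good in auto)
        moreover have "{x \<in> space (mat_borel m k). x \<in> stiefel m k} \<in> sets (mat_borel m k)"
          using stiefel_sets[of m k] by (simp add: stiefel_def)
        moreover have "X \<in> ?U \<rightarrow>\<^sub>M mat_borel m k" by measurable
        ultimately show "AE V in distr ?U (mat_borel m k) X. V \<in> stiefel m k"
          by (simp add: AE_distr_iff)
        fix R and G :: "real mat \<Rightarrow> ennreal"
        assume R: "R \<in> stiefel m m" and G[measurable]: "G \<in> borel_measurable (mat_borel m k)"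
        note mR[measurable] = measurable_left_mult[OF stiefel_carrier[OF R], of k]
        obtain Q where Q: "Q \<in> stiefel (m + n) (m + n)"
          "\<And>A B k. A \<in> carrier_mat m k \<Longrightarrow> B \<in> carrier_mat n k \<Longrightarrow> Q * (A @\<^sub>r B) = (R * A) @\<^sub>r B"
          using block_orth[OF R] by blast
        have QV: "X (Q * V) = R * X V" "?b (Q * V) = ?b V" if V: "V \<in> carrier_mat (m + n) k" for V
        proof -
          have Rt: "R * ?t V \<in> carrier_mat m k" using stiefel_carrier[OF R] by (intro mult_carrier_mat) auto
          have eq: "Q * V = (R * ?t V) @\<^sub>r ?b V" using Q(2)[OF top_rows_carrier[of m k V] bot_rows_carrier[of m n k V]] append_top_bot[OF V] by simp
          show b: "?b (Q * V) = ?b V" unfolding eq using bot_rows_append[OF Rt bot_rows_carrier] by simp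
          have t: "?t (Q * V) = R * ?t V" unfolding eq using bot_rows_append[OF Rt bot_rows_carrier] by simp
          have "mat_inv (root_cogram k (?b V)) \<in> carrier_mat k k"
            unfolding mat_inv_def using adj_mat(1)[OF root_cogram_carrier[OF bot_rows_carrier]] by simp
          then show "X (Q * V) = R * X V" unfolding X_def b t
            using assoc_mult_mat[OF stiefel_carrier[OF R] top_rows_carrier] by blast
        qed
        have "(\<integral>\<^sup>+V. G (R * V) \<partial>distr ?U (mat_borel m k) X) = (\<integral>\<^sup>+V. G (R * X V) \<partial>?U)"
          by (rule nn_integral_distr) measurable
        also have "\<dots> = (\<integral>\<^sup>+V. G (R * X V) * indicator E V \<partial>M) / emeasure M E"
          by (rule nn_integral_uniform_measure) measurable
        \<comment> \<open>\<open>Q\<close> acts as \<open>R\<close> on the upper rows and fixes the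
          lower ones, so the integrand is a function of \<open>Q * V\<close>, and the invariance of
          \<open>M\<close> applies.\<close>
        also have "(\<integral>\<^sup>+V. G (R * X V) * indicator E V \<partial>M) = (\<integral>\<^sup>+V. G (X (Q * V)) * indicator B (?b (Q * V)) \<partial>M)"
          by (rule nn_integral_cong) (auto simp: QV is_haarD(3)[OF M] E_def split: split_indicator)
        also have "\<dots> = (\<integral>\<^sup>+V. G (X V) * indicator B (?b V) \<partial>M)"
          by (rule nn_integral_haar_left[OF M Q(1)]) measurable
        also have "\<dots> = (\<integral>\<^sup>+V. G (X V) * indicator E V \<partial>M)"
          by (rule nn_integral_cong) (auto simp: E_def split: split_indicator)
        also have "\<dots> / emeasure M E = (\<integral>\<^sup>+V. G (X V) \<partial>?U)"
          by (rule nn_integral_uniform_measure[symmetric]) measurable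
        also have "\<dots> = (\<integral>\<^sup>+V. G V \<partial>distr ?U (mat_borel m k) X)"
          by (rule nn_integral_distr[symmetric]) measurable
        finally show "(\<integral>\<^sup>+V. G (R * V) \<partial>distr ?U (mat_borel m k) X) = (\<integral>\<^sup>+V. G V \<partial>distr ?U (mat_borel m k) X)" .
      qed simp
      then have NU: "N = distr ?U (mat_borel m k) X" using N haar_unique by blast
      have "emeasure (distr ?U (mat_borel m k) X) A = emeasure ?U (X -` A \<inter> space ?U)"
        by (rule emeasure_distr) measurable
      then have "emeasure N A = emeasure ?U (X -` A \<inter> space M)" using NU by simp
      also have "\<dots> = emeasure M (E \<inter> (X -` A \<inter> space M)) / emeasure M E"
        by (rule emeasure_uniform_measure) measurable
      also have "E \<inter> (X -` A \<inter> space M) = X -` A \<inter> E" by (auto simp: E_def)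
      finally have "emeasure N A * emeasure M E = emeasure M (X -` A \<inter> E)"
        using False ennreal_divide_mult_cancel by simp
      then show ?thesis by (simp add: LB JAB)
    qed
  qed
  interpret pair_sigma_finite N ?L by unfold_locales
  let ?F = "\<lambda>x. F ((fst x * root_cogram k (snd x)) @\<^sub>r snd x)"
  have mF: "?F \<in> borel_measurable (mat_borel m k \<Otimes>\<^sub>M mat_borel n k)"
    by (rule measurable_compose[OF measurable_append_rows[OF measurable_mat_mult[where l=k]] F]) measurable
  have "(\<integral>\<^sup>+V. F V \<partial>M) = (\<integral>\<^sup>+V. ?F (X V, ?b V) \<partial>M)"
  proof (rule nn_integral_cong_AE)
    show "AE V in M. F V = ?F (X V, ?b V)"
      using good by eventually_elim (simp add: append_top_bot)
  qed
  also have "\<dots> = (\<integral>\<^sup>+x. ?F x \<partial>?J)"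
    by (rule nn_integral_distr[symmetric]) (use mF in measurable)
  also have "\<dots> = (\<integral>\<^sup>+y. (\<integral>\<^sup>+R. ?F (R, y) \<partial>N) \<partial>?L)"
    unfolding J[symmetric]
    by (rule nn_integral_snd[symmetric]) (use mF sN in \<open>simp cong: measurable_cong_sets sets_pair_measure_cong\<close>)
  also have "\<dots> = (\<integral>\<^sup>+V. (\<integral>\<^sup>+R. ?F (R, ?b V) \<partial>N) \<partial>M)"
  proof (rule nn_integral_distr)
    have "(\<lambda>x. (snd x, fst x)) \<in> mat_borel n k \<Otimes>\<^sub>M N \<rightarrow>\<^sub>M mat_borel m k \<Otimes>\<^sub>M mat_borel n k" by measurable
    from measurable_compose[OF this mF]
    have "(\<lambda>y. \<integral>\<^sup>+R. ?F (R, y) \<partial>N) \<in> borel_measurable (mat_borel n k)"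
      by (intro N.borel_measurable_nn_integral) (simp add: case_prod_unfold)
    then show "(\<lambda>y. \<integral>\<^sup>+R. ?F (R, y) \<partial>N) \<in> borel_measurable ?L" by simp
  qed measurable
  finally show ?thesis by simp
qed

section \<open>The law of a single row\<close>

lemma nn_integral_uniform_fball_right:
  assumes R: "R \<in> stiefel m m" and F[measurable]: "F \<in> borel_measurable (mat_borel n m)"
  shows "(\<integral>\<^sup>+g. F (g * R) \<partial>uniform_measure (leb_mat n m) (fball n m)) = (\<integral>\<^sup>+g. F g \<partial>uniform_measure (leb_mat n m) (fball n m))"
proof -
  note m[measurable] = measurable_right_mult[OF stiefel_carrier[OF R], of n]
  have mF: "(\<lambda>g. F (g * R)) \<in> borel_measurable (mat_borel n m)" by measurable
  have "(\<integral>\<^sup>+g. F (g * R) * indicator (fball n m) g \<partial>leb_mat n m) = (\<integral>\<^sup>+g. F (g * R) * indicator (fball n m) (g * R) \<partial>leb_mat n m)"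
  proof (rule nn_integral_cong)
    fix g assume "g \<in> space (leb_mat n m)"
    then have g: "g \<in> carrier_mat n m" by simp
    have "g * R \<in> carrier_mat n m" using mult_carrier_mat[OF g stiefel_carrier[OF R]] .
    then have "g * R \<in> fball n m \<longleftrightarrow> g \<in> fball n m" using g fnorm2_stiefel_right[OF R g] by (simp add: fball_def)
    then show "F (g * R) * indicator (fball n m) g = F (g * R) * indicator (fball n m) (g * R)"
      by (simp split: split_indicator)
  qed
  also have "\<dots> = (\<integral>\<^sup>+g. F g * indicator (fball n m) g \<partial>leb_mat n m)"
    by (rule nn_integral_leb_mat_right_orth[OF R]) measurable
  finally show ?thesis unfolding nn_integral_uniform_fball[OF F] nn_integral_uniform_fball[OF mF] by simp
qed

text \<open>Reversal of the order of rows: a Householder reflection has the given unit vector as its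
  first row, whereas the row to be split off is the last one.\<close>

definition flip_mat :: "nat \<Rightarrow> real mat" where
  "flip_mat p = Matrix.mat p p (\<lambda>(i, j). if j = p - 1 - i then 1 else 0)"

lemma flip_mat_carrier[simp]: "flip_mat p \<in> carrier_mat p p" by (simp add: flip_mat_def)

lemma flip_mat_mult_index:
  assumes "A \<in> carrier_mat p k" "i < p" "j < k"
  shows "(flip_mat p * A) $$ (i,j) = A $$ (p - 1 - i, j)"
proof -
  have "(flip_mat p * A) $$ (i,j) = (\<Sum>l<p. flip_mat p $$ (i,l) * A $$ (l,j))"
    by (rule mult_index[OF flip_mat_carrier assms])
  also have "\<dots> = (\<Sum>l<p. if l = p - 1 - i then A $$ (p - 1 - i, j) else 0)"
    using assms by (intro sum.cong) (auto simp: flip_mat_def)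
  finally show ?thesis using assms by simp
qed

lemma flip_mat_stiefel: "flip_mat p \<in> stiefel p p"
proof -
  have "flip_mat p * flip_mat p = 1\<^sub>m p"
    by (rule eq_matI) (auto simp: flip_mat_mult_index[OF flip_mat_carrier] simp del: index_mult_mat(1), auto simp: flip_mat_def)
  moreover have "(flip_mat p)\<^sup>T = flip_mat p" by (rule eq_matI) (auto simp: flip_mat_def)
  ultimately show ?thesis by (simp add: stiefel_def)
qed

text \<open>Rotating by an orthogonal matrix whose last row is \<open>\<omega>\<close> turns the last row of \<open>V\<close> into \<open>\<omega> V\<close>;
  averaging over uniform \<open>\<omega>\<close> and using invariance in \<open>\<omega>\<close> replaces \<open>V\<close> by a fixed frame.\<close>
lemma haar_last_row:
  assumes M: "is_haar (Suc q) k M" and F[measurable]: "F \<in> borel_measurable (mat_borel 1 k)"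
  shows "(\<integral>\<^sup>+V. F (bot_rows q 1 k V) \<partial>M) =
    (\<integral>\<^sup>+g. F ((1 / sqrt (fnorm2 g)) \<cdot>\<^sub>m (g * eye (Suc q) k)) \<partial>uniform_measure (leb_mat 1 (Suc q)) (fball 1 (Suc q)))"
proof -
  let ?p = "Suc q" and ?U = "uniform_measure (leb_mat 1 (Suc q)) (fball 1 (Suc q))"
  note sM[measurable_cong] = is_haarD(2)[OF M]
  interpret M: prob_space M by (rule is_haarD(1)[OF M])
  interpret U: prob_space ?U by (rule prob_space_uniform_fball)
  interpret pair_sigma_finite M ?U by unfold_locales
  have mb: "(\<lambda>V. F (bot_rows q 1 k V)) \<in> borel_measurable (mat_borel ?p k)"
    using measurable_compose[OF measurable_bot_rows[of q 1 k] F] by simp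
  have mj: "(\<lambda>x. (1 / sqrt (fnorm2 (snd x))) \<cdot>\<^sub>m (snd x * fst x)) \<in> M \<Otimes>\<^sub>M ?U \<rightarrow>\<^sub>M mat_borel 1 k"
    by (rule measurable_mat_smult[OF _ measurable_mat_mult[where l="?p"]]) measurable
  have "(\<integral>\<^sup>+V. F (bot_rows q 1 k V) \<partial>M) = (\<integral>\<^sup>+g. (\<integral>\<^sup>+V. F (bot_rows q 1 k V) \<partial>M) \<partial>?U)"
    by (subst nn_integral_const) (simp only: U.emeasure_space_1 mult_1_right)
  also have "\<dots> = (\<integral>\<^sup>+g. (\<integral>\<^sup>+V. F ((1 / sqrt (fnorm2 g)) \<cdot>\<^sub>m (g * V)) \<partial>M) \<partial>?U)"
  proof (rule nn_integral_cong_AE)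
    have "AE g in ?U. fnorm2 g \<noteq> 0" by (rule AE_uniform_fball[OF AE_leb_mat_nonzero]) auto
    then show "AE g in ?U. (\<integral>\<^sup>+V. F (bot_rows q 1 k V) \<partial>M) = (\<integral>\<^sup>+V. F ((1 / sqrt (fnorm2 g)) \<cdot>\<^sub>m (g * V)) \<partial>M)"
      using AE_space
    proof eventually_elim
      case (elim g)
      then have g: "g \<in> carrier_mat 1 ?p" "fnorm2 g \<noteq> 0" by auto
      define w where "w = (1 / sqrt (fnorm2 g)) \<cdot>\<^sub>m g"
      have w: "w \<in> carrier_mat 1 ?p" using g by (simp add: w_def)
      have v: "w\<^sup>T \<in> carrier_mat ?p 1" "fnorm2 (w\<^sup>T) = 1"
        using w fnorm2_normalize[OF g(2)] by (auto simp: fnorm2_transpose w_def)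
      note v2 = v(2)[unfolded fnorm2_col[OF v(1)]]
      let ?H = "householder ?p (w\<^sup>T)"
      \<comment> \<open>The symmetric reflection has \<open>w\<close> as its row 0, so the last row
        of \<open>R\<close> is \<open>w\<close>.\<close>
      define R where "R = flip_mat ?p * ?H"
      have R: "R \<in> stiefel ?p ?p" unfolding R_def by (rule stiefel_mult[OF flip_mat_stiefel householder_stiefel])
      have bR: "bot_rows q 1 k (R * V) = (1 / sqrt (fnorm2 g)) \<cdot>\<^sub>m (g * V)" if V: "V \<in> carrier_mat ?p k" for V
      proof -
        have HV: "?H * V \<in> carrier_mat ?p k" using V by (rule mult_carrier_mat[OF householder_carrier])
        have "(1 / sqrt (fnorm2 g)) \<cdot>\<^sub>m (g * V) = w * V"
          unfolding w_def using mult_smult_assoc_mat[OF g(1) V] by simp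
        moreover have "bot_rows q 1 k (R * V) = w * V"
        proof (rule eq_matI)
          fix i j assume "i < dim_row (w * V)" "j < dim_col (w * V)"
          then have ij: "i = 0" "j < k" using w V by auto
          have "R * V = flip_mat ?p * (?H * V)" unfolding R_def by (rule assoc_mult_mat[OF flip_mat_carrier householder_carrier V])
          then have "bot_rows q 1 k (R * V) $$ (i,j) = (?H * V) $$ (0,j)"
            using ij flip_mat_mult_index[OF HV, of q j] by (simp add: bot_rows_def)
          also have "\<dots> = (\<Sum>l<?p. ?H $$ (0,l) * V $$ (l,j))"
            by (rule mult_index[OF householder_carrier V]) (use ij in auto)
          also have "\<dots> = (\<Sum>l<?p. w $$ (0,l) * V $$ (l,j))"
          proof (rule sum.cong[OF refl])
            fix l assume "l \<in> {..<?p}"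
            then have l: "l < ?p" by simp
            have "?H $$ (0,l) = ?H\<^sup>T $$ (l,0)" using l carrier_matD[OF householder_carrier[of ?p "w\<^sup>T"]] by simp
            also have "\<dots> = w\<^sup>T $$ (l,0)" unfolding householder_transpose by (rule householder_col0[OF v(1) v2 l])
            also have "\<dots> = w $$ (0,l)" using w l by simp
            finally show "?H $$ (0,l) * V $$ (l,j) = w $$ (0,l) * V $$ (l,j)" by simp
          qed
          also have "\<dots> = (w * V) $$ (i,j)" using mult_index[OF w V, of i j] ij by simp
          finally show "bot_rows q 1 k (R * V) $$ (i,j) = (w * V) $$ (i,j)" .
        qed (use w V in \<open>auto simp: bot_rows_def\<close>)
        ultimately show ?thesis by simp
      qed
      have "(\<integral>\<^sup>+V. F (bot_rows q 1 k V) \<partial>M) = (\<integral>\<^sup>+V. F (bot_rows q 1 k (R * V)) \<partial>M)"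
        by (rule nn_integral_haar_left[OF M R mb, symmetric])
      also have "\<dots> = (\<integral>\<^sup>+V. F ((1 / sqrt (fnorm2 g)) \<cdot>\<^sub>m (g * V)) \<partial>M)"
        by (intro nn_integral_cong) (simp only: bR is_haarD(3)[OF M])
      finally show ?case .
    qed
  qed
  also have "\<dots> = (\<integral>\<^sup>+V. (\<integral>\<^sup>+g. F ((1 / sqrt (fnorm2 g)) \<cdot>\<^sub>m (g * V)) \<partial>?U) \<partial>M)"
    by (rule Fubini') (use measurable_compose[OF mj F] in \<open>simp add: case_prod_unfold\<close>)
  also have "\<dots> = (\<integral>\<^sup>+V. (\<integral>\<^sup>+g. F ((1 / sqrt (fnorm2 g)) \<cdot>\<^sub>m (g * eye ?p k)) \<partial>?U) \<partial>M)"
  proof (rule nn_integral_cong_AE)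
    show "AE V in M. (\<integral>\<^sup>+g. F ((1 / sqrt (fnorm2 g)) \<cdot>\<^sub>m (g * V)) \<partial>?U) = (\<integral>\<^sup>+g. F ((1 / sqrt (fnorm2 g)) \<cdot>\<^sub>m (g * eye ?p k)) \<partial>?U)"
      using is_haarD(4)[OF M]
    proof eventually_elim
      case (elim V)
      obtain P where P: "P \<in> stiefel ?p ?p" "V = P * eye ?p k" using stiefel_completion[OF elim] by blast
      have mE[measurable]: "(\<lambda>g. g * eye ?p k) \<in> mat_borel 1 ?p \<rightarrow>\<^sub>M mat_borel 1 k"
        by (rule measurable_right_mult[OF eye_carrier])
      have "(\<integral>\<^sup>+g. F ((1 / sqrt (fnorm2 g)) \<cdot>\<^sub>m (g * V)) \<partial>?U)
        = (\<integral>\<^sup>+g. F ((1 / sqrt (fnorm2 (g * P))) \<cdot>\<^sub>m (g * P * eye ?p k)) \<partial>?U)"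
      proof (rule nn_integral_cong)
        fix g assume "g \<in> space ?U"
        then have g: "g \<in> carrier_mat 1 ?p" by simp
        show "F ((1 / sqrt (fnorm2 g)) \<cdot>\<^sub>m (g * V)) = F ((1 / sqrt (fnorm2 (g * P))) \<cdot>\<^sub>m (g * P * eye ?p k))"
          using assoc_mult_mat[OF g stiefel_carrier[OF P(1)] eye_carrier[of ?p k]] fnorm2_stiefel_right[OF P(1) g] P(2) by simp
      qed
      also have "\<dots> = (\<integral>\<^sup>+g. F ((1 / sqrt (fnorm2 g)) \<cdot>\<^sub>m (g * eye ?p k)) \<partial>?U)"
        by (rule nn_integral_uniform_fball_right[OF P(1)]) measurable
      finally show ?case .
    qed
  qed
  also have "\<dots> = (\<integral>\<^sup>+g. F ((1 / sqrt (fnorm2 g)) \<cdot>\<^sub>m (g * eye ?p k)) \<partial>?U)" by (simp add: M.emeasure_space_1)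
  finally show ?thesis .
qed

lemma emeasure_leb_mat_norm_le:
  assumes t: "0 < t"
  shows "emeasure (leb_mat m 1) {b \<in> carrier_mat m 1. fnorm2 b \<le> t} = ennreal (t powr (m / 2)) * emeasure (leb_mat m 1) (fball m 1)"
proof -
  define c where "c = (\<lambda>ij::nat\<times>nat. sqrt t)"
  have c: "c ij \<noteq> 0" for ij using t by (simp add: c_def)
  let ?S = "{b \<in> carrier_mat m 1. fnorm2 b \<le> t}"
  have "{b \<in> space (mat_borel m 1). fnorm2 b \<le> t} \<in> sets (mat_borel m 1)" by measurable
  then have S: "?S \<in> sets (mat_borel m 1)" by simp
  have "(\<Prod>ij\<in>{..<m} \<times> {..<1::nat}. \<bar>c ij\<bar>) = sqrt t ^ m" using t by (simp add: c_def)
  also have "\<dots> = t powr (m / 2)" using t by (simp add: powr_half_sqrt[symmetric] powr_realpow[symmetric] powr_powr mult.commute)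
  finally have 1: "(\<Prod>ij\<in>{..<m} \<times> {..<1::nat}. \<bar>c ij\<bar>) = t powr (m / 2)" .
  have "ennreal (t powr (m / 2)) * (\<integral>\<^sup>+A. indicator ?S (Matrix.mat m 1 (\<lambda>ij. c ij * A $$ ij)) \<partial>leb_mat m 1)
    = (\<integral>\<^sup>+A. indicator ?S A \<partial>leb_mat m 1)"
    unfolding 1[symmetric] by (rule nn_integral_leb_mat_scale[OF c]) (use S in simp)
  also have "(\<integral>\<^sup>+A. indicator ?S (Matrix.mat m 1 (\<lambda>ij. c ij * A $$ ij)) \<partial>leb_mat m 1) = (\<integral>\<^sup>+A. indicator (fball m 1) A \<partial>leb_mat m 1)"
  proof (rule nn_integral_cong)
    fix A assume "A \<in> space (leb_mat m 1)"
    then have A: "A \<in> carrier_mat m 1" by simp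
    have "Matrix.mat m 1 (\<lambda>ij. c ij * A $$ ij) = sqrt t \<cdot>\<^sub>m A" using A by (intro eq_matI) (auto simp: c_def)
    then have "Matrix.mat m 1 (\<lambda>ij. c ij * A $$ ij) \<in> ?S \<longleftrightarrow> A \<in> fball m 1"
      using A t by (simp add: fball_def fnorm2_smult)
    then show "(indicator ?S (Matrix.mat m 1 (\<lambda>ij. c ij * A $$ ij)) :: ennreal) = indicator (fball m 1) A"
      by (simp split: split_indicator)
  qed
  finally show ?thesis using S fball_sets[of m 1] by simp
qed

text \<open>Integration of radial functions in the variable s, the squared norm. Scaling gives the
  volume v s^(m/2) of a ball, with v the volume of the unit ball; its derivative is the density,
  which explains the constant v m / 2. Two measures on the line with equal finite values on
  half-lines agree.\<close>

lemma nn_integral_leb_mat_radial: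
  assumes m: "0 < m"
  obtains C :: real where "0 < C"
    "\<And>\<psi>. \<psi> \<in> borel_measurable borel \<Longrightarrow>
      (\<integral>\<^sup>+b. \<psi> (fnorm2 b) \<partial>leb_mat m 1) = (\<integral>\<^sup>+s. \<psi> s * ennreal (C * (if 0 < s then s powr (m / 2 - 1) else 0)) \<partial>lborel)"
proof -
  define v where "v = measure (leb_mat m 1) (fball m 1)"
  have ev: "emeasure (leb_mat m 1) (fball m 1) = ennreal v"
    using emeasure_fball(2)[of m 1] by (simp add: v_def emeasure_eq_ennreal_measure less_top[symmetric])
  then have v: "0 < v" using emeasure_fball(1)[of m 1] by simp
  define C where "C = v * m / 2"
  have C: "0 < C" using v m by (simp add: C_def)
  define f where "f = (\<lambda>s::real. C * (if 0 < s then s powr (m / 2 - 1) else 0))"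
  have f[measurable]: "f \<in> borel_measurable borel" unfolding f_def by measurable
  have f0: "0 \<le> f s" for s using C by (simp add: f_def)
  let ?\<mu> = "distr (leb_mat m 1) borel fnorm2" and ?\<nu> = "density lborel (\<lambda>s. ennreal (f s))"
  have mn[measurable]: "fnorm2 \<in> leb_mat m 1 \<rightarrow>\<^sub>M borel" by measurable
  have le: "emeasure ?\<mu> {..t} = ennreal (if 0 < t then v * t powr (m / 2) else 0)" for t :: real
  proof -
    have "emeasure ?\<mu> {..t} = emeasure (leb_mat m 1) (fnorm2 -` {..t} \<inter> space (leb_mat m 1))"
      by (rule emeasure_distr) measurable
    also have "fnorm2 -` {..t} \<inter> space (leb_mat m 1) = {b \<in> carrier_mat m 1. fnorm2 b \<le> t}" by auto
    also have "emeasure (leb_mat m 1) \<dots> = ennreal (if 0 < t then v * t powr (m / 2) else 0)"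
    proof (cases "0 < t")
      case True
      then show ?thesis unfolding emeasure_leb_mat_norm_le[OF True] ev using v
        by (simp add: ennreal_mult[symmetric] mult.commute)
    next
      case False
      have "emeasure (leb_mat m 1) {b \<in> space (leb_mat m 1). fnorm2 b \<le> t} = 0"
      proof (rule emeasure_eq_0_AE)
        have "AE b in leb_mat m 1. fnorm2 b \<noteq> 0" by (rule AE_leb_mat_nonzero) (use m in auto)
        then show "AE b in leb_mat m 1. \<not> fnorm2 b \<le> t"
        proof eventually_elim
          case (elim b)
          then show ?case using False fnorm2_nonneg[of b] by linarith
        qed
      qed
      then show ?thesis using False by simp
    qed
    finally show ?thesis .
  qed
  have le': "emeasure ?\<nu> {..t} = ennreal (if 0 < t then v * t powr (m / 2) else 0)" for t :: real
  proof -
    have "emeasure ?\<nu> {..t} = (\<integral>\<^sup>+s. ennreal (f s) * indicator {..t} s \<partial>lborel)"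
      by (rule emeasure_density) auto
    also have "\<dots> = ennreal (if 0 < t then v * t powr (m / 2) else 0)"
    proof (cases "0 < t")
      case True
      have "((\<lambda>s. s powr (m / 2 - 1)) has_integral (t powr (m / 2 - 1 + 1) / (m / 2 - 1 + 1))) {0..t}"
        using m True by (intro has_integral_powr_from_0) auto
      then have "((\<lambda>s. C * s powr (m / 2 - 1)) has_integral (C * (t powr (m / 2 - 1 + 1) / (m / 2 - 1 + 1)))) {0..t}"
        by (rule has_integral_mult_right)
      also have "C * (t powr (m / 2 - 1 + 1) / (m / 2 - 1 + 1)) = v * t powr (m / 2)" using m by (simp add: C_def)
      finally have I: "((\<lambda>s. C * s powr (m / 2 - 1)) has_integral (v * t powr (m / 2))) {0..t}" .
      have "(\<integral>\<^sup>+s. ennreal (f s) * indicator {..t} s \<partial>lborel) = (\<integral>\<^sup>+s. ennreal (C * s powr (m / 2 - 1)) * indicator {0..t} s \<partial>lborel)"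
        by (rule nn_integral_cong) (auto simp: f_def split: split_indicator)
      also have "\<dots> = ennreal (v * t powr (m / 2))"
        by (rule nn_integral_has_integral_lebesgue'[OF _ I]) (use C in auto)
      finally show ?thesis using True by simp
    next
      case False
      then have "(\<integral>\<^sup>+s. ennreal (f s) * indicator {..t} s \<partial>lborel) = (\<integral>\<^sup>+s. 0 \<partial>(lborel :: real measure))"
        by (intro nn_integral_cong) (auto simp: f_def split: split_indicator)
      then show ?thesis using False by simp
    qed
    finally show ?thesis .
  qed
  have "?\<mu> = ?\<nu>"
  proof (rule measure_eqI_generator_eq[where E="range atMost" and A="\<lambda>n::nat. {..real n}" and \<Omega>=UNIV])
    show "Int_stable (range (atMost :: real \<Rightarrow> _))" by (auto simp: Int_stable_def)
    show "sets ?\<mu> = sigma_sets UNIV (range atMost)" "sets ?\<nu> = sigma_sets UNIV (range atMost)"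
      by (simp_all add: borel_eq_atMost)
    show "emeasure ?\<mu> X = emeasure ?\<nu> X" if "X \<in> range atMost" for X using that le le' by auto
    show "(\<Union>n::nat. {..real n}) = UNIV" using real_arch_simple by auto
    show "emeasure ?\<mu> {..real n} \<noteq> \<infinity>" for n :: nat using le by simp
  qed auto
  note eq = this
  show ?thesis
  proof (rule that[OF C])
    fix \<psi> :: "real \<Rightarrow> ennreal" assume \<psi>[measurable]: "\<psi> \<in> borel_measurable borel"
    have "(\<integral>\<^sup>+b. \<psi> (fnorm2 b) \<partial>leb_mat m 1) = (\<integral>\<^sup>+s. \<psi> s \<partial>?\<mu>)" by (rule nn_integral_distr[symmetric]) measurable
    also have "\<dots> = (\<integral>\<^sup>+s. ennreal (f s) * \<psi> s \<partial>lborel)" unfolding eq by (rule nn_integral_density) auto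
    finally show "(\<integral>\<^sup>+b. \<psi> (fnorm2 b) \<partial>leb_mat m 1) = (\<integral>\<^sup>+s. \<psi> s * ennreal (C * (if 0 < s then s powr (m / 2 - 1) else 0)) \<partial>lborel)"
      by (simp add: f_def mult.commute)
  qed
qed

lemma fnorm2_append:
  assumes "A \<in> carrier_mat n k" "B \<in> carrier_mat m k"
  shows "fnorm2 (A @\<^sub>r B) = fnorm2 A + fnorm2 B"
proof -
  have c: "A @\<^sub>r B \<in> carrier_mat (n + m) k" using assms by auto
  have "fnorm2 (A @\<^sub>r B) = (\<Sum>i<n + m. \<Sum>j<k. ((A @\<^sub>r B) $$ (i,j))\<^sup>2)" by (rule fnorm2_eq[OF c])
  also have "\<dots> = (\<Sum>i<n + m. if i < n then \<Sum>j<k. (A $$ (i,j))\<^sup>2 else \<Sum>j<k. (B $$ (i - n,j))\<^sup>2)"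
    using append_rows_index[OF assms] by (intro sum.cong refl) auto
  also have "\<dots> = (\<Sum>i<n. \<Sum>j<k. (A $$ (i,j))\<^sup>2) + (\<Sum>i<m. \<Sum>j<k. (B $$ (i,j))\<^sup>2)"
    by (induction m) auto
  finally show ?thesis using fnorm2_eq[OF assms(1)] fnorm2_eq[OF assms(2)] by simp
qed

text \<open>The unnormalised density of \<open>k\<close> coordinates of a uniform unit vector in
  dimension \<open>k + m\<close>, where \<open>k\<close> is the length of the row.\<close>

definition row_density :: "nat \<Rightarrow> real mat \<Rightarrow> real" where
  "row_density m y = (if fnorm2 y < 1 then (1 - fnorm2 y) powr (m / 2 - 1) else 0)"

lemma measurable_row_density[measurable]: "row_density m \<in> borel_measurable (mat_borel n k)"
  unfolding row_density_def by measurable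

text \<open>By \<open>haar_last_row\<close> the row consists of \<open>k\<close> coordinates
  \<open>a\<close> of a point of the ball, divided by its norm. The other coordinates enter through
  their squared norm only. With the total squared norm \<open>w\<close> as variable and the
  substitution of sqrt w y for \<open>a\<close>, the integrand factors into a function of
  \<open>w\<close> and the row density at \<open>y\<close>.\<close>

lemma haar_row_law:
  assumes M: "is_haar (k + Suc n) k M"
  obtains c :: real where "0 < c"
    "\<And>F. F \<in> borel_measurable (mat_borel 1 k) \<Longrightarrow>
      (\<integral>\<^sup>+V. F (bot_rows (k + n) 1 k V) \<partial>M) = ennreal c * (\<integral>\<^sup>+y. F y * ennreal (row_density (Suc n) y) \<partial>leb_mat 1 k)"
    "(\<integral>\<^sup>+y. ennreal (row_density (Suc n) y) \<partial>leb_mat 1 k) < \<infinity>"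
proof -
  let ?m = "Suc n" and ?p = "k + Suc n"
  interpret M: prob_space M by (rule is_haarD(1)[OF M])
  obtain C where C: "0 < C" and rad: "\<And>\<psi>. \<psi> \<in> borel_measurable borel \<Longrightarrow>
      (\<integral>\<^sup>+b. \<psi> (fnorm2 b) \<partial>leb_mat ?m 1) = (\<integral>\<^sup>+s. \<psi> s * ennreal (C * (if 0 < s then s powr (?m / 2 - 1) else 0)) \<partial>lborel)"
    using nn_integral_leb_mat_radial[of ?m] by auto
  define vol where "vol = emeasure (leb_mat 1 ?p) (fball 1 ?p)"
  have vol: "vol \<noteq> 0" "vol \<noteq> \<infinity>" using emeasure_fball[of 1 ?p] by (auto simp: vol_def)
  define f where "f = (\<lambda>s::real. C * (if 0 < s then s powr (?m / 2 - 1) else 0))"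
  have f[measurable]: "f \<in> borel_measurable borel" unfolding f_def by measurable
  have f0: "0 \<le> f s" for s using C by (simp add: f_def)
  \<comment> \<open>The factor in \<open>w\<close> that separates off; sqrt w ^ k is the Jacobian of
    the rescaling of \<open>a\<close>.\<close>
  define D where "D = (\<integral>\<^sup>+w. ennreal (sqrt w ^ k) * ennreal (f w) * indicator {0<..1} w \<partial>lborel)"
  interpret sfk: sigma_finite_measure "leb_mat 1 k" by (rule sigma_finite_leb_mat)
  interpret MLeb: pair_sigma_finite "leb_mat 1 k" lborel
    by (simp add: pair_sigma_finite_def sigma_finite_leb_mat sigma_finite_lborel)
  have main: "(\<integral>\<^sup>+V. F (bot_rows (k + n) 1 k V) \<partial>M) * vol = D * (\<integral>\<^sup>+y. F y * ennreal (row_density ?m y) \<partial>leb_mat 1 k)"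
    if F[measurable]: "F \<in> borel_measurable (mat_borel 1 k)" for F
  proof -
    define G where "G = (\<lambda>g. F ((1 / sqrt (fnorm2 g)) \<cdot>\<^sub>m (g * eye ?p k)) * indicator (fball 1 ?p) g)"
    have mE[measurable]: "(\<lambda>g. g * eye ?p k) \<in> mat_borel 1 ?p \<rightarrow>\<^sub>M mat_borel 1 k"
      by (rule measurable_right_mult[OF eye_carrier])
    have G[measurable]: "G \<in> borel_measurable (mat_borel 1 ?p)" unfolding G_def by measurable
    have GT[measurable]: "(\<lambda>A. G (A\<^sup>T)) \<in> borel_measurable (mat_borel ?p 1)" by measurable
    define K where "K = (\<lambda>(a, w). F ((1 / sqrt w) \<cdot>\<^sub>m a) * indicator {..1} w * ennreal (f (w - fnorm2 a)))"
    have K[measurable]: "K \<in> borel_measurable (mat_borel 1 k \<Otimes>\<^sub>M borel)" unfolding K_def by measurable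
    have mn: "(\<lambda>g. F ((1 / sqrt (fnorm2 g)) \<cdot>\<^sub>m (g * eye ?p k))) \<in> borel_measurable (mat_borel 1 ?p)" by measurable
    have "(\<integral>\<^sup>+V. F (bot_rows (k + n) 1 k V) \<partial>M) = (\<integral>\<^sup>+g. G g \<partial>leb_mat 1 ?p) / vol"
      using haar_last_row[OF M[unfolded add_Suc_right] F] nn_integral_uniform_fball[OF mn]
      by (simp only: add_Suc_right G_def vol_def)
    then have "(\<integral>\<^sup>+V. F (bot_rows (k + n) 1 k V) \<partial>M) * vol = (\<integral>\<^sup>+g. G g \<partial>leb_mat 1 ?p)"
      by (simp only: ennreal_divide_mult_cancel[OF vol])
    also have "\<dots> = (\<integral>\<^sup>+A. G (A\<^sup>T) \<partial>leb_mat ?p 1)" by (rule nn_integral_leb_mat_transpose[OF G, symmetric])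
    also have "\<dots> = (\<integral>\<^sup>+a. (\<integral>\<^sup>+b. G ((a @\<^sub>r b)\<^sup>T) \<partial>leb_mat ?m 1) \<partial>leb_mat k 1)"
      by (rule nn_integral_leb_mat_append_rows[OF GT])
    also have "\<dots> = (\<integral>\<^sup>+a. (\<integral>\<^sup>+b. G ((a\<^sup>T @\<^sub>r b)\<^sup>T) \<partial>leb_mat ?m 1) \<partial>leb_mat 1 k)"
    proof (rule nn_integral_leb_mat_transpose[symmetric, where F="\<lambda>a. \<integral>\<^sup>+b. G ((a @\<^sub>r b)\<^sup>T) \<partial>leb_mat ?m 1"])
      interpret sigma_finite_measure "leb_mat ?m 1" by (rule sigma_finite_leb_mat)
      show "(\<lambda>a. \<integral>\<^sup>+b. G ((a @\<^sub>r b)\<^sup>T) \<partial>leb_mat ?m 1) \<in> borel_measurable (mat_borel k 1)"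
        by (rule borel_measurable_nn_integral) measurable
    qed
    also have "\<dots> = (\<integral>\<^sup>+a. (\<integral>\<^sup>+w. K (a, w) \<partial>lborel) \<partial>leb_mat 1 k)"
    proof (rule nn_integral_cong)
      fix a assume "a \<in> space (leb_mat 1 k)"
      then have a: "a \<in> carrier_mat 1 k" by simp
      define \<psi> where "\<psi> = (\<lambda>s. F ((1 / sqrt (fnorm2 a + s)) \<cdot>\<^sub>m a) * indicator {..1} (fnorm2 a + s))"
      have \<psi>[measurable]: "\<psi> \<in> borel_measurable borel" unfolding \<psi>_def using a by measurable
      have "(\<integral>\<^sup>+b. G ((a\<^sup>T @\<^sub>r b)\<^sup>T) \<partial>leb_mat ?m 1) = (\<integral>\<^sup>+b. \<psi> (fnorm2 b) \<partial>leb_mat ?m 1)"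
      proof (rule nn_integral_cong)
        fix b assume "b \<in> space (leb_mat ?m 1)"
        then have b: "b \<in> carrier_mat ?m 1" by simp
        have aT: "a\<^sup>T \<in> carrier_mat k 1" using a by simp
        have ab: "a\<^sup>T @\<^sub>r b \<in> carrier_mat ?p 1" using carrier_append_rows[OF aT b] .
        have n: "fnorm2 ((a\<^sup>T @\<^sub>r b)\<^sup>T) = fnorm2 a + fnorm2 b"
          using fnorm2_append[OF aT b] by (simp add: fnorm2_transpose)
        have "(a\<^sup>T @\<^sub>r b)\<^sup>T * eye ?p k = a"
        proof (rule eq_matI)
          fix i j assume "i < dim_row a" "j < dim_col a"
          then have ij: "i = 0" "j < k" using a by auto
          have "((a\<^sup>T @\<^sub>r b)\<^sup>T * eye ?p k) $$ (i,j) = (\<Sum>l<?p. (a\<^sup>T @\<^sub>r b)\<^sup>T $$ (i,l) * eye ?p k $$ (l,j))"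
            by (rule mult_index[OF _ eye_carrier, of _ 1]) (use ab ij in auto)
          also have "\<dots> = (\<Sum>l<?p. if l = j then (a\<^sup>T @\<^sub>r b)\<^sup>T $$ (i,j) else 0)"
            using ij by (intro sum.cong) (auto simp: eye_def)
          also have "\<dots> = (a\<^sup>T @\<^sub>r b)\<^sup>T $$ (i,j)" using ij by simp
          also have "\<dots> = (a\<^sup>T @\<^sub>r b) $$ (j,i)" using ab ij by simp
          also have "\<dots> = a $$ (i,j)" using append_rows_index[OF aT b, of j i] ij a by simp
          finally show "((a\<^sup>T @\<^sub>r b)\<^sup>T * eye ?p k) $$ (i,j) = a $$ (i,j)" .
        qed (use a ab carrier_matD[OF eye_carrier[of ?p k]] in auto)
        then show "G ((a\<^sup>T @\<^sub>r b)\<^sup>T) = \<psi> (fnorm2 b)"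
          using ab n by (auto simp: G_def \<psi>_def fball_def split: split_indicator)
      qed
      also have "\<dots> = (\<integral>\<^sup>+s. \<psi> s * ennreal (f s) \<partial>lborel)"
        unfolding f_def by (rule rad[OF \<psi>])
      \<comment> \<open>The shift makes \<open>w\<close> the squared norm of the whole vector;
        \<open>f\<close> vanishes on nonpositive arguments, so the range of \<open>w\<close> needs
        no bookkeeping.\<close>
      also have "\<dots> = ennreal \<bar>1\<bar> * (\<integral>\<^sup>+w. \<psi> (- fnorm2 a + 1 * w) * ennreal (f (- fnorm2 a + 1 * w)) \<partial>lborel)"
        by (rule nn_integral_real_affine) auto
      also have "\<dots> = (\<integral>\<^sup>+w. K (a, w) \<partial>lborel)"
        by (simp add: K_def \<psi>_def)
      finally show "(\<integral>\<^sup>+b. G ((a\<^sup>T @\<^sub>r b)\<^sup>T) \<partial>leb_mat ?m 1) = (\<integral>\<^sup>+w. K (a, w) \<partial>lborel)" .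
    qed
    also have "\<dots> = (\<integral>\<^sup>+w. (\<integral>\<^sup>+a. K (a, w) \<partial>leb_mat 1 k) \<partial>lborel)"
      by (rule MLeb.Fubini'[symmetric]) (use K in \<open>simp cong: measurable_cong_sets sets_pair_measure_cong\<close>)
    also have "\<dots> = (\<integral>\<^sup>+w. ennreal (sqrt w ^ k) * ennreal (f w) * indicator {0<..1} w * (\<integral>\<^sup>+y. F y * ennreal (row_density ?m y) \<partial>leb_mat 1 k) \<partial>lborel)"
    proof (rule nn_integral_cong)
      fix w :: real
      have Kw[measurable]: "(\<lambda>a. K (a, w)) \<in> borel_measurable (mat_borel 1 k)" by measurable
      show "(\<integral>\<^sup>+a. K (a, w) \<partial>leb_mat 1 k) = ennreal (sqrt w ^ k) * ennreal (f w) * indicator {0<..1} w * (\<integral>\<^sup>+y. F y * ennreal (row_density ?m y) \<partial>leb_mat 1 k)"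
      proof (cases "0 < w \<and> w \<le> 1")
        case False
        have "K (a, w) = 0" for a
          using False fnorm2_nonneg[of a] by (auto simp: K_def f_def split: split_indicator)
        then show ?thesis using False by simp
      next
        case True
        define c where "c = (\<lambda>ij::nat\<times>nat. sqrt w)"
        have c: "c ij \<noteq> 0" for ij using True by (simp add: c_def)
        have 1: "(\<Prod>ij\<in>{..<1::nat} \<times> {..<k}. \<bar>c ij\<bar>) = sqrt w ^ k" using True by (simp add: c_def)
        have "(\<integral>\<^sup>+a. K (a, w) \<partial>leb_mat 1 k)
          = ennreal (sqrt w ^ k) * (\<integral>\<^sup>+y. K (Matrix.mat 1 k (\<lambda>ij. c ij * y $$ ij), w) \<partial>leb_mat 1 k)"
          unfolding 1[symmetric] by (rule nn_integral_leb_mat_scale[OF c Kw, symmetric])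
        also have "(\<integral>\<^sup>+y. K (Matrix.mat 1 k (\<lambda>ij. c ij * y $$ ij), w) \<partial>leb_mat 1 k)
          = (\<integral>\<^sup>+y. ennreal (f w) * (F y * ennreal (row_density ?m y)) \<partial>leb_mat 1 k)"
        proof (rule nn_integral_cong)
          fix y assume "y \<in> space (leb_mat 1 k)"
          then have y: "y \<in> carrier_mat 1 k" by simp
          have e: "Matrix.mat 1 k (\<lambda>ij. c ij * y $$ ij) = sqrt w \<cdot>\<^sub>m y" using y by (intro eq_matI) (auto simp: c_def)
          have s: "(1 / sqrt w) \<cdot>\<^sub>m (sqrt w \<cdot>\<^sub>m y) = y" using y True by (intro eq_matI) auto
          have "w - fnorm2 (sqrt w \<cdot>\<^sub>m y) = w * (1 - fnorm2 y)" using True by (simp add: fnorm2_smult algebra_simps)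
          moreover have "f (w * (1 - fnorm2 y)) = f w * row_density ?m y"
            using True by (auto simp: f_def row_density_def powr_mult zero_less_mult_iff)
          ultimately show "K (Matrix.mat 1 k (\<lambda>ij. c ij * y $$ ij), w) = ennreal (f w) * (F y * ennreal (row_density ?m y))"
            unfolding K_def prod.case e s using True f0 by (simp add: ennreal_mult' mult_ac)
        qed
        also have "\<dots> = ennreal (f w) * (\<integral>\<^sup>+y. F y * ennreal (row_density ?m y) \<partial>leb_mat 1 k)"
          by (rule nn_integral_cmult) measurable
        finally show ?thesis using True by (simp add: mult_ac)
      qed
    qed
    also have "\<dots> = D * (\<integral>\<^sup>+y. F y * ennreal (row_density ?m y) \<partial>leb_mat 1 k)"
      unfolding D_def by (rule nn_integral_multc) measurable
    finally show ?thesis .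
  qed
  \<comment> \<open>The test function 1 shows that \<open>D\<close> and the mass of the row density
    have a positive finite product, so both are positive and finite.\<close>
  have "vol = D * (\<integral>\<^sup>+y. ennreal (row_density ?m y) \<partial>leb_mat 1 k)"
    using main[of "\<lambda>_. 1"] by (simp add: M.emeasure_space_1)
  then have D: "D \<noteq> 0" "D \<noteq> \<infinity>" and I: "(\<integral>\<^sup>+y. ennreal (row_density ?m y) \<partial>leb_mat 1 k) \<noteq> \<infinity>"
    using vol by (auto simp: ennreal_mult_eq_top_iff)
  define c where "c = enn2real (D / vol)"
  have Dv: "D / vol \<noteq> \<infinity>" "D / vol \<noteq> 0" using D vol by (auto simp: ennreal_divide_eq_top_iff)
  then have ec: "ennreal c = D / vol" by (simp add: c_def less_top)
  show ?thesis
  proof (rule that[of c])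
    show "0 < c" using Dv by (simp add: c_def enn2real_positive_iff less_top zero_less_iff_neq_zero)
    show "(\<integral>\<^sup>+y. ennreal (row_density ?m y) \<partial>leb_mat 1 k) < \<infinity>" using I by (simp add: less_top)
    fix F :: "real mat \<Rightarrow> ennreal" assume F: "F \<in> borel_measurable (mat_borel 1 k)"
    have "(\<integral>\<^sup>+V. F (bot_rows (k + n) 1 k V) \<partial>M) = (\<integral>\<^sup>+V. F (bot_rows (k + n) 1 k V) \<partial>M) * vol / vol"
      using vol by (simp add: ennreal_mult_divide_eq)
    also have "\<dots> = ennreal c * (\<integral>\<^sup>+y. F y * ennreal (row_density (Suc n) y) \<partial>leb_mat 1 k)"
      unfolding main[OF F] ec by (simp only: divide_ennreal_def mult_ac)
    finally show "(\<integral>\<^sup>+V. F (bot_rows (k + n) 1 k V) \<partial>M) = ennreal c * (\<integral>\<^sup>+y. F y * ennreal (row_density (Suc n) y) \<partial>leb_mat 1 k)" .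
  qed
qed

section \<open>The density of the last rows\<close>

definition stiefel_density :: "nat \<Rightarrow> real mat \<Rightarrow> real" where
  "stiefel_density k Z = (if sym_pd k (cogram k Z) then 1 / sqrt (det (cogram k Z)) else 0)"

lemma stiefel_density_nonneg: "0 \<le> stiefel_density k Z"
  using det_sym_pd_pos[of k "cogram k Z"] by (auto simp: stiefel_density_def intro: less_imp_le)

lemma measurable_stiefel_density[measurable]: "stiefel_density k \<in> borel_measurable (mat_borel n k)"
  unfolding stiefel_density_def
proof (rule measurable_If)
  have "(\<lambda>Z. sqrt (det (cogram k Z))) \<in> borel_measurable (mat_borel n k)"
    by (rule measurable_compose[OF measurable_det[OF measurable_cogram] borel_measurable_sqrt])
  then show "(\<lambda>Z. 1 / sqrt (det (cogram k Z))) \<in> borel_measurable (mat_borel n k)" by measurable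
  show "{Z \<in> space (mat_borel n k). sym_pd k (cogram k Z)} \<in> sets (mat_borel n k)"
    using pred_cogram_pd[where n=n and k=k] by (simp add: pred_def)
qed simp

text \<open>A rank-one perturbation of the identity: the eigenvalue 1 - |y|^2 belongs to the
  direction of \<open>y\<close>, placed in column 0 by a reflection, and all others are 1. For
  \<open>y = 0\<close> any orthogonal matrix diagonalises, so no unit vector is needed.\<close>

lemma cogram_row:
  assumes y: "y \<in> carrier_mat 1 k"
  shows "sym_pd k (cogram k y) \<longleftrightarrow> fnorm2 y < 1" "det (cogram k y) = 1 - fnorm2 y"
proof -
  define s where "s = fnorm2 y"
  have s: "s = (\<Sum>j<k. (y $$ (0,j))\<^sup>2)" "0 \<le> s" using fnorm2_eq[OF y] fnorm2_nonneg[of y] by (auto simp: s_def)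
  define v where "v = (1 / sqrt s) \<cdot>\<^sub>m y\<^sup>T"
  define d where "d = (\<lambda>i::nat. if i = 0 then 1 - s else 1)"
  let ?W = "householder k v"
  have W: "?W \<in> stiefel k k" by (rule householder_stiefel)
  have v: "v \<in> carrier_mat k 1" using y by (simp add: v_def)
  have W0: "s * ?W $$ (a,0) * ?W $$ (b,0) = y $$ (0,a) * y $$ (0,b)" if "a < k" "b < k" for a b
  proof (cases "s = 0")
    case True
    have "\<forall>j\<in>{..<k}. (y $$ (0,j))\<^sup>2 = 0" using True s(1) by (subst (asm) s(1)) (simp add: sum_nonneg_eq_0_iff)
    then show ?thesis using True that by auto
  next
    case False
    then have "fnorm2 v = 1" using s by (simp add: v_def fnorm2_smult fnorm2_transpose s_def power_divide)
    then have "?W $$ (i,0) = v $$ (i,0)" if "i < k" for i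
      using householder_col0[OF v _ that] fnorm2_col[OF v] by simp
    then show ?thesis using that y s False by (simp add: v_def)
  qed
  have eq: "cogram k y = ?W * mat_diag k d * ?W\<^sup>T"
  proof (rule eq_matI)
    note c = conj_diag_carrier[OF householder_carrier[of k v], of d]
    show "dim_row (cogram k y) = dim_row (?W * mat_diag k d * ?W\<^sup>T)" "dim_col (cogram k y) = dim_col (?W * mat_diag k d * ?W\<^sup>T)"
      using carrier_matD[OF c] carrier_matD[OF cogram_carrier[OF y]] by auto
    fix a b assume "a < dim_row (?W * mat_diag k d * ?W\<^sup>T)" "b < dim_col (?W * mat_diag k d * ?W\<^sup>T)"
    then have ab: "a < k" "b < k" using carrier_matD[OF c] by auto
    have k0: "0 < k" using ab by simp
    have "(?W * mat_diag k d * ?W\<^sup>T) $$ (a,b) = (\<Sum>l<k. ?W $$ (a,l) * d l * ?W $$ (b,l))"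
      by (rule conj_diag_index[OF householder_carrier ab])
    also have "\<dots> = (\<Sum>l<k. ?W $$ (a,l) * ?W $$ (b,l) - (if l = 0 then s * ?W $$ (a,0) * ?W $$ (b,0) else 0))"
      by (intro sum.cong) (auto simp: d_def algebra_simps)
    also have "\<dots> = (\<Sum>l<k. ?W $$ (a,l) * ?W $$ (b,l)) - s * ?W $$ (a,0) * ?W $$ (b,0)"
      using k0 by (simp add: sum_subtractf)
    also have "(\<Sum>l<k. ?W $$ (a,l) * ?W $$ (b,l)) = (?W * ?W\<^sup>T) $$ (a,b)"
      using mult_index[OF householder_carrier[of k v], of "?W\<^sup>T" k a b] ab carrier_matD[OF householder_carrier[of k v]] by simp
    also have "\<dots> = (if a = b then 1 else 0)" using stiefel_square(3)[OF W] ab by simp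
    also have "(if a = b then 1 else 0) - s * ?W $$ (a,0) * ?W $$ (b,0) = cogram k y $$ (a,b)"
    proof -
      have "(y\<^sup>T * y) $$ (a,b) = y $$ (0,a) * y $$ (0,b)"
        using mult_index[of "y\<^sup>T" k 1 y k a b] y ab by simp
      moreover have "cogram k y $$ (a,b) = (if a = b then 1 else 0) - (y\<^sup>T * y) $$ (a,b)"
        unfolding cogram_def using y ab by (subst index_minus_mat(1)) auto
      ultimately show ?thesis using W0[OF ab] by simp
    qed
    finally show "cogram k y $$ (a,b) = (?W * mat_diag k d * ?W\<^sup>T) $$ (a,b)" by simp
  qed
  have s0: "s = 0" if "k = 0" using s that by simp
  show "sym_pd k (cogram k y) \<longleftrightarrow> fnorm2 y < 1"
    unfolding eq sym_pd_conj_diag_iff[OF W] s_def[symmetric] using s0 by (cases "k = 0") (auto simp: d_def)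
  have "(\<Prod>i<k. d i) = 1 - s"
  proof (cases k)
    case (Suc q)
    then show ?thesis unfolding Suc prod.lessThan_Suc_shift by (simp add: d_def)
  qed (simp add: s0)
  then show "det (cogram k y) = 1 - fnorm2 y" unfolding eq det_conj_diag[OF W] by (simp add: s_def)
qed

lemma root_cogram_pd:
  assumes "sym_pd k (cogram k Y)"
  shows "sym_pd k (root_cogram k Y)" "root_cogram k Y * root_cogram k Y = cogram k Y"
    "det (root_cogram k Y) = sqrt (det (cogram k Y))" "root_cogram k Y \<in> carrier_mat k k"
    "(root_cogram k Y)\<^sup>T = root_cogram k Y" "0 < det (root_cogram k Y)"
  using psd_sqrt_pos_pd[OF assms] sym_pd_carrier[of k "root_cogram k Y"] det_sym_pd_pos[of k "root_cogram k Y"]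
  by (auto simp: root_cogram_def)

text \<open>Both sides are the power of 1 - |y|^2 with exponent n/2 - 1/2. The right side exhibits
  the Jacobian of the substitution of \<open>Z * root_cogram k y\<close> for the \<open>n\<close>
  rows above \<open>y\<close>.\<close>

lemma row_density_eq:
  assumes y: "y \<in> carrier_mat 1 k"
  shows "row_density (Suc n) y = stiefel_density k y * det (root_cogram k y) ^ n"
proof (cases "fnorm2 y < 1")
  case True
  have x: "0 < 1 - fnorm2 y" using True by simp
  have "real (Suc n) / 2 - 1 = real n / 2 - 1 / 2" by (simp add: field_simps)
  then have "(1 - fnorm2 y) powr (Suc n / 2 - 1) = (1 - fnorm2 y) powr (real n / 2) / (1 - fnorm2 y) powr (1 / 2)"
    by (simp only: powr_diff)
  also have "(1 - fnorm2 y) powr (real n / 2) = ((1 - fnorm2 y) powr (1 / 2)) powr (real n)"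
    by (simp add: powr_powr)
  also have "(1 - fnorm2 y) powr (1 / 2) = sqrt (1 - fnorm2 y)" using x by (intro powr_half_sqrt) simp
  also have "sqrt (1 - fnorm2 y) powr (real n) = sqrt (1 - fnorm2 y) ^ n" using x by (intro powr_realpow) simp
  finally have "(1 - fnorm2 y) powr (Suc n / 2 - 1) = 1 / sqrt (1 - fnorm2 y) * sqrt (1 - fnorm2 y) ^ n" by simp
  then show ?thesis using True cogram_row[OF y] root_cogram_pd(3)[of k y] by (simp add: row_density_def stiefel_density_def)
next
  case False
  then show ?thesis using cogram_row[OF y] by (simp add: row_density_def stiefel_density_def)
qed

text \<open>With \<open>P\<close> the root, \<open>P * P\<close> is
  \<open>1\<^sub>m k - Y\<^sup>T * Y\<close>, so subtracting \<open>P * (Z\<^sup>T * Z) * P\<close>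
  from it leaves the congruence by \<open>P\<close>.\<close>

lemma cogram_append_scaled:
  assumes Z: "Z \<in> carrier_mat n k" and Y: "Y \<in> carrier_mat m k" and pd: "sym_pd k (cogram k Y)"
  shows "cogram k ((Z * root_cogram k Y) @\<^sub>r Y) = root_cogram k Y * cogram k Z * root_cogram k Y"
proof -
  define P where "P = root_cogram k Y"
  note P = root_cogram_pd[OF pd, folded P_def]
  have ZP: "Z * P \<in> carrier_mat n k" using Z P by (intro mult_carrier_mat)
  have g: "Z\<^sup>T * Z \<in> carrier_mat k k" "Z\<^sup>T \<in> carrier_mat k n" using Z by auto
  have "(Z * P)\<^sup>T * (Z * P) = P * Z\<^sup>T * (Z * P)" using transpose_mult[OF Z P(4)] P(5) by simp
  also have "\<dots> = P * (Z\<^sup>T * (Z * P))" by (rule assoc_mult_mat[OF P(4) g(2) ZP])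
  also have "Z\<^sup>T * (Z * P) = (Z\<^sup>T * Z) * P" by (rule assoc_mult_mat[OF g(2) Z P(4), symmetric])
  also have "P * ((Z\<^sup>T * Z) * P) = P * (Z\<^sup>T * Z) * P" by (rule assoc_square[OF P(4) g(1) P(4), symmetric])
  finally have 1: "(Z * P)\<^sup>T * (Z * P) = P * (Z\<^sup>T * Z) * P" .
  have "P * cogram k Z * P = (P * 1\<^sub>m k - P * (Z\<^sup>T * Z)) * P"
    unfolding cogram_def using mult_minus_distrib_mat[OF P(4) _ g(1), of "1\<^sub>m k"] by simp
  also have "\<dots> = P * 1\<^sub>m k * P - P * (Z\<^sup>T * Z) * P"
    using P g by (intro minus_mult_distrib_mat[of _ k k]) (auto intro: mult_carrier_square)
  also have "\<dots> = cogram k Y - (Z * P)\<^sup>T * (Z * P)" using P 1 by simp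
  also have "\<dots> = cogram k ((Z * P) @\<^sub>r Y)" by (rule cogram_append(1)[OF ZP Y, symmetric])
  finally show ?thesis by (simp add: P_def)
qed

lemma stiefel_density_append_scaled:
  assumes Z: "Z \<in> carrier_mat n k" and Y: "Y \<in> carrier_mat m k" and pd: "sym_pd k (cogram k Y)"
  shows "stiefel_density k ((Z * root_cogram k Y) @\<^sub>r Y) * det (root_cogram k Y) = stiefel_density k Z"
proof -
  define P where "P = root_cogram k Y"
  note P = root_cogram_pd[OF pd, folded P_def]
  note c = cogram_carrier[OF Z]
  have "det (P * cogram k Z * P) = (det P)\<^sup>2 * det (cogram k Z)"
    by (simp only: det_mult[OF mult_carrier_square[OF P(4) c] P(4)] det_mult[OF P(4) c] power2_eq_square mult_ac)
  moreover have "cogram k ((Z * P) @\<^sub>r Y) = P * cogram k Z * P"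
    using cogram_append_scaled[OF assms] by (simp only: P_def)
  ultimately show ?thesis
    unfolding P_def[symmetric] using P(6) sym_pd_congruence_iff[OF P(1) c] by (simp add: stiefel_density_def real_sqrt_mult)
qed

text \<open>The substitution of \<open>Z * P\<close> for \<open>Z\<close>, with \<open>P\<close> the
  root, has Jacobian \<open>det P ^ n\<close> and turns the density of the stack into that of
  \<open>Z\<close> divided by \<open>det P\<close>. The factor stays a quotient because
  \<open>n\<close> may be 0.\<close>

lemma nn_integral_stiefel_density_fiber:
  assumes Y: "Y \<in> carrier_mat m k" and F[measurable]: "F \<in> borel_measurable (mat_borel (n + m) k)"
  shows "(\<integral>\<^sup>+Z. F (Z @\<^sub>r Y) * ennreal (stiefel_density k (Z @\<^sub>r Y)) \<partial>leb_mat n k)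
    = (if sym_pd k (cogram k Y) then ennreal (det (root_cogram k Y) ^ n / det (root_cogram k Y)) *
        (\<integral>\<^sup>+Z. F ((Z * root_cogram k Y) @\<^sub>r Y) * ennreal (stiefel_density k Z) \<partial>leb_mat n k) else 0)"
proof (cases "sym_pd k (cogram k Y)")
  case False
  have "stiefel_density k (Z @\<^sub>r Y) = 0" if "Z \<in> carrier_mat n k" for Z
    using cogram_append_pd(2)[OF that Y] False by (auto simp: stiefel_density_def)
  then have "(\<integral>\<^sup>+Z. F (Z @\<^sub>r Y) * ennreal (stiefel_density k (Z @\<^sub>r Y)) \<partial>leb_mat n k) = (\<integral>\<^sup>+Z. 0 \<partial>leb_mat n k)"
    by (intro nn_integral_cong) simp
  then show ?thesis using False by simp
next
  case True
  define P where "P = root_cogram k Y"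
  note P = root_cogram_pd[OF True, folded P_def]
  let ?G = "\<lambda>Z. F (Z @\<^sub>r Y) * ennreal (stiefel_density k (Z @\<^sub>r Y))"
  have [measurable]: "(\<lambda>Z. Z @\<^sub>r Y) \<in> mat_borel n k \<rightarrow>\<^sub>M mat_borel (n + m) k" "(\<lambda>Z. Z * P) \<in> mat_borel n k \<rightarrow>\<^sub>M mat_borel n k"
    using Y measurable_right_mult[OF P(4)] by measurable
  have "(\<integral>\<^sup>+Z. ?G Z \<partial>leb_mat n k) = ennreal (det P ^ n) * (\<integral>\<^sup>+Z. ?G (Z * P) \<partial>leb_mat n k)"
    by (rule nn_integral_leb_mat_right_pd[OF P(1), symmetric]) measurable
  also have "(\<integral>\<^sup>+Z. ?G (Z * P) \<partial>leb_mat n k)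
    = (\<integral>\<^sup>+Z. ennreal (1 / det P) * (F ((Z * P) @\<^sub>r Y) * ennreal (stiefel_density k Z)) \<partial>leb_mat n k)"
  proof (rule nn_integral_cong)
    fix Z assume "Z \<in> space (leb_mat n k)"
    then have Z: "Z \<in> carrier_mat n k" by simp
    have "stiefel_density k ((Z * P) @\<^sub>r Y) = 1 / det P * stiefel_density k Z"
      using stiefel_density_append_scaled[OF Z Y True] P(6) by (simp add: P_def[symmetric] field_simps)
    then show "?G (Z * P) = ennreal (1 / det P) * (F ((Z * P) @\<^sub>r Y) * ennreal (stiefel_density k Z))"
      using P(6) stiefel_density_nonneg[of k Z] by (simp only: ennreal_mult less_imp_le zero_le_divide_1_iff mult_ac)
  qed
  also have "\<dots> = ennreal (1 / det P) * (\<integral>\<^sup>+Z. F ((Z * P) @\<^sub>r Y) * ennreal (stiefel_density k Z) \<partial>leb_mat n k)"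
    by (rule nn_integral_cmult) measurable
  also have "ennreal (det P ^ n) * \<dots> = ennreal (det P ^ n / det P) * (\<integral>\<^sup>+Z. F ((Z * P) @\<^sub>r Y) * ennreal (stiefel_density k Z) \<partial>leb_mat n k)"
  proof -
    have "ennreal (det P ^ n) * ennreal (1 / det P) = ennreal (det P ^ n / det P)"
      using P(6) by (simp add: ennreal_mult'[symmetric])
    then show ?thesis by (simp add: mult.assoc[symmetric])
  qed
  finally show ?thesis using True by (simp add: P_def)
qed

lemma nn_integral_leb_mat_0_rows:
  assumes F: "F \<in> borel_measurable (mat_borel 0 k)"
  shows "(\<integral>\<^sup>+Z. F Z \<partial>leb_mat 0 k) = F (0\<^sub>m 0 k)"
proof -
  have box: "mat_box 0 k (\<lambda>_. UNIV) = carrier_mat 0 k" by (auto simp: mat_box_def)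
  have e: "emeasure (leb_mat 0 k) (carrier_mat 0 k) = 1"
    unfolding box[symmetric] by (subst emeasure_leb_mat_box) auto
  have "(\<integral>\<^sup>+Z. F Z \<partial>leb_mat 0 k) = (\<integral>\<^sup>+Z. F (0\<^sub>m 0 k) \<partial>leb_mat 0 k)"
  proof (rule nn_integral_cong)
    fix Z assume "Z \<in> space (leb_mat 0 k)"
    then have "Z = 0\<^sub>m 0 k" by (intro eq_matI) auto
    then show "F Z = F (0\<^sub>m 0 k)" by simp
  qed
  also have "\<dots> = F (0\<^sub>m 0 k)" using e by simp
  finally show ?thesis .
qed

lemma sym_pd_one: "sym_pd k (1\<^sub>m k)"
  using sym_pd_conj_diag_iff[of "1\<^sub>m k" k "\<lambda>_. 1"] by (simp add: stiefel_def)

text \<open>Induction on the number of rows. Given the last row \<open>y\<close>, the rows above it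
  are those of a uniform frame in one dimension less, times the root belonging to \<open>y\<close>;
  the induction hypothesis gives the density of the lower rows of that frame. The weight of
  \<open>y\<close> is exactly the factor by which \<open>nn_integral_stiefel_density_fiber\<close>
  rescales, so the two recombine to the density with one more row.\<close>

theorem haar_bot_rows_law:
  "is_haar (k + n) k M \<Longrightarrow> \<exists>c>0. \<forall>F\<in>borel_measurable (mat_borel n k).
    (\<integral>\<^sup>+V. F (bot_rows k n k V) \<partial>M) = ennreal c * (\<integral>\<^sup>+Z. F Z * ennreal (stiefel_density k Z) \<partial>leb_mat n k)"
proof (induction n arbitrary: M)
  case 0
  interpret M: prob_space M by (rule is_haarD(1)[OF 0])
  have z: "cogram k (0\<^sub>m 0 k) = 1\<^sub>m k"
    unfolding cogram_def by (rule eq_matI) (auto simp: scalar_prod_def)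
  have h: "stiefel_density k (0\<^sub>m 0 k) = 1" by (simp add: stiefel_density_def z sym_pd_one)
  have b: "bot_rows k 0 k V = 0\<^sub>m 0 k" for V by (rule eq_matI) (auto simp: bot_rows_def)
  show ?case
  proof (intro exI[of _ 1] conjI ballI)
    fix F :: "real mat \<Rightarrow> ennreal" assume [measurable]: "F \<in> borel_measurable (mat_borel 0 k)"
    have "(\<integral>\<^sup>+Z. F Z * ennreal (stiefel_density k Z) \<partial>leb_mat 0 k) = F (0\<^sub>m 0 k)"
      by (subst nn_integral_leb_mat_0_rows) (auto simp: h)
    then show "(\<integral>\<^sup>+V. F (bot_rows k 0 k V) \<partial>M) = ennreal 1 * (\<integral>\<^sup>+Z. F Z * ennreal (stiefel_density k Z) \<partial>leb_mat 0 k)"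
      by (simp add: b M.emeasure_space_1)
  qed simp
next
  case (Suc n)
  note M = Suc.prems
  \<comment> \<open>The same dimension read as \<open>k + n\<close> rows above a single one, the
    shape that \<open>haar_split\<close> takes.\<close>
  have M': "is_haar (k + n + 1) k M" using M by simp
  interpret M: prob_space M by (rule is_haarD(1)[OF M])
  obtain N where N: "is_haar (k + n) k N" using haar_exists[of k "k + n"] by auto
  interpret N: prob_space N by (rule is_haarD(1)[OF N])
  obtain c0 where c0: "0 < c0" and IH: "\<And>F. F \<in> borel_measurable (mat_borel n k) \<Longrightarrow>
    (\<integral>\<^sup>+V. F (bot_rows k n k V) \<partial>N) = ennreal c0 * (\<integral>\<^sup>+Z. F Z * ennreal (stiefel_density k Z) \<partial>leb_mat n k)"
    using Suc.IH[OF N] by blast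
  obtain c1 where c1: "0 < c1" and row: "\<And>F. F \<in> borel_measurable (mat_borel 1 k) \<Longrightarrow>
      (\<integral>\<^sup>+V. F (bot_rows (k + n) 1 k V) \<partial>M) = ennreal c1 * (\<integral>\<^sup>+y. F y * ennreal (row_density (Suc n) y) \<partial>leb_mat 1 k)"
    using haar_row_law[OF M] by blast
  note mb = measurable_bot_rows[of "k + n" 1 k]
  have pd: "AE V in M. sym_pd k (cogram k (bot_rows (k + n) 1 k V))"
  proof -
    let ?A = "{y \<in> space (mat_borel 1 k). \<not> sym_pd k (cogram k y)}"
    have A: "?A \<in> sets (mat_borel 1 k)"
      using pred_cogram_pd[where n=1 and k=k] by (intro sets.sets_Collect_neg) (simp only: pred_def)
    have "(\<integral>\<^sup>+V. indicator ?A (bot_rows (k + n) 1 k V) \<partial>M) = ennreal c1 * (\<integral>\<^sup>+y. indicator ?A y * ennreal (row_density (Suc n) y) \<partial>leb_mat 1 k)"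
      by (rule row) (use A in simp)
    also have "(\<integral>\<^sup>+y. indicator ?A y * ennreal (row_density (Suc n) y) \<partial>leb_mat 1 k) = (\<integral>\<^sup>+y. 0 \<partial>leb_mat 1 k)"
      by (rule nn_integral_cong) (auto simp: row_density_eq stiefel_density_def split: split_indicator)
    finally have "(\<integral>\<^sup>+V. indicator ?A (bot_rows (k + n) 1 k V) \<partial>M) = 0" by simp
    moreover have "(\<lambda>V. indicator ?A (bot_rows (k + n) 1 k V) :: ennreal) \<in> borel_measurable M"
      using measurable_compose[OF mb borel_measurable_indicator[OF A]] is_haarD(2)[OF M'] by (simp cong: measurable_cong_sets)
    ultimately have "AE V in M. (indicator ?A (bot_rows (k + n) 1 k V) :: ennreal) = 0"
      by (subst (asm) nn_integral_0_iff_AE) auto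
    then show ?thesis by eventually_elim (auto split: split_indicator_asm)
  qed
  show ?case
  proof (intro exI[of _ "c1 * c0"] conjI ballI)
    show "0 < c1 * c0" using c0 c1 by simp
    fix F :: "real mat \<Rightarrow> ennreal" assume "F \<in> borel_measurable (mat_borel (Suc n) k)"
    then have F[measurable]: "F \<in> borel_measurable (mat_borel (n + 1) k)" by simp
    define \<Phi> where "\<Phi> = (\<lambda>y. \<integral>\<^sup>+Z. F ((Z * root_cogram k y) @\<^sub>r y) * ennreal (stiefel_density k Z) \<partial>leb_mat n k)"
    interpret L: sigma_finite_measure "leb_mat n k" by (rule sigma_finite_leb_mat)
    interpret LL: pair_sigma_finite "leb_mat 1 k" "leb_mat n k" by (simp add: pair_sigma_finite_def sigma_finite_leb_mat)
    note [measurable] = measurable_compose[OF _ measurable_root_cogram[of k 1]]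
    have mj: "(\<lambda>x. (snd x * root_cogram k (fst x)) @\<^sub>r fst x) \<in> mat_borel 1 k \<Otimes>\<^sub>M mat_borel n k \<rightarrow>\<^sub>M mat_borel (n + 1) k"
      by (rule measurable_append_rows[OF measurable_mat_mult[where l=k]]) measurable
    have \<Phi>[measurable]: "\<Phi> \<in> borel_measurable (mat_borel 1 k)"
      unfolding \<Phi>_def
    proof (rule L.borel_measurable_nn_integral)
      note [measurable] = measurable_compose[OF mj F]
      have "(\<lambda>x. F ((snd x * root_cogram k (fst x)) @\<^sub>r fst x) * ennreal (stiefel_density k (snd x))) \<in> borel_measurable (mat_borel 1 k \<Otimes>\<^sub>M mat_borel n k)"
        by measurable
      then show "(\<lambda>(y, Z). F ((Z * root_cogram k y) @\<^sub>r y) * ennreal (stiefel_density k Z)) \<in> borel_measurable (mat_borel 1 k \<Otimes>\<^sub>M leb_mat n k)"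
        by (simp add: case_prod_unfold cong: measurable_cong_sets sets_pair_measure_cong)
    qed
    have mB: "(\<lambda>V. F (bot_rows k (Suc n) k V)) \<in> borel_measurable (mat_borel (k + n + 1) k)"
      using measurable_compose[OF measurable_bot_rows[of k "Suc n" k], of F] F by simp
    have bot: "bot_rows k (Suc n) k (A @\<^sub>r y) = bot_rows k n k A @\<^sub>r y"
      if A: "A \<in> carrier_mat (k + n) k" and y: "y \<in> carrier_mat 1 k" for A y
    proof (rule eq_matI)
      have c: "bot_rows k n k A @\<^sub>r y \<in> carrier_mat (n + 1) k" by (rule carrier_append_rows[OF bot_rows_carrier y])
      show "dim_row (bot_rows k (Suc n) k (A @\<^sub>r y)) = dim_row (bot_rows k n k A @\<^sub>r y)"
        "dim_col (bot_rows k (Suc n) k (A @\<^sub>r y)) = dim_col (bot_rows k n k A @\<^sub>r y)"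
        using carrier_matD[OF c] by (auto simp: bot_rows_def)
      fix i j assume "i < dim_row (bot_rows k n k A @\<^sub>r y)" "j < dim_col (bot_rows k n k A @\<^sub>r y)"
      then have ij: "i < n + 1" "j < k" using carrier_matD[OF c] by auto
      have "bot_rows k (Suc n) k (A @\<^sub>r y) $$ (i,j) = (A @\<^sub>r y) $$ (k + i, j)" using ij by (simp add: bot_rows_def)
      also have "\<dots> = (if k + i < k + n then A $$ (k + i,j) else y $$ (k + i - (k + n),j))"
        by (rule append_rows_index[OF A y]) (use ij in auto)
      also have "\<dots> = (bot_rows k n k A @\<^sub>r y) $$ (i,j)"
        using append_rows_index[OF bot_rows_carrier y ij, of k A] ij by (auto simp: bot_rows_def)
      finally show "bot_rows k (Suc n) k (A @\<^sub>r y) $$ (i,j) = (bot_rows k n k A @\<^sub>r y) $$ (i,j)" .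
    qed
    have botm: "bot_rows k n k (R * P) = bot_rows k n k R * P" if R: "R \<in> carrier_mat (k + n) k" and P: "P \<in> carrier_mat k k" for R P
    proof -
      have "R = top_rows k k R @\<^sub>r bot_rows k n k R" using append_top_bot[OF R] by simp
      then have "R * P = (top_rows k k R * P) @\<^sub>r (bot_rows k n k R * P)"
        using append_rows_mult[OF top_rows_carrier[of k k R] bot_rows_carrier[of k n k R] P] by simp
      then show ?thesis
        using bot_rows_append(1)[OF mult_carrier_mat[OF top_rows_carrier P] mult_carrier_mat[OF bot_rows_carrier P]] by simp
    qed
    have "(\<integral>\<^sup>+V. F (bot_rows k (Suc n) k V) \<partial>M)
      = (\<integral>\<^sup>+V. (\<integral>\<^sup>+R. F (bot_rows k (Suc n) k ((R * root_cogram k (bot_rows (k + n) 1 k V)) @\<^sub>r bot_rows (k + n) 1 k V)) \<partial>N) \<partial>M)"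
      by (rule haar_split[OF M' N pd mB])
    \<comment> \<open>The frame \<open>R\<close> enters the integrand only through its lower
      \<open>n\<close> rows, so the induction hypothesis evaluates the inner integral.\<close>
    also have "\<dots> = (\<integral>\<^sup>+V. ennreal c0 * \<Phi> (bot_rows (k + n) 1 k V) \<partial>M)"
    proof (rule nn_integral_cong)
      fix V
      define y where "y = bot_rows (k + n) 1 k V"
      have y: "y \<in> carrier_mat 1 k" unfolding y_def by (rule bot_rows_carrier)
      define P where "P = root_cogram k y"
      have P: "P \<in> carrier_mat k k" unfolding P_def by (rule root_cogram_carrier[OF y])
      have "(\<integral>\<^sup>+R. F (bot_rows k (Suc n) k ((R * P) @\<^sub>r y)) \<partial>N) = (\<integral>\<^sup>+R. F ((bot_rows k n k R * P) @\<^sub>r y) \<partial>N)"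
      proof (rule nn_integral_cong)
        fix R assume "R \<in> space N"
        then have R: "R \<in> carrier_mat (k + n) k" by (simp add: is_haarD(3)[OF N])
        show "F (bot_rows k (Suc n) k ((R * P) @\<^sub>r y)) = F ((bot_rows k n k R * P) @\<^sub>r y)"
          using bot[OF mult_carrier_mat[OF R P] y] botm[OF R P] by simp
      qed
      also have "\<dots> = ennreal c0 * \<Phi> y"
        unfolding \<Phi>_def P_def[symmetric]
      proof (rule IH[of "\<lambda>Z. F ((Z * P) @\<^sub>r y)"])
        note [measurable] = measurable_right_mult[OF P, of n]
        show "(\<lambda>Z. F ((Z * P) @\<^sub>r y)) \<in> borel_measurable (mat_borel n k)" using y by measurable
      qed
      finally show "(\<integral>\<^sup>+R. F (bot_rows k (Suc n) k ((R * root_cogram k (bot_rows (k + n) 1 k V)) @\<^sub>r bot_rows (k + n) 1 k V)) \<partial>N)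
        = ennreal c0 * \<Phi> (bot_rows (k + n) 1 k V)" by (simp only: y_def P_def)
    qed
    also have "\<dots> = ennreal c1 * (\<integral>\<^sup>+y. ennreal c0 * \<Phi> y * ennreal (row_density (Suc n) y) \<partial>leb_mat 1 k)"
      by (rule row[of "\<lambda>y. ennreal c0 * \<Phi> y"]) measurable
    also have "(\<integral>\<^sup>+y. ennreal c0 * \<Phi> y * ennreal (row_density (Suc n) y) \<partial>leb_mat 1 k)
      = ennreal c0 * (\<integral>\<^sup>+y. \<Phi> y * ennreal (row_density (Suc n) y) \<partial>leb_mat 1 k)"
      unfolding mult.assoc by (rule nn_integral_cmult) measurable
    \<comment> \<open>On the domain the row density is \<open>det P ^ n / det P\<close> with
      \<open>P\<close> the root of \<open>y\<close>, the factor of the fibre formula; off the domain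
      both sides vanish.\<close>
    also have "(\<integral>\<^sup>+y. \<Phi> y * ennreal (row_density (Suc n) y) \<partial>leb_mat 1 k)
      = (\<integral>\<^sup>+y. (\<integral>\<^sup>+Z. F (Z @\<^sub>r y) * ennreal (stiefel_density k (Z @\<^sub>r y)) \<partial>leb_mat n k) \<partial>leb_mat 1 k)"
    proof (rule nn_integral_cong)
      fix y assume "y \<in> space (leb_mat 1 k)"
      then have y: "y \<in> carrier_mat 1 k" by simp
      have "row_density (Suc n) y = det (root_cogram k y) ^ n / det (root_cogram k y)" if "sym_pd k (cogram k y)"
        unfolding row_density_eq[OF y] using root_cogram_pd(3)[OF that] that by (simp add: stiefel_density_def)
      moreover have "row_density (Suc n) y = 0" if "\<not> sym_pd k (cogram k y)"
        unfolding row_density_eq[OF y] using that by (simp add: stiefel_density_def)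
      ultimately show "\<Phi> y * ennreal (row_density (Suc n) y) = (\<integral>\<^sup>+Z. F (Z @\<^sub>r y) * ennreal (stiefel_density k (Z @\<^sub>r y)) \<partial>leb_mat n k)"
        unfolding nn_integral_stiefel_density_fiber[OF y F] \<Phi>_def by (simp add: mult.commute)
    qed
    also have "\<dots> = (\<integral>\<^sup>+Z. (\<integral>\<^sup>+y. F (Z @\<^sub>r y) * ennreal (stiefel_density k (Z @\<^sub>r y)) \<partial>leb_mat 1 k) \<partial>leb_mat n k)"
      by (rule LL.Fubini'[symmetric]) measurable
    also have "\<dots> = (\<integral>\<^sup>+Z. F Z * ennreal (stiefel_density k Z) \<partial>leb_mat (n + 1) k)"
      by (rule nn_integral_leb_mat_append_rows[symmetric]) measurable
    finally show "(\<integral>\<^sup>+V. F (bot_rows k (Suc n) k V) \<partial>M) = ennreal (c1 * c0) * (\<integral>\<^sup>+Z. F Z * ennreal (stiefel_density k Z) \<partial>leb_mat (Suc n) k)"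
      using c0 c1 by (simp add: ennreal_mult mult.assoc)
  qed
qed

section \<open>Right rotations and the representation of a uniform frame\<close>

lemma psd_sqrt_pos_conj:
  assumes A: "A \<in> carrier_mat n n" "A\<^sup>T = A" and R: "R \<in> stiefel n n"
  shows "psd_sqrt_pos (R\<^sup>T * A * R) = R\<^sup>T * psd_sqrt_pos A * R"
proof -
  note Rs = stiefel_square[OF R]
  obtain W d where W: "spectral_decomp n A W d" using spectral_theorem[OF A] by auto
  have Ws: "W \<in> stiefel n n" and AW: "A = W * mat_diag n d * W\<^sup>T" using W by (auto simp: spectral_decomp_def)
  note Wc = stiefel_square(1)[OF Ws]
  have RT: "R\<^sup>T \<in> carrier_mat n n" "W\<^sup>T \<in> carrier_mat n n" using Rs Wc by auto
  have conj: "R\<^sup>T * (W * mat_diag n f * W\<^sup>T) * R = (R\<^sup>T * W) * mat_diag n f * (R\<^sup>T * W)\<^sup>T" for f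
  proof -
    have "(R\<^sup>T * W)\<^sup>T = W\<^sup>T * R" using transpose_mult[OF RT(1) Wc] by simp
    then show ?thesis using Rs(1) Wc RT by (simp add: assoc_square[where n=n] mult_carrier_square)
  qed
  have "spectral_decomp n (R\<^sup>T * A * R) (R\<^sup>T * W) d"
    unfolding spectral_decomp_def AW conj using stiefel_mult[OF Rs(4) Ws] by simp
  from psd_sqrt_pos_eq[OF this] show ?thesis unfolding psd_sqrt_pos_eq[OF W] conj .
qed

lemma cogram_right_orth:
  assumes Z: "Z \<in> carrier_mat n k" and R: "R \<in> stiefel k k"
  shows "cogram k (Z * R) = R\<^sup>T * cogram k Z * R"
proof -
  note Rs = stiefel_square[OF R]
  have g: "Z\<^sup>T * Z \<in> carrier_mat k k" "Z\<^sup>T \<in> carrier_mat k n" "R\<^sup>T \<in> carrier_mat k k" using Z Rs by auto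
  have ZR: "Z * R \<in> carrier_mat n k" using Z Rs by (intro mult_carrier_mat)
  have "(Z * R)\<^sup>T * (Z * R) = R\<^sup>T * Z\<^sup>T * (Z * R)" using transpose_mult[OF Z Rs(1)] by simp
  also have "\<dots> = R\<^sup>T * (Z\<^sup>T * (Z * R))" by (rule assoc_mult_mat[OF g(3,2) ZR])
  also have "Z\<^sup>T * (Z * R) = (Z\<^sup>T * Z) * R" by (rule assoc_mult_mat[OF g(2) Z Rs(1), symmetric])
  also have "R\<^sup>T * ((Z\<^sup>T * Z) * R) = R\<^sup>T * (Z\<^sup>T * Z) * R" by (rule assoc_square[OF g(3,1) Rs(1), symmetric])
  finally have 1: "(Z * R)\<^sup>T * (Z * R) = R\<^sup>T * (Z\<^sup>T * Z) * R" .
  have "R\<^sup>T * cogram k Z * R = (R\<^sup>T * 1\<^sub>m k - R\<^sup>T * (Z\<^sup>T * Z)) * R"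
    unfolding cogram_def using mult_minus_distrib_mat[OF g(3) _ g(1), of "1\<^sub>m k"] by simp
  also have "\<dots> = R\<^sup>T * 1\<^sub>m k * R - R\<^sup>T * (Z\<^sup>T * Z) * R"
    using Rs g by (intro minus_mult_distrib_mat[of _ k k]) (auto intro: mult_carrier_square)
  also have "\<dots> = cogram k (Z * R)" using Rs(2) right_mult_one_mat[OF g(3)] 1 by (simp add: cogram_def)
  finally show ?thesis by simp
qed

lemma stiefel_density_right_orth:
  assumes Z: "Z \<in> carrier_mat n k" and R: "R \<in> stiefel k k"
  shows "stiefel_density k (Z * R) = stiefel_density k Z"
proof -
  note Rs = stiefel_square[OF R] and c = cogram_carrier[OF Z]
  have dR: "det R \<noteq> 0" using det_stiefel[OF R] by auto
  have RT: "R\<^sup>T \<in> carrier_mat k k" "det (R\<^sup>T) \<noteq> 0" using Rs det_transpose[OF Rs(1)] dR by auto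
  have "sym_pd k (R\<^sup>T * cogram k Z * R) \<longleftrightarrow> sym_pd k (cogram k Z)"
  proof
    assume "sym_pd k (R\<^sup>T * cogram k Z * R)"
    then have "sym_pd k ((R\<^sup>T)\<^sup>T * (R\<^sup>T * cogram k Z * R) * R\<^sup>T)" by (rule sym_pd_congruence[OF RT])
    also have "(R\<^sup>T)\<^sup>T * (R\<^sup>T * cogram k Z * R) * R\<^sup>T = R * (R\<^sup>T * (cogram k Z * (R * R\<^sup>T)))"
      using Rs(1) RT c by (simp only: transpose_transpose assoc_square[where n=k] mult_carrier_square)
    also have "\<dots> = (R * R\<^sup>T) * cogram k Z"
      using Rs RT c assoc_square[OF Rs(1) RT(1) c] by simp
    also have "\<dots> = cogram k Z" using Rs c by simp
    finally show "sym_pd k (cogram k Z)" .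
  qed (rule sym_pd_congruence[OF Rs(1) dR])
  moreover have "det (R\<^sup>T * cogram k Z * R) = det (cogram k Z) * (det R * det R)"
    by (simp only: det_mult[OF mult_carrier_square[OF RT(1) c] Rs(1)] det_mult[OF RT(1) c] det_transpose[OF Rs(1)] mult_ac)
  ultimately show ?thesis unfolding stiefel_density_def cogram_right_orth[OF assms] by (simp add: det_stiefel[OF R])
qed

text \<open>The root is conjugated along with its argument, so the root at \<open>Z * R\<close> is
  \<open>R\<^sup>T * root_cogram k Z * R\<close>, and \<open>R\<close> cancels
  \<open>R\<^sup>T\<close>.\<close>

lemma root_cogram_right_orth:
  assumes Z: "Z \<in> carrier_mat n k" and R: "R \<in> stiefel k k"
  shows "R * root_cogram k (Z * R) = root_cogram k Z * R"
proof -
  note Rs = stiefel_square[OF R] and P = root_cogram_carrier[OF Z]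
  have RT: "R\<^sup>T \<in> carrier_mat k k" using Rs by simp
  have PR: "root_cogram k Z * R \<in> carrier_mat k k" using P Rs by (intro mult_carrier_square)
  have "root_cogram k (Z * R) = R\<^sup>T * root_cogram k Z * R"
    unfolding root_cogram_def cogram_right_orth[OF assms] by (rule psd_sqrt_pos_conj[OF cogram_carrier[OF Z] cogram_transpose[OF Z] R])
  also have "\<dots> = R\<^sup>T * (root_cogram k Z * R)" by (rule assoc_square[OF RT P Rs(1)])
  finally have "R * root_cogram k (Z * R) = (R * R\<^sup>T) * (root_cogram k Z * R)"
    using assoc_square[OF Rs(1) RT PR] by simp
  then show ?thesis using Rs(3) left_mult_one_mat[OF PR] by simp
qed

text \<open>The frame with lower block \<open>Z\<close> whose upper block is symmetric and positive.
  The expression \<open>frame k Z * R\<close> with \<open>R\<close> orthogonal is the polar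
  decomposition with respect to the upper block.\<close>

definition frame :: "nat \<Rightarrow> real mat \<Rightarrow> real mat" where
  "frame k Z = root_cogram k Z @\<^sub>r Z"

lemma frame_carrier: "Z \<in> carrier_mat n k \<Longrightarrow> frame k Z \<in> carrier_mat (k + n) k"
  unfolding frame_def by (intro carrier_append_rows root_cogram_carrier)

lemma measurable_frame: "frame k \<in> mat_borel n k \<rightarrow>\<^sub>M mat_borel (k + n) k"
  unfolding frame_def by (rule measurable_append_rows[OF measurable_root_cogram]) measurable

text \<open>\<open>haar_split\<close> leaves the rotation on the left of the upper block alone.
  Substituting \<open>Z * R\<close> for the lower block moves it to the right of the whole frame,
  since the root at \<open>Z * R\<close> times \<open>R\<close> from the left is
  \<open>root_cogram k Z * R\<close>; Lebesgue measure and the density are unchanged by right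
  rotations.\<close>

theorem haar_representation:
  assumes M: "is_haar (k + n) k M" and N: "is_haar k k N"
  obtains c :: real where "0 < c" "\<And>F. F \<in> borel_measurable (mat_borel (k + n) k) \<Longrightarrow>
    (\<integral>\<^sup>+V. F V \<partial>M) = ennreal c * (\<integral>\<^sup>+Z. (\<integral>\<^sup>+R. F (frame k Z * R) \<partial>N) * ennreal (stiefel_density k Z) \<partial>leb_mat n k)"
proof -
  note sM[measurable_cong] = is_haarD(2)[OF M] and sN[measurable_cong] = is_haarD(2)[OF N]
  interpret M: prob_space M by (rule is_haarD(1)[OF M])
  interpret N: prob_space N by (rule is_haarD(1)[OF N])
  interpret L: sigma_finite_measure "leb_mat n k" by (rule sigma_finite_leb_mat)
  interpret LN: pair_sigma_finite "leb_mat n k" N by unfold_locales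
  obtain c where c: "0 < c" and law: "\<And>F. F \<in> borel_measurable (mat_borel n k) \<Longrightarrow>
    (\<integral>\<^sup>+V. F (bot_rows k n k V) \<partial>M) = ennreal c * (\<integral>\<^sup>+Z. F Z * ennreal (stiefel_density k Z) \<partial>leb_mat n k)"
    using haar_bot_rows_law[OF M] by blast
  note mb = measurable_bot_rows[of k n k]
  have pd: "AE V in M. sym_pd k (cogram k (bot_rows k n k V))"
  proof -
    let ?A = "{y \<in> space (mat_borel n k). \<not> sym_pd k (cogram k y)}"
    have A: "?A \<in> sets (mat_borel n k)"
      using pred_cogram_pd[where n=n and k=k] by (intro sets.sets_Collect_neg) (simp only: pred_def)
    have "(\<integral>\<^sup>+V. indicator ?A (bot_rows k n k V) \<partial>M) = ennreal c * (\<integral>\<^sup>+Z. indicator ?A Z * ennreal (stiefel_density k Z) \<partial>leb_mat n k)"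
      by (rule law) (use A in simp)
    also have "(\<integral>\<^sup>+Z. indicator ?A Z * ennreal (stiefel_density k Z) \<partial>leb_mat n k) = (\<integral>\<^sup>+y. 0 \<partial>leb_mat n k)"
      by (rule nn_integral_cong) (auto simp: stiefel_density_def split: split_indicator)
    finally have "(\<integral>\<^sup>+V. indicator ?A (bot_rows k n k V) \<partial>M) = 0" by simp
    moreover have "(\<lambda>V. indicator ?A (bot_rows k n k V) :: ennreal) \<in> borel_measurable M"
      using measurable_compose[OF mb borel_measurable_indicator[OF A]] sM by (simp cong: measurable_cong_sets)
    ultimately have "AE V in M. (indicator ?A (bot_rows k n k V) :: ennreal) = 0"
      by (subst (asm) nn_integral_0_iff_AE) auto
    then show ?thesis by eventually_elim (auto split: split_indicator_asm)
  qed
  show ?thesis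
  proof (rule that[OF c])
    fix F :: "real mat \<Rightarrow> ennreal" assume F: "F \<in> borel_measurable (mat_borel (k + n) k)"
    note mr[measurable] = measurable_compose[OF _ measurable_root_cogram[of k n]] and mf[measurable] = measurable_compose[OF _ measurable_frame[of k n]]
    have m1: "(\<lambda>x. (snd x * root_cogram k (fst x)) @\<^sub>r fst x) \<in> leb_mat n k \<Otimes>\<^sub>M N \<rightarrow>\<^sub>M mat_borel (k + n) k"
      by (rule measurable_append_rows[OF measurable_mat_mult[where l=k]]) measurable
    have m2: "(\<lambda>x. frame k (fst x) * snd x) \<in> leb_mat n k \<Otimes>\<^sub>M N \<rightarrow>\<^sub>M mat_borel (k + n) k"
      by (rule measurable_mat_mult[where l=k]) measurable
    note [measurable] = measurable_compose[OF m1 F] measurable_compose[OF m2 F]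
    define G where "G = (\<lambda>Y. \<integral>\<^sup>+R. F ((R * root_cogram k Y) @\<^sub>r Y) \<partial>N)"
    have G[measurable]: "G \<in> borel_measurable (mat_borel n k)"
    proof -
      have "(\<lambda>Y. \<integral>\<^sup>+R. F ((R * root_cogram k Y) @\<^sub>r Y) \<partial>N) \<in> borel_measurable (leb_mat n k)"
        using measurable_compose[OF m1 F] by (intro N.borel_measurable_nn_integral) (simp add: case_prod_unfold)
      then show ?thesis by (simp add: G_def cong: measurable_cong_sets)
    qed
    have "(\<integral>\<^sup>+V. F V \<partial>M) = (\<integral>\<^sup>+V. G (bot_rows k n k V) \<partial>M)"
      unfolding G_def by (rule haar_split[OF M N pd F])
    also have "\<dots> = ennreal c * (\<integral>\<^sup>+Y. G Y * ennreal (stiefel_density k Y) \<partial>leb_mat n k)" by (rule law[OF G])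
    also have "(\<integral>\<^sup>+Y. G Y * ennreal (stiefel_density k Y) \<partial>leb_mat n k)
      = (\<integral>\<^sup>+Y. (\<integral>\<^sup>+R. F ((R * root_cogram k Y) @\<^sub>r Y) * ennreal (stiefel_density k Y) \<partial>N) \<partial>leb_mat n k)"
    proof (rule nn_integral_cong)
      fix Y assume Y: "Y \<in> space (leb_mat n k)"
      have "(\<lambda>R. (Y, R)) \<in> N \<rightarrow>\<^sub>M leb_mat n k \<Otimes>\<^sub>M N" using Y by measurable
      from measurable_compose[OF this measurable_compose[OF m1 F]]
      have "(\<lambda>R. F ((R * root_cogram k Y) @\<^sub>r Y)) \<in> borel_measurable N" by simp
      from nn_integral_multc[OF this]
      show "G Y * ennreal (stiefel_density k Y) = (\<integral>\<^sup>+R. F ((R * root_cogram k Y) @\<^sub>r Y) * ennreal (stiefel_density k Y) \<partial>N)"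
        by (simp add: G_def)
    qed
    \<comment> \<open>The order of integration is exchanged because the substitution is made for
      fixed \<open>R\<close>.\<close>
    also have "\<dots> = (\<integral>\<^sup>+R. (\<integral>\<^sup>+Y. F ((R * root_cogram k Y) @\<^sub>r Y) * ennreal (stiefel_density k Y) \<partial>leb_mat n k) \<partial>N)"
      by (rule LN.Fubini'[symmetric]) (simp add: case_prod_unfold, measurable)
    also have "\<dots> = (\<integral>\<^sup>+R. (\<integral>\<^sup>+Z. F (frame k Z * R) * ennreal (stiefel_density k Z) \<partial>leb_mat n k) \<partial>N)"
    proof (rule nn_integral_cong_AE)
      show "AE R in N. (\<integral>\<^sup>+Y. F ((R * root_cogram k Y) @\<^sub>r Y) * ennreal (stiefel_density k Y) \<partial>leb_mat n k)
        = (\<integral>\<^sup>+Z. F (frame k Z * R) * ennreal (stiefel_density k Z) \<partial>leb_mat n k)"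
        using is_haarD(4)[OF N]
      proof eventually_elim
        case (elim R)
        note Rc = stiefel_carrier[OF elim]
        let ?H = "\<lambda>Y. F ((R * root_cogram k Y) @\<^sub>r Y) * ennreal (stiefel_density k Y)"
        have "R \<in> space N" using Rc by (simp add: is_haarD(3)[OF N])
        then have "(\<lambda>Y. (Y, R)) \<in> mat_borel n k \<rightarrow>\<^sub>M leb_mat n k \<Otimes>\<^sub>M N" by measurable
        from measurable_compose[OF this measurable_compose[OF m1 F]]
        have [measurable]: "(\<lambda>Y. F ((R * root_cogram k Y) @\<^sub>r Y)) \<in> borel_measurable (mat_borel n k)" by simp
        have "(\<integral>\<^sup>+Y. ?H Y \<partial>leb_mat n k) = (\<integral>\<^sup>+Z. ?H (Z * R) \<partial>leb_mat n k)"
          by (rule nn_integral_leb_mat_right_orth[OF elim, symmetric]) measurable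
        also have "\<dots> = (\<integral>\<^sup>+Z. F (frame k Z * R) * ennreal (stiefel_density k Z) \<partial>leb_mat n k)"
        proof (rule nn_integral_cong)
          fix Z assume "Z \<in> space (leb_mat n k)"
          then have Z: "Z \<in> carrier_mat n k" by simp
          have "(R * root_cogram k (Z * R)) @\<^sub>r (Z * R) = frame k Z * R"
            unfolding root_cogram_right_orth[OF Z elim] frame_def
            by (rule append_rows_mult[OF root_cogram_carrier[OF Z] Z Rc, symmetric])
          then show "?H (Z * R) = F (frame k Z * R) * ennreal (stiefel_density k Z)"
            by (simp add: stiefel_density_right_orth[OF Z elim])
        qed
        finally show ?case .
      qed
    qed
    also have "\<dots> = (\<integral>\<^sup>+Z. (\<integral>\<^sup>+R. F (frame k Z * R) * ennreal (stiefel_density k Z) \<partial>N) \<partial>leb_mat n k)"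
      by (rule LN.Fubini') (simp add: case_prod_unfold, measurable)
    also have "\<dots> = (\<integral>\<^sup>+Z. (\<integral>\<^sup>+R. F (frame k Z * R) \<partial>N) * ennreal (stiefel_density k Z) \<partial>leb_mat n k)"
    proof (rule nn_integral_cong)
      fix Z assume Z: "Z \<in> space (leb_mat n k)"
      have "(\<lambda>R. (Z, R)) \<in> N \<rightarrow>\<^sub>M leb_mat n k \<Otimes>\<^sub>M N" using Z by measurable
      from measurable_compose[OF this measurable_compose[OF m2 F]]
      have "(\<lambda>R. F (frame k Z * R)) \<in> borel_measurable N" by simp
      from nn_integral_multc[OF this]
      show "(\<integral>\<^sup>+R. F (frame k Z * R) * ennreal (stiefel_density k Z) \<partial>N) = (\<integral>\<^sup>+R. F (frame k Z * R) \<partial>N) * ennreal (stiefel_density k Z)" by simp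
    qed
    finally show "(\<integral>\<^sup>+V. F V \<partial>M) = ennreal c * (\<integral>\<^sup>+Z. (\<integral>\<^sup>+R. F (frame k Z * R) \<partial>N) * ennreal (stiefel_density k Z) \<partial>leb_mat n k)" .
  qed
qed

section \<open>Gaussian matrices\<close>

lemma nn_integral_leb_mat_prod:
  assumes g: "\<And>ij. g ij \<in> borel_measurable borel"
  shows "(\<integral>\<^sup>+Z. (\<Prod>ij\<in>{..<n} \<times> {..<k}. g ij (Z $$ ij)) \<partial>leb_mat n k) = (\<Prod>ij\<in>{..<n} \<times> {..<k}. \<integral>\<^sup>+x. g ij x \<partial>lborel)"
proof -
  let ?I = "{..<n} \<times> {..<k}"
  interpret product_sigma_finite "\<lambda>_::nat\<times>nat. lborel :: real measure"
    by (simp add: product_sigma_finite_def sigma_finite_lborel)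
  have e: "(\<lambda>Z. g ij (Z $$ ij)) \<in> borel_measurable (mat_borel n k)" if "ij \<in> ?I" for ij
    using measurable_compose[OF measurable_entry0 g, of "fst ij" n "snd ij" k ij] that by auto
  have mm: "(\<lambda>Z. \<Prod>ij\<in>?I. g ij (Z $$ ij)) \<in> borel_measurable (mat_borel n k)"
    by (rule borel_measurable_prod_ennreal) (use e in auto)
  have "(\<integral>\<^sup>+Z. (\<Prod>ij\<in>?I. g ij (Z $$ ij)) \<partial>leb_mat n k) = (\<integral>\<^sup>+z. (\<Prod>ij\<in>?I. g ij (Matrix.mat n k z $$ ij)) \<partial>(\<Pi>\<^sub>M ij\<in>?I. lborel))"
    unfolding prod_mat_def by (rule nn_integral_distr[OF measurable_mat_of_PiM]) (use mm in simp_all)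
  also have "\<dots> = (\<integral>\<^sup>+z. (\<Prod>ij\<in>?I. g ij (z ij)) \<partial>(\<Pi>\<^sub>M ij\<in>?I. lborel))"
    by (intro nn_integral_cong prod.cong refl) auto
  also have "\<dots> = (\<Prod>ij\<in>?I. \<integral>\<^sup>+x. g ij x \<partial>lborel)"
    by (rule product_nn_integral_prod) (use g in auto)
  finally show ?thesis .
qed

definition gaussian_density :: "nat \<Rightarrow> nat \<Rightarrow> (nat \<Rightarrow> nat \<Rightarrow> real) \<Rightarrow> real mat \<Rightarrow> real" where
  "gaussian_density n k v Z = (\<Prod>(i, j)\<in>{..<n} \<times> {..<k}. normal_density 0 (sqrt (v i j)) (Z $$ (i, j)))"

lemma gaussian_density_nonneg: "0 \<le> gaussian_density n k v Z"
  by (auto simp: gaussian_density_def intro!: prod_nonneg)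

lemma measurable_gaussian_density[measurable]: "gaussian_density n k v \<in> borel_measurable (mat_borel n k)"
  unfolding gaussian_density_def
  by (intro borel_measurable_prod) (auto intro!: measurable_compose[OF measurable_entry0 borel_measurable_normal_density])

lemma gaussian_mat_eq: "gaussian_mat n k v = density (leb_mat n k) (\<lambda>Z. ennreal (gaussian_density n k v Z))"
proof -
  let ?I = "{..<n} \<times> {..<k}"
  define f where "f = (\<lambda>(i, j). normal_density 0 (sqrt (v i j)))"
  have f[measurable]: "f ij \<in> borel_measurable borel" for ij by (cases ij) (simp add: f_def)
  have f0: "0 \<le> f ij x" for ij x by (cases ij) (simp add: f_def)
  define N where "N = (\<lambda>ij. density lborel (\<lambda>x. ennreal (f ij x)))"
  have "gaussian_mat n k v = prod_mat n k N"
    unfolding gaussian_mat_def prod_mat_def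
    by (intro arg_cong2[where f="\<lambda>A B. distr A B _"] PiM_cong refl) (auto simp: N_def f_def)
  also have "\<dots> = density (leb_mat n k) (\<lambda>Z. ennreal (gaussian_density n k v Z))"
  proof (rule prod_mat_eqI[symmetric])
    show "sigma_finite_measure (N ij)" for ij
      unfolding N_def by (subst sigma_finite_measure.sigma_finite_iff_density_finite[OF sigma_finite_lborel]) auto
    show "sets (N ij) = sets borel" for ij by (simp add: N_def)
    fix B :: "nat \<times> nat \<Rightarrow> real set" assume B: "\<And>ij. B ij \<in> sets borel"
    have "emeasure (density (leb_mat n k) (\<lambda>Z. ennreal (gaussian_density n k v Z))) (mat_box n k B)
      = (\<integral>\<^sup>+Z. ennreal (gaussian_density n k v Z) * indicator (mat_box n k B) Z \<partial>leb_mat n k)"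
      by (rule emeasure_density) (use B in \<open>auto intro!: mat_box_sets\<close>)
    also have "\<dots> = (\<integral>\<^sup>+Z. (\<Prod>ij\<in>?I. ennreal (f ij (Z $$ ij)) * indicator (B ij) (Z $$ ij)) \<partial>leb_mat n k)"
    proof (rule nn_integral_cong)
      fix Z assume "Z \<in> space (leb_mat n k)"
      then have Z: "Z \<in> carrier_mat n k" by simp
      have i: "(indicator (mat_box n k B) Z :: ennreal) = (\<Prod>ij\<in>?I. indicator (B ij) (Z $$ ij))"
      proof (cases "Z \<in> mat_box n k B")
        case True
        then have "\<forall>ij\<in>?I. (indicator (B ij) (Z $$ ij) :: ennreal) = 1" by (auto simp: mat_box_def)
        then have "(\<Prod>ij\<in>?I. (indicator (B ij) (Z $$ ij) :: ennreal)) = 1" by (intro prod.neutral)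
        then show ?thesis using True by simp
      next
        case False
        then obtain i j where "i < n" "j < k" "Z $$ (i,j) \<notin> B (i,j)" using Z by (auto simp: mat_box_def)
        then have "\<exists>ij\<in>?I. (indicator (B ij) (Z $$ ij) :: ennreal) = 0" by (intro bexI[of _ "(i,j)"]) auto
        then have "(\<Prod>ij\<in>?I. (indicator (B ij) (Z $$ ij) :: ennreal)) = 0" by (intro prod_zero) auto
        then show ?thesis using False by simp
      qed
      have d: "gaussian_density n k v Z = (\<Prod>ij\<in>?I. f ij (Z $$ ij))"
        unfolding gaussian_density_def f_def by (intro prod.cong) auto
      show "ennreal (gaussian_density n k v Z) * indicator (mat_box n k B) Z = (\<Prod>ij\<in>?I. ennreal (f ij (Z $$ ij)) * indicator (B ij) (Z $$ ij))"
        unfolding i d by (simp add: prod.distrib prod_ennreal[symmetric] f0)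
    qed
    also have "\<dots> = (\<Prod>ij\<in>?I. \<integral>\<^sup>+x. ennreal (f ij x) * indicator (B ij) x \<partial>lborel)"
      by (rule nn_integral_leb_mat_prod) (use B in measurable)
    also have "\<dots> = (\<Prod>ij\<in>?I. emeasure (N ij) (B ij))"
      unfolding N_def by (intro prod.cong refl emeasure_density[symmetric]) (use B in auto)
    finally show "emeasure (density (leb_mat n k) (\<lambda>Z. ennreal (gaussian_density n k v Z))) (mat_box n k B) = (\<Prod>ij\<in>?I. emeasure (N ij) (B ij))" .
  qed simp
  finally show ?thesis .
qed

lemma prob_space_gaussian_mat:
  assumes v: "\<And>i j. i < n \<Longrightarrow> j < k \<Longrightarrow> 0 < v i j"
  shows "prob_space (gaussian_mat n k v)"
proof
  have "emeasure (gaussian_mat n k v) (space (gaussian_mat n k v)) = (\<integral>\<^sup>+Z. ennreal (gaussian_density n k v Z) \<partial>leb_mat n k)"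
    unfolding gaussian_mat_eq using sets.top[of "mat_borel n k"]
    by (subst emeasure_density) (auto intro!: nn_integral_cong)
  also have "\<dots> = (\<integral>\<^sup>+Z. (\<Prod>ij\<in>{..<n} \<times> {..<k}. ennreal (normal_density 0 (sqrt (v (fst ij) (snd ij))) (Z $$ ij))) \<partial>leb_mat n k)"
    by (intro nn_integral_cong) (simp add: gaussian_density_def prod_ennreal case_prod_unfold)
  also have "\<dots> = (\<Prod>ij\<in>{..<n} \<times> {..<k}. \<integral>\<^sup>+x. ennreal (normal_density 0 (sqrt (v (fst ij) (snd ij))) x) \<partial>lborel)"
    by (rule nn_integral_leb_mat_prod) measurable
  also have "\<dots> = (\<Prod>ij\<in>{..<n} \<times> {..<k}. 1)"
  proof (rule prod.cong[OF refl])
    fix ij assume "ij \<in> {..<n} \<times> {..<k}"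
    then have "0 < sqrt (v (fst ij) (snd ij))" using v by auto
    then have "(\<integral>\<^sup>+x. ennreal (normal_density 0 (sqrt (v (fst ij) (snd ij))) x) \<partial>lborel) = ennreal (\<integral>x. normal_density 0 (sqrt (v (fst ij) (snd ij))) x \<partial>lborel)"
      by (intro nn_integral_eq_integral) auto
    then show "(\<integral>\<^sup>+x. ennreal (normal_density 0 (sqrt (v (fst ij) (snd ij))) x) \<partial>lborel) = 1"
      using \<open>0 < sqrt _\<close> by simp
  qed
  finally show "emeasure (gaussian_mat n k v) (space (gaussian_mat n k v)) = 1" by simp
qed

lemma sets_gaussian_mat[simp, measurable_cong]: "sets (gaussian_mat n k v) = sets (mat_borel n k)"
  by (simp add: gaussian_mat_def)

lemma space_gaussian_mat[simp]: "space (gaussian_mat n k v) = carrier_mat n k"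
  by (simp add: gaussian_mat_def)

lemma nn_integral_gaussian_mat:
  "F \<in> borel_measurable (mat_borel n k) \<Longrightarrow> (\<integral>\<^sup>+Z. F Z \<partial>gaussian_mat n k v) = (\<integral>\<^sup>+Z. ennreal (gaussian_density n k v Z) * F Z \<partial>leb_mat n k)"
  unfolding gaussian_mat_eq by (rule nn_integral_density) auto

section \<open>The Gibbs measure in Gaussian coordinates\<close>

lemma measurable_mat_trace[measurable (raw)]:
  assumes f: "f \<in> M \<rightarrow>\<^sub>M mat_borel n m" and nm: "n \<le> m"
  shows "(\<lambda>x. mat_trace (f x)) \<in> borel_measurable M"
proof -
  have eq: "mat_trace (f x) = (\<Sum>i<n. f x $$ (i,i))" if "x \<in> space M" for x
    using measurable_mat_carrier[OF f that] by (simp add: mat_trace_def)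
  show ?thesis
    by (subst measurable_cong[OF eq], assumption) (intro borel_measurable_sum measurable_entry[OF f], use nm in auto)
qed

lemma measurable_gibbs_weight:
  assumes S: "S \<in> carrier_mat p p"
  shows "gibbs_weight S \<beta> \<in> borel_measurable (mat_borel p k)"
proof -
  have "(\<lambda>V. V\<^sup>T * S * V) \<in> mat_borel p k \<rightarrow>\<^sub>M mat_borel k k"
    by (rule measurable_mat_mult[where l=p, OF measurable_compose[OF measurable_mat_transpose[OF measurable_ident_sets[OF refl]] measurable_right_mult[OF S]]]) auto
  from measurable_mat_trace[OF this] show ?thesis unfolding gibbs_weight_def by measurable
qed

lemma row_sum_squares:
  fixes B :: "real mat"
  assumes "B \<in> carrier_mat n k" "i < n"
  shows "(\<Sum>j<k. (B $$ (i,j))\<^sup>2) = (B * B\<^sup>T) $$ (i,i)"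
  using mult_index[of B n k "B\<^sup>T" n i i] assms by (simp add: power2_eq_square)

lemma row_sum_squares_orth:
  fixes B :: "real mat"
  assumes B: "B \<in> carrier_mat n k" and R: "R \<in> stiefel k k" and i: "i < n"
  shows "(\<Sum>j<k. ((B * R) $$ (i,j))\<^sup>2) = (\<Sum>j<k. (B $$ (i,j))\<^sup>2)"
proof -
  note Rs = stiefel_square[OF R]
  have T: "R\<^sup>T \<in> carrier_mat k k" "B\<^sup>T \<in> carrier_mat k n" "R\<^sup>T * B\<^sup>T \<in> carrier_mat k n"
    using Rs B by (auto intro: mult_carrier_mat)
  have BR: "B * R \<in> carrier_mat n k" using B Rs by (intro mult_carrier_mat)
  have "(B * R) * (B * R)\<^sup>T = B * R * (R\<^sup>T * B\<^sup>T)" using transpose_mult[OF B Rs(1)] by simp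
  also have "\<dots> = B * (R * (R\<^sup>T * B\<^sup>T))" by (rule assoc_mult_mat[OF B Rs(1) T(3)])
  also have "R * (R\<^sup>T * B\<^sup>T) = B\<^sup>T" using assoc_mult_mat[OF Rs(1) T(1,2)] Rs(3) left_mult_one_mat[OF T(2)] by simp
  finally show ?thesis using row_sum_squares[OF BR i] row_sum_squares[OF B i] by simp
qed

lemma mat_trace_conj_diag:
  assumes U: "U \<in> stiefel p p" and B: "B \<in> carrier_mat p k"
  shows "mat_trace ((U * B)\<^sup>T * (U * mat_diag p l * U\<^sup>T) * (U * B)) = (\<Sum>i<p. l i * (\<Sum>j<k. (B $$ (i,j))\<^sup>2))"
proof -
  note Us = stiefel_square[OF U]
  have c: "U\<^sup>T \<in> carrier_mat p p" "B\<^sup>T \<in> carrier_mat k p" "U * B \<in> carrier_mat p k" "mat_diag p l * B \<in> carrier_mat p k"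
    "U * mat_diag p l \<in> carrier_mat p p" "U * mat_diag p l * U\<^sup>T \<in> carrier_mat p p" "B\<^sup>T * U\<^sup>T \<in> carrier_mat k p"
    "U * (mat_diag p l * B) \<in> carrier_mat p k"
    using Us B by (auto intro: mult_carrier_mat[of _ _ p])
  have D: "mat_diag p l \<in> carrier_mat p p" by simp
  have 1: "(U * mat_diag p l * U\<^sup>T) * (U * B) = U * (mat_diag p l * B)"
  proof -
    have "(U * mat_diag p l * U\<^sup>T) * (U * B) = (U * mat_diag p l) * (U\<^sup>T * (U * B))" by (rule assoc_mult_mat[OF c(5,1,3)])
    also have "U\<^sup>T * (U * B) = B" using assoc_mult_mat[OF c(1) Us(1) B] Us(2) left_mult_one_mat[OF B] by simp
    also have "(U * mat_diag p l) * B = U * (mat_diag p l * B)" by (rule assoc_mult_mat[OF Us(1) D B])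
    finally show ?thesis .
  qed
  have "(U * B)\<^sup>T * (U * mat_diag p l * U\<^sup>T) * (U * B) = (B\<^sup>T * U\<^sup>T) * ((U * mat_diag p l * U\<^sup>T) * (U * B))"
    unfolding transpose_mult[OF Us(1) B] by (rule assoc_mult_mat[OF c(7,6,3)])
  also have "\<dots> = B\<^sup>T * (U\<^sup>T * (U * (mat_diag p l * B)))"
    unfolding 1 by (rule assoc_mult_mat[OF c(2,1,8)])
  also have "U\<^sup>T * (U * (mat_diag p l * B)) = mat_diag p l * B"
    using assoc_mult_mat[OF c(1) Us(1) c(4)] Us(2) left_mult_one_mat[OF c(4)] by simp
  finally have eq: "(U * B)\<^sup>T * (U * mat_diag p l * U\<^sup>T) * (U * B) = B\<^sup>T * (mat_diag p l * B)" .
  have kk: "B\<^sup>T * (mat_diag p l * B) \<in> carrier_mat k k" by (rule mult_carrier_mat[OF c(2,4)])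
  have "mat_trace (B\<^sup>T * (mat_diag p l * B)) = (\<Sum>j<k. (B\<^sup>T * (mat_diag p l * B)) $$ (j,j))"
    unfolding mat_trace_def using carrier_matD(1)[OF kk] by (rule arg_cong[where f="\<lambda>n. sum _ {..<n}"])
  also have "\<dots> = (\<Sum>j<k. \<Sum>i<p. l i * (B $$ (i,j))\<^sup>2)"
  proof (rule sum.cong[OF refl])
    fix j assume "j \<in> {..<k}"
    then have j: "j < k" by simp
    have "(B\<^sup>T * (mat_diag p l * B)) $$ (j,j) = (\<Sum>i<p. B\<^sup>T $$ (j,i) * (mat_diag p l * B) $$ (i,j))"
      by (rule mult_index[OF c(2,4) j j])
    also have "\<dots> = (\<Sum>i<p. l i * (B $$ (i,j))\<^sup>2)"
      using B j by (intro sum.cong refl) (simp add: mat_diag_mult_left[OF B] power2_eq_square)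
    finally show "(B\<^sup>T * (mat_diag p l * B)) $$ (j,j) = (\<Sum>i<p. l i * (B $$ (i,j))\<^sup>2)" .
  qed
  also have "\<dots> = (\<Sum>i<p. l i * (\<Sum>j<k. (B $$ (i,j))\<^sup>2))"
    unfolding sum_distrib_left by (rule sum.swap)
  finally show ?thesis unfolding eq .
qed

text \<open>The trace sees only the squared row norms of \<open>frame k Z * R\<close>, which do not
  depend on \<open>R\<close>. Row \<open>i\<close> of the symmetric root has squared norm equal to
  the diagonal entry \<open>(i,i)\<close> of \<open>cogram k Z\<close>, that is 1 minus the squared
  norm of column \<open>i\<close> of \<open>Z\<close>.\<close>

lemma mat_trace_frame:
  assumes Z: "Z \<in> carrier_mat n k" and pd: "sym_pd k (cogram k Z)" and R: "R \<in> stiefel k k" and U: "U \<in> stiefel (k + n) (k + n)"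
  shows "mat_trace ((U * (frame k Z * R))\<^sup>T * (U * mat_diag (k + n) l * U\<^sup>T) * (U * (frame k Z * R)))
    = (\<Sum>j<k. l j) - (\<Sum>i<n. \<Sum>j<k. (l j - l (k + i)) * (Z $$ (i,j))\<^sup>2)"
proof -
  note P = root_cogram_pd[OF pd] and f = frame_carrier[OF Z]
  have fR: "frame k Z * R \<in> carrier_mat (k + n) k" by (rule mult_carrier_mat[OF f stiefel_carrier[OF R]])
  have top: "(\<Sum>j<k. (frame k Z $$ (i,j))\<^sup>2) = 1 - (\<Sum>r<n. (Z $$ (r,i))\<^sup>2)" if i: "i < k" for i
  proof -
    have "(\<Sum>j<k. (frame k Z $$ (i,j))\<^sup>2) = (\<Sum>j<k. (root_cogram k Z $$ (i,j))\<^sup>2)"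
      using append_rows_index[OF P(4) Z] i by (intro sum.cong) (auto simp: frame_def)
    also have "\<dots> = cogram k Z $$ (i,i)" using row_sum_squares[OF P(4) i] P(2,5) by simp
    also have "\<dots> = 1 - (Z\<^sup>T * Z) $$ (i,i)" unfolding cogram_def using Z i by (subst index_minus_mat(1)) auto
    also have "(Z\<^sup>T * Z) $$ (i,i) = (\<Sum>r<n. (Z $$ (r,i))\<^sup>2)"
      using mult_index[of "Z\<^sup>T" k n Z k i i] Z i by (simp add: power2_eq_square)
    finally show ?thesis .
  qed
  have bot: "(\<Sum>j<k. (frame k Z $$ (k + i,j))\<^sup>2) = (\<Sum>j<k. (Z $$ (i,j))\<^sup>2)" if i: "i < n" for i
    using append_rows_index[OF P(4) Z] i by (intro sum.cong) (auto simp: frame_def)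
  have "(\<Sum>i<k + n. l i * (\<Sum>j<k. ((frame k Z * R) $$ (i,j))\<^sup>2)) = (\<Sum>i<k + n. l i * (\<Sum>j<k. (frame k Z $$ (i,j))\<^sup>2))"
    by (intro sum.cong refl) (simp add: row_sum_squares_orth[OF f R])
  also have "\<dots> = (\<Sum>i<k. l i * (\<Sum>j<k. (frame k Z $$ (i,j))\<^sup>2)) + (\<Sum>i<n. l (k + i) * (\<Sum>j<k. (frame k Z $$ (k + i,j))\<^sup>2))"
    by (induction n) (auto simp: add.assoc)
  also have "\<dots> = (\<Sum>j<k. l j * (1 - (\<Sum>r<n. (Z $$ (r,j))\<^sup>2))) + (\<Sum>i<n. l (k + i) * (\<Sum>j<k. (Z $$ (i,j))\<^sup>2))"
    by (simp add: top bot)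
  also have "\<dots> = (\<Sum>j<k. l j) - ((\<Sum>j<k. \<Sum>i<n. l j * (Z $$ (i,j))\<^sup>2) - (\<Sum>i<n. \<Sum>j<k. l (k + i) * (Z $$ (i,j))\<^sup>2))"
    by (simp add: right_diff_distrib sum_subtractf sum_distrib_left)
  also have "(\<Sum>j<k. \<Sum>i<n. l j * (Z $$ (i,j))\<^sup>2) = (\<Sum>i<n. \<Sum>j<k. l j * (Z $$ (i,j))\<^sup>2)" by (rule sum.swap)
  finally show ?thesis unfolding mat_trace_conj_diag[OF U fR] by (simp add: sum_subtractf left_diff_distrib)
qed

lemma gaussian_density_exp:
  assumes a: "\<And>i j. i < n \<Longrightarrow> j < k \<Longrightarrow> 0 < a i j"
  obtains K where "0 < K" "\<And>Z. gaussian_density n k (\<lambda>i j. 1 / a i j) Z = K * exp (- (\<Sum>i<n. \<Sum>j<k. a i j * (Z $$ (i,j))\<^sup>2) / 2)"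
proof -
  define K where "K = (\<Prod>(i,j)\<in>{..<n} \<times> {..<k}. 1 / sqrt (2 * pi * (1 / a i j)))"
  have K0: "0 < K" unfolding K_def using a by (intro prod_pos) auto
  have main: "gaussian_density n k (\<lambda>i j. 1 / a i j) Z = K * exp (- (\<Sum>i<n. \<Sum>j<k. a i j * (Z $$ (i,j))\<^sup>2) / 2)" for Z
  proof -
  have "gaussian_density n k (\<lambda>i j. 1 / a i j) Z
    = (\<Prod>(i,j)\<in>{..<n} \<times> {..<k}. 1 / sqrt (2 * pi * (1 / a i j)) * exp (- (a i j * (Z $$ (i,j))\<^sup>2) / 2))"
    unfolding gaussian_density_def normal_density_def
  proof (rule prod.cong[OF refl])
    fix ij assume ij0: "ij \<in> {..<n} \<times> {..<k}"
    obtain i j where ij: "ij = (i, j)" by (cases ij)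
    then have "0 < a i j" using a ij0 by auto
    then have "1 / sqrt (2 * pi * (sqrt (1 / a i j))\<^sup>2) * exp (- (Z $$ (i, j) - 0)\<^sup>2 / (2 * (sqrt (1 / a i j))\<^sup>2))
      = 1 / sqrt (2 * pi * (1 / a i j)) * exp (- (a i j * (Z $$ (i, j))\<^sup>2) / 2)"
      by (simp add: field_simps)
    then show "(case ij of (i, j) \<Rightarrow> 1 / sqrt (2 * pi * (sqrt (1 / a i j))\<^sup>2) * exp (- (Z $$ (i, j) - 0)\<^sup>2 / (2 * (sqrt (1 / a i j))\<^sup>2)))
      = (case ij of (i, j) \<Rightarrow> 1 / sqrt (2 * pi * (1 / a i j)) * exp (- (a i j * (Z $$ (i, j))\<^sup>2) / 2))"
      by (simp only: ij prod.case)
  qed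
  also have "\<dots> = K * (\<Prod>(i,j)\<in>{..<n} \<times> {..<k}. exp (- (a i j * (Z $$ (i,j))\<^sup>2) / 2))"
    unfolding K_def by (simp only: prod.distrib[symmetric] case_prod_unfold)
  also have "(\<Prod>(i,j)\<in>{..<n} \<times> {..<k}. exp (- (a i j * (Z $$ (i,j))\<^sup>2) / 2)) = exp (\<Sum>(i,j)\<in>{..<n} \<times> {..<k}. - (a i j * (Z $$ (i,j))\<^sup>2) / 2)"
    by (subst exp_sum) (auto simp: case_prod_unfold)
  also have "(\<Sum>(i,j)\<in>{..<n} \<times> {..<k}. - (a i j * (Z $$ (i,j))\<^sup>2) / 2) = - (\<Sum>i<n. \<Sum>j<k. a i j * (Z $$ (i,j))\<^sup>2) / 2"
    by (simp add: sum.cartesian_product[symmetric] sum_negf sum_divide_distrib)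
  finally show ?thesis .
  qed
  show ?thesis by (rule that[OF K0 main])
qed

definition gibbs_variance :: "real mat \<Rightarrow> real \<Rightarrow> nat \<Rightarrow> nat \<Rightarrow> nat \<Rightarrow> real" where
  "gibbs_variance S \<beta> k i j = 1 / (\<beta> * real (dim_row S) * (eigval S (j + 1) - eigval S (k + (i + 1))))"

lemma gibbs_approx_eq:
  assumes "dim_row S = k + n"
  shows "gibbs_approx S U \<beta> k = distr (gaussian_mat n k (gibbs_variance S \<beta> k) \<Otimes>\<^sub>M stiefel_uniform k k)
    (mat_borel (k + n) k) (\<lambda>(Z, Q). U * frame k Z * Q)"
  using assms unfolding gibbs_approx_def Let_def frame_def root_cogram_def psd_sqrt_pos_def cogram_def gibbs_variance_def
  by simp

context
  fixes k n :: nat and S U :: "real mat" and \<beta> :: real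
  assumes S: "S \<in> carrier_mat (k + n) (k + n)" and U: "U \<in> stiefel (k + n) (k + n)"
    and SU: "S = U * mat_diag (k + n) (\<lambda>i. eigval S (i + 1)) * U\<^sup>T"
    and \<beta>: "0 < \<beta>" and kn: "0 < k + n"
    and gap: "\<And>i j. i < n \<Longrightarrow> j < k \<Longrightarrow> eigval S (k + (i + 1)) < eigval S (j + 1)"
begin

private abbreviation (input) "G \<equiv> gaussian_mat n k (gibbs_variance S \<beta> k)"
private abbreviation (input) "h \<equiv> stiefel_density k"

lemma gibbs_variance_pos: "i < n \<Longrightarrow> j < k \<Longrightarrow> 0 < gibbs_variance S \<beta> k i j"
  unfolding gibbs_variance_def using gap[of i j] \<beta> kn S by (intro divide_pos_pos mult_pos_pos) auto

lemma gibbs_weight_frame: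
  obtains C where "0 < C" "\<And>Z R. Z \<in> carrier_mat n k \<Longrightarrow> sym_pd k (cogram k Z) \<Longrightarrow> R \<in> stiefel k k \<Longrightarrow>
    gibbs_weight S \<beta> (U * (frame k Z * R)) = C * gaussian_density n k (gibbs_variance S \<beta> k) Z"
proof -
  define l where "l = (\<lambda>i. eigval S (i + 1))"
  define p where "p = real (k + n)"
  have p: "0 < p" using kn unfolding p_def by (simp only: of_nat_0_less_iff)
  define a where "a = (\<lambda>i j. \<beta> * p * (l j - l (k + i)))"
  have a: "0 < a i j" if "i < n" "j < k" for i j using gap[OF that] \<beta> p by (simp add: a_def l_def)
  have v: "gibbs_variance S \<beta> k = (\<lambda>i j. 1 / a i j)"
    using S by (simp add: gibbs_variance_def a_def l_def p_def fun_eq_iff)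
  obtain K where K: "0 < K" "\<And>Z. gaussian_density n k (\<lambda>i j. 1 / a i j) Z = K * exp (- (\<Sum>i<n. \<Sum>j<k. a i j * (Z $$ (i,j))\<^sup>2) / 2)"
    using gaussian_density_exp[of n k a] a by blast
  have Sl: "S = U * mat_diag (k + n) l * U\<^sup>T" using SU by (simp add: l_def)
  show ?thesis
  \<comment> \<open>The exponential is the Gibbs weight at \<open>Z = 0\<close>; \<open>K\<close> is
    the normaliser of the Gaussian density.\<close>
  proof (rule that[of "exp (p * \<beta> / 2 * (\<Sum>j<k. l j)) / K"])
    show "0 < exp (p * \<beta> / 2 * (\<Sum>j<k. l j)) / K" using K by simp
    fix Z R assume Z: "Z \<in> carrier_mat n k" "sym_pd k (cogram k Z)" and R: "R \<in> stiefel k k"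
    have "p * \<beta> / 2 * mat_trace ((U * (frame k Z * R))\<^sup>T * S * (U * (frame k Z * R)))
      = p * \<beta> / 2 * ((\<Sum>j<k. l j) - (\<Sum>i<n. \<Sum>j<k. (l j - l (k + i)) * (Z $$ (i,j))\<^sup>2))"
      by (subst Sl) (simp only: mat_trace_frame[OF Z R U])
    also have "\<dots> = p * \<beta> / 2 * (\<Sum>j<k. l j) + - (\<Sum>i<n. \<Sum>j<k. a i j * (Z $$ (i,j))\<^sup>2) / 2"
    proof -
      have e: "(\<Sum>i<n. \<Sum>j<k. a i j * (Z $$ (i,j))\<^sup>2) = \<beta> * p * (\<Sum>i<n. \<Sum>j<k. (l j - l (k + i)) * (Z $$ (i,j))\<^sup>2)"
        unfolding a_def by (simp add: sum_distrib_left mult.assoc)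
      show ?thesis unfolding e by (simp add: right_diff_distrib)
    qed
    finally have e1: "p * \<beta> / 2 * mat_trace ((U * (frame k Z * R))\<^sup>T * S * (U * (frame k Z * R)))
      = p * \<beta> / 2 * (\<Sum>j<k. l j) + - (\<Sum>i<n. \<Sum>j<k. a i j * (Z $$ (i,j))\<^sup>2) / 2" .
    have dr: "real (dim_row S) = p" using carrier_matD(1)[OF S] by (simp only: p_def)
    show "gibbs_weight S \<beta> (U * (frame k Z * R)) = exp (p * \<beta> / 2 * (\<Sum>j<k. l j)) / K * gaussian_density n k (gibbs_variance S \<beta> k) Z"
      unfolding gibbs_weight_def dr e1 v K(2) exp_add using K(1) by simp
  qed
qed

text \<open>In both laws the rotation is uniform and independent of \<open>Z\<close>; the laws of
  \<open>Z\<close> are the Gaussian one and the Gaussian one weighted by \<open>h Z\<close> over its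
  mean. An event thus differs in probability by the mean of a function with values in [0,1] times
  the deviation of that weight from 1. The lower bound is stated as well because a real supremum is
  usable only once the set is known to be bounded.\<close>

lemma tv_dist_gibbs_le:
  assumes h: "integrable G h" and H: "0 < (LINT Z|G. h Z)"
  shows "0 \<le> tv_dist (gibbs S \<beta> k) (gibbs_approx S U \<beta> k)"
    "tv_dist (gibbs S \<beta> k) (gibbs_approx S U \<beta> k) \<le> (LINT Z|G. \<bar>h Z / (LINT Z|G. h Z) - 1\<bar>)"
proof -
  let ?p = "k + n" and ?H = "LINT Z|G. h Z"
  define M where "M = stiefel_uniform ?p k"
  define N where "N = stiefel_uniform k k"
  have M: "is_haar ?p k M" and N: "is_haar k k N"
    unfolding M_def N_def by (rule is_haar_stiefel_uniform, simp)+
  note sM[measurable_cong] = is_haarD(2)[OF M] and sN[measurable_cong] = is_haarD(2)[OF N]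
  interpret M: prob_space M by (rule is_haarD(1)[OF M])
  interpret N: prob_space N by (rule is_haarD(1)[OF N])
  interpret G: prob_space G by (rule prob_space_gaussian_mat[OF gibbs_variance_pos])
  interpret GN: pair_prob_space G N by unfold_locales
  let ?w = "gibbs_weight S \<beta>"
  note mw[measurable] = measurable_gibbs_weight[OF S, of \<beta> k]
  have w0: "0 < ?w V" for V by (simp add: gibbs_weight_def)
  note mf[measurable] = measurable_compose[OF _ measurable_frame[of k n]]
  note Uc = stiefel_carrier[OF U]
  have mj: "(\<lambda>x. U * (frame k (fst x) * snd x)) \<in> mat_borel n k \<Otimes>\<^sub>M N \<rightarrow>\<^sub>M mat_borel ?p k"
    by (rule measurable_compose[OF measurable_mat_mult[where l=k] measurable_left_mult[OF Uc]]) measurable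
  \<comment> \<open>The conditional expectation of \<open>F\<close> given \<open>Z\<close>.\<close>
  define a where "a = (\<lambda>F Z. \<integral>\<^sup>+R. (F (U * (frame k Z * R)) :: ennreal) \<partial>N)"
  have ma: "a F \<in> borel_measurable (mat_borel n k)" if F: "F \<in> borel_measurable (mat_borel ?p k)" for F
    unfolding a_def using measurable_compose[OF mj F] by (intro N.borel_measurable_nn_integral) (simp add: case_prod_unfold)
  have mR: "(\<lambda>R. F (U * (frame k Z * R))) \<in> borel_measurable N"
    if F: "F \<in> borel_measurable (mat_borel ?p k)" and Z: "Z \<in> carrier_mat n k" for F :: "real mat \<Rightarrow> ennreal" and Z
  proof -
    have "(\<lambda>R. (Z, R)) \<in> N \<rightarrow>\<^sub>M mat_borel n k \<Otimes>\<^sub>M N" using Z by measurable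
    from measurable_compose[OF this measurable_compose[OF mj F]] show ?thesis by simp
  qed
  obtain c where c: "0 < c" and rep: "\<And>F. F \<in> borel_measurable (mat_borel ?p k) \<Longrightarrow>
    (\<integral>\<^sup>+V. F V \<partial>M) = ennreal c * (\<integral>\<^sup>+Z. (\<integral>\<^sup>+R. F (frame k Z * R) \<partial>N) * ennreal (h Z) \<partial>leb_mat n k)"
    using haar_representation[OF M N] by blast
  obtain C where C: "0 < C" and wC: "\<And>Z R. Z \<in> carrier_mat n k \<Longrightarrow> sym_pd k (cogram k Z) \<Longrightarrow> R \<in> stiefel k k \<Longrightarrow>
    ?w (U * (frame k Z * R)) = C * gaussian_density n k (gibbs_variance S \<beta> k) Z"
    using gibbs_weight_frame by blast
  have T: "(\<integral>\<^sup>+V. ennreal (?w V) * F V \<partial>M) = ennreal (c * C) * (\<integral>\<^sup>+Z. ennreal (h Z) * a F Z \<partial>G)"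
    if F[measurable]: "F \<in> borel_measurable (mat_borel ?p k)" for F
  proof -
    note [measurable] = ma[OF F] measurable_left_mult[OF Uc, of k]
    \<comment> \<open>Rotating by \<open>U\<close> passes to the eigenbasis before the
      representation is applied.\<close>
    have "(\<integral>\<^sup>+V. ennreal (?w V) * F V \<partial>M) = (\<integral>\<^sup>+V. ennreal (?w (U * V)) * F (U * V) \<partial>M)"
      by (rule nn_integral_haar_left[OF M U, symmetric]) measurable
    also have "\<dots> = ennreal c * (\<integral>\<^sup>+Z. (\<integral>\<^sup>+R. ennreal (?w (U * (frame k Z * R))) * F (U * (frame k Z * R)) \<partial>N) * ennreal (h Z) \<partial>leb_mat n k)"
      by (rule rep) measurable
    also have "(\<integral>\<^sup>+Z. (\<integral>\<^sup>+R. ennreal (?w (U * (frame k Z * R))) * F (U * (frame k Z * R)) \<partial>N) * ennreal (h Z) \<partial>leb_mat n k)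
      = (\<integral>\<^sup>+Z. ennreal C * (ennreal (gaussian_density n k (gibbs_variance S \<beta> k) Z) * (ennreal (h Z) * a F Z)) \<partial>leb_mat n k)"
    proof (rule nn_integral_cong)
      fix Z assume "Z \<in> space (leb_mat n k)"
      then have Z: "Z \<in> carrier_mat n k" by simp
      show "(\<integral>\<^sup>+R. ennreal (?w (U * (frame k Z * R))) * F (U * (frame k Z * R)) \<partial>N) * ennreal (h Z)
        = ennreal C * (ennreal (gaussian_density n k (gibbs_variance S \<beta> k) Z) * (ennreal (h Z) * a F Z))"
      proof (cases "sym_pd k (cogram k Z)")
        case True
        have "(\<integral>\<^sup>+R. ennreal (?w (U * (frame k Z * R))) * F (U * (frame k Z * R)) \<partial>N)
          = (\<integral>\<^sup>+R. ennreal (C * gaussian_density n k (gibbs_variance S \<beta> k) Z) * F (U * (frame k Z * R)) \<partial>N)"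
        proof (rule nn_integral_cong_AE)
          show "AE R in N. ennreal (?w (U * (frame k Z * R))) * F (U * (frame k Z * R))
            = ennreal (C * gaussian_density n k (gibbs_variance S \<beta> k) Z) * F (U * (frame k Z * R))"
            using is_haarD(4)[OF N] by eventually_elim (simp add: wC[OF Z True])
        qed
        also have "\<dots> = ennreal (C * gaussian_density n k (gibbs_variance S \<beta> k) Z) * a F Z"
          unfolding a_def by (rule nn_integral_cmult[OF mR[OF F Z]])
        finally show ?thesis using C gaussian_density_nonneg[of n k "gibbs_variance S \<beta> k" Z]
          by (simp add: ennreal_mult mult_ac)
      qed (simp add: stiefel_density_def)
    qed
    also have "\<dots> = ennreal C * (\<integral>\<^sup>+Z. ennreal (gaussian_density n k (gibbs_variance S \<beta> k) Z) * (ennreal (h Z) * a F Z) \<partial>leb_mat n k)"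
      by (rule nn_integral_cmult) measurable
    also have "(\<integral>\<^sup>+Z. ennreal (gaussian_density n k (gibbs_variance S \<beta> k) Z) * (ennreal (h Z) * a F Z) \<partial>leb_mat n k)
      = (\<integral>\<^sup>+Z. ennreal (h Z) * a F Z \<partial>G)"
      by (rule nn_integral_gaussian_mat[symmetric]) measurable
    finally show ?thesis using c C by (simp add: ennreal_mult mult.assoc)
  qed
  have Hn: "(\<integral>\<^sup>+Z. ennreal (h Z) \<partial>G) = ennreal ?H"
    by (rule nn_integral_eq_integral[OF h]) (simp add: stiefel_density_nonneg)
  have a1: "a (\<lambda>_. 1) Z = 1" for Z by (simp add: a_def N.emeasure_space_1)
  \<comment> \<open>The constant function gives the partition function; both unknown constants
    cancel against it and only \<open>h Z\<close> divided by its mean survives.\<close>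
  have "(\<integral>\<^sup>+V. ennreal (?w V) \<partial>M) = ennreal (c * C * ?H)"
    using T[of "\<lambda>_. 1"] Hn c C H by (simp add: a1 ennreal_mult)
  then have W: "(LINT V|M. ?w V) = c * C * ?H"
    using c C H w0 by (subst integral_eq_nn_integral) (auto intro: less_imp_le)
  have gd: "gibbs S \<beta> k = density M (\<lambda>V. ennreal (?w V / (c * C * ?H)))"
    using S by (simp add: gibbs_def Let_def M_def[symmetric] W)
  have gm: "emeasure (gibbs S \<beta> k) A = (\<integral>\<^sup>+Z. ennreal (h Z / ?H) * a (indicator A) Z \<partial>G)"
    if A: "A \<in> sets (mat_borel ?p k)" for A
  proof -
    have AM[measurable]: "A \<in> sets M" using A sM by simp
    have iA[measurable]: "indicator A \<in> borel_measurable (mat_borel ?p k)" using A by simp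
    note [measurable] = ma[OF iA]
    have "emeasure (gibbs S \<beta> k) A = (\<integral>\<^sup>+V. ennreal (?w V / (c * C * ?H)) * indicator A V \<partial>M)"
      unfolding gd by (rule emeasure_density) measurable
    also have "\<dots> = (\<integral>\<^sup>+V. ennreal (1 / (c * C * ?H)) * (ennreal (?w V) * indicator A V) \<partial>M)"
      using c C H w0 by (intro nn_integral_cong) (simp add: ennreal_mult'[symmetric] mult.assoc[symmetric] less_imp_le)
    also have "\<dots> = ennreal (1 / (c * C * ?H)) * (\<integral>\<^sup>+V. ennreal (?w V) * indicator A V \<partial>M)"
      by (rule nn_integral_cmult) measurable
    also have "\<dots> = ennreal (1 / (c * C * ?H)) * (ennreal (c * C) * (\<integral>\<^sup>+Z. ennreal (h Z) * a (indicator A) Z \<partial>G))"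
      by (simp only: T[OF iA])
    also have "\<dots> = ennreal (1 / ?H) * (\<integral>\<^sup>+Z. ennreal (h Z) * a (indicator A) Z \<partial>G)"
      using c C H by (simp add: ennreal_mult'[symmetric] mult.assoc[symmetric])
    also have "\<dots> = (\<integral>\<^sup>+Z. ennreal (1 / ?H) * (ennreal (h Z) * a (indicator A) Z) \<partial>G)"
      by (rule nn_integral_cmult[symmetric]) measurable
    also have "\<dots> = (\<integral>\<^sup>+Z. ennreal (h Z / ?H) * a (indicator A) Z \<partial>G)"
      using H stiefel_density_nonneg[of k] by (intro nn_integral_cong) (simp add: ennreal_mult'[symmetric] mult.assoc[symmetric])
    finally show ?thesis .
  qed
  have am: "emeasure (gibbs_approx S U \<beta> k) A = (\<integral>\<^sup>+Z. a (indicator A) Z \<partial>G)"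
    if A: "A \<in> sets (mat_borel ?p k)" for A
  proof -
    have iA: "(indicator A :: _ \<Rightarrow> ennreal) \<in> borel_measurable (mat_borel ?p k)" using A by simp
    have m3: "(\<lambda>(Z, Q). U * frame k Z * Q) \<in> G \<Otimes>\<^sub>M N \<rightarrow>\<^sub>M mat_borel ?p k"
      unfolding case_prod_unfold
      by (rule measurable_mat_mult[where l=k, OF measurable_compose[OF _ measurable_left_mult[OF Uc]]]) measurable
    have "gibbs_approx S U \<beta> k = distr (G \<Otimes>\<^sub>M N) (mat_borel ?p k) (\<lambda>(Z, Q). U * frame k Z * Q)"
      unfolding N_def by (rule gibbs_approx_eq) (use S in simp)
    moreover have "emeasure (distr (G \<Otimes>\<^sub>M N) (mat_borel ?p k) (\<lambda>(Z, Q). U * frame k Z * Q)) A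
      = (\<integral>\<^sup>+V. indicator A V \<partial>distr (G \<Otimes>\<^sub>M N) (mat_borel ?p k) (\<lambda>(Z, Q). U * frame k Z * Q))"
      by (rule nn_integral_indicator[symmetric]) (use A in simp)
    moreover have "\<dots> = (\<integral>\<^sup>+x. indicator A ((\<lambda>(Z, Q). U * frame k Z * Q) x) \<partial>(G \<Otimes>\<^sub>M N))"
      by (rule nn_integral_distr[OF m3]) (use iA in simp)
    ultimately have "emeasure (gibbs_approx S U \<beta> k) A = (\<integral>\<^sup>+x. indicator A ((\<lambda>(Z, Q). U * frame k Z * Q) x) \<partial>(G \<Otimes>\<^sub>M N))"
      by simp
    also have "\<dots> = (\<integral>\<^sup>+Z. (\<integral>\<^sup>+R. indicator A (U * frame k Z * R) \<partial>N) \<partial>G)"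
      using measurable_compose[OF m3 iA] by (subst N.nn_integral_fst[symmetric]) auto
    also have "\<dots> = (\<integral>\<^sup>+Z. a (indicator A) Z \<partial>G)"
      unfolding a_def
    proof (intro nn_integral_cong)
      fix Z R assume "Z \<in> space G" "R \<in> space N"
      then have "Z \<in> carrier_mat n k" "R \<in> carrier_mat k k" by (simp_all add: is_haarD(3)[OF N])
      then show "(indicator A (U * frame k Z * R) :: ennreal) = indicator A (U * (frame k Z * R))"
        using assoc_mult_mat[OF Uc frame_carrier] by simp
    qed
    finally show ?thesis .
  qed
  have hH: "integrable G (\<lambda>Z. \<bar>h Z / ?H - 1\<bar>)" using h by auto
  have bound: "\<bar>measure (gibbs S \<beta> k) A - measure (gibbs_approx S U \<beta> k) A\<bar> \<le> (LINT Z|G. \<bar>h Z / ?H - 1\<bar>)"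
    if A: "A \<in> sets (mat_borel ?p k)" for A
  proof -
    have iA: "(indicator A :: _ \<Rightarrow> ennreal) \<in> borel_measurable (mat_borel ?p k)" using A by simp
    define b where "b = (\<lambda>Z. enn2real (a (indicator A) Z))"
    have ale: "a (indicator A) Z \<le> 1" for Z
    proof -
      have "a (indicator A) Z \<le> (\<integral>\<^sup>+R. 1 \<partial>N)" unfolding a_def by (intro nn_integral_mono) (auto split: split_indicator)
      then show ?thesis by (simp add: N.emeasure_space_1)
    qed
    have ab: "a (indicator A) Z = ennreal (b Z)" for Z
      unfolding b_def using le_less_trans[OF ale[of Z] ennreal_one_less_top] by simp
    have b01: "0 \<le> b Z" "b Z \<le> 1" for Z
    proof -
      show "0 \<le> b Z" by (simp add: b_def)
      show "b Z \<le> 1" using ale[of Z] unfolding ab by simp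
    qed
    have mb[measurable]: "b \<in> borel_measurable (mat_borel n k)"
      unfolding b_def using ma[OF iA] by measurable
    have ib: "integrable G b" using b01 by (intro G.integrable_const_bound[of _ 1]) auto
    have ihb: "integrable G (\<lambda>Z. h Z / ?H * b Z)"
    proof (rule Bochner_Integration.integrable_bound[of G "\<lambda>Z. h Z / ?H"])
      show "integrable G (\<lambda>Z. h Z / ?H)" using h by simp
      show "AE Z in G. norm (h Z / ?H * b Z) \<le> norm (h Z / ?H)"
      proof (rule AE_I2)
        fix Z
        have "\<bar>b Z\<bar> \<le> 1" using b01[of Z] by simp
        then have "\<bar>h Z / ?H\<bar> * \<bar>b Z\<bar> \<le> \<bar>h Z / ?H\<bar>" by (intro mult_left_le) auto
        then show "norm (h Z / ?H * b Z) \<le> norm (h Z / ?H)" by (simp only: real_norm_def abs_mult)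
      qed
    qed measurable
    have "measure (gibbs S \<beta> k) A = (LINT Z|G. h Z / ?H * b Z)"
    proof -
      have "emeasure (gibbs S \<beta> k) A = (\<integral>\<^sup>+Z. ennreal (h Z / ?H * b Z) \<partial>G)"
        unfolding gm[OF A] ab using H b01 stiefel_density_nonneg[of k]
        by (intro nn_integral_cong ennreal_mult[symmetric] divide_nonneg_pos) auto
      also have "\<dots> = ennreal (LINT Z|G. h Z / ?H * b Z)"
        using H b01 stiefel_density_nonneg[of k] by (intro nn_integral_eq_integral[OF ihb] AE_I2) simp
      finally show ?thesis using H b01 stiefel_density_nonneg[of k] by (simp add: measure_def)
    qed
    moreover have "measure (gibbs_approx S U \<beta> k) A = (LINT Z|G. b Z)"
    proof -
      have "emeasure (gibbs_approx S U \<beta> k) A = ennreal (LINT Z|G. b Z)"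
        unfolding am[OF A] ab using b01 by (intro nn_integral_eq_integral[OF ib] AE_I2) simp
      then show ?thesis using b01 by (simp add: measure_def)
    qed
    ultimately have "\<bar>measure (gibbs S \<beta> k) A - measure (gibbs_approx S U \<beta> k) A\<bar> = \<bar>LINT Z|G. (h Z / ?H - 1) * b Z\<bar>"
      using ib ihb by (simp add: Bochner_Integration.integral_diff[symmetric] left_diff_distrib)
    also have "\<dots> \<le> (LINT Z|G. \<bar>(h Z / ?H - 1) * b Z\<bar>)" by (rule integral_abs_bound)
    also have "\<dots> \<le> (LINT Z|G. \<bar>h Z / ?H - 1\<bar>)"
    proof (rule integral_mono[OF _ hH])
      have "integrable G (\<lambda>Z. (h Z / ?H - 1) * b Z)" using ib ihb by (simp add: left_diff_distrib)
      then show "integrable G (\<lambda>Z. \<bar>(h Z / ?H - 1) * b Z\<bar>)" by simp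
      show "\<bar>(h Z / ?H - 1) * b Z\<bar> \<le> \<bar>h Z / ?H - 1\<bar>" for Z
        using b01[of Z] by (simp add: abs_mult mult_left_le)
    qed
    finally show ?thesis .
  qed
  have sg: "sets (gibbs S \<beta> k) = sets (mat_borel ?p k)" unfolding gd using sM by simp
  have bdd: "bdd_above ((\<lambda>A. \<bar>measure (gibbs S \<beta> k) A - measure (gibbs_approx S U \<beta> k) A\<bar>) ` sets (gibbs S \<beta> k))"
    using bound by (intro bdd_aboveI2) (auto simp: sg)
  show "tv_dist (gibbs S \<beta> k) (gibbs_approx S U \<beta> k) \<le> (LINT Z|G. \<bar>h Z / ?H - 1\<bar>)"
    unfolding tv_dist_def using bound by (intro cSUP_least) (auto simp: sg)
  show "0 \<le> tv_dist (gibbs S \<beta> k) (gibbs_approx S U \<beta> k)"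
    unfolding tv_dist_def by (rule cSUP_upper2[OF bdd sets.empty_sets]) simp
qed

end

section \<open>Exponential moments\<close>

lemma nn_integral_normal_density:
  assumes "0 < \<sigma>"
  shows "(\<integral>\<^sup>+x. ennreal (normal_density \<mu> \<sigma> x) \<partial>lborel) = 1"
proof -
  have "(\<integral>\<^sup>+x. ennreal (normal_density \<mu> \<sigma> x) \<partial>lborel) = ennreal (\<integral>x. normal_density \<mu> \<sigma> x \<partial>lborel)"
    using assms by (intro nn_integral_eq_integral) auto
  then show ?thesis using assms by simp
qed

text \<open>The factor turns the density into that of variance v / (1 - 2 t v), up to the quotient
  of the two normalisers.\<close>

lemma nn_integral_normal_exp_square:
  assumes v: "0 < v" and t: "2 * t * v < 1"
  shows "(\<integral>\<^sup>+x. ennreal (normal_density 0 (sqrt v) x * exp (t * x\<^sup>2)) \<partial>lborel) = ennreal (1 / sqrt (1 - 2 * t * v))"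
proof -
  define w where "w = v / (1 - 2 * t * v)"
  have w: "0 < w" using v t by (simp add: w_def)
  have e: "normal_density 0 (sqrt v) x * exp (t * x\<^sup>2) = 1 / sqrt (1 - 2 * t * v) * normal_density 0 (sqrt w) x" for x
  proof -
    have "1 / sqrt (1 - 2 * t * v) * (1 / sqrt (2 * pi * w)) = 1 / sqrt ((1 - 2 * t * v) * (2 * pi * w))"
      by (simp add: real_sqrt_mult)
    also have "(1 - 2 * t * v) * (2 * pi * w) = 2 * pi * v" using t by (simp add: w_def)
    finally have 1: "1 / sqrt (1 - 2 * t * v) * (1 / sqrt (2 * pi * w)) = 1 / sqrt (2 * pi * v)" .
    have "- x\<^sup>2 / (2 * w) = - x\<^sup>2 / (2 * v) + t * x\<^sup>2" using v t by (simp add: w_def field_simps)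
    then have 2: "exp (- x\<^sup>2 / (2 * w)) = exp (- x\<^sup>2 / (2 * v)) * exp (t * x\<^sup>2)" by (simp only: exp_add)
    have nv: "normal_density 0 (sqrt v) x = 1 / sqrt (2 * pi * v) * exp (- x\<^sup>2 / (2 * v))"
      and nw: "normal_density 0 (sqrt w) x = 1 / sqrt (2 * pi * w) * exp (- x\<^sup>2 / (2 * w))"
      using v w by (simp_all add: normal_density_def)
    show ?thesis unfolding nv nw 2 1[symmetric] by (simp only: mult_ac)
  qed
  have "(\<integral>\<^sup>+x. ennreal (normal_density 0 (sqrt v) x * exp (t * x\<^sup>2)) \<partial>lborel)
    = (\<integral>\<^sup>+x. ennreal (1 / sqrt (1 - 2 * t * v)) * ennreal (normal_density 0 (sqrt w) x) \<partial>lborel)"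
    unfolding e using t by (intro nn_integral_cong ennreal_mult) auto
  also have "\<dots> = ennreal (1 / sqrt (1 - 2 * t * v)) * (\<integral>\<^sup>+x. ennreal (normal_density 0 (sqrt w) x) \<partial>lborel)"
    by (rule nn_integral_cmult) measurable
  finally show ?thesis using nn_integral_normal_density[of "sqrt w" 0] w by simp
qed

lemma nn_integral_normal_exp_linear:
  assumes v: "0 < v"
  shows "(\<integral>\<^sup>+x. ennreal (normal_density 0 (sqrt v) x * exp (r * x)) \<partial>lborel) = ennreal (exp (r\<^sup>2 * v / 2))"
proof -
  have "normal_density 0 (sqrt v) x * exp (r * x) = exp (r\<^sup>2 * v / 2) * normal_density (r * v) (sqrt v) x" for x
  proof -
    have "- x\<^sup>2 / (2 * v) + r * x = r\<^sup>2 * v / 2 + - (x - r * v)\<^sup>2 / (2 * v)"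
      using v by (simp add: field_simps power2_eq_square)
    then have "exp (- x\<^sup>2 / (2 * v)) * exp (r * x) = exp (r\<^sup>2 * v / 2) * exp (- (x - r * v)\<^sup>2 / (2 * v))"
      by (simp only: exp_add[symmetric])
    then show ?thesis unfolding normal_density_def using v by simp
  qed
  then have "(\<integral>\<^sup>+x. ennreal (normal_density 0 (sqrt v) x * exp (r * x)) \<partial>lborel)
    = (\<integral>\<^sup>+x. ennreal (exp (r\<^sup>2 * v / 2)) * ennreal (normal_density (r * v) (sqrt v) x) \<partial>lborel)"
    by (intro nn_integral_cong) (simp add: ennreal_mult)
  also have "\<dots> = ennreal (exp (r\<^sup>2 * v / 2)) * (\<integral>\<^sup>+x. ennreal (normal_density (r * v) (sqrt v) x) \<partial>lborel)"
    by (rule nn_integral_cmult) measurable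
  finally show ?thesis using nn_integral_normal_density[of "sqrt v" "r * v"] v by simp
qed

text \<open>This is half of the bound ln (1 - u) \<ge> -u - 2 u^2, valid for |u| \<le> 1/2 and both
  signs of u.\<close>

lemma inverse_sqrt_le_exp:
  assumes "\<bar>u\<bar> \<le> 1 / 2"
  shows "1 / sqrt (1 - u) \<le> exp (u / 2 + u\<^sup>2)"
proof -
  have pos: "0 < 1 - u" using assms by linarith
  have "- u - 2 * u\<^sup>2 \<le> ln (1 - u)"
  proof (cases "0 \<le> u")
    case True
    then show ?thesis using ln_one_minus_pos_lower_bound[of u] assms by auto
  next
    case False
    then show ?thesis using ln_one_plus_pos_lower_bound[of "-u"] assms by (auto intro: order_trans[rotated])
  qed
  then have "exp (- (u / 2 + u\<^sup>2)) \<le> exp (ln (1 - u) / 2)" by simp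
  also have "\<dots> = sqrt (1 - u)"
    using pos by (simp add: powr_half_sqrt[symmetric] powr_def)
  finally have "1 / sqrt (1 - u) \<le> 1 / exp (- (u / 2 + u\<^sup>2))"
    using pos by (intro divide_left_mono mult_pos_pos) auto
  also have "\<dots> = exp (u / 2 + u\<^sup>2)" by (simp only: exp_minus inverse_eq_divide[symmetric] inverse_inverse_eq)
  finally show ?thesis .
qed

text \<open>The entries are independent and only column \<open>a\<close> carries an exponential
  factor. The bound 1/4 makes u = 2 s v at most 1/2 in absolute value, and u/2 + u^2 is the exponent
  shown.\<close>

lemma nn_integral_gaussian_exp_square:
  assumes v: "\<And>i j. i < n \<Longrightarrow> j < k \<Longrightarrow> 0 < v i j" and s: "\<And>i. i < n \<Longrightarrow> \<bar>s\<bar> * v i a \<le> 1 / 4" and a: "a < k"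
  shows "(\<integral>\<^sup>+Z. ennreal (gaussian_density n k v Z) * ennreal (exp (s * (\<Sum>i<n. (Z $$ (i,a))\<^sup>2))) \<partial>leb_mat n k)
    \<le> ennreal (exp (\<Sum>i<n. s * v i a + 4 * s\<^sup>2 * (v i a)\<^sup>2))"
proof -
  let ?I = "{..<n} \<times> {..<k}"
  define g where "g = (\<lambda>ij x. ennreal (normal_density 0 (sqrt (v (fst ij) (snd ij))) x * exp ((if snd ij = a then s else 0) * x\<^sup>2)))"
  have "(\<integral>\<^sup>+Z. ennreal (gaussian_density n k v Z) * ennreal (exp (s * (\<Sum>i<n. (Z $$ (i,a))\<^sup>2))) \<partial>leb_mat n k)
    = (\<integral>\<^sup>+Z. (\<Prod>ij\<in>?I. g ij (Z $$ ij)) \<partial>leb_mat n k)"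
  proof (rule nn_integral_cong)
    fix Z
    have "exp (s * (\<Sum>i<n. (Z $$ (i,a))\<^sup>2)) = exp (\<Sum>ij\<in>?I. (if snd ij = a then s else 0) * (Z $$ ij)\<^sup>2)"
    proof -
      have "(\<Sum>ij\<in>?I. (if snd ij = a then s else 0) * (Z $$ ij)\<^sup>2) = (\<Sum>i<n. \<Sum>j<k. if j = a then s * (Z $$ (i,a))\<^sup>2 else 0)"
        by (subst sum.cartesian_product) (intro sum.cong, auto)
      also have "\<dots> = s * (\<Sum>i<n. (Z $$ (i,a))\<^sup>2)" using a by (simp add: sum_distrib_left)
      finally show ?thesis by simp
    qed
    also have "\<dots> = (\<Prod>ij\<in>?I. exp ((if snd ij = a then s else 0) * (Z $$ ij)\<^sup>2))" by (rule exp_sum) simp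
    finally have "gaussian_density n k v Z * exp (s * (\<Sum>i<n. (Z $$ (i,a))\<^sup>2))
      = (\<Prod>ij\<in>?I. normal_density 0 (sqrt (v (fst ij) (snd ij))) (Z $$ ij) * exp ((if snd ij = a then s else 0) * (Z $$ ij)\<^sup>2))"
      by (simp only: gaussian_density_def case_prod_unfold prod.distrib prod.collapse)
    then show "ennreal (gaussian_density n k v Z) * ennreal (exp (s * (\<Sum>i<n. (Z $$ (i,a))\<^sup>2))) = (\<Prod>ij\<in>?I. g ij (Z $$ ij))"
      unfolding g_def by (subst prod_ennreal) (auto simp: ennreal_mult[symmetric] gaussian_density_nonneg)
  qed
  also have "\<dots> = (\<Prod>ij\<in>?I. \<integral>\<^sup>+x. g ij x \<partial>lborel)"
    by (rule nn_integral_leb_mat_prod) (simp add: g_def)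
  also have "\<dots> \<le> (\<Prod>ij\<in>?I. ennreal (if snd ij = a then exp (s * v (fst ij) a + 4 * s\<^sup>2 * (v (fst ij) a)\<^sup>2) else 1))"
  proof (rule prod_mono_ennreal)
    fix ij assume "ij \<in> ?I"
    then obtain i j where ij: "ij = (i,j)" "i < n" "j < k" by auto
    show "(\<integral>\<^sup>+x. g ij x \<partial>lborel) \<le> ennreal (if snd ij = a then exp (s * v (fst ij) a + 4 * s\<^sup>2 * (v (fst ij) a)\<^sup>2) else 1)"
    proof (cases "j = a")
      case True
      have va: "0 < v i a" using v[OF ij(2) a] .
      have "\<bar>2 * s * v i a\<bar> = 2 * (\<bar>s\<bar> * v i a)" using va by (simp add: abs_mult)
      then have u: "\<bar>2 * s * v i a\<bar> \<le> 1 / 2" using s[OF ij(2)] by linarith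
      then have lt: "2 * s * v i a < 1" by linarith
      have "(\<integral>\<^sup>+x. g ij x \<partial>lborel) = ennreal (1 / sqrt (1 - 2 * s * v i a))"
        using nn_integral_normal_exp_square[OF va lt] by (simp add: g_def ij True)
      also have "\<dots> \<le> ennreal (exp (2 * s * v i a / 2 + (2 * s * v i a)\<^sup>2))"
        by (rule ennreal_leI[OF inverse_sqrt_le_exp[OF u]])
      finally show ?thesis by (simp add: ij True power_mult_distrib)
    next
      case False
      then show ?thesis using nn_integral_normal_density[of "sqrt (v i j)" 0] v[OF ij(2,3)] by (simp add: g_def ij)
    qed
  qed
  also have "\<dots> = ennreal (\<Prod>ij\<in>?I. if snd ij = a then exp (s * v (fst ij) a + 4 * s\<^sup>2 * (v (fst ij) a)\<^sup>2) else 1)"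
    by (rule prod_ennreal) auto
  also have "(\<Prod>ij\<in>?I. if snd ij = a then exp (s * v (fst ij) a + 4 * s\<^sup>2 * (v (fst ij) a)\<^sup>2) else 1)
    = (\<Prod>i<n. \<Prod>j<k. if j = a then exp (s * v i a + 4 * s\<^sup>2 * (v i a)\<^sup>2) else 1)"
    unfolding prod.cartesian_product by (intro prod.cong) auto
  also have "\<dots> = exp (\<Sum>i<n. s * v i a + 4 * s\<^sup>2 * (v i a)\<^sup>2)"
    using a by (simp add: exp_sum)
  finally show ?thesis .
qed

lemma measurable_gram_sum:
  assumes "a < k" "b < k"
  shows "(\<lambda>Z. \<Sum>i<n. Z $$ (i,a) * Z $$ (i,b)) \<in> borel_measurable (mat_borel n k)"
  using assms by (intro borel_measurable_sum borel_measurable_times measurable_entry0) auto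

text \<open>The exponent is linear in column \<open>b\<close>, so integrating that column first
  leaves a quadratic exponent in column \<open>a\<close>, to which the bound for squares applies. No
  first-order term appears because the product of distinct columns is centred.\<close>

lemma nn_integral_gaussian_exp_product:
  assumes v: "\<And>i j. i < n \<Longrightarrow> j < k \<Longrightarrow> 0 < v i j"
    and s: "\<And>i. i < n \<Longrightarrow> \<bar>s\<bar> * v i a \<le> 1 / 4" "\<And>i. i < n \<Longrightarrow> \<bar>s\<bar> * v i b \<le> 1 / 4"
    and ab: "a < k" "b < k" "a \<noteq> b"
  shows "(\<integral>\<^sup>+Z. ennreal (gaussian_density n k v Z) * ennreal (exp (s * (\<Sum>i<n. Z $$ (i,a) * Z $$ (i,b)))) \<partial>leb_mat n k)
    \<le> ennreal (exp (\<Sum>i<n. 4 * s\<^sup>2 * (v i a * v i b)))"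
proof -
  let ?I = "{..<n} \<times> {..<k}" and ?B = "{..<n} \<times> {b}" and ?J = "{..<n} \<times> ({..<k} - {b})"
  have IJ: "?I = ?J \<union> ?B" "?J \<inter> ?B = {}" "finite ?J" "finite ?B" using ab by auto
  interpret product_sigma_finite "\<lambda>_::nat\<times>nat. lborel :: real measure"
    by (simp add: product_sigma_finite_def sigma_finite_lborel)
  let ?P = "\<lambda>A. \<Pi>\<^sub>M ij\<in>A. (lborel :: real measure)"
  define f where "f = (\<lambda>ij. normal_density 0 (sqrt (v (fst ij) (snd ij))))"
  have f0: "0 \<le> f ij x" for ij x by (simp add: f_def)
  have f[measurable]: "f ij \<in> borel_measurable borel" for ij by (simp add: f_def)
  define F where "F = (\<lambda>Z. ennreal (gaussian_density n k v Z) * ennreal (exp (s * (\<Sum>i<n. Z $$ (i,a) * Z $$ (i,b)))))"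
  note [measurable] = measurable_gram_sum[OF ab(1,2), of n]
  have F[measurable]: "F \<in> borel_measurable (mat_borel n k)" unfolding F_def by measurable
  have mm: "Matrix.mat n k \<in> ?P ?I \<rightarrow>\<^sub>M mat_borel n k" by (rule measurable_mat_of_PiM) simp
  have FI: "(\<lambda>z. F (Matrix.mat n k z)) \<in> borel_measurable (?P (?J \<union> ?B))"
    using measurable_compose[OF mm F] by (simp only: IJ(1)[symmetric])
  have prodB: "(\<Prod>ij\<in>?B. g ij) = (\<Prod>i<n. g (i,b))" for g :: "nat \<times> nat \<Rightarrow> 'c :: comm_monoid_mult"
    by (rule prod.reindex_bij_witness[of _ "\<lambda>i. (i,b)" fst]) auto
  have val: "F (Matrix.mat n k (merge ?J ?B (x, y)))
    = ennreal (\<Prod>ij\<in>?J. f ij (x ij)) * (\<Prod>ij\<in>?B. ennreal (f ij (y ij) * exp (s * x (fst ij, a) * y ij)))" for x y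
  proof -
    define z where "z = merge ?J ?B (x, y)"
    have zJ: "z ij = x ij" if "ij \<in> ?J" for ij using that by (simp add: z_def merge_def)
    have zB: "z ij = y ij" if "ij \<in> ?B" for ij using that by (auto simp: z_def merge_def)
    have "gaussian_density n k v (Matrix.mat n k z) = (\<Prod>ij\<in>?I. f ij (z ij))"
      unfolding gaussian_density_def f_def by (intro prod.cong) auto
    also have "\<dots> = (\<Prod>ij\<in>?J. f ij (z ij)) * (\<Prod>ij\<in>?B. f ij (z ij))"
      unfolding IJ(1) by (rule prod.union_disjoint[OF IJ(3,4,2)])
    also have "\<dots> = (\<Prod>ij\<in>?J. f ij (x ij)) * (\<Prod>ij\<in>?B. f ij (y ij))"
      using zJ zB by (intro arg_cong2[where f="(*)"] prod.cong) auto
    finally have 1: "gaussian_density n k v (Matrix.mat n k z) = (\<Prod>ij\<in>?J. f ij (x ij)) * (\<Prod>ij\<in>?B. f ij (y ij))" .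
    have "exp (s * (\<Sum>i<n. Matrix.mat n k z $$ (i,a) * Matrix.mat n k z $$ (i,b))) = exp (\<Sum>i<n. s * x (i,a) * y (i,b))"
      unfolding sum_distrib_left using ab zJ zB by (intro arg_cong[where f=exp] sum.cong) auto
    also have "\<dots> = (\<Prod>i<n. exp (s * x (i,a) * y (i,b)))" by (rule exp_sum) simp
    also have "\<dots> = (\<Prod>ij\<in>?B. exp (s * x (fst ij,a) * y ij))" by (simp add: prodB)
    finally have 2: "exp (s * (\<Sum>i<n. Matrix.mat n k z $$ (i,a) * Matrix.mat n k z $$ (i,b))) = (\<Prod>ij\<in>?B. exp (s * x (fst ij,a) * y ij))" .
    have "F (Matrix.mat n k z) = ennreal ((\<Prod>ij\<in>?J. f ij (x ij)) * ((\<Prod>ij\<in>?B. f ij (y ij)) * (\<Prod>ij\<in>?B. exp (s * x (fst ij,a) * y ij))))"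
      unfolding F_def 1 2 by (subst ennreal_mult[symmetric]) (auto intro!: mult_nonneg_nonneg prod_nonneg simp: f0 mult.assoc)
    also have "\<dots> = ennreal (\<Prod>ij\<in>?J. f ij (x ij)) * ennreal (\<Prod>ij\<in>?B. f ij (y ij) * exp (s * x (fst ij, a) * y ij))"
      unfolding prod.distrib[symmetric] by (intro ennreal_mult prod_nonneg) (auto simp: f0)
    also have "ennreal (\<Prod>ij\<in>?B. f ij (y ij) * exp (s * x (fst ij, a) * y ij)) = (\<Prod>ij\<in>?B. ennreal (f ij (y ij) * exp (s * x (fst ij, a) * y ij)))"
      by (intro prod_ennreal[symmetric]) (auto simp: f0)
    finally show ?thesis by (simp only: z_def)
  qed
  \<comment> \<open>Completing the square in column \<open>b\<close> turns the linear coefficient s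
    x into the exponent s^2 v x^2 / 2, with v the variance in column \<open>b\<close> and x the
    entry in column \<open>a\<close>.\<close>
  define g where "g = (\<lambda>ij x. ennreal (f ij x * exp ((if snd ij = a then s\<^sup>2 * v (fst ij) b / 2 else 0) * x\<^sup>2)))"
  have inner: "(\<integral>\<^sup>+y. F (Matrix.mat n k (merge ?J ?B (x, y))) \<partial>?P ?B) = (\<Prod>ij\<in>?J. g ij (x ij))" for x
  proof -
    have "(\<integral>\<^sup>+y. F (Matrix.mat n k (merge ?J ?B (x, y))) \<partial>?P ?B)
      = ennreal (\<Prod>ij\<in>?J. f ij (x ij)) * (\<integral>\<^sup>+y. (\<Prod>ij\<in>?B. ennreal (f ij (y ij) * exp (s * x (fst ij, a) * y ij))) \<partial>?P ?B)"
      unfolding val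
    proof (rule nn_integral_cmult)
      show "(\<lambda>y. \<Prod>ij\<in>?B. ennreal (f ij (y ij) * exp (s * x (fst ij, a) * y ij))) \<in> borel_measurable (?P ?B)"
      proof (rule borel_measurable_prod_ennreal)
        fix ij assume "ij \<in> ?B"
        then have [measurable]: "(\<lambda>y. y ij) \<in> borel_measurable (?P ?B)"
          using measurable_component_singleton[of ij ?B "\<lambda>_. lborel :: real measure"] by (simp cong: measurable_cong_sets)
        show "(\<lambda>y. ennreal (f ij (y ij) * exp (s * x (fst ij, a) * y ij))) \<in> borel_measurable (?P ?B)" by measurable
      qed
    qed
    also have "(\<integral>\<^sup>+y. (\<Prod>ij\<in>?B. ennreal (f ij (y ij) * exp (s * x (fst ij, a) * y ij))) \<partial>?P ?B)
      = (\<Prod>ij\<in>?B. \<integral>\<^sup>+y. ennreal (f ij y * exp (s * x (fst ij, a) * y)) \<partial>lborel)"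
      by (rule product_nn_integral_prod) auto
    also have "\<dots> = (\<Prod>i<n. ennreal (exp (s\<^sup>2 * v i b / 2 * (x (i,a))\<^sup>2)))"
      unfolding prodB f_def
    proof (rule prod.cong[OF refl])
      fix i assume "i \<in> {..<n}"
      then have "0 < v i b" using v ab by auto
      from nn_integral_normal_exp_linear[OF this, of "s * x (i,a)"]
      show "(\<integral>\<^sup>+y. ennreal (normal_density 0 (sqrt (v (fst (i,b)) (snd (i,b)))) y * exp (s * x (fst (i,b), a) * y)) \<partial>lborel)
        = ennreal (exp (s\<^sup>2 * v i b / 2 * (x (i,a))\<^sup>2))"
        by (simp add: power_mult_distrib mult_ac)
    qed
    also have "\<dots> = ennreal (\<Prod>i<n. exp (s\<^sup>2 * v i b / 2 * (x (i,a))\<^sup>2))" by (rule prod_ennreal) simp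
    also have "(\<Prod>i<n. exp (s\<^sup>2 * v i b / 2 * (x (i,a))\<^sup>2)) = (\<Prod>i<n. \<Prod>j\<in>{..<k} - {b}. if j = a then exp (s\<^sup>2 * v i b / 2 * (x (i,a))\<^sup>2) else 1)"
      using ab by (intro prod.cong refl) simp
    also have "\<dots> = (\<Prod>ij\<in>?J. exp ((if snd ij = a then s\<^sup>2 * v (fst ij) b / 2 else 0) * (x ij)\<^sup>2))"
      unfolding prod.cartesian_product by (intro prod.cong) auto
    finally have "(\<integral>\<^sup>+y. F (Matrix.mat n k (merge ?J ?B (x, y))) \<partial>?P ?B)
      = ennreal ((\<Prod>ij\<in>?J. f ij (x ij)) * (\<Prod>ij\<in>?J. exp ((if snd ij = a then s\<^sup>2 * v (fst ij) b / 2 else 0) * (x ij)\<^sup>2)))"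
      by (simp add: ennreal_mult prod_nonneg f0)
    then show ?thesis unfolding prod.distrib[symmetric] g_def by (simp add: prod_ennreal f0)
  qed
  have "(\<integral>\<^sup>+Z. F Z \<partial>leb_mat n k) = (\<integral>\<^sup>+z. F (Matrix.mat n k z) \<partial>?P (?J \<union> ?B))"
    unfolding prod_mat_def IJ(1)[symmetric] by (rule nn_integral_distr[OF mm]) (use F in simp)
  also have "\<dots> = (\<integral>\<^sup>+x. (\<integral>\<^sup>+y. F (Matrix.mat n k (merge ?J ?B (x, y))) \<partial>?P ?B) \<partial>?P ?J)"
    by (rule product_nn_integral_fold[OF IJ(2,3,4) FI])
  also have "\<dots> = (\<integral>\<^sup>+x. (\<Prod>ij\<in>?J. g ij (x ij)) \<partial>?P ?J)" by (simp only: inner)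
  also have "\<dots> = (\<Prod>ij\<in>?J. \<integral>\<^sup>+x. g ij x \<partial>lborel)"
    by (rule product_nn_integral_prod) (auto simp: g_def)
  also have "\<dots> \<le> (\<Prod>ij\<in>?J. ennreal (if snd ij = a then exp (4 * s\<^sup>2 * (v (fst ij) a * v (fst ij) b)) else 1))"
  proof (rule prod_mono_ennreal)
    fix ij assume "ij \<in> ?J"
    then obtain i j where ij: "ij = (i,j)" "i < n" "j < k" by auto
    show "(\<integral>\<^sup>+x. g ij x \<partial>lborel) \<le> ennreal (if snd ij = a then exp (4 * s\<^sup>2 * (v (fst ij) a * v (fst ij) b)) else 1)"
    proof (cases "j = a")
      case True
      have va: "0 < v i a" "0 < v i b" using v[OF ij(2)] ab by auto
      define u where "u = 2 * (s\<^sup>2 * v i b / 2) * v i a"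
      have "(\<bar>s\<bar> * v i a) * (\<bar>s\<bar> * v i b) = (\<bar>s\<bar> * \<bar>s\<bar>) * (v i a * v i b)" by (simp only: mult_ac)
      then have "u = (\<bar>s\<bar> * v i a) * (\<bar>s\<bar> * v i b)" by (simp add: u_def power2_eq_square)
      also have "\<dots> \<le> (1 / 4) * (1 / 4)" using s[OF ij(2)] va by (intro mult_mono) auto
      finally have u: "0 \<le> u" "u \<le> 1 / 16" using va by (auto simp: u_def)
      have lt: "2 * (s\<^sup>2 * v i b / 2) * v i a < 1" using u by (simp only: u_def[symmetric])
      have "(\<integral>\<^sup>+x. g ij x \<partial>lborel) = ennreal (1 / sqrt (1 - u))"
        using nn_integral_normal_exp_square[OF va(1) lt] by (simp add: g_def f_def ij True u_def)
      also have "\<dots> \<le> ennreal (exp (u / 2 + u\<^sup>2))"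
        by (rule ennreal_leI[OF inverse_sqrt_le_exp]) (use u in auto)
      \<comment> \<open>A generous constant, taken so that diagonal and off-diagonal entries obey
        the same bound.\<close>
      also have "\<dots> \<le> ennreal (exp (4 * u))"
      proof (rule ennreal_leI)
        have "u\<^sup>2 \<le> u" using u by (simp add: power2_eq_square mult_left_le)
        then show "exp (u / 2 + u\<^sup>2) \<le> exp (4 * u)" using u by simp
      qed
      also have "4 * u = 4 * s\<^sup>2 * (v i a * v i b)" by (simp add: u_def)
      finally show ?thesis by (simp add: ij True)
    next
      case False
      then show ?thesis using nn_integral_normal_density[of "sqrt (v i j)" 0] v[OF ij(2,3)] by (simp add: g_def f_def ij)
    qed
  qed
  also have "\<dots> = ennreal (\<Prod>ij\<in>?J. if snd ij = a then exp (4 * s\<^sup>2 * (v (fst ij) a * v (fst ij) b)) else 1)"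
    by (rule prod_ennreal) auto
  also have "(\<Prod>ij\<in>?J. if snd ij = a then exp (4 * s\<^sup>2 * (v (fst ij) a * v (fst ij) b)) else 1)
    = (\<Prod>i<n. \<Prod>j\<in>{..<k} - {b}. if j = a then exp (4 * s\<^sup>2 * (v i a * v i b)) else 1)"
    unfolding prod.cartesian_product by (intro prod.cong) auto
  also have "\<dots> = exp (\<Sum>i<n. 4 * s\<^sup>2 * (v i a * v i b))"
    using ab by (simp add: exp_sum)
  finally show ?thesis by (simp only: F_def)
qed

section \<open>Concentration of the Gram matrix\<close>

definition gram_entry :: "nat \<Rightarrow> nat \<Rightarrow> nat \<Rightarrow> real mat \<Rightarrow> real" where
  "gram_entry n a b Z = (\<Sum>i<n. Z $$ (i,a) * Z $$ (i,b))"

definition gram_mean :: "nat \<Rightarrow> (nat \<Rightarrow> nat \<Rightarrow> real) \<Rightarrow> nat \<Rightarrow> nat \<Rightarrow> real" where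
  "gram_mean n v a b = (if a = b then \<Sum>i<n. v i a else 0)"

lemma measurable_gram_entry: "a < k \<Longrightarrow> b < k \<Longrightarrow> gram_entry n a b \<in> borel_measurable (mat_borel n k)"
  unfolding gram_entry_def by (rule measurable_gram_sum)

lemma gram_entry_index: "Z \<in> carrier_mat n k \<Longrightarrow> a < k \<Longrightarrow> b < k \<Longrightarrow> (Z\<^sup>T * Z) $$ (a,b) = gram_entry n a b Z"
  using mult_index[of "Z\<^sup>T" k n Z k a b] by (simp add: gram_entry_def)

text \<open>Centring removes the first-order term of the diagonal case; the second-order terms of
  the two cases already have the same form.\<close>

lemma nn_integral_gaussian_exp_gram:
  assumes v: "\<And>i j. i < n \<Longrightarrow> j < k \<Longrightarrow> 0 < v i j" and s: "\<And>i j. i < n \<Longrightarrow> j < k \<Longrightarrow> \<bar>s\<bar> * v i j \<le> 1 / 4"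
    and ab: "a < k" "b < k"
  shows "(\<integral>\<^sup>+Z. ennreal (gaussian_density n k v Z) * ennreal (exp (s * (gram_entry n a b Z - gram_mean n v a b))) \<partial>leb_mat n k)
    \<le> ennreal (exp (4 * s\<^sup>2 * (\<Sum>i<n. v i a * v i b)))"
proof -
  note [measurable] = measurable_gram_entry[OF ab, of n]
  have "(\<integral>\<^sup>+Z. ennreal (gaussian_density n k v Z) * ennreal (exp (s * (gram_entry n a b Z - gram_mean n v a b))) \<partial>leb_mat n k)
    = (\<integral>\<^sup>+Z. ennreal (exp (- s * gram_mean n v a b)) * (ennreal (gaussian_density n k v Z) * ennreal (exp (s * gram_entry n a b Z))) \<partial>leb_mat n k)"
  proof (rule nn_integral_cong)
    fix Z
    have "ennreal (exp (s * (gram_entry n a b Z - gram_mean n v a b))) = ennreal (exp (- s * gram_mean n v a b)) * ennreal (exp (s * gram_entry n a b Z))"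
      by (subst ennreal_mult[symmetric]) (auto simp: exp_add[symmetric] algebra_simps)
    then show "ennreal (gaussian_density n k v Z) * ennreal (exp (s * (gram_entry n a b Z - gram_mean n v a b)))
      = ennreal (exp (- s * gram_mean n v a b)) * (ennreal (gaussian_density n k v Z) * ennreal (exp (s * gram_entry n a b Z)))"
      by (simp only: mult_ac)
  qed
  also have "\<dots> = ennreal (exp (- s * gram_mean n v a b)) * (\<integral>\<^sup>+Z. ennreal (gaussian_density n k v Z) * ennreal (exp (s * gram_entry n a b Z)) \<partial>leb_mat n k)"
    by (rule nn_integral_cmult) measurable
  also have "\<dots> \<le> ennreal (exp (- s * gram_mean n v a b)) * ennreal (exp (s * gram_mean n v a b + 4 * s\<^sup>2 * (\<Sum>i<n. v i a * v i b)))"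
  proof (rule mult_left_mono)
    show "(\<integral>\<^sup>+Z. ennreal (gaussian_density n k v Z) * ennreal (exp (s * gram_entry n a b Z)) \<partial>leb_mat n k)
      \<le> ennreal (exp (s * gram_mean n v a b + 4 * s\<^sup>2 * (\<Sum>i<n. v i a * v i b)))"
    proof (cases "a = b")
      case True
      have "(\<integral>\<^sup>+Z. ennreal (gaussian_density n k v Z) * ennreal (exp (s * gram_entry n a b Z)) \<partial>leb_mat n k)
        \<le> ennreal (exp (\<Sum>i<n. s * v i a + 4 * s\<^sup>2 * (v i a)\<^sup>2))"
        using nn_integral_gaussian_exp_square[of n k v s a] v s ab True by (simp add: gram_entry_def power2_eq_square)
      also have "(\<Sum>i<n. s * v i a + 4 * s\<^sup>2 * (v i a)\<^sup>2) = s * gram_mean n v a b + 4 * s\<^sup>2 * (\<Sum>i<n. v i a * v i b)"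
        by (simp add: True gram_mean_def sum.distrib sum_distrib_left power2_eq_square)
      finally show ?thesis .
    next
      case False
      then show ?thesis using nn_integral_gaussian_exp_product[of n k v s a b] v s ab
        by (simp add: gram_entry_def gram_mean_def sum_distrib_left)
    qed
  qed simp
  also have "\<dots> = ennreal (exp (4 * s\<^sup>2 * (\<Sum>i<n. v i a * v i b)))"
    by (subst ennreal_mult[symmetric]) (auto simp: exp_add[symmetric])
  finally show ?thesis .
qed

lemma gaussian_density_rows: "gaussian_density n k v Z = (\<Prod>i<n. \<Prod>j<k. normal_density 0 (sqrt (v i j)) (Z $$ (i,j)))"
  by (simp add: gaussian_density_def prod.cartesian_product)

lemma gaussian_density_append:
  assumes w: "w \<in> carrier_mat 1 k" and Y: "Y \<in> carrier_mat m k"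
  shows "gaussian_density (1 + m) k v (w @\<^sub>r Y) = gaussian_density 1 k v w * gaussian_density m k (\<lambda>i. v (Suc i)) Y"
proof -
  have "gaussian_density (1 + m) k v (w @\<^sub>r Y) = (\<Prod>i<Suc m. \<Prod>j<k. normal_density 0 (sqrt (v i j)) (if i < 1 then w $$ (i,j) else Y $$ (i - 1,j)))"
    unfolding gaussian_density_rows using append_rows_index[OF w Y] by (intro prod.cong) auto
  then show ?thesis unfolding prod.lessThan_Suc_shift gaussian_density_rows by simp
qed

lemma gram_entry_append:
  assumes w: "w \<in> carrier_mat 1 k" and Y: "Y \<in> carrier_mat m k" and ab: "a < k" "b < k"
  shows "gram_entry (1 + m) a b (w @\<^sub>r Y) = w $$ (0,a) * w $$ (0,b) + gram_entry m a b Y"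
proof -
  have "gram_entry (1 + m) a b (w @\<^sub>r Y) = (\<Sum>i<Suc m. if i < 1 then w $$ (i,a) * w $$ (i,b) else Y $$ (i - 1,a) * Y $$ (i - 1,b))"
    unfolding gram_entry_def using append_rows_index[OF w Y] ab by (intro sum.cong) auto
  then show ?thesis unfolding sum.lessThan_Suc_shift gram_entry_def by simp
qed

text \<open>Since |s| v \<le> 1/4, each of the squares that dominate the product of two entries is
  at most half the Gaussian exponent \<open>q\<close>. The exponential factor therefore cannot
  exceed exp q, and the normaliser of the row is left.\<close>

lemma gaussian_row_bound:
  assumes v: "\<And>j. j < k \<Longrightarrow> 0 < v 0 j" and s: "\<And>j. j < k \<Longrightarrow> \<bar>s\<bar> * v 0 j \<le> 1 / 4" and ab: "a < k" "b < k"
  shows "gaussian_density 1 k v w * exp (s * (w $$ (0,a) * w $$ (0,b))) \<le> (\<Prod>j<k. 1 / sqrt (2 * pi * v 0 j))"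
proof -
  let ?L = "\<Prod>j<k. 1 / sqrt (2 * pi * v 0 j)"
  define q where "q = (\<Sum>j<k. (w $$ (0,j))\<^sup>2 / (2 * v 0 j))"
  have L: "0 \<le> ?L" using v by (intro prod_nonneg) (auto intro: less_imp_le)
  have "gaussian_density 1 k v w = (\<Prod>j<k. 1 / sqrt (2 * pi * v 0 j) * exp (- ((w $$ (0,j))\<^sup>2 / (2 * v 0 j))))"
    unfolding gaussian_density_rows using v by (simp add: normal_density_def less_imp_le)
  also have "\<dots> = ?L * exp (- q)"
    by (simp add: prod.distrib exp_sum[symmetric] q_def sum_negf prod_dividef)
  finally have gd: "gaussian_density 1 k v w = ?L * exp (- q)" .
  have h: "\<bar>s\<bar> * (w $$ (0,c))\<^sup>2 \<le> q / 2" if c: "c < k" for c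
  proof -
    have "\<bar>s\<bar> \<le> 1 / (4 * v 0 c)" using s[OF c] v[OF c] by (simp add: field_simps)
    then have "\<bar>s\<bar> * (w $$ (0,c))\<^sup>2 \<le> 1 / (4 * v 0 c) * (w $$ (0,c))\<^sup>2" by (intro mult_right_mono) auto
    also have "\<dots> = (w $$ (0,c))\<^sup>2 / (2 * v 0 c) / 2" by simp
    also have "\<dots> \<le> q / 2"
      unfolding q_def using c v by (intro divide_right_mono member_le_sum[where f="\<lambda>j. (w $$ (0,j))\<^sup>2 / (2 * v 0 j)"]) (auto intro: divide_nonneg_pos)
    finally show ?thesis .
  qed
  have q0: "0 \<le> q" unfolding q_def using v by (intro sum_nonneg) (auto intro: divide_nonneg_pos)
  have "s * (w $$ (0,a) * w $$ (0,b)) \<le> \<bar>s\<bar> * \<bar>w $$ (0,a) * w $$ (0,b)\<bar>"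
    using abs_ge_self[of "s * (w $$ (0,a) * w $$ (0,b))"] by (simp add: abs_mult)
  also have "\<dots> \<le> \<bar>s\<bar> * (((w $$ (0,a))\<^sup>2 + (w $$ (0,b))\<^sup>2) / 2)"
  proof (rule mult_left_mono)
    have "0 \<le> (\<bar>w $$ (0,a)\<bar> - \<bar>w $$ (0,b)\<bar>)\<^sup>2" by simp
    then show "\<bar>w $$ (0,a) * w $$ (0,b)\<bar> \<le> ((w $$ (0,a))\<^sup>2 + (w $$ (0,b))\<^sup>2) / 2"
      unfolding power2_diff by (simp add: abs_mult)
  qed simp
  also have "\<dots> = (\<bar>s\<bar> * (w $$ (0,a))\<^sup>2 + \<bar>s\<bar> * (w $$ (0,b))\<^sup>2) / 2" by (simp add: algebra_simps)
  also have "\<dots> \<le> (q / 2 + q / 2) / 2" by (intro divide_right_mono add_mono h ab) simp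
  also have "\<dots> \<le> q" using q0 by simp
  finally have "exp (- q) * exp (s * (w $$ (0,a) * w $$ (0,b))) \<le> 1" by (simp add: exp_add[symmetric])
  then have "?L * (exp (- q) * exp (s * (w $$ (0,a) * w $$ (0,b)))) \<le> ?L" by (rule mult_left_le[OF _ L])
  then show ?thesis unfolding gd by (simp only: mult.assoc)
qed

text \<open>For a single row the function is the row density of a uniform frame in dimension
  \<open>k + 1\<close>, whose mass is finite by \<open>haar_row_law\<close>.\<close>

lemma nn_integral_stiefel_density_row:
  "(\<integral>\<^sup>+y. ennreal (stiefel_density k y) \<partial>leb_mat 1 k) < \<infinity>"
proof -
  obtain M where "is_haar (k + Suc 0) k M" using haar_exists[of k "k + Suc 0"] by auto
  from haar_row_law[OF this] have "(\<integral>\<^sup>+y. ennreal (row_density (Suc 0) y) \<partial>leb_mat 1 k) < \<infinity>" by blast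
  also have "(\<integral>\<^sup>+y. ennreal (row_density (Suc 0) y) \<partial>leb_mat 1 k) = (\<integral>\<^sup>+y. ennreal (stiefel_density k y) \<partial>leb_mat 1 k)"
    by (rule nn_integral_cong) (simp only: space_prod_mat row_density_eq power_0 mult_1_right)
  finally show ?thesis .
qed

text \<open>The integral of 1 / sqrt (1 - |y|^2) over the unit ball in dimension \<open>k\<close>;
  by the preceding lemma the conversion to a real number loses nothing.\<close>

definition row_mass :: "nat \<Rightarrow> real" where
  "row_mass k = enn2real (\<integral>\<^sup>+y. ennreal (stiefel_density k y) \<partial>leb_mat 1 k)"

text \<open>With one row in the fibre the Jacobian \<open>det P\<close> cancels exactly the factor 1
  / \<open>det P\<close> of the density, so the integral is \<open>row_mass k\<close> or 0 and no
  trace of \<open>Y\<close> remains.\<close>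

lemma nn_integral_stiefel_density_fiber_le:
  assumes Y: "Y \<in> carrier_mat m k"
  shows "(\<integral>\<^sup>+w. ennreal (stiefel_density k (w @\<^sub>r Y)) \<partial>leb_mat 1 k) \<le> ennreal (row_mass k)"
proof -
  have e: "ennreal (row_mass k) = (\<integral>\<^sup>+y. ennreal (stiefel_density k y) \<partial>leb_mat 1 k)"
    unfolding row_mass_def using nn_integral_stiefel_density_row[of k] by simp
  have "(\<integral>\<^sup>+w. 1 * ennreal (stiefel_density k (w @\<^sub>r Y)) \<partial>leb_mat 1 k)
    = (if sym_pd k (cogram k Y) then ennreal (det (root_cogram k Y) ^ 1 / det (root_cogram k Y)) *
        (\<integral>\<^sup>+Z. 1 * ennreal (stiefel_density k Z) \<partial>leb_mat 1 k) else 0)"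
    by (rule nn_integral_stiefel_density_fiber[OF Y, of "\<lambda>_. 1" 1]) simp
  also have "\<dots> \<le> ennreal (row_mass k)"
    unfolding e using root_cogram_pd(6)[of k Y] by auto
  finally show ?thesis by simp
qed

text \<open>The factor \<open>stiefel_density\<close> is singular, but its integral over the first row is bounded
  uniformly in the other rows, so it only costs the supremum of the density of the first row.\<close>
lemma nn_integral_gaussian_exp_gram_density:
  assumes v: "\<And>i j. i < 1 + m \<Longrightarrow> j < k \<Longrightarrow> 0 < v i j" and s: "\<And>i j. i < 1 + m \<Longrightarrow> j < k \<Longrightarrow> \<bar>s\<bar> * v i j \<le> 1 / 4"
    and ab: "a < k" "b < k"
  shows "(\<integral>\<^sup>+Z. ennreal (gaussian_density (1 + m) k v Z) *
      (ennreal (stiefel_density k Z) * ennreal (exp (s * (gram_entry (1 + m) a b Z - gram_mean m (\<lambda>i. v (Suc i)) a b)))) \<partial>leb_mat (1 + m) k)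
    \<le> ennreal ((\<Prod>j<k. 1 / sqrt (2 * pi * v 0 j)) * row_mass k * exp (4 * s\<^sup>2 * (\<Sum>i<m. v (Suc i) a * v (Suc i) b)))"
proof -
  let ?L = "\<Prod>j<k. 1 / sqrt (2 * pi * v 0 j)" and ?v = "\<lambda>i. v (Suc i)"
  have L: "0 \<le> ?L" using v[of 0] by (intro prod_nonneg) (auto intro: less_imp_le)
  have rm: "0 \<le> row_mass k" by (simp add: row_mass_def)
  note [measurable] = measurable_gram_entry[OF ab, of "1 + m"] measurable_gram_entry[OF ab, of m]
  interpret pair_sigma_finite "leb_mat 1 k" "leb_mat m k" by (simp add: pair_sigma_finite_def sigma_finite_leb_mat)
  define E where "E = (\<lambda>Y. ennreal (gaussian_density m k ?v Y) * ennreal (exp (s * (gram_entry m a b Y - gram_mean m ?v a b))))"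
  have E[measurable]: "E \<in> borel_measurable (mat_borel m k)" unfolding E_def by measurable
  let ?F = "\<lambda>Z. ennreal (gaussian_density (1 + m) k v Z) *
      (ennreal (stiefel_density k Z) * ennreal (exp (s * (gram_entry (1 + m) a b Z - gram_mean m ?v a b))))"
  \<comment> \<open>The Gaussian density of the first row, together with its share of the exponent,
    is replaced by its supremum. This is why the exponent is centred at the mean of the remaining
    rows only.\<close>
  have le: "?F (w @\<^sub>r Y) \<le> ennreal ?L * E Y * ennreal (stiefel_density k (w @\<^sub>r Y))"
    if w: "w \<in> carrier_mat 1 k" and Y: "Y \<in> carrier_mat m k" for w Y
  proof -
    let ?e = "exp (s * (gram_entry m a b Y - gram_mean m ?v a b))"
    have "exp (s * (gram_entry (1 + m) a b (w @\<^sub>r Y) - gram_mean m ?v a b)) = exp (s * (w $$ (0,a) * w $$ (0,b))) * ?e"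
      unfolding gram_entry_append[OF w Y ab] by (simp add: exp_add[symmetric] algebra_simps)
    then have "?F (w @\<^sub>r Y) = ennreal ((gaussian_density 1 k v w * exp (s * (w $$ (0,a) * w $$ (0,b)))) * ((gaussian_density m k ?v Y * ?e) * stiefel_density k (w @\<^sub>r Y)))"
      unfolding gaussian_density_append[OF w Y]
      by (simp add: ennreal_mult gaussian_density_nonneg stiefel_density_nonneg mult_ac)
    also have "\<dots> \<le> ennreal (?L * ((gaussian_density m k ?v Y * ?e) * stiefel_density k (w @\<^sub>r Y)))"
      by (intro ennreal_leI mult_right_mono gaussian_row_bound v s ab)
         (auto intro!: mult_nonneg_nonneg gaussian_density_nonneg stiefel_density_nonneg)
    also have "\<dots> = ennreal ?L * E Y * ennreal (stiefel_density k (w @\<^sub>r Y))"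
      unfolding E_def using L by (simp add: ennreal_mult gaussian_density_nonneg stiefel_density_nonneg mult.assoc)
    finally show ?thesis .
  qed
  have "(\<integral>\<^sup>+Z. ?F Z \<partial>leb_mat (1 + m) k) = (\<integral>\<^sup>+w. (\<integral>\<^sup>+Y. ?F (w @\<^sub>r Y) \<partial>leb_mat m k) \<partial>leb_mat 1 k)"
    by (rule nn_integral_leb_mat_append_rows) measurable
  also have "\<dots> \<le> (\<integral>\<^sup>+w. (\<integral>\<^sup>+Y. ennreal ?L * E Y * ennreal (stiefel_density k (w @\<^sub>r Y)) \<partial>leb_mat m k) \<partial>leb_mat 1 k)"
    by (intro nn_integral_mono le) auto
  \<comment> \<open>The first row is integrated first: only the singular factor still depends on
    it.\<close>
  also have "\<dots> = (\<integral>\<^sup>+Y. (\<integral>\<^sup>+w. ennreal ?L * E Y * ennreal (stiefel_density k (w @\<^sub>r Y)) \<partial>leb_mat 1 k) \<partial>leb_mat m k)"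
    by (rule Fubini'[symmetric]) measurable
  also have "\<dots> \<le> (\<integral>\<^sup>+Y. ennreal (?L * row_mass k) * E Y \<partial>leb_mat m k)"
  proof (rule nn_integral_mono)
    fix Y assume "Y \<in> space (leb_mat m k)"
    then have Y: "Y \<in> carrier_mat m k" by simp
    have "(\<lambda>w. w @\<^sub>r Y) \<in> mat_borel 1 k \<rightarrow>\<^sub>M mat_borel (1 + m) k" using Y by measurable
    note [measurable] = measurable_compose[OF this measurable_stiefel_density]
    have "(\<integral>\<^sup>+w. ennreal ?L * E Y * ennreal (stiefel_density k (w @\<^sub>r Y)) \<partial>leb_mat 1 k)
      = ennreal ?L * E Y * (\<integral>\<^sup>+w. ennreal (stiefel_density k (w @\<^sub>r Y)) \<partial>leb_mat 1 k)"
      by (rule nn_integral_cmult) measurable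
    also have "\<dots> \<le> ennreal ?L * E Y * ennreal (row_mass k)"
      by (intro mult_left_mono nn_integral_stiefel_density_fiber_le[OF Y]) simp
    also have "\<dots> = ennreal (?L * row_mass k) * E Y" using L rm by (simp only: ennreal_mult mult_ac)
    finally show "(\<integral>\<^sup>+w. ennreal ?L * E Y * ennreal (stiefel_density k (w @\<^sub>r Y)) \<partial>leb_mat 1 k) \<le> ennreal (?L * row_mass k) * E Y" .
  qed
  also have "\<dots> = ennreal (?L * row_mass k) * (\<integral>\<^sup>+Y. E Y \<partial>leb_mat m k)"
    by (rule nn_integral_cmult) measurable
  also have "\<dots> \<le> ennreal (?L * row_mass k) * ennreal (exp (4 * s\<^sup>2 * (\<Sum>i<m. ?v i a * ?v i b)))"
    unfolding E_def by (intro mult_left_mono nn_integral_gaussian_exp_gram) (use v s ab in auto)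
  also have "\<dots> = ennreal (?L * row_mass k * exp (4 * s\<^sup>2 * (\<Sum>i<m. ?v i a * ?v i b)))"
    using L rm by (intro ennreal_mult[symmetric] mult_nonneg_nonneg) auto
  finally show ?thesis .
qed

text \<open>A two-sided Chernoff bound under the weight \<open>g\<close>, which is taken to be 1 and
  \<open>stiefel_density k\<close>.\<close>

lemma nn_integral_tail_le:
  assumes s: "0 \<le> s" and g[measurable]: "g \<in> borel_measurable M" and X[measurable]: "X \<in> borel_measurable M"
    and up: "(\<integral>\<^sup>+x. g x * ennreal (exp (s * X x)) \<partial>M) \<le> B" and dn: "(\<integral>\<^sup>+x. g x * ennreal (exp (- s * X x)) \<partial>M) \<le> B"
  shows "(\<integral>\<^sup>+x. g x * indicator {x. \<delta> < \<bar>X x\<bar>} x \<partial>M) \<le> ennreal (exp (- s * \<delta>)) * (2 * B)"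
proof -
  have "(\<integral>\<^sup>+x. g x * indicator {x. \<delta> < \<bar>X x\<bar>} x \<partial>M)
    \<le> (\<integral>\<^sup>+x. ennreal (exp (- s * \<delta>)) * (g x * ennreal (exp (s * X x)) + g x * ennreal (exp (- s * X x))) \<partial>M)"
  proof (rule nn_integral_mono)
    fix x
    have "1 \<le> ennreal (exp (- s * \<delta>)) * (ennreal (exp (s * X x)) + ennreal (exp (- s * X x)))" if "\<delta> < \<bar>X x\<bar>"
    proof -
      have "s * \<delta> \<le> s * \<bar>X x\<bar>" using that s by (intro mult_left_mono) auto
      then have "1 \<le> exp (- s * \<delta>) * exp (s * \<bar>X x\<bar>)" by (simp add: exp_add[symmetric])
      also have "\<dots> \<le> exp (- s * \<delta>) * (exp (s * X x) + exp (- s * X x))"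
        by (intro mult_left_mono) (auto simp: abs_if)
      finally have "ennreal 1 \<le> ennreal (exp (- s * \<delta>) * (exp (s * X x) + exp (- s * X x)))" by (rule ennreal_leI)
      then show ?thesis by (simp add: ennreal_mult ennreal_plus)
    qed
    then have "g x * indicator {x. \<delta> < \<bar>X x\<bar>} x \<le> g x * (ennreal (exp (- s * \<delta>)) * (ennreal (exp (s * X x)) + ennreal (exp (- s * X x))))"
      by (intro mult_left_mono) (auto split: split_indicator)
    then show "g x * indicator {x. \<delta> < \<bar>X x\<bar>} x \<le> ennreal (exp (- s * \<delta>)) * (g x * ennreal (exp (s * X x)) + g x * ennreal (exp (- s * X x)))"
      by (simp only: distrib_left mult_ac)
  qed
  also have "\<dots> = ennreal (exp (- s * \<delta>)) * ((\<integral>\<^sup>+x. g x * ennreal (exp (s * X x)) \<partial>M) + (\<integral>\<^sup>+x. g x * ennreal (exp (- s * X x)) \<partial>M))"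
    by (subst nn_integral_cmult, measurable, subst nn_integral_add, measurable)
  also have "\<dots> \<le> ennreal (exp (- s * \<delta>)) * (B + B)" by (intro mult_left_mono add_mono up dn) auto
  finally show ?thesis by (simp only: mult_2)
qed

text \<open>If every Gram entry is within 2 \<delta> of its limit, continuity bounds the deviation
  by \<eta>. Otherwise |h - h0| \<le> h0 + h, and some entry is more than \<delta> away from its
  mean, as that mean is within \<delta> of the limit. Both parts of this bound have exponentially
  small integrals over the tail event; the factor 2 counts the two signs and k^2 the
  entries.\<close>

lemma stiefel_density_L1:
  fixes D :: "nat \<Rightarrow> real"
  assumes v: "\<And>i j. i < 1 + m \<Longrightarrow> j < k \<Longrightarrow> 0 < v i j" and s: "\<And>i j. i < 1 + m \<Longrightarrow> j < k \<Longrightarrow> s * v i j \<le> 1 / 4"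
    and s0: "0 \<le> s" and h0: "0 \<le> h0" and \<eta>: "0 \<le> \<eta>"
    and cont: "\<And>Z. Z \<in> carrier_mat (1 + m) k \<Longrightarrow>
      (\<And>a b. a < k \<Longrightarrow> b < k \<Longrightarrow> \<bar>gram_entry (1 + m) a b Z - (if a = b then D a else 0)\<bar> \<le> 2 * \<delta>) \<Longrightarrow> \<bar>stiefel_density k Z - h0\<bar> \<le> \<eta>"
    and mean: "\<And>a. a < k \<Longrightarrow> \<bar>(\<Sum>i<1+m. v i a) - D a\<bar> \<le> \<delta>" "\<And>a. a < k \<Longrightarrow> \<bar>(\<Sum>i<m. v (Suc i) a) - D a\<bar> \<le> \<delta>"
    and var: "\<And>a b. a < k \<Longrightarrow> b < k \<Longrightarrow> (\<Sum>i<1+m. v i a * v i b) \<le> S2"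
    and L: "(\<Prod>j<k. 1 / sqrt (2 * pi * v 0 j)) \<le> L"
  shows "(\<integral>\<^sup>+Z. ennreal \<bar>stiefel_density k Z - h0\<bar> \<partial>gaussian_mat (1 + m) k v)
    \<le> ennreal (\<eta> + (real k)\<^sup>2 * (2 * exp (4 * s\<^sup>2 * S2 - s * \<delta>) * (h0 + L * row_mass k)))"
proof -
  let ?G = "gaussian_mat (1 + m) k v" and ?h = "stiefel_density k" and ?n = "1 + m" and ?v = "\<lambda>i. v (Suc i)"
  let ?L = "\<Prod>j<k. 1 / sqrt (2 * pi * v 0 j)"
  have L0: "0 \<le> ?L" using v[of 0] by (intro prod_nonneg) (auto intro: less_imp_le)
  have rm: "0 \<le> row_mass k" by (simp add: row_mass_def)
  interpret prob_space ?G by (rule prob_space_gaussian_mat[OF v])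
  have \<delta>0: "0 \<le> \<delta>" if "0 < k" using mean(1)[OF that] by (meson abs_ge_zero order_trans)
  define X where "X = (\<lambda>a b Z. gram_entry ?n a b Z - gram_mean ?n v a b)"
  \<comment> \<open>Two centrings of the same entry: \<open>X\<close> at the full mean for the part
    with \<open>h0\<close>, and \<open>X'\<close> at the mean without the first row, because the
    moment bound weighted by the density is available only there.\<close>
  define X' where "X' = (\<lambda>a b Z. gram_entry ?n a b Z - gram_mean m ?v a b)"
  have X[measurable]: "X a b \<in> borel_measurable ?G" "X' a b \<in> borel_measurable ?G" if "a < k" "b < k" for a b
    using measurable_gram_entry[OF that, of ?n] unfolding X_def X'_def by measurable
  let ?E = "exp (4 * s\<^sup>2 * S2)"
  have S2': "(\<Sum>i<m. v (Suc i) a * v (Suc i) b) \<le> S2" if "a < k" "b < k" for a b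
  proof -
    have "(\<Sum>i<1+m. v i a * v i b) = v 0 a * v 0 b + (\<Sum>i<m. v (Suc i) a * v (Suc i) b)"
      by (simp only: plus_1_eq_Suc sum.lessThan_Suc_shift)
    moreover have "0 \<le> v 0 a * v 0 b" using v[of 0] that by (simp add: less_imp_le)
    ultimately show ?thesis using var[OF that] by linarith
  qed
  have mgf: "(\<integral>\<^sup>+Z. 1 * ennreal (exp (r * X a b Z)) \<partial>?G) \<le> ennreal ?E"
    if ab: "a < k" "b < k" and r: "\<bar>r\<bar> = s" for a b r
  proof -
    note [measurable] = measurable_gram_entry[OF ab, of ?n]
    have r2: "r\<^sup>2 = s\<^sup>2" using r by (metis power2_abs)
    have "(\<integral>\<^sup>+Z. 1 * ennreal (exp (r * X a b Z)) \<partial>?G) = (\<integral>\<^sup>+Z. ennreal (gaussian_density ?n k v Z) * ennreal (exp (r * (gram_entry ?n a b Z - gram_mean ?n v a b))) \<partial>leb_mat ?n k)"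
      unfolding X_def mult_1_left by (rule nn_integral_gaussian_mat) measurable
    also have "\<dots> \<le> ennreal (exp (4 * r\<^sup>2 * (\<Sum>i<?n. v i a * v i b)))"
      by (rule nn_integral_gaussian_exp_gram[OF v _ ab]) (use s r in auto)
    also have "\<dots> \<le> ennreal ?E" unfolding r2 using var[OF ab] by (intro ennreal_leI) (simp add: mult_left_mono)
    finally show ?thesis .
  qed
  have mgf': "(\<integral>\<^sup>+Z. ennreal (?h Z) * ennreal (exp (r * X' a b Z)) \<partial>?G) \<le> ennreal (L * row_mass k * ?E)"
    if ab: "a < k" "b < k" and r: "\<bar>r\<bar> = s" for a b r
  proof -
    note [measurable] = measurable_gram_entry[OF ab, of ?n]
    have r2: "r\<^sup>2 = s\<^sup>2" using r by (metis power2_abs)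
    have "(\<integral>\<^sup>+Z. ennreal (?h Z) * ennreal (exp (r * X' a b Z)) \<partial>?G) = (\<integral>\<^sup>+Z. ennreal (gaussian_density ?n k v Z) * (ennreal (?h Z) * ennreal (exp (r * (gram_entry ?n a b Z - gram_mean m ?v a b)))) \<partial>leb_mat ?n k)"
      unfolding X'_def by (rule nn_integral_gaussian_mat) measurable
    also have "\<dots> \<le> ennreal (?L * row_mass k * exp (4 * r\<^sup>2 * (\<Sum>i<m. v (Suc i) a * v (Suc i) b)))"
      by (rule nn_integral_gaussian_exp_gram_density[OF v _ ab]) (use s r in auto)
    also have "\<dots> \<le> ennreal (L * row_mass k * ?E)"
      unfolding r2 using S2'[OF ab] L L0 rm by (intro ennreal_leI mult_mono) (auto simp: mult_left_mono intro!: mult_nonneg_nonneg)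
    finally show ?thesis .
  qed
  let ?e = "exp (- s * \<delta>)"
  have t1: "(\<integral>\<^sup>+Z. 1 * indicator {Z. \<delta> < \<bar>X a b Z\<bar>} Z \<partial>?G) \<le> ennreal ?e * (2 * ennreal ?E)" if ab: "a < k" "b < k" for a b
    using s0 by (intro nn_integral_tail_le X ab mgf) auto
  have t2: "(\<integral>\<^sup>+Z. ennreal (?h Z) * indicator {Z. \<delta> < \<bar>X' a b Z\<bar>} Z \<partial>?G) \<le> ennreal ?e * (2 * ennreal (L * row_mass k * ?E))"
    if ab: "a < k" "b < k" for a b
    using s0 by (intro nn_integral_tail_le X ab mgf') (auto intro!: measurable_compose[OF measurable_stiefel_density])
  \<comment> \<open>If entry (\<open>a\<close>, \<open>b\<close>) violates the 2 \<delta> condition,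
    both indicators are 1 and \<open>f a b Z\<close> is h0 + h.\<close>
  define f where "f = (\<lambda>a b Z. ennreal h0 * (1 * indicator {Z. \<delta> < \<bar>X a b Z\<bar>} Z) + ennreal (?h Z) * indicator {Z. \<delta> < \<bar>X' a b Z\<bar>} Z)"
  have fm[measurable]: "f a b \<in> borel_measurable ?G" if ab: "a < k" "b < k" for a b
  proof -
    note [measurable] = X[OF ab]
    show ?thesis unfolding f_def by measurable
  qed
  have fint: "(\<integral>\<^sup>+Z. f a b Z \<partial>?G) \<le> ennreal (2 * exp (4 * s\<^sup>2 * S2 - s * \<delta>) * (h0 + L * row_mass k))" if ab: "a < k" "b < k" for a b
  proof -
    note [measurable] = X[OF ab]
    have "(\<integral>\<^sup>+Z. f a b Z \<partial>?G) = ennreal h0 * (\<integral>\<^sup>+Z. 1 * indicator {Z. \<delta> < \<bar>X a b Z\<bar>} Z \<partial>?G) + (\<integral>\<^sup>+Z. ennreal (?h Z) * indicator {Z. \<delta> < \<bar>X' a b Z\<bar>} Z \<partial>?G)"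
      unfolding f_def by (subst nn_integral_add, measurable, subst nn_integral_cmult, measurable)
    also have "\<dots> \<le> ennreal h0 * (ennreal ?e * (2 * ennreal ?E)) + ennreal ?e * (2 * ennreal (L * row_mass k * ?E))"
      by (intro add_mono mult_left_mono t1 t2 ab) auto
    also have "\<dots> = ennreal (h0 * (?e * (2 * ?E)) + ?e * (2 * (L * row_mass k * ?E)))"
    proof -
      have LR: "0 \<le> L * row_mass k" using order_trans[OF L0 L] rm by simp
      have "ennreal x * (ennreal e * (2 * ennreal y)) = ennreal (x * (e * (2 * y)))" if "0 \<le> x" "0 \<le> e" "0 \<le> y" for x e y
        using that by (simp add: ennreal_mult)
      moreover have "ennreal e * (2 * ennreal y) = ennreal (e * (2 * y))" if "0 \<le> e" "0 \<le> y" for e y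
        using that by (simp add: ennreal_mult)
      moreover have "0 \<le> ?e" "0 \<le> ?E" by simp_all
      ultimately have "ennreal h0 * (ennreal ?e * (2 * ennreal ?E)) = ennreal (h0 * (?e * (2 * ?E)))"
        "ennreal ?e * (2 * ennreal (L * row_mass k * ?E)) = ennreal (?e * (2 * (L * row_mass k * ?E)))"
        using h0 LR mult_nonneg_nonneg[OF LR \<open>0 \<le> ?E\<close>] by blast+
      then show ?thesis using h0 order_trans[OF L0 L] rm by (simp only:) (intro ennreal_plus[symmetric] mult_nonneg_nonneg, auto)
    qed
    also have "h0 * (?e * (2 * ?E)) + ?e * (2 * (L * row_mass k * ?E)) = 2 * (?E * ?e) * (h0 + L * row_mass k)"
      by (simp add: algebra_simps)
    also have "?E * ?e = exp (4 * s\<^sup>2 * S2 - s * \<delta>)" by (simp add: exp_add[symmetric])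
    finally show ?thesis .
  qed
  have pt: "ennreal \<bar>?h Z - h0\<bar> \<le> ennreal \<eta> + (\<Sum>a<k. \<Sum>b<k. f a b Z)" if Z: "Z \<in> carrier_mat ?n k" for Z
  proof (cases "\<forall>a<k. \<forall>b<k. \<bar>gram_entry ?n a b Z - (if a = b then D a else 0)\<bar> \<le> 2 * \<delta>")
    case True
    then have "\<bar>?h Z - h0\<bar> \<le> \<eta>" using cont[OF Z] by blast
    then have "ennreal \<bar>?h Z - h0\<bar> \<le> ennreal \<eta>" by (rule ennreal_leI)
    also have "\<dots> \<le> ennreal \<eta> + (\<Sum>a<k. \<Sum>b<k. f a b Z)" by simp
    finally show ?thesis .
  next
    case False
    then obtain a b where ab: "a < k" "b < k" and bad: "2 * \<delta> < \<bar>gram_entry ?n a b Z - (if a = b then D a else 0)\<bar>"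
      by (auto simp: not_le)
    have d0: "0 \<le> \<delta>" using \<delta>0 ab by simp
    have "\<bar>gram_mean ?n v a b - (if a = b then D a else 0)\<bar> \<le> \<delta>" "\<bar>gram_mean m ?v a b - (if a = b then D a else 0)\<bar> \<le> \<delta>"
      using mean(1)[OF ab(1)] mean(2)[OF ab(1)] d0 by (auto simp: gram_mean_def)
    then have "\<delta> < \<bar>X a b Z\<bar>" "\<delta> < \<bar>X' a b Z\<bar>" using bad unfolding X_def X'_def by linarith+
    then have fz: "f a b Z = ennreal h0 + ennreal (?h Z)" by (simp add: f_def)
    have "ennreal \<bar>?h Z - h0\<bar> \<le> ennreal (h0 + ?h Z)" using h0 stiefel_density_nonneg[of k Z] by (intro ennreal_leI) auto
    also have "\<dots> = f a b Z" using h0 stiefel_density_nonneg[of k Z] by (simp add: fz)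
    also have "\<dots> \<le> (\<Sum>b<k. f a b Z)" using ab by (intro member_le_sum) auto
    also have "\<dots> \<le> (\<Sum>a<k. \<Sum>b<k. f a b Z)" using ab by (intro member_le_sum[where f="\<lambda>a. \<Sum>b<k. f a b Z"]) auto
    also have "\<dots> \<le> ennreal \<eta> + (\<Sum>a<k. \<Sum>b<k. f a b Z)" by simp
    finally show ?thesis .
  qed
  have sm: "(\<lambda>Z. \<Sum>b<k. f a b Z) \<in> borel_measurable ?G" if "a < k" for a
    using that by (intro borel_measurable_sum fm) auto
  have sm2: "(\<lambda>Z. \<Sum>a<k. \<Sum>b<k. f a b Z) \<in> borel_measurable ?G"
    by (intro borel_measurable_sum sm) auto
  have "(\<integral>\<^sup>+Z. ennreal \<bar>?h Z - h0\<bar> \<partial>?G) \<le> (\<integral>\<^sup>+Z. ennreal \<eta> + (\<Sum>a<k. \<Sum>b<k. f a b Z) \<partial>?G)"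
    by (intro nn_integral_mono pt) simp
  also have "\<dots> = (\<integral>\<^sup>+Z. ennreal \<eta> \<partial>?G) + (\<integral>\<^sup>+Z. (\<Sum>a<k. \<Sum>b<k. f a b Z) \<partial>?G)"
    by (rule nn_integral_add[OF _ sm2]) simp
  also have "(\<integral>\<^sup>+Z. ennreal \<eta> \<partial>?G) = ennreal \<eta>" using emeasure_space_1 by simp
  also have "(\<integral>\<^sup>+Z. (\<Sum>a<k. \<Sum>b<k. f a b Z) \<partial>?G) = (\<Sum>a<k. \<Sum>b<k. (\<integral>\<^sup>+Z. f a b Z \<partial>?G))"
  proof (subst nn_integral_sum)
    show "(\<Sum>a<k. \<integral>\<^sup>+Z. (\<Sum>b<k. f a b Z) \<partial>?G) = (\<Sum>a<k. \<Sum>b<k. (\<integral>\<^sup>+Z. f a b Z \<partial>?G))"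
      by (intro sum.cong refl nn_integral_sum fm) auto
  qed (intro sm, simp)
  also have "\<dots> \<le> (\<Sum>a<k. \<Sum>b<k. ennreal (2 * exp (4 * s\<^sup>2 * S2 - s * \<delta>) * (h0 + L * row_mass k)))"
    by (intro sum_mono fint) auto
  also have "\<dots> = ennreal ((real k)\<^sup>2 * (2 * exp (4 * s\<^sup>2 * S2 - s * \<delta>) * (h0 + L * row_mass k)))"
  proof -
    have "(\<Sum>a<k. \<Sum>b<k. ennreal x) = ennreal ((real k)\<^sup>2 * x)" if "0 \<le> x" for x
      using that by (simp add: sum_ennreal ennreal_of_nat_eq_real_of_nat ennreal_mult[symmetric] power2_eq_square mult.assoc)
    then show ?thesis using h0 order_trans[OF L0 L] rm by simp
  qed
  also have "ennreal \<eta> + \<dots> = ennreal (\<eta> + (real k)\<^sup>2 * (2 * exp (4 * s\<^sup>2 * S2 - s * \<delta>) * (h0 + L * row_mass k)))"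
    using \<eta> h0 order_trans[OF L0 L] rm by (intro ennreal_plus[symmetric]) auto
  finally show ?thesis by (simp add: add_left_mono)
qed

section \<open>Continuity of the density of the lower block\<close>

lemma tendsto_det:
  fixes M :: "nat \<Rightarrow> real mat"
  assumes M: "\<And>n. M n \<in> carrier_mat k k" and B: "B \<in> carrier_mat k k"
    and lim: "\<And>i j. i < k \<Longrightarrow> j < k \<Longrightarrow> (\<lambda>n. M n $$ (i,j)) \<longlonglongrightarrow> B $$ (i,j)"
  shows "(\<lambda>n. det (M n)) \<longlonglongrightarrow> det B"
  unfolding det_def'[OF M] det_def'[OF B]
proof (intro tendsto_sum tendsto_mult tendsto_const tendsto_prod lim)
  fix p i assume "p \<in> {p. p permutes {0..<k}}" "i \<in> {0..<k}"
  then show "i < k" "p i < k" using permutes_in_image[of p "{0..<k}" i] by auto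
qed

text \<open>By the inequality between arithmetic and geometric mean, an error of at most \<epsilon>
  per entry changes the quadratic form by at most k \<epsilon> |v|^2, which is less than c
  |v|^2.\<close>

lemma sym_pd_near_diag:
  assumes M: "M \<in> carrier_mat k k" "M\<^sup>T = M"
    and near: "\<And>a b. a < k \<Longrightarrow> b < k \<Longrightarrow> \<bar>M $$ (a,b) - (if a = b then d a else 0)\<bar> \<le> \<epsilon>"
    and c: "\<And>a. a < k \<Longrightarrow> c \<le> d a" "real k * \<epsilon> < c"
  shows "sym_pd k M"
  unfolding sym_pd_iff
proof (intro conjI ballI impI M)
  fix v :: "real vec" assume v: "v \<in> carrier_vec k" "v \<noteq> 0\<^sub>v k"
  let ?v = "vec_index v"
  define q where "q = (\<Sum>a<k. (?v a)\<^sup>2)"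
  have q: "0 < q" using scalar_prod_self_pos[OF v] unfolding scalar_prod_self[OF v(1)] q_def .
  have pt: "?v a * ?v b * (if a = b then d a else 0) - \<epsilon> * (((?v a)\<^sup>2 + (?v b)\<^sup>2) / 2) \<le> ?v a * ?v b * M $$ (a,b)"
    if ab: "a < k" "b < k" for a b
  proof -
    let ?e = "M $$ (a,b) - (if a = b then d a else 0)"
    have e0: "0 \<le> \<epsilon>" using near[OF ab] by (meson abs_ge_zero order_trans)
    have "0 \<le> (\<bar>?v a\<bar> - \<bar>?v b\<bar>)\<^sup>2" by simp
    then have am: "\<bar>?v a * ?v b\<bar> \<le> ((?v a)\<^sup>2 + (?v b)\<^sup>2) / 2"
      unfolding power2_diff by (simp add: abs_mult)
    have "- (?v a * ?v b * ?e) \<le> \<bar>?v a * ?v b\<bar> * \<bar>?e\<bar>" by (metis abs_ge_minus_self abs_mult)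
    also have "\<dots> \<le> ((?v a)\<^sup>2 + (?v b)\<^sup>2) / 2 * \<epsilon>" by (intro mult_mono am near ab) auto
    finally show ?thesis by (simp add: right_diff_distrib mult.commute)
  qed
  have "scalar_prod v (M *\<^sub>v v) = (\<Sum>a<k. \<Sum>b<k. ?v a * ?v b * M $$ (a,b))"
    using v M by (simp add: scalar_prod_def atLeast0LessThan sum_distrib_left mult_ac)
  also have "\<dots> \<ge> (\<Sum>a<k. \<Sum>b<k. ?v a * ?v b * (if a = b then d a else 0) - \<epsilon> * (((?v a)\<^sup>2 + (?v b)\<^sup>2) / 2))"
    by (intro sum_mono pt) auto
  moreover have "(\<Sum>a<k. \<Sum>b<k. ?v a * ?v b * (if a = b then d a else 0) - \<epsilon> * (((?v a)\<^sup>2 + (?v b)\<^sup>2) / 2))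
    = (\<Sum>a<k. d a * (?v a)\<^sup>2) - \<epsilon> * (real k * q)"
  proof -
    have "(\<Sum>a<k. \<Sum>b<k. ?v a * ?v b * (if a = b then d a else 0)) = (\<Sum>a<k. d a * (?v a)\<^sup>2)"
      by (simp add: if_distrib[of "\<lambda>x. _ * x"] power2_eq_square mult_ac cong: if_cong)
    moreover have "(\<Sum>a<k. \<Sum>b<k. \<epsilon> * (((?v a)\<^sup>2 + (?v b)\<^sup>2) / 2)) = \<epsilon> * (\<Sum>a<k. \<Sum>b<k. ((?v a)\<^sup>2 / 2 + (?v b)\<^sup>2 / 2))"
      by (simp add: sum_distrib_left add_divide_distrib)
    moreover have "(\<Sum>a<k. \<Sum>b<k. ((?v a)\<^sup>2 / 2 + (?v b)\<^sup>2 / 2)) = real k * q"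
      by (simp add: sum.distrib q_def flip: sum_divide_distrib sum_distrib_left)
    ultimately show ?thesis by (simp add: sum_subtractf)
  qed
  moreover have "c * q \<le> (\<Sum>a<k. d a * (?v a)\<^sup>2)"
    unfolding q_def sum_distrib_left using c by (intro sum_mono mult_right_mono) auto
  moreover have "\<epsilon> * (real k * q) < c * q" using mult_strict_right_mono[OF c(2) q] by (simp only: mult_ac)
  ultimately show "0 < scalar_prod v (M *\<^sub>v v)" by linarith
qed

lemma cogram_index:
  assumes "Z \<in> carrier_mat n k" "a < k" "b < k"
  shows "cogram k Z $$ (a,b) = (if a = b then 1 else 0) - gram_entry n a b Z"
  using gram_entry_index[OF assms] assms by (simp add: cogram_def)

text \<open>The radius \<delta> has to be uniform in the number of rows. A counterexample for every
  \<delta> would give a sequence of matrices with varying numbers of rows, but their complements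
  \<open>cogram k Z\<close> all have size \<open>k\<close> and converge to a positive diagonal
  matrix, where the determinant is continuous.\<close>

lemma stiefel_density_near:
  assumes D: "\<And>a. a < k \<Longrightarrow> D a < 1" and \<eta>: "0 < \<eta>"
  obtains \<delta> where "0 < \<delta>" "\<And>n Z. Z \<in> carrier_mat n k \<Longrightarrow>
      (\<And>a b. a < k \<Longrightarrow> b < k \<Longrightarrow> \<bar>gram_entry n a b Z - (if a = b then D a else 0)\<bar> \<le> 2 * \<delta>) \<Longrightarrow>
      \<bar>stiefel_density k Z - 1 / sqrt (\<Prod>a<k. 1 - D a)\<bar> \<le> \<eta>"
proof (rule ccontr)
  let ?h0 = "1 / sqrt (\<Prod>a<k. 1 - D a)"
  let ?P = "\<lambda>\<delta> n Z. Z \<in> carrier_mat n k \<and> (\<forall>a<k. \<forall>b<k. \<bar>gram_entry n a b Z - (if a = b then D a else 0)\<bar> \<le> 2 * \<delta>)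
    \<and> \<not> \<bar>stiefel_density k Z - ?h0\<bar> \<le> \<eta>"
  note st = that
  assume "\<not> thesis"
  then have ex: "\<exists>n Z. ?P \<delta> n Z" if "0 < \<delta>" for \<delta> using st[OF that] by blast
  have "\<forall>m. \<exists>n Z. ?P (1 / real (Suc m)) n Z" by (rule allI, rule ex) simp
  then obtain N Z where P: "\<And>m. ?P (1 / real (Suc m)) (N m) (Z m)" by metis
  \<comment> \<open>A positive lower bound for the limiting diagonal; the inserted 1 covers
    \<open>k = 0\<close>.\<close>
  define c where "c = Min (insert 1 ((\<lambda>a. 1 - D a) ` {..<k}))"
  have c: "0 < c" "\<And>a. a < k \<Longrightarrow> c \<le> 1 - D a" unfolding c_def using D by (auto intro: Min_le)
  define M where "M = (\<lambda>m. cogram k (Z m))"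
  have Mc: "M m \<in> carrier_mat k k" "(M m)\<^sup>T = M m" for m
    unfolding M_def using P[of m] cogram_carrier cogram_transpose by blast+
  have near: "\<bar>M m $$ (a,b) - (if a = b then 1 - D a else 0)\<bar> \<le> 2 * (1 / real (Suc m))" if "a < k" "b < k" for m a b
  proof -
    have "M m $$ (a,b) - (if a = b then 1 - D a else 0) = - (gram_entry (N m) a b (Z m) - (if a = b then D a else 0))"
      using P[of m] that cogram_index[of "Z m" "N m" k a b] by (simp add: M_def)
    then show ?thesis using P[of m] that by (simp only: abs_minus_cancel)
  qed
  have l0: "(\<lambda>m. 2 * (1 / real (Suc m))) \<longlonglongrightarrow> 0" by real_asymp
  have "(\<lambda>m. M m $$ (a,b)) \<longlonglongrightarrow> mat_diag k (\<lambda>a. 1 - D a) $$ (a,b)" if ab: "a < k" "b < k" for a b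
  proof -
    have "(\<lambda>m. M m $$ (a,b) - (if a = b then 1 - D a else 0)) \<longlonglongrightarrow> 0"
      by (rule tendsto_rabs_zero_cancel, rule tendsto_sandwich[OF _ _ tendsto_const l0]) (use near[OF ab] in auto)
    then have "(\<lambda>m. M m $$ (a,b)) \<longlonglongrightarrow> (if a = b then 1 - D a else 0)" by (rule LIM_zero_cancel)
    then show ?thesis using ab by (cases "a = b") (simp_all add: mat_diag_def)
  qed
  then have "(\<lambda>m. det (M m)) \<longlonglongrightarrow> det (mat_diag k (\<lambda>a. 1 - D a))"
    by (intro tendsto_det[where k=k] Mc) (auto simp: mat_diag_def)
  also have "det (mat_diag k (\<lambda>a. 1 - D a)) = (\<Prod>a<k. 1 - D a)"
  proof -
    have "upper_triangular (mat_diag k (\<lambda>a. 1 - D a))" by (auto simp: mat_diag_def upper_triangular_def)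
    then show ?thesis using det_upper_triangular[of "mat_diag k (\<lambda>a. 1 - D a)" k]
      by (simp add: mat_diag_def diag_mat_def atLeast0LessThan[symmetric] prod.list_conv_set_nth)
  qed
  finally have "(\<lambda>m. det (M m)) \<longlonglongrightarrow> (\<Prod>a<k. 1 - D a)" .
  moreover have "0 < (\<Prod>a<k. 1 - D a)" using D by (intro prod_pos) auto
  then have "sqrt (\<Prod>a<k. 1 - D a) \<noteq> 0" by (metis less_irrefl real_sqrt_eq_zero_cancel_iff)
  ultimately have "(\<lambda>m. 1 / sqrt (det (M m))) \<longlonglongrightarrow> ?h0" by (intro tendsto_intros)
  then have "\<forall>\<^sub>F m in sequentially. dist (1 / sqrt (det (M m))) ?h0 < \<eta>" by (rule tendstoD[OF _ \<eta>])
  moreover have "\<forall>\<^sub>F m in sequentially. real k * (2 * (1 / real (Suc m))) < c"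
    using tendsto_mult[OF tendsto_const[of "real k"] l0] c(1) by (intro order_tendstoD(2)[of _ 0]) auto
  ultimately have "\<forall>\<^sub>F m in sequentially. False"
  proof eventually_elim
    case (elim m)
    have "sym_pd k (M m)" by (rule sym_pd_near_diag[OF Mc near c(2) elim(2)])
    then show ?case using elim(1) P[of m] by (simp add: stiefel_density_def M_def dist_real_def)
  qed
  then show False by simp
qed

section \<open>The ordered eigenvalues and the bulk spectral measure\<close>

lemma proots_prod_linear: "proots (\<Prod>a\<leftarrow>xs. [:- a, 1:]) = mset (xs :: real list)"
proof (induction xs)
  case (Cons a xs)
  have "(\<Prod>a\<leftarrow>xs. [:- a, 1:]) \<noteq> 0" by (auto simp: prod_list_zero_iff)
  then have "proots ([:- a, 1:] * (\<Prod>a\<leftarrow>xs. [:- a, 1:])) = proots [:- a, 1:] + proots (\<Prod>a\<leftarrow>xs. [:- a, 1:])"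
    by (intro proots_mult) auto
  then show ?case using Cons by simp
qed simp

text \<open>Similarity to a diagonal matrix makes the characteristic polynomial split, so the sorted
  list of roots has length \<open>p\<close> and the positions \<open>i\<close> and \<open>j\<close>
  lie inside it.\<close>

lemma eigval_antimono:
  assumes U: "U \<in> stiefel p p" and A: "A = U * mat_diag p d * U\<^sup>T" and ij: "1 \<le> i" "i \<le> j" "j \<le> p"
  shows "eigval A j \<le> eigval A i"
proof -
  note Us = stiefel_square[OF U]
  have dc: "mat_diag p d \<in> carrier_mat p p" by (simp add: mat_diag_def)
  have Ac: "A \<in> carrier_mat p p" unfolding A by (rule conj_diag_carrier[OF Us(1)])
  have "similar_mat_wit A (mat_diag p d) U (U\<^sup>T)"
    unfolding similar_mat_wit_def Let_def using Us Ac dc A by auto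
  then have "char_poly A = char_poly (mat_diag p d)" by (intro char_poly_similar) (auto simp: similar_mat_def)
  also have "\<dots> = (\<Prod>a\<leftarrow>diag_mat (mat_diag p d). [:- a, 1:])"
    by (rule char_poly_upper_triangular[OF dc]) (auto simp: mat_diag_def upper_triangular_def)
  finally have "proots (char_poly A) = mset (diag_mat (mat_diag p d))" by (simp only: proots_prod_linear)
  then have "size (proots (char_poly A)) = p" using dc by (simp add: diag_mat_def)
  then have len: "length (sorted_list_of_multiset (proots (char_poly A))) = p"
    by (metis mset_sorted_list_of_multiset size_mset)
  show ?thesis
    unfolding eigval_def using ij len by (subst (1 2) rev_nth) (auto intro!: sorted_nth_mono sorted_sorted_list_of_multiset)
qed

lemma measure_distr_point_measure:
  fixes g :: "'a \<Rightarrow> real"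
  assumes A: "finite A" and c: "0 \<le> c" and B: "B \<in> sets borel"
  shows "measure (distr (point_measure A (\<lambda>_. ennreal c)) borel g) B = c * real (card {a\<in>A. g a \<in> B})"
proof -
  have g: "g \<in> point_measure A (\<lambda>_. ennreal c) \<rightarrow>\<^sub>M borel" by (simp add: measurable_point_measure_eq1)
  have "emeasure (distr (point_measure A (\<lambda>_. ennreal c)) borel g) B = emeasure (point_measure A (\<lambda>_. ennreal c)) {a\<in>A. g a \<in> B}"
    unfolding emeasure_distr[OF g B] by (intro arg_cong2[where f=emeasure]) (auto simp: space_point_measure)
  also have "\<dots> = (\<Sum>a\<in>{a\<in>A. g a \<in> B}. ennreal c)" using A by (intro emeasure_point_measure_finite) auto
  also have "\<dots> = ennreal (c * real (card {a\<in>A. g a \<in> B}))"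
    using c by (simp add: ennreal_of_nat_eq_real_of_nat ennreal_mult[symmetric] mult.commute)
  finally show ?thesis using c by (simp add: measure_def)
qed

text \<open>The bulk measure has mass (p - k)/p. Rescaling to the probability measure
  \<open>N\<close> gives access to convergence of integrals of bounded continuous functions, and the
  factor, which tends to 1, is then put back.\<close>

lemma weak_conv_bulk:
  fixes S :: "nat \<Rightarrow> real mat" and f :: "real \<Rightarrow> real"
  assumes \<mu>: "real_distribution \<mu>" and w: "weak_conv_m (\<lambda>p. bulk_spectral_measure (S p) k) \<mu>"
    and S: "\<And>p. dim_row (S p) = p" and f: "\<And>x. isCont f x" "\<And>x. \<bar>f x\<bar> \<le> B"
  shows "(\<lambda>p. (\<Sum>i\<in>{k+1..p}. f (eigval (S p) i)) / real p) \<longlonglongrightarrow> (LINT t|\<mu>. f t)"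
proof -
  \<comment> \<open>The shift makes the number p - k of bulk eigenvalues equal to m + 1, hence
    positive for every m.\<close>
  let ?p = "\<lambda>m. m + (k + 1)"
  let ?P = "\<lambda>m. point_measure {k+1..?p m} (\<lambda>_. ennreal (1 / real (m + 1)))"
  define N where "N = (\<lambda>m. distr (?P m) borel (eigval (S (?p m))))"
  have gm: "eigval (S (?p m)) \<in> ?P m \<rightarrow>\<^sub>M borel" for m by (simp add: measurable_point_measure_eq1)
  have fm: "f \<in> borel_measurable borel"
    using f(1) by (intro borel_measurable_continuous_onI continuous_at_imp_continuous_on) auto
  have meas: "measure (N m) A = 1 / real (m + 1) * real (card {i\<in>{k+1..?p m}. eigval (S (?p m)) i \<in> A})"
    if "A \<in> sets borel" for m A
    unfolding N_def by (rule measure_distr_point_measure) (use that in auto)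
  have rd: "real_distribution (N m)" for m
  proof -
    have "{i\<in>{k+1..?p m}. eigval (S (?p m)) i \<in> UNIV} = {k+1..?p m}" by auto
    moreover have "(UNIV :: real set) \<in> sets borel" by simp
    ultimately have "measure (N m) UNIV = 1" using meas[of UNIV m] by (simp only:) simp
    then have "emeasure (N m) UNIV = 1" by (cases "emeasure (N m) UNIV") (auto simp: measure_def)
    then have "emeasure (N m) (space (N m)) = 1" by (simp add: N_def)
    then have "prob_space (N m)" by (rule prob_spaceI)
    then show ?thesis by (simp add: real_distribution_def real_distribution_axioms_def N_def)
  qed
  have cdf: "cdf (N m) x = cdf (bulk_spectral_measure (S (?p m)) k) x * (real (?p m) / real (m + 1))" for m x
  proof -
    let ?n = "real (card {i\<in>{k+1..?p m}. eigval (S (?p m)) i \<in> {..x}})"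
    have n: "measure (N m) {..x} = 1 / real (m + 1) * ?n" by (rule meas) simp
    have b: "measure (bulk_spectral_measure (S (?p m)) k) {..x} = 1 / real (?p m) * ?n"
      unfolding bulk_spectral_measure_def S by (rule measure_distr_point_measure) auto
    have g: "1 / a * n = 1 / b * n * (b / a)" if "b \<noteq> 0" for a b n :: real using that by simp
    show ?thesis unfolding cdf_def n b by (rule g) simp
  qed
  have wN: "weak_conv_m N \<mu>"
    unfolding weak_conv_m_def weak_conv_def
  proof (intro allI impI)
    fix x assume "isCont (cdf \<mu>) x"
    then have "(\<lambda>p. cdf (bulk_spectral_measure (S p) k) x) \<longlonglongrightarrow> cdf \<mu> x"
      using w by (simp add: weak_conv_m_def weak_conv_def)
    then have "(\<lambda>m. cdf (bulk_spectral_measure (S (?p m)) k) x) \<longlonglongrightarrow> cdf \<mu> x" by (rule LIMSEQ_ignore_initial_segment)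
    moreover have "(\<lambda>m. real (?p m) / real (m + 1)) \<longlonglongrightarrow> 1" by real_asymp
    ultimately have "(\<lambda>m. cdf (bulk_spectral_measure (S (?p m)) k) x * (real (?p m) / real (m + 1))) \<longlonglongrightarrow> cdf \<mu> x * 1"
      by (rule tendsto_mult)
    then show "(\<lambda>m. cdf (N m) x) \<longlonglongrightarrow> cdf \<mu> x" by (simp only: cdf mult_1_right)
  qed
  have "(\<lambda>m. LINT t|N m. f t) \<longlonglongrightarrow> (LINT t|\<mu>. f t)"
    using weak_conv_imp_integral_bdd_continuous_conv[OF rd \<mu> wN f(1), of B] f(2) by simp
  moreover have "(\<lambda>m. real (m + 1) / real (?p m)) \<longlonglongrightarrow> 1" by real_asymp
  ultimately have "(\<lambda>m. (LINT t|N m. f t) * (real (m + 1) / real (?p m))) \<longlonglongrightarrow> (LINT t|\<mu>. f t) * 1"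
    by (rule tendsto_mult)
  moreover have "(LINT t|N m. f t) * (real (m + 1) / real (?p m)) = (\<Sum>i\<in>{k+1..?p m}. f (eigval (S (?p m)) i)) / real (?p m)" for m
  proof -
    have "(LINT t|N m. f t) = (LINT i|?P m. f (eigval (S (?p m)) i))" unfolding N_def by (rule integral_distr[OF gm fm])
    also have "\<dots> = (\<Sum>i\<in>{k+1..?p m}. 1 / real (m + 1) * f (eigval (S (?p m)) i))"
      by (subst lebesgue_integral_point_measure_finite[where f="\<lambda>_. 1 / real (m + 1)"]) auto
    finally show ?thesis by (simp add: field_simps flip: sum_divide_distrib)
  qed
  ultimately have "(\<lambda>m. (\<Sum>i\<in>{k+1..?p m}. f (eigval (S (?p m)) i)) / real (?p m)) \<longlonglongrightarrow> (LINT t|\<mu>. f t)"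
    by (simp only: mult_1_right)
  then show ?thesis by (rule LIMSEQ_offset)
qed

section \<open>The limit\<close>

text \<open>Variances of order 1/p allow exponential moments with parameter \<tau> p. The sums of
  products of variances are of order 1/p, so both terms of the tail exponent are linear in p, and
  for small \<tau> the negative one wins. The resulting exp(-c p) beats the power
  \<open>(B * real p) ^ k\<close> that bounds the normaliser of the first row.\<close>

lemma stiefel_density_L1_limit:
  fixes v :: "nat \<Rightarrow> nat \<Rightarrow> nat \<Rightarrow> real"
  assumes C: "0 < C" and B: "0 \<le> B"
    and v: "\<forall>\<^sub>F p in sequentially. \<forall>i<p - k. \<forall>j<k. 0 < v p i j \<and> v p i j \<le> C / real p"
    and v0: "\<forall>\<^sub>F p in sequentially. \<forall>j<k. 1 / sqrt (2 * pi * v p 0 j) \<le> B * real p"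
    and mean: "\<And>j. j < k \<Longrightarrow> (\<lambda>p. \<Sum>i<p - k. v p i j) \<longlonglongrightarrow> D j" and D: "\<And>j. j < k \<Longrightarrow> D j < 1"
    and \<epsilon>: "0 < \<epsilon>"
  shows "\<forall>\<^sub>F p in sequentially. (\<integral>\<^sup>+Z. ennreal \<bar>stiefel_density k Z - 1 / sqrt (\<Prod>a<k. 1 - D a)\<bar> \<partial>gaussian_mat (p - k) k (v p)) \<le> ennreal \<epsilon>"
proof -
  let ?h0 = "1 / sqrt (\<Prod>a<k. 1 - D a)"
  have "0 < (\<Prod>a<k. 1 - D a)" using D by (intro prod_pos) auto
  then have h0: "0 \<le> ?h0" by simp
  obtain \<delta> where \<delta>: "0 < \<delta>" and cont: "\<And>n Z. Z \<in> carrier_mat n k \<Longrightarrow>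
      (\<And>a b. a < k \<Longrightarrow> b < k \<Longrightarrow> \<bar>gram_entry n a b Z - (if a = b then D a else 0)\<bar> \<le> 2 * \<delta>) \<Longrightarrow>
      \<bar>stiefel_density k Z - ?h0\<bar> \<le> \<epsilon> / 2"
    using stiefel_density_near[of k D "\<epsilon> / 2"] D \<epsilon> by (metis half_gt_zero)
  \<comment> \<open>The first bound keeps \<tau> p times a variance below 1/4; the second makes the
    quadratic term of the tail exponent at most half of the linear one.\<close>
  define \<tau> where "\<tau> = min (1 / (4 * C)) (\<delta> / (8 * C\<^sup>2))"
  have \<tau>: "0 < \<tau>" "\<tau> * C \<le> 1 / 4" "8 * \<tau> * C\<^sup>2 \<le> \<delta>"
  proof -
    show "0 < \<tau>" using C \<delta> by (simp add: \<tau>_def)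
    have "\<tau> * C \<le> 1 / (4 * C) * C" unfolding \<tau>_def using C by (intro mult_right_mono) auto
    then show "\<tau> * C \<le> 1 / 4" using C by simp
    have "\<tau> * (8 * C\<^sup>2) \<le> \<delta> / (8 * C\<^sup>2) * (8 * C\<^sup>2)" unfolding \<tau>_def by (intro mult_right_mono) auto
    then show "8 * \<tau> * C\<^sup>2 \<le> \<delta>" using C by (simp add: mult_ac)
  qed
  \<comment> \<open>The half of the linear rate \<tau> \<delta> that the quadratic term leaves
    over.\<close>
  define c where "c = \<tau> * \<delta> / 2"
  have c: "0 < c" using \<tau> \<delta> by (simp add: c_def)
  let ?R = "row_mass k"
  define r where "r = (\<lambda>p. (real k)\<^sup>2 * (2 * exp (- c * real p) * (?h0 + (B * real p) ^ k * ?R)))"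
  have "r \<longlonglongrightarrow> 0"
  proof -
    have cp: "filterlim (\<lambda>p. c * real p) at_top sequentially" using c by real_asymp
    have "(\<lambda>p. (c * real p) ^ k / exp (c * real p)) \<longlonglongrightarrow> 0"
      by (rule filterlim_compose[OF tendsto_power_div_exp_0 cp])
    moreover have "(\<lambda>p. (c * real p) ^ 0 / exp (c * real p)) \<longlonglongrightarrow> 0"
      by (rule filterlim_compose[OF tendsto_power_div_exp_0 cp])
    ultimately have "(\<lambda>p. (real k)\<^sup>2 * (2 * (?h0 * ((c * real p) ^ 0 / exp (c * real p)) + (B / c) ^ k * ?R * ((c * real p) ^ k / exp (c * real p))))) \<longlonglongrightarrow>
      (real k)\<^sup>2 * (2 * (?h0 * 0 + (B / c) ^ k * ?R * 0))"
      by (intro tendsto_mult tendsto_add tendsto_const)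
    moreover have "(real k)\<^sup>2 * (2 * (?h0 * ((c * real p) ^ 0 / exp (c * real p)) + (B / c) ^ k * ?R * ((c * real p) ^ k / exp (c * real p)))) = r p" for p
    proof -
      have "(B / c) ^ k * (c * real p) ^ k = (B * real p) ^ k" using c by (simp add: power_mult_distrib[symmetric])
      then have "(B / c) ^ k * ?R * ((c * real p) ^ k / exp (c * real p)) = (B * real p) ^ k * ?R / exp (c * real p)" by (simp add: mult_ac)
      then show ?thesis unfolding r_def by (simp add: exp_minus field_simps)
    qed
    ultimately show ?thesis by simp
  qed
  then have "\<forall>\<^sub>F p in sequentially. r p < \<epsilon> / 2" using \<epsilon> by (intro order_tendstoD(2)[of _ 0]) auto
  moreover have "\<forall>\<^sub>F p in sequentially. \<forall>j\<in>{..<k}. dist (\<Sum>i<p - k. v p i j) (D j) < \<delta> / 2"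
    using mean \<delta> by (intro eventually_ball_finite ballI tendstoD) auto
  moreover have "\<forall>\<^sub>F p in sequentially. C / real p < \<delta> / 2"
  proof (rule order_tendstoD(2)[of _ 0])
    show "(\<lambda>p. C / real p) \<longlonglongrightarrow> 0" by real_asymp
  qed (use \<delta> in simp)
  ultimately show ?thesis using v v0 eventually_gt_at_top[of k]
  proof eventually_elim
    case (elim p)
    \<comment> \<open>One of the p - k rows is set aside as the first row.\<close>
    define m where "m = p - k - 1"
    have pm: "p - k = 1 + m" and p0: "0 < p" using elim(6) by (auto simp: m_def)
    have vb: "0 < v p i j" "v p i j \<le> C / real p" if "i < 1 + m" "j < k" for i j using elim(4) that unfolding pm by blast+
    have sp: "0 \<le> \<tau> * real p" using \<tau> by simp
    \<comment> \<open>Only half of \<delta> is spent here; the other half pays for dropping the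
      first row, whose variance is at most C / p < \<delta> / 2.\<close>
    have mn: "\<bar>(\<Sum>i<1+m. v p i a) - D a\<bar> \<le> \<delta> / 2" if "a < k" for a
      using elim(2) that unfolding pm dist_real_def by (meson lessThan_iff less_imp_le)
    have "(\<integral>\<^sup>+Z. ennreal \<bar>stiefel_density k Z - ?h0\<bar> \<partial>gaussian_mat (1 + m) k (v p))
      \<le> ennreal (\<epsilon> / 2 + (real k)\<^sup>2 * (2 * exp (4 * (\<tau> * real p)\<^sup>2 * (C\<^sup>2 / real p) - \<tau> * real p * \<delta>) * (?h0 + (B * real p) ^ k * ?R)))"
    proof (rule stiefel_density_L1[where D=D and \<delta>=\<delta>, OF vb(1) _ sp h0])
      show "\<tau> * real p * v p i j \<le> 1 / 4" if ij: "i < 1 + m" "j < k" for i j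
      proof -
        have "\<tau> * real p * v p i j \<le> \<tau> * real p * (C / real p)" by (intro mult_left_mono vb ij sp)
        also have "\<dots> = \<tau> * C" using p0 by simp
        finally show ?thesis using \<tau>(2) by simp
      qed
      show "\<bar>(\<Sum>i<1+m. v p i a) - D a\<bar> \<le> \<delta>" if "a < k" for a using mn[OF that] \<delta> by simp
      show "\<bar>(\<Sum>i<m. v p (Suc i) a) - D a\<bar> \<le> \<delta>" if a: "a < k" for a
      proof -
        have "(\<Sum>i<1+m. v p i a) = v p 0 a + (\<Sum>i<m. v p (Suc i) a)"
          by (simp only: plus_1_eq_Suc sum.lessThan_Suc_shift)
        then show ?thesis using mn[OF a] vb[of 0 a] a elim(3) by linarith
      qed
      show "(\<Sum>i<1+m. v p i a * v p i b) \<le> C\<^sup>2 / real p" if ab: "a < k" "b < k" for a b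
      proof -
        have "(\<Sum>i<1+m. v p i a * v p i b) \<le> (\<Sum>i<1+m. C / real p * (C / real p))"
          using ab vb C by (intro sum_mono mult_mono) (auto intro: less_imp_le simp: zero_le_divide_iff)
        also have "\<dots> = real (1 + m) * (C / real p * (C / real p))" by simp
        also have "\<dots> \<le> real p * (C / real p * (C / real p))" using pm C by (intro mult_right_mono) auto
        also have "\<dots> = C\<^sup>2 / real p" using p0 by (simp add: power2_eq_square)
        finally show ?thesis .
      qed
      have "(\<Prod>j<k. 1 / sqrt (2 * pi * v p 0 j)) \<le> (\<Prod>j<k. B * real p)"
        using elim(5) vb[of 0] by (intro prod_mono) (auto intro!: less_imp_le)
      then show "(\<Prod>j<k. 1 / sqrt (2 * pi * v p 0 j)) \<le> (B * real p) ^ k" by simp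
      show "\<bar>stiefel_density k Z - ?h0\<bar> \<le> \<epsilon> / 2" if "Z \<in> carrier_mat (1 + m) k"
        "\<And>a b. a < k \<Longrightarrow> b < k \<Longrightarrow> \<bar>gram_entry (1 + m) a b Z - (if a = b then D a else 0)\<bar> \<le> 2 * \<delta>" for Z
        by (rule cont[OF that])
      show "0 \<le> \<epsilon> / 2" using \<epsilon> by simp
    qed
    also have "\<dots> \<le> ennreal (\<epsilon> / 2 + r p)"
    proof -
      have "4 * (\<tau> * real p)\<^sup>2 * (C\<^sup>2 / real p) = \<tau> * real p / 2 * (8 * \<tau> * C\<^sup>2)" using p0 by (simp add: power2_eq_square field_simps)
      also have "\<dots> \<le> \<tau> * real p / 2 * \<delta>" using \<tau> sp by (intro mult_left_mono) auto
      finally have "4 * (\<tau> * real p)\<^sup>2 * (C\<^sup>2 / real p) \<le> \<tau> * real p / 2 * \<delta>" .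
      moreover have "- c * real p = \<tau> * real p / 2 * \<delta> - \<tau> * real p * \<delta>" by (simp add: c_def)
      ultimately have "4 * (\<tau> * real p)\<^sup>2 * (C\<^sup>2 / real p) - \<tau> * real p * \<delta> \<le> - c * real p" by linarith
      then show ?thesis unfolding r_def
        using h0 B by (intro ennreal_leI add_left_mono mult_left_mono mult_right_mono add_nonneg_nonneg mult_nonneg_nonneg) (auto simp: row_mass_def)
    qed
    also have "\<dots> \<le> ennreal \<epsilon>" using elim(1) by (intro ennreal_leI) simp
    finally show ?case unfolding pm .
  qed
qed

text \<open>The mean H of \<open>h\<close> is within \<open>e\<close> of \<open>h0\<close>, hence at
  least h0/2. Then |h/H - 1| \<le> (|h - h0| + e) / H, whose expectation is at most 2 e /
  (h0/2).\<close>

lemma (in prob_space) normalized_deviation_le: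
  fixes h :: "'a \<Rightarrow> real"
  assumes h[measurable]: "h \<in> borel_measurable M" and e: "(\<integral>\<^sup>+x. ennreal \<bar>h x - h0\<bar> \<partial>M) \<le> ennreal e"
    and h0: "0 < h0" "0 \<le> e" "e \<le> h0 / 2"
  shows "integrable M h" "0 < expectation h" "expectation (\<lambda>x. \<bar>h x / expectation h - 1\<bar>) \<le> 4 / h0 * e"
proof -
  have i: "integrable M (\<lambda>x. h x - h0)"
  proof (rule integrableI_bounded)
    show "(\<integral>\<^sup>+x. ennreal (norm (h x - h0)) \<partial>M) < \<infinity>"
      using le_less_trans[OF e ennreal_less_top] by simp
  qed measurable
  then have "integrable M (\<lambda>x. (h x - h0) + h0)" by (intro Bochner_Integration.integrable_add) auto
  then show ih: "integrable M h" by simp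
  have ia: "integrable M (\<lambda>x. \<bar>h x - h0\<bar>)" using i by (rule integrable_abs)
  have "ennreal (expectation (\<lambda>x. \<bar>h x - h0\<bar>)) \<le> ennreal e" using e nn_integral_eq_integral[OF ia] by simp
  then have d: "expectation (\<lambda>x. \<bar>h x - h0\<bar>) \<le> e" using h0 by simp
  let ?H = "expectation h"
  have "?H - h0 = expectation (\<lambda>x. h x - h0)" using ih by (simp add: prob_space)
  then have dH: "\<bar>?H - h0\<bar> \<le> e" using d integral_abs_bound[of M "\<lambda>x. h x - h0"] by linarith
  then have H: "h0 / 2 \<le> ?H" using h0 by linarith
  then show H0: "0 < ?H" using h0 by linarith
  have ib: "integrable M (\<lambda>x. (\<bar>h x - h0\<bar> + e) / ?H)" using ia by (intro integrable_divide Bochner_Integration.integrable_add) auto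
  have "expectation (\<lambda>x. \<bar>h x / ?H - 1\<bar>) \<le> expectation (\<lambda>x. (\<bar>h x - h0\<bar> + e) / ?H)"
  proof (rule integral_mono)
    show "integrable M (\<lambda>x. \<bar>h x / ?H - 1\<bar>)" using ih by (intro integrable_abs Bochner_Integration.integrable_diff integrable_divide) auto
    fix x
    have "\<bar>h x / ?H - 1\<bar> = \<bar>h x - ?H\<bar> / ?H" using H0 by (simp add: field_simps abs_if)
    also have "\<dots> \<le> (\<bar>h x - h0\<bar> + e) / ?H" using dH H0 by (intro divide_right_mono) auto
    finally show "\<bar>h x / ?H - 1\<bar> \<le> (\<bar>h x - h0\<bar> + e) / ?H" .
  qed (rule ib)
  also have "\<dots> = (expectation (\<lambda>x. \<bar>h x - h0\<bar>) + e) / ?H" using ia by (simp add: prob_space)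
  also have "\<dots> \<le> (e + e) / (h0 / 2)" using d H h0 by (intro frac_le) auto
  also have "\<dots> = 4 / h0 * e" by simp
  finally show "expectation (\<lambda>x. \<bar>h x / ?H - 1\<bar>) \<le> 4 / h0 * e" .
qed

section \<open>Spectral asymptotics and the conclusion\<close>

context
  fixes k :: nat and S U :: "nat \<Rightarrow> real mat" and \<gamma> :: "nat \<Rightarrow> real" and \<mu> :: "real measure"
    and \<beta>s :: "nat \<Rightarrow> real" and \<beta> :: real
  assumes k: "k \<ge> 1" and S: "\<And>p. S p \<in> carrier_mat p p"
    and \<gamma>: "\<And>i. i \<in> {1..k+1} \<Longrightarrow> (\<lambda>p. eigval (S p) i) \<longlonglongrightarrow> \<gamma> i" and gap: "\<gamma> k - \<gamma> (k+1) > 0"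
    and \<mu>: "real_distribution \<mu>" and bulk: "weak_conv_m (\<lambda>p. bulk_spectral_measure (S p) k) \<mu>"
    and \<beta>s: "\<beta>s \<longlonglongrightarrow> \<beta>" and H: "stieltjes \<mu> (\<gamma> k) < \<beta>"
    and U: "\<And>p. U p \<in> stiefel p p"
    and SU: "\<And>p. S p = U p * mat_diag p (\<lambda>i. eigval (S p) (i + 1)) * (U p)\<^sup>T"
begin

private abbreviation (input) ev where "ev p i \<equiv> eigval (S p) i"

text \<open>A third of the gap leaves room on both sides: eventually the bulk lies below \<gamma>
  (k+1) + c and the leading eigenvalues above \<gamma> k - c, and these levels are still c
  apart.\<close>

definition gap_third where "gap_third = (\<gamma> k - \<gamma> (k+1)) / 3"

private abbreviation (input) "c \<equiv> gap_third"

definition bulk_edge where "bulk_edge = \<gamma> (k+1) + c"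

lemma gap_third: "0 < c" "\<gamma> k = bulk_edge + 2 * c"
  using gap by (auto simp: gap_third_def bulk_edge_def field_simps)

lemma ev_antimono: "1 \<le> i \<Longrightarrow> i \<le> j \<Longrightarrow> j \<le> p \<Longrightarrow> ev p j \<le> ev p i"
  by (rule eigval_antimono[OF U SU])

lemma gamma_ge: "1 \<le> j \<Longrightarrow> j \<le> k \<Longrightarrow> bulk_edge + 2 * c \<le> \<gamma> j"
proof -
  assume j: "1 \<le> j" "j \<le> k"
  have "\<gamma> k \<le> \<gamma> j"
  proof (rule tendsto_le[OF sequentially_bot])
    show "(\<lambda>p. ev p j) \<longlonglongrightarrow> \<gamma> j" "(\<lambda>p. ev p k) \<longlonglongrightarrow> \<gamma> k" using \<gamma>[of j] \<gamma>[of k] j k by auto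
    show "\<forall>\<^sub>F p in sequentially. ev p k \<le> ev p j"
      using eventually_ge_at_top[of k] by eventually_elim (use ev_antimono j in auto)
  qed
  then show ?thesis using gap_third by simp
qed

lemma eventually_bulk: "\<forall>\<^sub>F p in sequentially. \<forall>i\<in>{k+1..p}. ev p i \<le> bulk_edge"
proof -
  have "\<forall>\<^sub>F p in sequentially. ev p (k+1) < bulk_edge"
    using \<gamma>[of "k+1"] gap_third by (intro order_tendstoD(2)[of _ "\<gamma> (k+1)"]) (auto simp: bulk_edge_def)
  then show ?thesis
  proof eventually_elim
    case (elim p)
    show ?case
    proof
      fix i assume "i \<in> {k+1..p}"
      then have "ev p i \<le> ev p (k+1)" by (intro ev_antimono) auto
      then show "ev p i \<le> bulk_edge" using elim by simp
    qed
  qed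
qed

lemma eventually_top: "\<forall>\<^sub>F p in sequentially. \<forall>j<k. bulk_edge + c \<le> ev p (j+1)"
proof -
  have "\<forall>\<^sub>F p in sequentially. bulk_edge + c < ev p k"
    using \<gamma>[of k] gap_third k by (intro order_tendstoD(1)[of _ "\<gamma> k"]) auto
  then show ?thesis using eventually_ge_at_top[of k]
  proof eventually_elim
    case (elim p)
    show ?case
    proof (intro allI impI)
      fix j assume "j < k"
      then have "ev p k \<le> ev p (j+1)" using elim by (intro ev_antimono) auto
      then show "bulk_edge + c \<le> ev p (j+1)" using elim by simp
    qed
  qed
qed

text \<open>The test function that clips t - \<open>bulk_edge\<close> to [0,1] vanishes at all bulk
  eigenvalues for large p, so its integral against the weak limit is 0.\<close>

lemma AE_bulk: "AE t in \<mu>. t \<le> bulk_edge"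
proof -
  interpret real_distribution \<mu> by (rule \<mu>)
  let ?f = "\<lambda>t. max 0 (min 1 (t - bulk_edge))"
  have "(\<lambda>p. (\<Sum>i\<in>{k+1..p}. ?f (ev p i)) / real p) \<longlonglongrightarrow> (LINT t|\<mu>. ?f t)"
    using S by (intro weak_conv_bulk[OF \<mu> bulk, where B=1] continuous_max continuous_min continuous_intros) auto
  moreover have "(\<lambda>p. (\<Sum>i\<in>{k+1..p}. ?f (ev p i)) / real p) \<longlonglongrightarrow> 0"
  proof (rule tendsto_eventually)
    show "\<forall>\<^sub>F p in sequentially. (\<Sum>i\<in>{k+1..p}. ?f (ev p i)) / real p = 0"
      using eventually_bulk
    proof eventually_elim
      case (elim p)
      then have "(\<Sum>i\<in>{k+1..p}. ?f (ev p i)) = (\<Sum>i\<in>{k+1..p}. 0)" by (intro sum.cong) (auto intro!: max_absorb1 min.coboundedI2)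
      then show ?case by simp
    qed
  qed
  ultimately have "(LINT t|\<mu>. ?f t) = 0" by (rule LIMSEQ_unique)
  moreover have "integrable \<mu> ?f" by (rule integrable_const_bound[where B=1]) auto
  ultimately have "AE t in \<mu>. ?f t = 0" by (subst (asm) integral_nonneg_eq_0_iff_AE) auto
  then show ?thesis by (rule AE_mp) (auto intro!: AE_I2 simp: max_def min_def split: if_splits)
qed

text \<open>The truncation at \<open>bulk_edge\<close> makes the resolvent a bounded continuous test function without
  changing it on the bulk eigenvalues.\<close>
definition resolvent :: "nat \<Rightarrow> real \<Rightarrow> real" where
  "resolvent j t = 1 / (\<gamma> (j+1) - min t bulk_edge)"

lemma resolvent:
  assumes "j < k"
  shows "isCont (resolvent j) t" "0 \<le> resolvent j t" "\<bar>resolvent j t\<bar> \<le> 1 / (2 * c)"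
proof -
  have d: "2 * c \<le> \<gamma> (j+1) - min t bulk_edge" for t using gamma_ge[of "j+1"] assms by auto
  then have d0: "0 < \<gamma> (j+1) - min t bulk_edge" for t using gap_third(1) by (meson less_le_trans mult_pos_pos zero_less_numeral)
  show "isCont (resolvent j) t" unfolding resolvent_def using d0[of t] by (intro continuous_intros) auto
  show "0 \<le> resolvent j t" unfolding resolvent_def using d0[of t] by simp
  then show "\<bar>resolvent j t\<bar> \<le> 1 / (2 * c)" unfolding resolvent_def using d[of t] gap_third(1) by (simp add: frac_le)
qed

text \<open>H_\<mu> at \<gamma> (j+1), divided by \<beta>: the limit of the diagonal entry
  \<open>j\<close> of \<open>Z\<^sup>T * Z\<close>. The truncation inside \<open>resolvent\<close>
  is invisible \<mu>-almost everywhere.\<close>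

definition column_mass :: "nat \<Rightarrow> real" where
  "column_mass j = (LINT t|\<mu>. resolvent j t) / \<beta>"

lemma integrable_resolvent: "j < k \<Longrightarrow> integrable \<mu> (resolvent j)"
proof -
  assume j: "j < k"
  interpret real_distribution \<mu> by (rule \<mu>)
  have "resolvent j \<in> borel_measurable borel"
    using resolvent(1)[OF j] by (intro borel_measurable_continuous_onI continuous_at_imp_continuous_on) auto
  then show ?thesis using resolvent(3)[OF j] by (intro integrable_const_bound[where B="1 / (2 * c)"]) auto
qed

lemma stieltjes_eq: "stieltjes \<mu> (\<gamma> k) = (LINT t|\<mu>. resolvent (k - 1) t)"
  unfolding stieltjes_def
proof (rule integral_cong_AE)
  interpret real_distribution \<mu> by (rule \<mu>)
  show "(\<lambda>t. 1 / (\<gamma> k - t)) \<in> borel_measurable \<mu>" by measurable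
  show "resolvent (k - 1) \<in> borel_measurable \<mu>" using integrable_resolvent[of "k - 1"] k by auto
  show "AE t in \<mu>. 1 / (\<gamma> k - t) = resolvent (k - 1) t" using AE_bulk by eventually_elim (use k in \<open>simp add: resolvent_def\<close>)
qed

text \<open>\<beta> exceeds the Stieltjes transform at a point to the right of all mass of \<mu>,
  where the integrand is nonnegative.\<close>

lemma beta_pos: "0 < \<beta>"
proof -
  have "0 \<le> (LINT t|\<mu>. resolvent (k - 1) t)" using resolvent(2)[of "k - 1"] k by (intro integral_nonneg_AE AE_I2) auto
  then show ?thesis using H stieltjes_eq by simp
qed

text \<open>A larger \<gamma> (j+1) makes the resolvent smaller, so the last of the leading columns
  is the worst, and there the bound is the assumption on \<beta>.\<close>

lemma column_mass_less: assumes j: "j < k" shows "column_mass j < 1"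
proof -
  have "(LINT t|\<mu>. resolvent j t) \<le> (LINT t|\<mu>. resolvent (k - 1) t)"
  proof (rule integral_mono)
    show "integrable \<mu> (resolvent j)" "integrable \<mu> (resolvent (k - 1))" using integrable_resolvent j by auto
    fix t
    have "\<gamma> k \<le> \<gamma> (j + 1)" using gamma_ge[of "j+1"] gap_third(2) j by simp
    then show "resolvent j t \<le> resolvent (k - 1) t"
      unfolding resolvent_def using k gap_third by (intro frac_le) (auto simp: min_def)
  qed
  then show ?thesis unfolding column_mass_def using H beta_pos stieltjes_eq by simp
qed

private abbreviation (input) "var p \<equiv> gibbs_variance (S p) (\<beta>s p) k"

lemma sum_gibbs_variance:
  "(\<Sum>i<p - k. var p i j) = (\<Sum>i\<in>{k+1..p}. 1 / (ev p (j+1) - ev p i)) / real p / \<beta>s p"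
proof -
  have "(\<Sum>i<p - k. var p i j) = (\<Sum>i<p - k. 1 / (ev p (j+1) - ev p (k+(i+1))) / real p / \<beta>s p)"
    using S[of p] by (intro sum.cong) (auto simp: gibbs_variance_def mult_ac)
  also have "\<dots> = (\<Sum>i\<in>{k+1..p}. 1 / (ev p (j+1) - ev p i) / real p / \<beta>s p)"
    by (rule sum.reindex_bij_witness[of _ "\<lambda>i. i - (k+1)" "\<lambda>i. k+(i+1)"]) auto
  finally show ?thesis by (simp only: sum_divide_distrib)
qed

text \<open>Weak convergence needs a fixed test function, whereas the pole \<open>ev p (j+1)\<close>
  moves with p. Both denominators are at least c, so replacing the pole by its limit changes each
  summand by at most the displacement divided by c^2, uniformly in the bulk index.\<close>

lemma tendsto_sum_gibbs_variance:
  assumes j: "j < k"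
  shows "(\<lambda>p. \<Sum>i<p - k. var p i j) \<longlonglongrightarrow> column_mass j"
proof -
  let ?A = "\<lambda>p. (\<Sum>i\<in>{k+1..p}. 1 / (ev p (j+1) - ev p i)) / real p"
  let ?F = "\<lambda>p. (\<Sum>i\<in>{k+1..p}. resolvent j (ev p i)) / real p"
  have F: "?F \<longlonglongrightarrow> (LINT t|\<mu>. resolvent j t)"
    by (rule weak_conv_bulk[OF \<mu> bulk _ resolvent(1,3)[OF j]]) (use S in auto)
  let ?e = "\<lambda>p. \<bar>ev p (j+1) - \<gamma> (j+1)\<bar> / (c * c)"
  have "(\<lambda>p. ?A p - ?F p) \<longlonglongrightarrow> 0"
  proof (rule Lim_null_comparison)
    have "(\<lambda>p. ev p (j+1) - \<gamma> (j+1)) \<longlonglongrightarrow> 0" using \<gamma>[of "j+1"] j by (intro LIM_zero) auto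
    from tendsto_divide[OF tendsto_rabs_zero[OF this] tendsto_const[of "c * c"]]
    show "?e \<longlonglongrightarrow> 0" using gap_third(1) by simp
    show "\<forall>\<^sub>F p in sequentially. norm (?A p - ?F p) \<le> ?e p"
      using eventually_bulk eventually_top eventually_gt_at_top[of 0]
    proof eventually_elim
      case (elim p)
      have pt: "\<bar>1 / (ev p (j+1) - ev p i) - resolvent j (ev p i)\<bar> \<le> ?e p" if i: "i \<in> {k+1..p}" for i
      proof -
        have t: "ev p i \<le> bulk_edge" using elim(1) i by blast
        have x: "c \<le> ev p (j+1) - ev p i" "c \<le> \<gamma> (j+1) - ev p i"
          using elim(2) j t gamma_ge[of "j+1"] gap_third(1) by fastforce+
        have "1 / (ev p (j+1) - ev p i) - resolvent j (ev p i) = (\<gamma> (j+1) - ev p (j+1)) / ((ev p (j+1) - ev p i) * (\<gamma> (j+1) - ev p i))"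
          unfolding resolvent_def min_absorb1[OF t] using x gap_third(1) by (subst diff_frac_eq) auto
        also have "\<bar>\<dots>\<bar> = \<bar>ev p (j+1) - \<gamma> (j+1)\<bar> / ((ev p (j+1) - ev p i) * (\<gamma> (j+1) - ev p i))"
          using x gap_third(1) by (simp add: abs_divide abs_mult abs_minus_commute)
        also have "\<dots> \<le> ?e p" using x gap_third(1) by (intro frac_le mult_mono) auto
        finally show ?thesis .
      qed
      have "norm (?A p - ?F p) = \<bar>\<Sum>i\<in>{k+1..p}. (1 / (ev p (j+1) - ev p i) - resolvent j (ev p i))\<bar> / real p"
        by (simp add: sum_subtractf diff_divide_distrib[symmetric] abs_divide)
      also have "\<dots> \<le> (\<Sum>i\<in>{k+1..p}. ?e p) / real p"
        by (intro divide_right_mono order_trans[OF sum_abs] sum_mono pt) auto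
      also have "\<dots> = real (p - k) * ?e p / real p" by simp
      also have "\<dots> \<le> real p * ?e p / real p" by (intro divide_right_mono mult_right_mono) auto
      also have "\<dots> = ?e p" using elim(3) by simp
      finally show ?case .
    qed
  qed
  from tendsto_add[OF this F] have "?A \<longlonglongrightarrow> (LINT t|\<mu>. resolvent j t)" by simp
  from tendsto_divide[OF this \<beta>s] show ?thesis
    unfolding sum_gibbs_variance column_mass_def using beta_pos by simp
qed

lemma eventually_beta: "\<forall>\<^sub>F p in sequentially. \<beta> / 2 < \<beta>s p"
  using \<beta>s beta_pos by (intro order_tendstoD(1)) auto

lemma eventually_gibbs_variance:
  "\<forall>\<^sub>F p in sequentially. \<forall>i<p - k. \<forall>j<k. 0 < var p i j \<and> var p i j \<le> 2 / (\<beta> * c) / real p"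
  using eventually_beta eventually_bulk eventually_top
proof eventually_elim
  case (elim p)
  show ?case
  proof (intro allI impI)
    fix i j assume ij: "i < p - k" "j < k"
    have "ev p (k+(i+1)) \<le> bulk_edge" using ij elim(2) by auto
    moreover have "bulk_edge + c \<le> ev p (j+1)" using ij elim(3) by blast
    ultimately have g: "c \<le> ev p (j+1) - ev p (k+(i+1))" by linarith
    have p: "0 < real p" using ij by simp
    have e: "var p i j = 1 / (\<beta>s p * real p * (ev p (j+1) - ev p (k+(i+1))))" using S[of p] by (simp add: gibbs_variance_def)
    have l: "\<beta> / 2 * real p * c \<le> \<beta>s p * real p * (ev p (j+1) - ev p (k+(i+1)))"
      using g p elim(1) beta_pos gap_third(1) by (intro mult_mono mult_nonneg_nonneg) auto
    moreover have l0: "0 < \<beta> / 2 * real p * c" using p beta_pos gap_third(1) by simp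
    ultimately have "var p i j \<le> 1 / (\<beta> / 2 * real p * c)" unfolding e by (intro frac_le) auto
    also have "\<dots> = 2 / (\<beta> * c) / real p" by (simp add: mult_ac)
    finally show "0 < var p i j \<and> var p i j \<le> 2 / (\<beta> * c) / real p" using l l0 unfolding e by auto
  qed
qed

text \<open>The reciprocal variances of the first row are p times a convergent sequence, so its
  normalisers grow like sqrt p at most. The coarser linear bound is enough against exponential
  tails.\<close>

lemma eventually_gibbs_variance_0:
  obtains B where "0 \<le> B" "\<forall>\<^sub>F p in sequentially. \<forall>j<k. 1 / sqrt (2 * pi * var p 0 j) \<le> B * real p"
proof -
  define M where "M = (\<lambda>p j. \<beta>s p * (ev p (j+1) - ev p (k+1)))"
  \<comment> \<open>The limits of \<open>M p j\<close> plus one bound all columns eventually; the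
    inserted 1 ensures that B p is at least 1, so that p B \<le> (B p)^2.\<close>
  define B where "B = Max (insert 1 ((\<lambda>j. \<beta> * (\<gamma> (j+1) - \<gamma> (k+1)) + 1) ` {..<k}))"
  have B: "1 \<le> B" "\<And>j. j < k \<Longrightarrow> \<beta> * (\<gamma> (j+1) - \<gamma> (k+1)) + 1 \<le> B" unfolding B_def by (auto intro: Max_ge)
  have "\<forall>\<^sub>F p in sequentially. M p j < B" if j: "j < k" for j
  proof (rule order_tendstoD(2))
    show "(\<lambda>p. M p j) \<longlonglongrightarrow> \<beta> * (\<gamma> (j+1) - \<gamma> (k+1))" unfolding M_def using \<gamma> \<beta>s j by (intro tendsto_intros) auto
  qed (use B(2)[OF j] in simp)
  then have "\<forall>\<^sub>F p in sequentially. \<forall>j\<in>{..<k}. M p j < B" by (intro eventually_ball_finite) auto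
  then have "\<forall>\<^sub>F p in sequentially. \<forall>j<k. 1 / sqrt (2 * pi * var p 0 j) \<le> B * real p"
    using eventually_ge_at_top[of 1]
  proof eventually_elim
    case (elim p)
    show ?case
    proof (intro allI impI)
      fix j assume j: "j < k"
      have "1 / sqrt (2 * pi * var p 0 j) = sqrt (real p * M p j / (2 * pi))"
        using S[of p] by (simp add: gibbs_variance_def M_def real_sqrt_divide real_sqrt_mult mult_ac)
      also have "\<dots> \<le> sqrt ((B * real p)\<^sup>2)"
      proof (rule real_sqrt_le_mono)
        have "real p * M p j / (2 * pi) \<le> real p * B / 1"
        proof (cases "0 \<le> M p j")
          case True
          moreover have "M p j \<le> B" using elim(1) j by (auto intro: less_imp_le)
          ultimately show ?thesis using B(1) pi_gt3 by (intro frac_le mult_left_mono mult_nonneg_nonneg) auto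
        next
          case False
          then have "real p * M p j / (2 * pi) \<le> 0" by (intro divide_nonpos_nonneg mult_nonneg_nonpos) auto
          also have "0 \<le> real p * B / 1" using B(1) by simp
          finally show ?thesis .
        qed
        also have "\<dots> \<le> (B * real p) * (B * real p)" using mult_mono[of 1 "B * real p" "B * real p" "B * real p"] B(1) elim(2) by (simp add: mult.commute mult_ge1_I)
        finally show "real p * M p j / (2 * pi) \<le> (B * real p)\<^sup>2" by (simp add: power2_eq_square)
      qed
      also have "\<dots> = B * real p" using B(1) by simp
      finally show "1 / sqrt (2 * pi * var p 0 j) \<le> B * real p" .
    qed
  qed
  then show ?thesis using that[of B] B(1) by simp
qed

lemma tendsto_tv_dist_gibbs:
  "(\<lambda>p. tv_dist (gibbs (S p) (\<beta>s p) k) (gibbs_approx (S p) (U p) (\<beta>s p) k)) \<longlonglongrightarrow> 0"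
proof (rule tendstoI)
  fix \<epsilon> :: real assume \<epsilon>: "0 < \<epsilon>"
  let ?h0 = "1 / sqrt (\<Prod>a<k. 1 - column_mass a)"
  have "0 < (\<Prod>a<k. 1 - column_mass a)" using column_mass_less by (intro prod_pos) auto
  then have h0: "0 < ?h0" by simp
  \<comment> \<open>The first bound is what \<open>normalized_deviation_le\<close> requires; the
    second makes its conclusion 4 e / h0 at most \<epsilon> / 2.\<close>
  define e where "e = min (?h0 / 2) (?h0 * \<epsilon> / 8)"
  have e: "0 < e" "e \<le> ?h0 / 2" "4 / ?h0 * e < \<epsilon>"
  proof -
    have "4 / ?h0 * e \<le> 4 / ?h0 * (?h0 * \<epsilon> / 8)" unfolding e_def using h0 by (intro mult_left_mono) auto
    also have "\<dots> < \<epsilon>" using h0 \<epsilon> by simp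
    finally show "4 / ?h0 * e < \<epsilon>" .
  qed (use h0 \<epsilon> in \<open>auto simp: e_def\<close>)
  obtain B where B: "0 \<le> B" "\<forall>\<^sub>F p in sequentially. \<forall>j<k. 1 / sqrt (2 * pi * var p 0 j) \<le> B * real p"
    by (rule eventually_gibbs_variance_0)
  have C: "0 < 2 / (\<beta> * c)" using beta_pos gap_third(1) by simp
  have "\<forall>\<^sub>F p in sequentially. (\<integral>\<^sup>+Z. ennreal \<bar>stiefel_density k Z - ?h0\<bar> \<partial>gaussian_mat (p - k) k (var p)) \<le> ennreal e"
    using k by (intro stiefel_density_L1_limit[OF C B(1) eventually_gibbs_variance B(2) tendsto_sum_gibbs_variance column_mass_less e(1)]) auto
  then show "\<forall>\<^sub>F p in sequentially. dist (tv_dist (gibbs (S p) (\<beta>s p) k) (gibbs_approx (S p) (U p) (\<beta>s p) k)) 0 < \<epsilon>"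
    using eventually_gt_at_top[of k] eventually_beta eventually_gibbs_variance eventually_bulk eventually_top
  proof eventually_elim
    case (elim p)
    define n where "n = p - k"
    have pn: "p = k + n" using elim(2) by (simp add: n_def)
    have \<beta>p: "0 < \<beta>s p" using elim(3) beta_pos by linarith
    have gp: "ev p (k+(i+1)) < ev p (j+1)" if "i < n" "j < k" for i j
    proof -
      have "ev p (k+(i+1)) \<le> bulk_edge" using that elim(5) pn by auto
      moreover have "bulk_edge + c \<le> ev p (j+1)" using that elim(6) by blast
      ultimately show ?thesis using gap_third(1) by linarith
    qed
    let ?G = "gaussian_mat n k (var p)"
    interpret prob_space ?G by (rule prob_space_gaussian_mat) (use elim(4) n_def in blast)
    have hm: "stiefel_density k \<in> borel_measurable ?G" by (simp add: measurable_stiefel_density cong: measurable_cong_sets)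
    note d = normalized_deviation_le[OF hm elim(1)[folded n_def] h0 less_imp_le[OF e(1)] e(2)]
    note tv = tv_dist_gibbs_le[OF S[of p, unfolded pn] U[of p, unfolded pn] SU[of p, unfolded pn], folded pn, OF \<beta>p _ gp d(1,2)]
    show ?case using tv k d(3) e(3) elim(2) by auto
  qed
qed

end

theorem theorem4:
  fixes k :: nat
    and S U :: "nat \<Rightarrow> real mat"
    and \<gamma> :: "nat \<Rightarrow> real"
    and \<mu> :: "real measure"
    and \<beta>s :: "nat \<Rightarrow> real"
    and \<beta> :: real
  assumes "k \<ge> 1"
    and "\<And>p. S p \<in> carrier_mat p p"
    and "\<And>p. (S p)\<^sup>T = S p"
    and "\<And>i. i \<in> {1..k+1} \<Longrightarrow> (\<lambda>p. eigval (S p) i) \<longlonglongrightarrow> \<gamma> i"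
    and "\<And>i. i \<in> {1..k+1} \<Longrightarrow> 0 \<le> \<gamma> i"
    and "\<gamma> k - \<gamma> (k+1) > 0"
    and "real_distribution \<mu>"
    and "bounded (measure_support \<mu>)"
    and "weak_conv_m (\<lambda>p. bulk_spectral_measure (S p) k) \<mu>"
    and "\<beta>s \<longlonglongrightarrow> \<beta>"
    and "stieltjes \<mu> (\<gamma> k) < \<beta>"
    and "\<And>p. U p \<in> stiefel p p"
    and "\<And>p. S p = U p * mat_diag p (\<lambda>i. eigval (S p) (i + 1)) * (U p)\<^sup>T"
  shows "(\<lambda>p. tv_dist (gibbs (S p) (\<beta>s p) k) (gibbs_approx (S p) (U p) (\<beta>s p) k)) \<longlonglongrightarrow> 0"
  using assms(1,2,4,6,7,9-13) by (rule tendsto_tv_dist_gibbs)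

end
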